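(* Let $K$ be a field such that the number of isomorphism classes of noncommutative finite division algebras over $K$ is finite and positive. Then $K$ is real closed.
   Context: A finite division algebra over $K$ is a division ring that is a finite-dimensional associative unital $K$-algebra ($K$ lies in the center, but the center may be strictly larger than $K$, i.e. the algebra is not required to be $K$-central). Isomorphism means isomorphism of $K$-algebras. *)

theory Defs
  imports
    "HOL-Algebra.Polynomial_Divisibility"
    "Jordan_Normal_Form.Missing_VectorSpace"
begin

locale skew_field = ring D for D (structure) +
  assumes one_not_zero: "\<one> \<noteq> \<zero>"
    and skew_field_Units: "Units D = carrier D - {\<zero>}"

text \<open>The locale \<^locale>\<open>algebra\<close> of HOL-Algebra requires a commutative multiplication, so it
  cannot be used here. The two associativity laws say that \<open>K\<close>, embedded as the scalar multiples
  of \<open>\<one>\<close>, lies in the center; the center may be larger.\<close>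

locale finite_division_algebra = vectorspace K D + D?: skew_field D for K and D +
  assumes smult_mult_left: "\<lbrakk>c \<in> carrier K; x \<in> carrier D; y \<in> carrier D\<rbrakk> \<Longrightarrow>
      (c \<odot>\<^bsub>D\<^esub> x) \<otimes>\<^bsub>D\<^esub> y = c \<odot>\<^bsub>D\<^esub> (x \<otimes>\<^bsub>D\<^esub> y)"
    and smult_mult_right: "\<lbrakk>c \<in> carrier K; x \<in> carrier D; y \<in> carrier D\<rbrakk> \<Longrightarrow>
      x \<otimes>\<^bsub>D\<^esub> (c \<odot>\<^bsub>D\<^esub> y) = c \<odot>\<^bsub>D\<^esub> (x \<otimes>\<^bsub>D\<^esub> y)"
    and finite_dimensional: "fin_dim"

definition noncommutative :: "('b, 'm) ring_scheme \<Rightarrow> bool" where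
  "noncommutative D \<longleftrightarrow> (\<exists>x\<in>carrier D. \<exists>y\<in>carrier D. x \<otimes>\<^bsub>D\<^esub> y \<noteq> y \<otimes>\<^bsub>D\<^esub> x)"

definition algebra_iso ::
  "('a, 'k) ring_scheme \<Rightarrow> ('a, 'b, 'm) module_scheme \<Rightarrow> ('a, 'c, 'n) module_scheme \<Rightarrow> ('b \<Rightarrow> 'c) set"
  where "algebra_iso K D E = ring_iso D E \<inter> module_hom K D E"

text \<open>Isomorphism classes are formed among the algebras whose elements are lists over the type of
  \<open>K\<close>. This loses nothing: a finite-dimensional algebra can be transported along coordinate lists,
  see \<open>list_representative\<close> below.\<close>

definition noncomm_division_algebras :: "('a, 'k) ring_scheme \<Rightarrow> ('a, 'a list) module set" where
  "noncomm_division_algebras K = {D. finite_division_algebra K D \<and> noncommutative D}"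

definition noncomm_division_algebra_classes ::
  "('a, 'k) ring_scheme \<Rightarrow> ('a, 'a list) module set set" where
  "noncomm_division_algebra_classes K = noncomm_division_algebras K //
     {(D, E). D \<in> noncomm_division_algebras K \<and> E \<in> noncomm_division_algebras K \<and>
        algebra_iso K D E \<noteq> {}}"

locale field_ordering = field K for K (structure) +
  fixes r :: "('a \<times> 'a) set"
  assumes linear_order: "linear_order_on (carrier K) r"
    and add_mono: "\<lbrakk>(a, b) \<in> r; c \<in> carrier K\<rbrakk> \<Longrightarrow> (a \<oplus> c, b \<oplus> c) \<in> r"
    and mult_nonneg: "\<lbrakk>(\<zero>, a) \<in> r; (\<zero>, b) \<in> r\<rbrakk> \<Longrightarrow> (\<zero>, a \<otimes> b) \<in> r"

text \<open>In \<^theory>\<open>HOL-Algebra.Polynomials\<close>, the degree of the zero polynomial is \<open>0\<close>.\<close>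

definition real_closed :: "('a, 'k) ring_scheme \<Rightarrow> bool" where
  "real_closed K \<longleftrightarrow> (\<exists>r. field_ordering K r \<and>
     (\<forall>a. (\<zero>\<^bsub>K\<^esub>, a) \<in> r \<longrightarrow> (\<exists>b\<in>carrier K. a = b \<otimes>\<^bsub>K\<^esub> b)) \<and>
     (\<forall>p\<in>carrier (poly_ring K). odd (Polynomials.degree p) \<longrightarrow> (\<exists>x. ring.is_root K p x)))"

lemma algebra_isoI:
  assumes "f \<in> module_hom K D E" "bij_betw f (carrier D) (carrier E)" "f \<one>\<^bsub>D\<^esub> = \<one>\<^bsub>E\<^esub>"
    and "\<And>x y. x \<in> carrier D \<Longrightarrow> y \<in> carrier D \<Longrightarrow> f (x \<otimes>\<^bsub>D\<^esub> y) = f x \<otimes>\<^bsub>E\<^esub> f y"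
  shows "f \<in> algebra_iso K D E"
  using assms unfolding algebra_iso_def ring_iso_def ring_hom_def module_hom_def by auto

lemma algebra_iso_id: "id \<in> algebra_iso K D D"
  by (rule algebra_isoI) (auto simp: module_hom_def)

lemma algebra_iso_comp:
  assumes "f \<in> algebra_iso K D E" "g \<in> algebra_iso K E F"
  shows "g \<circ> f \<in> algebra_iso K D F"
  using assms ring_iso_set_trans[of f D E g F]
  unfolding algebra_iso_def module_hom_def by (auto simp: Pi_iff)

lemma algebra_iso_inv:
  assumes D: "finite_division_algebra K D" and f: "f \<in> algebra_iso K D E"
  shows "inv_into (carrier D) f \<in> algebra_iso K E D"
proof -
  interpret D: finite_division_algebra K D by fact
  let ?g = "inv_into (carrier D) f"
  have iso: "f \<in> ring_iso D E" and hom: "f \<in> module_hom K D E"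
    using f by (auto simp: algebra_iso_def)
  have g: "?g \<in> ring_iso E D"
    using iso D.D.ring_axioms by (simp add: ring_iso_set_sym)
  have bij: "bij_betw f (carrier D) (carrier E)"
    using iso by (simp add: ring_iso_def)
  have "?g (c \<odot>\<^bsub>E\<^esub> y) = c \<odot>\<^bsub>D\<^esub> ?g y" if "c \<in> carrier K" "y \<in> carrier E" for c y
  proof -
    from bij that obtain x where "x \<in> carrier D" "y = f x"
      by (metis bij_betw_iff_bijections)
    moreover then have "f (c \<odot>\<^bsub>D\<^esub> x) = c \<odot>\<^bsub>E\<^esub> y"
      using hom that by (auto simp: module_hom_def)
    ultimately show ?thesis
      using bij that by (metis D.smult_closed bij_betw_inv_into_left)
  qed
  then show ?thesis
    using g unfolding algebra_iso_def module_hom_def ring_iso_def ring_hom_def by auto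
qed

lemma equiv_algebra_iso:
  "equiv (noncomm_division_algebras K)
     {(D, E). D \<in> noncomm_division_algebras K \<and> E \<in> noncomm_division_algebras K \<and>
        algebra_iso K D E \<noteq> {}}"
proof (rule equivI)
  show "sym {(D, E). D \<in> noncomm_division_algebras K \<and> E \<in> noncomm_division_algebras K \<and>
        algebra_iso K D E \<noteq> {}}"
    by (rule symI) (use algebra_iso_inv in \<open>fastforce simp: noncomm_division_algebras_def\<close>)
  show "trans {(D, E). D \<in> noncomm_division_algebras K \<and> E \<in> noncomm_division_algebras K \<and>
        algebra_iso K D E \<noteq> {}}"
    by (rule transI) (use algebra_iso_comp in fastforce)
qed (use algebra_iso_id in \<open>auto simp: refl_on_def\<close>)

lemma finite_division_algebra_transport:
  fixes E :: "('a, 'c, 'n) module_scheme"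
  assumes D: "finite_division_algebra K D" and hom: "f \<in> module_hom K D E"
    and bij: "bij_betw f (carrier D) (carrier E)"
    and one: "f \<one>\<^bsub>D\<^esub> = \<one>\<^bsub>E\<^esub>" and zero: "f \<zero>\<^bsub>D\<^esub> = \<zero>\<^bsub>E\<^esub>"
    and mult: "\<And>x y. x \<in> carrier D \<Longrightarrow> y \<in> carrier D \<Longrightarrow> f (x \<otimes>\<^bsub>D\<^esub> y) = f x \<otimes>\<^bsub>E\<^esub> f y"
  shows "finite_division_algebra K E"
proof -
  interpret D: finite_division_algebra K D by fact
  have add: "f (x \<oplus>\<^bsub>D\<^esub> y) = f x \<oplus>\<^bsub>E\<^esub> f y" if "x \<in> carrier D" "y \<in> carrier D" for x y
    using hom that by (auto simp: module_hom_def)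
  have smult: "f (c \<odot>\<^bsub>D\<^esub> x) = c \<odot>\<^bsub>E\<^esub> f x" if "c \<in> carrier K" "x \<in> carrier D" for c x
    using hom that by (auto simp: module_hom_def)
  have E: "carrier E = f ` carrier D" and inj: "inj_on f (carrier D)"
    using bij by (auto simp: bij_betw_def)
  have agE: "abelian_group E"
  proof (rule abelian_groupI)
    fix x assume "x \<in> carrier E"
    then obtain x' where x': "x' \<in> carrier D" "x = f x'" using E by auto
    then have "f (\<ominus>\<^bsub>D\<^esub> x') \<oplus>\<^bsub>E\<^esub> x = \<zero>\<^bsub>E\<^esub>"
      using add[of "\<ominus>\<^bsub>D\<^esub> x'" x'] zero by (simp add: abelian_group.l_neg[OF D.M.abelian_group_axioms])
    then show "\<exists>y\<in>carrier E. y \<oplus>\<^bsub>E\<^esub> x = \<zero>\<^bsub>E\<^esub>" using x' E by auto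
  qed (auto simp: E add[symmetric] zero[symmetric] D.M.a_ac)
  have ringE: "ring E"
    by (rule ringI[OF agE monoidI])
      (auto simp: E add[symmetric] mult[symmetric] one[symmetric] D.D.m_assoc D.D.l_distr D.D.r_distr)
  have modE: "module K E"
    by (rule moduleI[OF D.R.is_cring agE])
      (auto simp: E add[symmetric] smult[symmetric] D.smult_l_distr D.smult_r_distr D.smult_assoc1)
  have vsE: "vectorspace K E"
    using modE D.field_axioms by (simp add: vectorspace_def)
  have lin: "linear_map K D E f"
    using vsE D.vectorspace_axioms modE hom D.module_axioms
    by (simp add: linear_map_def mod_hom_def mod_hom_axioms_def)
  have fd: "vectorspace.fin_dim K E"
    using linear_map.surj_fin_dim[OF lin D.finite_dimensional] E by simp
  have U: "Units E = f ` Units D"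
  proof -
    have "f x \<in> Units E \<longleftrightarrow> x \<in> Units D" if "x \<in> carrier D" for x
      using that inj unfolding Units_def E
      by (auto simp: mult[symmetric] one[symmetric] inj_on_eq_iff)
    moreover have "Units E \<subseteq> f ` carrier D" "Units D \<subseteq> carrier D"
      by (auto simp: Units_def E)
    ultimately show ?thesis by blast
  qed
  have "\<one>\<^bsub>E\<^esub> \<noteq> \<zero>\<^bsub>E\<^esub>"
    using D.one_not_zero inj by (metis one zero D.D.one_closed D.M.zero_closed inj_onD)
  moreover have "Units E = carrier E - {\<zero>\<^bsub>E\<^esub>}"
    unfolding U E D.skew_field_Units zero[symmetric] using inj
    by (auto simp: inj_on_eq_iff)
  ultimately have sf: "skew_field E"
    using ringE by (simp add: skew_field_def skew_field_axioms_def)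
  have "finite_division_algebra_axioms K E"
    by (rule finite_division_algebra_axioms.intro)
      (auto simp: E mult[symmetric] smult[symmetric] D.smult_mult_left D.smult_mult_right fd)
  then show ?thesis
    using vsE sf by (simp add: finite_division_algebra_def)
qed

lemma (in finite_division_algebra) coordinate_list:
  shows "\<exists>f :: 'c \<Rightarrow> 'a list. inj_on f (carrier D)"
proof -
  obtain B where B: "finite B" "B \<subseteq> carrier D" "span B = carrier D"
    using finite_dimensional unfolding fin_dim_def by auto
  obtain bs where bs: "set bs = B" using B(1) List.finite_list by blast
  have "\<exists>a. a \<in> B \<rightarrow> carrier K \<and> lincomb a B = x" if "x \<in> carrier D" for x
  proof -
    have "x \<in> {lincomb a B | a. a \<in> B \<rightarrow> carrier K}"
      using that B(3) finite_span[OF B(1,2)] by simp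
    then show ?thesis by auto
  qed
  then obtain a where a: "\<And>x. x \<in> carrier D \<Longrightarrow> a x \<in> B \<rightarrow> carrier K \<and> lincomb (a x) B = x"
    by metis
  have "inj_on (\<lambda>x. map (a x) bs) (carrier D)"
  proof (rule inj_onI)
    fix x y assume xy: "x \<in> carrier D" "y \<in> carrier D" "map (a x) bs = map (a y) bs"
    then have "lincomb (a x) B = lincomb (a y) B"
      using a B bs by (intro lincomb_cong) auto
    then show "x = y" using a xy by metis
  qed
  then show ?thesis by blast
qed

theorem list_representative:
  fixes K :: "('a, 'k) ring_scheme" and D :: "('a, 'b, 'm) module_scheme"
  assumes D: "finite_division_algebra K D" and nc: "noncommutative D"
  shows "\<exists>E \<in> noncomm_division_algebras K. algebra_iso K D E \<noteq> {}"
proof -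
  interpret D: finite_division_algebra K D by fact
  obtain f :: "'b \<Rightarrow> 'a list" where inj: "inj_on f (carrier D)"
    using D.coordinate_list by blast
  define g where "g = inv_into (carrier D) f"
  have gf: "g (f x) = x" if "x \<in> carrier D" for x
    using inj that by (simp add: g_def)
  define E :: "('a, 'a list) module" where
    "E = \<lparr>carrier = f ` carrier D, mult = (\<lambda>x y. f (g x \<otimes>\<^bsub>D\<^esub> g y)), one = f \<one>\<^bsub>D\<^esub>,
      zero = f \<zero>\<^bsub>D\<^esub>, add = (\<lambda>x y. f (g x \<oplus>\<^bsub>D\<^esub> g y)), smult = (\<lambda>c x. f (c \<odot>\<^bsub>D\<^esub> g x))\<rparr>"
  have hom: "f \<in> module_hom K D E"
    by (auto simp: module_hom_def E_def gf)
  have bij: "bij_betw f (carrier D) (carrier E)"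
    using inj by (simp add: bij_betw_def E_def)
  have one: "f \<one>\<^bsub>D\<^esub> = \<one>\<^bsub>E\<^esub>" and zero: "f \<zero>\<^bsub>D\<^esub> = \<zero>\<^bsub>E\<^esub>"
    by (simp_all add: E_def)
  have mult: "f (x \<otimes>\<^bsub>D\<^esub> y) = f x \<otimes>\<^bsub>E\<^esub> f y" if "x \<in> carrier D" "y \<in> carrier D" for x y
    using that by (simp add: E_def gf)
  have "finite_division_algebra K E"
    by (rule finite_division_algebra_transport[OF D hom bij one zero]) (simp add: mult)
  moreover have "noncommutative E"
  proof -
    obtain x y where xy: "x \<in> carrier D" "y \<in> carrier D" "x \<otimes>\<^bsub>D\<^esub> y \<noteq> y \<otimes>\<^bsub>D\<^esub> x"
      using nc by (auto simp: noncommutative_def)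
    then have "f x \<otimes>\<^bsub>E\<^esub> f y \<noteq> f y \<otimes>\<^bsub>E\<^esub> f x"
      using inj by (metis D.D.m_closed inj_onD mult)
    then show ?thesis
      using xy bij by (auto simp: noncommutative_def bij_betw_def)
  qed
  moreover have "f \<in> algebra_iso K D E"
    by (rule algebra_isoI[OF hom bij one]) (simp add: mult)
  ultimately show ?thesis
    by (auto simp: noncomm_division_algebras_def)
qed

end

theory Submission
  imports
    Defs
    "HOL-Algebra.Algebraic_Closure"
    "HOL-Algebra.Sylow"
    "HOL-Algebra.Multiplicative_Group"
begin

text \<open>Choose \<open>D\<close> among the algebras with the degree of its center \<open>Z\<close> over \<open>K\<close> maximal. Then no proper finite
 extension of \<open>Z\<close> is the center of a noncommutative division algebra. Splitting \<open>D\<close> over such an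
 extension shows that its degree is divisible by every prime \<open>p\<close> dividing \<open>[D : Z]\<close>, and that \<open>D\<close>
 contains it if the degree is prime; splitting cyclic algebras shows that cyclic extensions of
 prime degree of such an extension have surjective norms. So \<open>Z\<close> has a cyclic extension \<open>M\<close> of
 degree \<open>p\<close>, and since \<open>M\<close> embeds into \<open>D\<close>, some \<open>a\<close> in \<open>Z\<close> is not a norm from \<open>M\<close>. Norms of a \<open>p\<close>-th root
 of \<open>a\<close> then force \<open>p = 2\<close> and that \<open>-1\<close> is no norm from any quadratic extension. Hence \<open>-1\<close> is not a
 sum of two squares, every element of \<open>Z\<close> is a square up to sign, and \<open>Z(i)\<close> is algebraically closed.
 It is finite over \<open>K\<close>, so \<open>K\<close> is real closed by the Artin-Schreier argument.\<close>

\<comment> \<open>Maximality of the center has one consequence from which the rest is drawn: a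
  division ring that is finite over an embedded copy of \<open>Z\<close> and whose center properly
  contains that copy is commutative. For the corner \<open>e A e\<close> of a central simple algebra
  over a larger field this means that the algebra splits. For centralizers in \<open>D\<close> it
  means that they are fields. Along the Frobenius embedding of \<open>Z\<close> it means that
  \<open>Z\<close> is perfect, so that Galois theory applies to all finite extensions.

  Numbers come from \<open>dim A = dim (A e) * dim (e A)\<close>: a skew field acting on
  \<open>A e\<close> from the left and on \<open>e A\<close> from the right has a dimension dividing
  both.

  The prime \<open>2\<close> is singled out by a sign. The product of all \<open>p\<close>-th roots
  of unity is \<open>1\<close> for odd \<open>p\<close> and \<open>-1\<close> for
  \<open>p = 2\<close>, so the norm of a \<open>p\<close>-th root of \<open>a\<close> is
  \<open>a\<close> or \<open>- a\<close>. For odd \<open>p\<close> every non-norm would thus become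
  a norm.

  Tensor products and cyclic algebras are realized as rings of additive operators, where
  associativity is automatic. Conjugation inside \<open>D\<close> is found by comparing left and
  right multiplications on \<open>D\<close>.\<close>
text \<open>\<open>x **[R] y\<close> abbreviates \<open>x \<otimes>\<^bsub>R\<^esub> y\<close>, and similarly for the other operations of a structure.\<close>

syntax "_index" :: "logic => index" ("[_]")
notation mult (infixl "**\<index>" 70)

lemmas poly_carrier = sym[OF univ_poly_carrier] polynomial_def

subsection \<open>Dimension counting\<close>

context ring
begin

lemma subalgebraI:
 assumes K: "subfield K R" and "V \<subseteq> carrier R" "\<zero> \<in> V"
  and "!!u v. u \<in> V ==> v \<in> V ==> u \<oplus> v \<in> V"
  and "!!k v. k \<in> K ==> v \<in> V ==> k ** v \<in> V"
 shows "subalgebra K V R"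
proof (rule subalgebra.intro)
 note KE = subringE[OF subfieldE(1)[OF K]]
 show "subgroup V (add_monoid R)"
 proof (rule add.subgroupI)
  fix a assume a: "a \<in> V"
  have "(\<ominus> \<one>) ** a \<in> V" using assms(5)[OF KE(5)[OF KE(3)] a] .
  then show "\<ominus> a \<in> V" using assms(2) a by (simp add: l_minus subset_iff)
 qed (use assms in auto)
qed (use assms in "auto simp: subalgebra_axioms_def")

lemma subalgebraD:
 assumes "subalgebra K V R"
 shows "V \<subseteq> carrier R" "\<zero> \<in> V" "!!u v. u \<in> V ==> v \<in> V ==> u \<oplus> v \<in> V"
  "!!u. u \<in> V ==> \<ominus> u \<in> V" "!!u v. u \<in> V ==> v \<in> V ==> u \<ominus> v \<in> V"
  "!!k v. k \<in> K ==> v \<in> V ==> k ** v \<in> V"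
proof -
 have s: "subgroup V (add_monoid R)" using assms by (simp add: subalgebra_def)
 show "V \<subseteq> carrier R" using subalgebra_in_carrier[OF assms] .
 show "\<zero> \<in> V" using subgroup.one_closed[OF s] by simp
 show add: "!!u v. u \<in> V ==> v \<in> V ==> u \<oplus> v \<in> V"
  using subgroup.m_closed[OF s] by simp
 show neg: "!!u. u \<in> V ==> \<ominus> u \<in> V" using add.subgroupE(3)[OF s] by simp
 show "!!u v. u \<in> V ==> v \<in> V ==> u \<ominus> v \<in> V" unfolding a_minus_def using add neg by auto
 show "!!k v. k \<in> K ==> v \<in> V ==> k ** v \<in> V" using subalgebra.smult_closed[OF assms] .
qed

text \<open>The clause for \<open>m = n\<close> is the usual source of equalities between subspaces
  and between fields: a subspace of full dimension is everything.\<close>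

lemma subspace_dimension:
 assumes "subfield K R" "dimension n K E" "subalgebra K V R" "V \<subseteq> E"
 obtains m where "dimension m K V" "m \<le> n" "m = n ==> V = E"
proof -
 obtain m where m: "dimension m K V"
  using subalbegra_incl_imp_finite_dimension[OF assms(1) finite_dimensionI[OF assms(2)] assms(3,4)]
  by auto
 obtain Us where Us: "set Us \<subseteq> carrier R" "independent K Us" "length Us = m" "Span K Us = V"
  using exists_base[OF assms(1) m] by auto
 have sub: "set Us \<subseteq> E"
  using Span_base_incl[OF assms(1) Us(1)] Us(4) assms(4) by auto
 have "m \<le> n" using independent_length_le_dimension[OF assms(1,2) Us(2) sub] Us(3) by simp
 moreover have "m = n ==> V = E"
  using independent_length_eq_dimension[OF assms(1,2) Us(2) sub] Us by simp
 ultimately show ?thesis using that m by blast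
qed

lemma direct_sum_dimension:
 assumes "subfield K R" "dimension n K E" "dimension m K F" "E \<inter> F \<subseteq> {\<zero>}"
 shows "dimension (n + m) K (E <+>[R] F)"
 using dimension_direct_sum_space[OF assms(1-3)] assms(4)
  space_subgroup_props(2)[OF assms(1,2)] space_subgroup_props(2)[OF assms(1,3)] by blast

lemma mem_set_add_iff: "x \<in> E <+>[R] F \<longleftrightarrow> (\<exists>u\<in>E. \<exists>v\<in>F. x = u \<oplus> v)"
 by (auto simp: set_add_def')

text \<open>\<open>f\<close> is linear over a fixed \<open>K\<close> on the space \<open>E\<close>
  alone, so that it may be a left or right multiplication rather than a ring homomorphism.\<close>

lemma dimension_linear_inj:
 assumes K: "subfield K R" and E: "dimension n K E"
  and cl: "!!u. u \<in> E ==> f u \<in> carrier R"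
  and add: "!!u v. u \<in> E ==> v \<in> E ==> f (u \<oplus> v) = f u \<oplus> f v"
  and smult: "!!k u. k \<in> K ==> u \<in> E ==> f (k ** u) = k ** f u"
  and inj: "!!u. u \<in> E ==> f u = \<zero> ==> u = \<zero>"
 shows "dimension n K (f ` E)"
proof -
 note Ep = space_subgroup_props[OF K E]
 obtain Us where Us: "set Us \<subseteq> carrier R" "independent K Us" "length Us = n" "Span K Us = E"
  using exists_base[OF K E] by auto
 have UE: "set Us \<subseteq> E" using Span_base_incl[OF K Us(1)] Us(4) by auto
 have f0: "f \<zero> = \<zero>"
  using add[OF Ep(2) Ep(2)] cl[OF Ep(2)] add.l_cancel_one[of "f \<zero>" "f \<zero>"] by simp
 have comb: "combine Ks Vs \<in> E \<and> combine Ks (map f Vs) = f (combine Ks Vs)"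
  if "set Ks \<subseteq> K" "set Vs \<subseteq> E" for Ks Vs
  using that
 proof (induction Ks Vs rule: combine.induct)
  case (1 k Ks u Us)
  then show ?case using Ep add smult by simp
 qed (use f0 Ep in auto)
 let ?Vs = "map f Us"
 have Vc: "set ?Vs \<subseteq> carrier R" using UE cl by auto
 have "independent K ?Vs"
 proof (rule trivial_combine_imp_independent[OF K Vc])
  fix Ks assume Ks: "set Ks \<subseteq> K" "combine Ks ?Vs = \<zero>"
  then have "combine Ks Us = \<zero>" using comb[OF Ks(1) UE] inj by auto
  then show "set (take (length ?Vs) Ks) \<subseteq> {\<zero>}"
   using independent_imp_trivial_combine[OF K Us(2) Ks(1)] by simp
 qed
 moreover have "Span K ?Vs = f ` E"
 proof -
  have "Span K ?Vs = {combine Ks ?Vs |Ks. set Ks \<subseteq> K}"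
   using Span_eq_combine_set[OF K Vc] by simp
  also have "\<dots> = f ` {combine Ks Us |Ks. set Ks \<subseteq> K}"
   unfolding image_Collect using comb[OF _ UE] by (intro Collect_cong) metis
  also have "\<dots> = f ` E" using Span_eq_combine_set[OF K Us(1)] Us(4) by simp
  finally show ?thesis .
 qed
 ultimately show ?thesis using dimensionI[OF K, of ?Vs] Us(3) by simp
qed

lemma dimension_larger_base:
 assumes K: "subfield K R" and L: "subfield L R" and "K \<subseteq> L" and V: "dimension n K V"
  and sub: "subalgebra L V R"
 shows "finite_dimension L V"
proof -
 obtain Us where Us: "set Us \<subseteq> carrier R" "Span K Us = V"
  using exists_base[OF K V] by auto
 have UV: "set Us \<subseteq> V" using Span_base_incl[OF K Us(1)] Us(2) by auto
 have "V \<subseteq> Span L Us"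
  unfolding Us(2)[symmetric] Span_eq_combine_set[OF K Us(1)] Span_eq_combine_set[OF L Us(1)]
  using \<open>K \<subseteq> L\<close> by blast
 moreover have "Span L Us \<subseteq> V" using subalgebra_Span_incl[OF L sub UV] .
 ultimately have "V = Span L Us" by blast
 then show ?thesis using Span_finite_dimension[OF L Us(1)] by metis
qed

text \<open>A space on which a skew field acts with all orbits \<open>B w\<close> of dimension \<open>d\<close> splits into
 such orbits.\<close>

lemma dimension_dvd:
 fixes act :: "'idx => 'a => 'a"
 assumes K: "subfield K R" and W: "dimension n K W"
  and add: "!!b u v. b \<in> B ==> u \<in> W ==> v \<in> W ==> act b (u \<oplus> v) = act b u \<oplus> act b v"
  and cl: "!!b u. b \<in> B ==> u \<in> W ==> act b u \<in> W"
  and orb: "!!w. w \<in> W ==> w ~= \<zero> ==> dimension d K ((%b. act b w) ` B)"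
  and self: "!!w. w \<in> W ==> w ~= \<zero> ==> w \<in> (%b. act b w) ` B"
  and tr: "!!b c w. b \<in> B ==> c \<in> B ==> w \<in> W ==> act b (act c w) \<in> (%b. act b w) ` B"
  and inv: "!!b w. b \<in> B ==> w \<in> W ==> act b w ~= \<zero> ==> \<exists>c\<in>B. act c (act b w) = w"
 shows "d dvd n"
proof -
 \<comment> \<open>\<open>U\<close> ranges over the \<open>B\<close>-stable subspaces whose
   dimension is a multiple of \<open>d\<close>; one of maximal dimension must be
   \<open>W\<close>.\<close>
 define P where "P U m \<longleftrightarrow> subalgebra K U R \<and> U \<subseteq> W \<and> (\<forall>b\<in>B. \<forall>u\<in>U. act b u \<in> U)
  \<and> d dvd m \<and> dimension m K U" for U m
 note Wp = space_subgroup_props[OF K W]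
 have le: "m \<le> n" if "P U m" for U m
  using subspace_dimension[OF K W, of U] that dimension_is_inj[OF K] unfolding P_def by metis
 have act0: "act b \<zero> = \<zero>" if "b \<in> B" for b
 proof -
  have "act b \<zero> \<in> carrier R" using cl[OF that Wp(2)] Wp(1) by auto
  moreover have "act b \<zero> = act b \<zero> \<oplus> act b \<zero>"
   using add[OF that Wp(2) Wp(2)] by simp
  ultimately show ?thesis using add.l_cancel_one by auto
 qed
 have "P {\<zero>} 0"
  unfolding P_def using Wp(2) act0 subringE(1)[OF subfieldE(1)[OF K]]
  by (auto intro!: subalgebraI[OF K])
 then have ex: "\<exists>m U. P U m" by blast
 define M where "M = Max {m. \<exists>U. P U m}"
 have fin: "finite {m. \<exists>U. P U m}" by (rule finite_subset[of _ "{..n}"]) (use le in auto)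
 have "M \<in> {m. \<exists>U. P U m}" unfolding M_def using fin ex by (intro Max_in) auto
 then obtain U where U: "P U M" by blast
 have max: "m \<le> M" if "P U' m" for U' m
  unfolding M_def using fin that by (intro Max_ge) auto
 note Us = subalgebraD[of K U]
 have "U = W"
 proof (rule ccontr)
  assume "U ~= W"
  then obtain w where w: "w \<in> W" "w \<notin> U" using U unfolding P_def by blast
  have w0: "w ~= \<zero>" using w U Us unfolding P_def by auto
  let ?c = "(%b. act b w) ` B"
  have dc: "dimension d K ?c" using orb w w0 by blast
  \<comment> \<open>A nonzero point of the orbit lying in the stable space \<open>U\<close> would
    pull \<open>w\<close> into \<open>U\<close>, because \<open>inv\<close> leads back to
    \<open>w\<close>.\<close>
  have int: "U \<inter> ?c \<subseteq> {\<zero>}"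
  proof
   fix x assume x: "x \<in> U \<inter> ?c"
   then obtain b where b: "b \<in> B" "x = act b w" by blast
   show "x \<in> {\<zero>}"
   proof (rule ccontr)
    assume "x \<notin> {\<zero>}"
    then obtain c where "c \<in> B" "act c x = w" using inv b w by auto
    then show False using U x w unfolding P_def by blast
   qed
  qed
  let ?U = "U <+>[R] ?c"
  have dU: "dimension (M + d) K ?U"
   using direct_sum_dimension[OF K _ dc int] U unfolding P_def by blast
  have "P ?U (M + d)"
   unfolding P_def
  proof (intro conjI ballI)
   show "subalgebra K ?U R"
    using finite_dimension_imp_subalgebra[OF K finite_dimensionI[OF dU]] .
   show "?U \<subseteq> W"
    using U Wp(3) cl w unfolding P_def set_add_def' by auto
   show "act b u \<in> ?U" if bu: "b \<in> B" "u \<in> ?U" for b u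
   proof -
    obtain x c where xc: "x \<in> U" "c \<in> B" "u = x \<oplus> act c w"
     using bu(2) unfolding mem_set_add_iff by blast
    have "act b u = act b x \<oplus> act b (act c w)"
     unfolding xc using add[OF bu(1)] xc U cl w unfolding P_def by blast
    then show ?thesis
     unfolding mem_set_add_iff using U xc bu tr w(1) unfolding P_def by blast
   qed
   show "d dvd M + d" using U unfolding P_def by simp
  qed (use dU in simp)
  \<comment> \<open>Adding an orbit contradicts maximality unless \<open>d = 0\<close>, and an orbit
    of dimension \<open>0\<close> cannot contain the nonzero \<open>w\<close>.\<close>
  then have "d = 0" using max by fastforce
  then have "?c = {\<zero>}" using dimension_zero[OF K] dc by auto
  then show False using self[OF w(1) w0] w0 by auto
 qed
 then show ?thesis using U W dimension_is_inj[OF K] unfolding P_def by blast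
qed

end

subsection \<open>Central simple algebras\<close>

text \<open>\<open>center\<close> and \<open>central\<close> say together that \<open>F\<close> is
  the center. It is a subset of \<open>A\<close> rather than a separate field, so that dimensions
  over \<open>F\<close> and over smaller fields can be compared inside one ring.\<close>

locale central_simple = ring A for A (structure) +
 fixes F :: "'a set" and N :: nat
 assumes base: "subfield F A"
  and center: "!!z. z \<in> carrier A ==> (!!a. a \<in> carrier A ==> z ** a = a ** z) ==> z \<in> F"
  and central: "!!z a. z \<in> F ==> a \<in> carrier A ==> z ** a = a ** z"
  and dim_A: "dimension N F (carrier A)"
  and simple: "!!I a. ideal I A ==> a \<in> I ==> a ~= \<zero> ==> I = carrier A"
begin

definition Lid :: "'a => 'a set" where "Lid s = (%a. a ** s) ` carrier A"
definition Rid :: "'a => 'a set" where "Rid s = (%a. s ** a) ` carrier A"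
definition Cor :: "'a => 'a set" where "Cor e = (%a. e ** a ** e) ` carrier A"

lemma F_carrier: "F \<subseteq> carrier A" using subfieldE(3)[OF base] .
lemma one_neq_zero: "\<one> ~= \<zero>" using subfieldE(6)[OF base] by simp

text \<open>\<open>subalgebra\<close> with all of \<open>A\<close> as scalars means left ideal;
  \<open>Lid_F\<close> forgets this down to an \<open>F\<close>-space.\<close>

lemma Lid_subalgebra: "s \<in> carrier A ==> subalgebra (carrier A) (Lid s) A"
proof (rule subalgebra.intro)
 assume s: "s \<in> carrier A"
 show "subgroup (Lid s) (add_monoid A)"
  unfolding Lid_def
 proof (rule add.subgroupI)
  fix x y assume "x \<in> (%a. a ** s) ` carrier A" "y \<in> (%a. a ** s) ` carrier A"
  then obtain a b where ab: "a \<in> carrier A" "b \<in> carrier A" "x = a ** s" "y = b ** s" by blast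
  have "x \<oplus> y = (a \<oplus> b) ** s" "\<ominus> x = (\<ominus> a) ** s"
   using ab s by (simp_all add: l_distr l_minus)
  then show "x \<oplus> y \<in> (%a. a ** s) ` carrier A" "\<ominus> x \<in> (%a. a ** s) ` carrier A"
   using ab by auto
 qed (use s in auto)
 show "subalgebra_axioms (carrier A) (Lid s) A"
  using s by (auto simp: subalgebra_axioms_def Lid_def m_assoc[symmetric])
qed

lemma Lid_F: "s \<in> carrier A ==> subalgebra F (Lid s) A"
 using Lid_subalgebra F_carrier by (auto simp: subalgebra_def subalgebra_axioms_def)

lemma Rid_F: assumes s: "s \<in> carrier A" shows "subalgebra F (Rid s) A"
proof (rule subalgebraI[OF base])
 show "Rid s \<subseteq> carrier A" using s by (auto simp: Rid_def)
 show "\<zero> \<in> Rid s" unfolding Rid_def using s by (intro image_eqI[of _ _ \<zero>]) auto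
 show "u \<oplus> v \<in> Rid s" if "u \<in> Rid s" "v \<in> Rid s" for u v
 proof -
  obtain a b where "a \<in> carrier A" "b \<in> carrier A" "u = s ** a" "v = s ** b"
   using \<open>u \<in> Rid s\<close> \<open>v \<in> Rid s\<close> unfolding Rid_def by blast
  then show ?thesis using s unfolding Rid_def by (intro image_eqI[of _ _ "a \<oplus> b"]) (auto simp: r_distr)
 qed
 show "k ** v \<in> Rid s" if k: "k \<in> F" and "v \<in> Rid s" for k v
 proof -
  obtain a where a: "a \<in> carrier A" "v = s ** a"
   using \<open>v \<in> Rid s\<close> unfolding Rid_def by blast
  have "k ** v = s ** (k ** a)"
   using central[OF k] a s k F_carrier by (metis m_assoc subsetD)
  then show ?thesis using a k F_carrier unfolding Rid_def by blast
 qed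
qed

lemma Lid_self: "s \<in> carrier A ==> s \<in> Lid s"
 unfolding Lid_def by (intro image_eqI[of _ _ \<one>]) auto

lemma Lid_mono: "s \<in> carrier A ==> t \<in> Lid s ==> Lid t \<subseteq> Lid s"
 unfolding Lid_def by (force simp: m_assoc[symmetric])

lemma Lid_carrier: "s \<in> carrier A ==> Lid s \<subseteq> carrier A"
 unfolding Lid_def by auto

text \<open>\<open>Tr u v\<close> relates \<open>\<Sum> x\<^sub>i u y\<^sub>i\<close> to \<open>\<Sum> x\<^sub>i v y\<^sub>i\<close>; the first components form a two-sided
 ideal.\<close>

inductive Tr :: "'a => 'a => 'a => 'a => bool" for u v where
 Tr0: "Tr u v \<zero> \<zero>"
| TrS: "Tr u v a b ==> x \<in> carrier A ==> y \<in> carrier A ==>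
  Tr u v (a \<oplus> x ** u ** y) (b \<oplus> x ** v ** y)"

lemma Tr_closed:
 assumes "Tr u v a b" "u \<in> carrier A" "v \<in> carrier A"
 shows "a \<in> carrier A" "b \<in> carrier A"
 using assms by (induction) auto

lemma Tr_add:
 assumes "Tr u v a b" "Tr u v c d" and uv: "u \<in> carrier A" "v \<in> carrier A"
 shows "Tr u v (a \<oplus> c) (b \<oplus> d)"
 using assms(2)
proof induction
 case Tr0 then show ?case using assms(1) Tr_closed[OF assms(1) uv] by simp
next
 case (TrS c d x y)
 then have "Tr u v (a \<oplus> c \<oplus> x ** u ** y) (b \<oplus> d \<oplus> x ** v ** y)"
  by (intro Tr.TrS)
 then show ?case
  using Tr_closed[OF assms(1) uv] Tr_closed[OF TrS(1) uv] TrS uv by (simp add: a_assoc)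
qed

lemma Tr_mult:
 assumes "Tr u v a b" and uv: "u \<in> carrier A" "v \<in> carrier A" and z: "z \<in> carrier A"
 shows "Tr u v (z ** a) (z ** b)" "Tr u v (a ** z) (b ** z)"
 using assms(1)
proof induction
 case Tr0
 case 1 show ?case using z by (simp add: Tr.Tr0)
next
 case Tr0
 case 2 show ?case using z by (simp add: Tr.Tr0)
next
 case (TrS a b x y)
 note cl = Tr_closed[OF TrS(1) uv]
 case 1
 have "Tr u v (z ** a \<oplus> (z ** x) ** u ** y) (z ** b \<oplus> (z ** x) ** v ** y)"
  using TrS z by (intro Tr.TrS) auto
 then show ?case using cl TrS z uv by (simp add: r_distr m_assoc)
next
 case (TrS a b x y)
 note cl = Tr_closed[OF TrS(1) uv]
 case 2
 have "Tr u v (a ** z \<oplus> x ** u ** (y ** z)) (b ** z \<oplus> x ** v ** (y ** z))"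
  using TrS z by (intro Tr.TrS) auto
 then show ?case using cl TrS z uv by (simp add: l_distr m_assoc)
qed

text \<open>The ideal of first components contains \<open>u\<close>, hence is everything by
  simplicity. In particular \<open>1\<close> has the form \<open>\<Sum> x_i u y_i\<close>.\<close>

lemma Tr_all:
 assumes u: "u \<in> carrier A" "u ~= \<zero>" and v: "v \<in> carrier A" and a: "a \<in> carrier A"
 shows "\<exists>b. Tr u v a b"
proof -
 let ?I = "{a. \<exists>b. Tr u v a b}"
 have "ideal ?I A"
 proof (rule idealI[OF ring_axioms])
  show "subgroup ?I (add_monoid A)"
  proof (rule add.subgroupI)
   show "?I \<subseteq> carrier A" using Tr_closed u v by blast
   show "?I ~= {}" using Tr0 by blast
   show "\<ominus> a \<in> ?I" if aI: "a \<in> ?I" for a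
   proof -
    obtain b where b: "Tr u v a b" using aI by blast
    have "Tr u v ((\<ominus> \<one>) ** a) ((\<ominus> \<one>) ** b)" using Tr_mult[OF b u(1) v] by simp
    then show ?thesis using Tr_closed[OF b u(1) v] by (auto simp: l_minus)
   qed
   show "a \<oplus> b \<in> ?I" if "a \<in> ?I" "b \<in> ?I" for a b
    using that Tr_add u v by blast
  qed
  show "x ** a \<in> ?I" "a ** x \<in> ?I" if "a \<in> ?I" "x \<in> carrier A" for a x
   using that Tr_mult u v by blast+
 qed
 moreover have "u \<in> ?I"
  using TrS[OF Tr0, of \<one> \<one> u v] u v by auto
 ultimately show ?thesis using simple[of ?I u] u a by blast
qed

text \<open>A simple ring is prime: multiplying an expression \<open>1 = \<Sum> x_i v y_i\<close> by
  \<open>u\<close> from the left makes every summand vanish.\<close>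

lemma zero_if_annihilated:
 assumes u: "u \<in> carrier A" and v: "v \<in> carrier A" "v ~= \<zero>"
  and z: "!!x. x \<in> carrier A ==> u ** x ** v = \<zero>"
 shows "u = \<zero>"
proof -
 obtain b where b: "Tr v v \<one> b" using Tr_all[OF v v(1), of \<one>] by auto
 have "u ** a = \<zero>" if "Tr v v a b" for a b
  using that
 proof induction
  case (TrS a b x y)
  have "u ** (a \<oplus> x ** v ** y) = u ** a \<oplus> (u ** x ** v) ** y"
   using TrS Tr_closed[OF TrS(1) v(1) v(1)] u v by (simp add: r_distr m_assoc)
  then show ?case using TrS z by simp
 qed (use u in simp)
 from this[OF b] show ?thesis using u by simp
qed

text \<open>Primitivity is stated as minimality of the left ideal \<open>A e\<close>, the form in
  which it produces inverses in the corner and makes right multiplications on \<open>A e\<close>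
  injective.\<close>

definition primitive_idem :: "'a => bool" where
 "primitive_idem e \<longleftrightarrow> e \<in> carrier A \<and> e ~= \<zero> \<and> e ** e = e \<and>
   (\<forall>t\<in>Lid e. t ~= \<zero> --> Lid t = Lid e)"

text \<open>Brauer's lemma: a minimal left ideal with nonzero square is generated by an idempotent.
  Minimality comes from least dimension.\<close>

lemma exists_primitive_idem: "\<exists>e. primitive_idem e"
proof -
 define P where "P s m \<longleftrightarrow> s \<in> carrier A \<and> s ~= \<zero> \<and> dimension m F (Lid s)" for s m
 have dimL: "\<exists>m. dimension m F (Lid s)" if "s \<in> carrier A" for s
  using subspace_dimension[OF base dim_A Lid_F[OF that] Lid_carrier[OF that]] by metis
 have "\<exists>m s. P s m" unfolding P_def using dimL one_neq_zero by blast
 then obtain s where s: "P s (LEAST m. \<exists>s. P s m)"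
  using LeastI_ex[of "%m. \<exists>s. P s m"] by blast
 define M where "M = (LEAST m. \<exists>s. P s m)"
 have min: "M \<le> m" if "P s m" for s m unfolding M_def using that by (intro Least_le) blast
 have sM: "s \<in> carrier A" "s ~= \<zero>" "dimension M F (Lid s)" using s by (auto simp: P_def M_def)
 have minl: "Lid t = Lid s" if t: "t \<in> Lid s" "t ~= \<zero>" for t
 proof -
  have tc: "t \<in> carrier A" using t sM Lid_carrier by blast
  obtain m where m: "dimension m F (Lid t)" "m \<le> M" "m = M ==> Lid t = Lid s"
   using subspace_dimension[OF base sM(3) Lid_F[OF tc] Lid_mono[OF sM(1) t(1)]] by blast
  then show ?thesis using min[of t m] t tc unfolding P_def by simp
 qed
 obtain x where x: "x \<in> carrier A" "s ** x ** s ~= \<zero>"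
  using zero_if_annihilated[OF sM(1) sM(1,2)] sM by blast
 \<comment> \<open>Right multiplication by \<open>g\<close> maps \<open>A s\<close> into itself and
   does not kill \<open>s\<close>, so by minimality it is bijective. The preimage \<open>e\<close>
   of \<open>g\<close> is idempotent, since \<open>e ** e\<close> and \<open>e\<close> have the same
   image.\<close>
 define g where "g = x ** s"
 have g: "g \<in> Lid s" "g \<in> carrier A" "s ** g ~= \<zero>"
  using x sM by (auto simp: g_def Lid_def m_assoc)
 have g0: "g ~= \<zero>" using g(3) sM(1) by auto
 have "s ** g \<in> Lid s" using g sM unfolding Lid_def by (auto simp: m_assoc[symmetric])
 then have "Lid (s ** g) = Lid s" using minl g(3) by blast
 then have "g \<in> Lid (s ** g)" using g(1) by simp
 then obtain y where y: "y \<in> carrier A" "y ** (s ** g) = g" unfolding Lid_def by auto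
 define e where "e = y ** s"
 have e: "e \<in> Lid s" "e \<in> carrier A" "e ** g = g"
  using y sM g by (auto simp: e_def Lid_def m_assoc)
 have e0: "e ~= \<zero>" using e(3) g0 g(2) by auto
 have Ls: "Lid e = Lid s" using minl e(1) e0 by blast
 have inj: "t = \<zero>" if t: "t \<in> Lid s" "t ** g = \<zero>" for t
 proof (rule ccontr)
  assume "t ~= \<zero>"
  then have "s \<in> Lid t" using minl[OF t(1)] Lid_self[OF sM(1)] by simp
  then obtain a where "a \<in> carrier A" "s = a ** t" unfolding Lid_def by auto
  moreover have "t \<in> carrier A" using t(1) Lid_carrier[OF sM(1)] by blast
  ultimately have "s ** g = \<zero>" using t(2) g(2) by (simp add: m_assoc)
  then show False using g by simp
 qed
 have "e ** e \<in> Lid s"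
  using subalgebraD(6)[OF Lid_subalgebra[OF sM(1)]] e by blast
 then have "e ** e \<ominus> e \<in> Lid s"
  using subalgebraD(5)[OF Lid_subalgebra[OF sM(1)]] e by blast
 moreover have "(e ** e \<ominus> e) ** g = \<zero>"
  using e g by (simp add: minus_eq l_distr l_minus m_assoc r_neg)
 ultimately have "e ** e \<ominus> e = \<zero>" using inj by blast
 then have "e ** e = e" using e by (simp add: r_right_minus_eq)
 then have "primitive_idem e"
  unfolding primitive_idem_def Ls using e(2) e0 minl by blast
 then show ?thesis ..
qed

context
 fixes e assumes prim: "primitive_idem e"
begin

lemma e_props: "e \<in> carrier A" "e ~= \<zero>" "e ** e = e" "t \<in> Lid e ==> t ~= \<zero> ==> Lid t = Lid e"
 using prim by (auto simp: primitive_idem_def)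

lemma Lid_e: "t \<in> Lid e ==> t ** e = t" "t \<in> Lid e ==> t \<in> carrier A"
 using e_props by (auto simp: Lid_def m_assoc)

lemma Rid_e: "t \<in> Rid e ==> e ** t = t" "t \<in> Rid e ==> t \<in> carrier A"
 using e_props by (auto simp: Rid_def m_assoc[symmetric])

lemma Cor_iff: "c \<in> Cor e \<longleftrightarrow> c \<in> carrier A \<and> e ** c = c \<and> c ** e = c"
proof
 assume "c \<in> Cor e"
 then obtain a where a: "a \<in> carrier A" "c = e ** a ** e" unfolding Cor_def by auto
 then show "c \<in> carrier A \<and> e ** c = c \<and> c ** e = c"
  using e_props(1,3) by (metis m_assoc m_closed)
next
 assume "c \<in> carrier A \<and> e ** c = c \<and> c ** e = c"
 then show "c \<in> Cor e" unfolding Cor_def by (intro image_eqI[of _ _ c]) auto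
qed

lemma Cor_eq: "Cor e = Lid e \<inter> Rid e"
proof -
 have "c \<in> Lid e" if "c \<in> carrier A" "c ** e = c" for c
  using that unfolding Lid_def by (intro image_eqI[of _ _ c]) auto
 moreover have "c \<in> Rid e" if "c \<in> carrier A" "e ** c = c" for c
  using that unfolding Rid_def by (intro image_eqI[of _ _ c]) auto
 ultimately show ?thesis using Lid_e Rid_e unfolding Cor_iff[abs_def] set_eq_iff Cor_iff by blast
qed

text \<open>Schur's lemma for \<open>A e\<close>: a nonzero \<open>c\<close> in the corner generates
  the same minimal left ideal as \<open>e\<close>, which yields a left inverse; left inverses of all
  nonzero elements are two-sided.\<close>

lemma corner_skew_field: "skew_field (A(|carrier := Cor e, one := e|))"
proof -
 let ?C = "A(|carrier := Cor e, one := e|)"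
 have sub: "subalgebra F (Cor e) A"
  unfolding Cor_eq using subalgebra_inter Lid_F Rid_F e_props by blast
 note S = subalgebraD[OF sub]
 have car: "c \<in> carrier A" "e ** c = c" "c ** e = c" if "c \<in> Cor e" for c
  using that Cor_iff by auto
 have mcl: "c ** d \<in> Cor e" if "c \<in> Cor e" "d \<in> Cor e" for c d
  using car[OF that(1)] car[OF that(2)] e_props(1) unfolding Cor_iff
  by (metis m_assoc m_closed)
 have eC: "e \<in> Cor e" using Cor_iff e_props by auto
 have ab: "abelian_group ?C"
 proof (rule abelian_groupI)
  show "\<exists>y\<in>carrier ?C. y \<oplus>[?C] x = \<zero>[?C]" if "x \<in> carrier ?C" for x
   using that S(4)[of x] car(1)[of x] by (auto intro!: bexI[of _ "\<ominus> x"] l_neg)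
 qed (use S(1-3) car(1) in "auto simp: a_ac")
 have mon: "Group.monoid ?C"
  by (rule monoidI) (use mcl eC car in "auto simp: m_assoc")
 have ring: "ring ?C"
  by (rule ringI[OF ab mon]) (use car(1) in "simp_all add: l_distr r_distr")
 have left: "\<exists>d\<in>Cor e. d ** c = e" if c: "c \<in> Cor e" "c ~= \<zero>" for c
 proof -
  have "Lid c = Lid e" using e_props(4)[OF _ c(2)] c(1) Cor_eq by blast
  then have "e \<in> Lid c" using Lid_self[OF e_props(1)] by simp
  then obtain a where a: "a \<in> carrier A" "e = a ** c" unfolding Lid_def by auto
  have "(e ** a ** e) ** c = e"
   using a car[OF c(1)] e_props by (metis m_assoc m_closed)
  then show ?thesis using a(1) unfolding Cor_def by blast
 qed
 have "Units ?C = Cor e - {\<zero>}"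
 proof
  have "\<zero> \<notin> Units ?C"
   using e_props car unfolding Units_def by auto
  then show "Units ?C \<subseteq> Cor e - {\<zero>}" unfolding Units_def by auto
  show "Cor e - {\<zero>} \<subseteq> Units ?C"
  proof
   fix c assume "c \<in> Cor e - {\<zero>}"
   then have c: "c \<in> Cor e" "c ~= \<zero>" by auto
   obtain d where d: "d \<in> Cor e" "d ** c = e" using left[OF c] by blast
   have "d ~= \<zero>" using d(2) e_props(2) car[OF c(1)] by auto
   then obtain d' where d': "d' \<in> Cor e" "d' ** d = e" using left d by blast
   have "c = d'" using d d' car c by (metis m_assoc)
   then show "c \<in> Units ?C" using c d d' unfolding Units_def by auto
  qed
 qed
 then show ?thesis
  using ring e_props unfolding skew_field_def skew_field_axioms_def by auto
qed

context
 assumes comm: "!!c d. c \<in> Cor e ==> d \<in> Cor e ==> c ** d = d ** c"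
begin

text \<open>As \<open>A = A e A\<close>, the assignment \<open>x e y \<mapsto> x c y\<close> extends
  to an endomorphism of \<open>A\<close> as a bimodule, that is, to multiplication by a central
  \<open>z\<close>, the image of \<open>1\<close>. Commutativity of the corner makes it well
  defined, which is the content of \<open>swap\<close> and \<open>key\<close>.\<close>

lemma corner_scalars: assumes c: "c \<in> Cor e" shows "\<exists>z\<in>F. c = z ** e"
proof -
 note cc = c[unfolded Cor_iff]
 note ee = e_props(1)
 obtain z where z: "Tr e c \<one> z" using Tr_all[OF e_props(1,2)] cc by blast
 have zc: "z \<in> carrier A" using Tr_closed[OF z] e_props cc by auto
 have swap: "c ** (y ** x) ** e = e ** (y ** x) ** c" if "x \<in> carrier A" "y \<in> carrier A" for x y
 proof -
  have "e ** (y ** x) ** e \<in> Cor e" unfolding Cor_def using that by auto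
  from comm[OF c this] have "c ** (e ** (y ** x) ** e) = (e ** (y ** x) ** e) ** c" .
  then show ?thesis using cc that ee by (metis m_assoc m_closed)
 qed
 have key: "b ** (x ** e ** y) = a ** (x ** c ** y) \<and> (x ** e ** y) ** b = (x ** c ** y) ** a"
  if "Tr e c a b" "x \<in> carrier A" "y \<in> carrier A" for a b x y
  using that(1)
 proof induction
  case Tr0 then show ?case using that cc ee by simp
 next
  case (TrS a b x' y')
  note cl = Tr_closed[OF TrS(1) ee] cc
  have 1: "x' ** c ** y' ** (x ** e ** y) = x' ** e ** y' ** (x ** c ** y)"
  proof -
   have "x' ** c ** y' ** (x ** e ** y) = x' ** (c ** (y' ** x) ** e) ** y"
    using TrS cl ee that by (simp add: m_assoc)
   also have "\<dots> = x' ** (e ** (y' ** x) ** c) ** y" using swap TrS that by simp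
   also have "\<dots> = x' ** e ** y' ** (x ** c ** y)" using TrS cl ee that by (simp add: m_assoc)
   finally show ?thesis .
  qed
  have 2: "(x ** e ** y) ** (x' ** c ** y') = (x ** c ** y) ** (x' ** e ** y')"
  proof -
   have "(x ** e ** y) ** (x' ** c ** y') = x ** (e ** (y ** x') ** c) ** y'"
    using TrS cl ee that by (simp add: m_assoc)
   also have "\<dots> = x ** (c ** (y ** x') ** e) ** y'" using swap TrS that by simp
   also have "\<dots> = (x ** c ** y) ** (x' ** e ** y')" using TrS cl ee that by (simp add: m_assoc)
   finally show ?thesis .
  qed
  show ?case
   using TrS cl ee that 1 2 by (simp add: l_distr r_distr)
 qed
 have comm_all: "z ** a = a ** z" if "Tr e c a b" for a b
  using that
 proof induction
  case Tr0 then show ?case using zc by simp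
 next
  case (TrS a b x y)
  have "z ** (x ** e ** y) = (x ** e ** y) ** z"
   using key[OF z TrS(2,3)] TrS cc by simp
  then show ?case using TrS zc ee Tr_closed[OF TrS(1) ee] cc by (simp add: l_distr r_distr)
 qed
 have "z \<in> F"
  using center[OF zc] comm_all Tr_all[OF e_props(1,2)] cc by blast
 moreover have "z ** e = c"
  using key[OF z, of \<one> \<one>] ee cc by simp
 ultimately show ?thesis by auto
qed

text \<open>With \<open>e A e = F e\<close>, a left ideal \<open>U\<close> is a direct sum of copies
  \<open>A t\<close> of \<open>A e\<close>, one for each \<open>t\<close> in an
  \<open>F\<close>-basis of \<open>U \<inter> e A\<close>. For \<open>U = A\<close> this is the
  product formula.\<close>

lemma corner_dims:
 obtains k l where "dimension k F (Lid e)" "dimension l F (Rid e)" "N = k * l"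
proof -
 note ee = e_props(1)
 obtain k where k: "dimension k F (Lid e)"
  using subspace_dimension[OF base dim_A Lid_F[OF ee] Lid_carrier[OF ee]] by metis
 have orbit: "dimension k F (Lid t)" if t: "t \<in> Rid e" "t ~= \<zero>" for t
 proof -
  have inj: "w = \<zero>" if w: "w \<in> Lid e" "w ** t = \<zero>" for w
  proof (rule ccontr)
   assume "w ~= \<zero>"
   then have "e \<in> Lid w" using e_props(4)[OF w(1)] Lid_self[OF ee] by simp
   then obtain a where "a \<in> carrier A" "e = a ** w" unfolding Lid_def by auto
   then have "e ** t = \<zero>" using w Lid_e Rid_e[OF t(1)] by (metis m_assoc r_null)
   then show False using Rid_e t by simp
  qed
  have tc: "t \<in> carrier A" "e ** t = t" using Rid_e t by auto
  have Lt: "Lid t = (%w. w ** t) ` Lid e"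
   unfolding Lid_def image_image using tc ee by (intro image_cong) (auto simp: m_assoc)
  show ?thesis
   unfolding Lt
  proof (rule dimension_linear_inj[OF base k])
   show "w ** t \<in> carrier A" if "w \<in> Lid e" for w using Lid_e(2)[OF that] tc by simp
   show "(u \<oplus> v) ** t = u ** t \<oplus> v ** t" if "u \<in> Lid e" "v \<in> Lid e" for u v
    using Lid_e(2)[OF that(1)] Lid_e(2)[OF that(2)] tc by (simp add: l_distr)
   show "z ** u ** t = z ** (u ** t)" if "z \<in> F" "u \<in> Lid e" for z u
    using Lid_e(2)[OF that(2)] tc that(1) F_carrier m_assoc by blast
  qed (use inj in blast)
 qed
 \<comment> \<open>Left ideals for which the two counts match; a maximal one contains
   \<open>e A\<close>, hence \<open>A e A = A\<close>.\<close>
 define P where "P U i \<longleftrightarrow> subalgebra (carrier A) U A \<and> dimension (k * i) F U \<and>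
   dimension i F (U \<inter> Rid e)" for U i
 have PF: "subalgebra F U A" if "P U i" for U i
  using that F_carrier unfolding P_def subalgebra_def subalgebra_axioms_def by auto
 obtain l where l: "dimension l F (Rid e)"
  using subspace_dimension[OF base dim_A Rid_F[OF ee] subalgebraD(1)[OF Rid_F[OF ee]]] by auto
 have le: "i \<le> l" if "P U i" for U i
 proof -
  have "subalgebra F (U \<inter> Rid e) A" using PF[OF that] Rid_F[OF ee] subalgebra_inter by blast
  then obtain m where "dimension m F (U \<inter> Rid e)" "m \<le> l"
   using subspace_dimension[OF base l _ Int_lower2] by metis
  then show ?thesis using \<open>P U i\<close> dimension_is_inj[OF base] unfolding P_def by metis
 qed
 have "P {\<zero>} 0"
 proof -
  have "\<zero> \<in> Rid e" using subalgebraD(2)[OF Rid_F[OF ee]] .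
  then have "{\<zero>} \<inter> Rid e = {\<zero>}" by auto
  moreover have "subalgebra (carrier A) {\<zero>} A"
   by (rule subalgebra.intro) (auto simp: subalgebra_axioms_def intro!: add.subgroupI)
  ultimately show ?thesis unfolding P_def by auto
 qed
 then have ex: "\<exists>i U. P U i" by blast
 define M where "M = Max {i. \<exists>U. P U i}"
 have fin: "finite {i. \<exists>U. P U i}" by (rule finite_subset[of _ "{..l}"]) (use le in auto)
 have "M \<in> {i. \<exists>U. P U i}" unfolding M_def using fin ex by (intro Max_in) auto
 then obtain U where U: "P U M" by blast
 have max: "i \<le> M" if "P U' i" for U' i
  unfolding M_def using fin that by (intro Max_ge) auto
 have sU: "subalgebra (carrier A) U A" using U by (simp add: P_def)
 note Us = subalgebraD[OF sU]
 have "Rid e \<subseteq> U"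
 proof (rule ccontr)
  assume "\<not> Rid e \<subseteq> U"
  then obtain t where t: "t \<in> Rid e" "t \<notin> U" by blast
  have t0: "t ~= \<zero>" using t Us by auto
  have tc: "t \<in> carrier A" "e ** t = t" using Rid_e t by auto
  \<comment> \<open>The one-dimensional corner enters here: \<open>A t\<close> meets
    \<open>e A\<close> only in the line \<open>F t\<close>.\<close>
  have eL: "x \<in> Lid t ==> x \<in> Rid e ==> \<exists>z\<in>F. x = z ** t" for x
  proof -
   assume x: "x \<in> Lid t" "x \<in> Rid e"
   then obtain a where a: "a \<in> carrier A" "x = a ** t" unfolding Lid_def by auto
   have "x = e ** x" using Rid_e x by simp
   also have "\<dots> = (e ** a ** e) ** t" using a tc ee by (simp add: m_assoc)
   finally have 1: "x = (e ** a ** e) ** t" .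
   have "e ** a ** e \<in> Cor e" using a unfolding Cor_def by auto
   then obtain z where z: "z \<in> F" "e ** a ** e = z ** e" using corner_scalars by blast
   have "x = z ** t" using 1 z tc ee F_carrier by (metis m_assoc subsetD)
   then show ?thesis using z by blast
  qed
  have int: "U \<inter> Lid t \<subseteq> {\<zero>}"
  proof
   fix x assume x: "x \<in> U \<inter> Lid t"
   then obtain a where a: "a \<in> carrier A" "x = a ** t" unfolding Lid_def by auto
   show "x \<in> {\<zero>}"
   proof (rule ccontr)
    assume x0: "x \<notin> {\<zero>}"
    have "a ** e ~= \<zero>" using a x0 tc ee by (metis insertI1 l_null m_assoc)
    then have "Lid (a ** e) = Lid e" using e_props(4) a(1) unfolding Lid_def by blast
    then have "e \<in> Lid (a ** e)" using Lid_self[OF ee] by simp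
    then obtain b where b: "b \<in> carrier A" "e = b ** (a ** e)" unfolding Lid_def by auto
    have "b ** x = b ** (a ** e) ** t" using a b tc ee by (metis m_assoc m_closed)
    also have "\<dots> = t" using b tc by simp
    finally show False using Us(6)[OF b(1)] x t by auto
   qed
  qed
  let ?U = "U <+>[A] Lid t"
  have dU: "dimension (k * M + k) F ?U"
   using direct_sum_dimension[OF base _ orbit[OF t(1) t0] int] U unfolding P_def by blast
  have line: "dimension 1 F ((%z. z ** t) ` F)"
  proof -
   have "Span F [t] = (%z. z ** t) ` F"
    using line_extension_mem_iff[of _ F t "{\<zero>}"] tc F_carrier by (auto simp: image_iff) (metis m_closed r_zero subsetD)+
   moreover have "independent F [t]"
    using t0 tc by (auto intro!: li_Cons)
   ultimately show ?thesis using dimensionI[OF base, of "[t]"] by simp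
  qed
  have split: "?U \<inter> Rid e = (U \<inter> Rid e) <+>[A] (%z. z ** t) ` F"
  proof
   show "?U \<inter> Rid e \<subseteq> (U \<inter> Rid e) <+>[A] (%z. z ** t) ` F"
   proof
    fix x assume x: "x \<in> ?U \<inter> Rid e"
    then obtain u w where uw: "u \<in> U" "w \<in> Lid t" "x = u \<oplus> w" using mem_set_add_iff by blast
    have c: "u \<in> carrier A" "w \<in> carrier A" using uw Us(1) Lid_carrier tc by auto
    have "x = e ** u \<oplus> e ** w" using x uw Rid_e(1)[of x] c ee by (simp add: r_distr)
    moreover have "e ** u \<in> U \<inter> Rid e" using Us(6)[OF ee uw(1)] c unfolding Rid_def by auto
    moreover have "e ** w \<in> Lid t" "e ** w \<in> Rid e"
     using subalgebraD(6)[OF Lid_subalgebra[OF tc(1)] ee uw(2)] c unfolding Rid_def by auto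
    ultimately show "x \<in> (U \<inter> Rid e) <+>[A] (%z. z ** t) ` F"
     unfolding mem_set_add_iff using eL by blast
   qed
   show "(U \<inter> Rid e) <+>[A] (%z. z ** t) ` F \<subseteq> ?U \<inter> Rid e"
   proof
    fix x assume "x \<in> (U \<inter> Rid e) <+>[A] (%z. z ** t) ` F"
    then obtain u z where uz: "u \<in> U" "u \<in> Rid e" "z \<in> F" "x = u \<oplus> z ** t"
     unfolding mem_set_add_iff by blast
    have "z ** t \<in> Lid t" unfolding Lid_def using uz F_carrier by auto
    moreover have "x \<in> Rid e"
     using subalgebraD(3,6)[OF Rid_F[OF ee]] uz t by simp
    ultimately show "x \<in> ?U \<inter> Rid e" unfolding Int_iff mem_set_add_iff using uz by blast
   qed
  qed
  have "(U \<inter> Rid e) \<inter> (%z. z ** t) ` F \<subseteq> {\<zero>}"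
   using int F_carrier unfolding Lid_def by blast
  then have "dimension (M + 1) F (?U \<inter> Rid e)"
   unfolding split using direct_sum_dimension[OF base _ line] U unfolding P_def by blast
  moreover have "subalgebra (carrier A) ?U A"
  proof (rule subalgebra.intro)
   show "subgroup ?U (add_monoid A)"
    using finite_dimension_imp_subalgebra[OF base finite_dimensionI[OF dU]]
    by (simp add: subalgebra_def)
   show "subalgebra_axioms (carrier A) ?U A"
   proof
    fix b x assume b: "b \<in> carrier A" and "x \<in> ?U"
    then obtain u w where uw: "u \<in> U" "w \<in> Lid t" "x = u \<oplus> w" using mem_set_add_iff by blast
    have c: "u \<in> carrier A" "w \<in> carrier A" using uw Us(1) Lid_carrier tc by auto
    have "b ** x = b ** u \<oplus> b ** w" using uw c b by (simp add: r_distr)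
    then show "b ** x \<in> ?U"
     unfolding mem_set_add_iff
     using Us(6)[OF b uw(1)] subalgebraD(6)[OF Lid_subalgebra[OF tc(1)] b uw(2)] by blast
   qed
  qed
  ultimately have "P ?U (M + 1)" unfolding P_def using dU by (simp add: add.commute)
  then show False using max by fastforce
 qed
 then have "U \<inter> Rid e = Rid e" by auto
 then have lM: "l = M" using U l dimension_is_inj[OF base] unfolding P_def by metis
 \<comment> \<open>\<open>Tr_all\<close> for \<open>e\<close> and \<open>e\<close> expresses
   \<open>A = A e A\<close>.\<close>
 have "a \<in> U" if "Tr e e a b" for a b
  using that
 proof induction
  case (TrS a b x y)
  have "e ** y \<in> U" using \<open>Rid e \<subseteq> U\<close> TrS unfolding Rid_def by auto
  then have "x ** (e ** y) \<in> U" using Us(6) TrS by simp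
  then show ?case using Us(3) TrS ee by (simp add: m_assoc)
 qed (use Us in simp)
 then have "U = carrier A" using Tr_all[OF e_props(1,2) ee] Us(1) by blast
 then have "dimension (k * l) F (carrier A)" using U lM unfolding P_def by simp
 then have "N = k * l" by (rule dimension_is_inj[OF base dim_A])
 then show ?thesis by (rule that[OF k l])
qed

end
end
end

subsection \<open>Coordinates\<close>

text \<open>Coefficients stand on the left, and the value depends on the operations of
  \<open>R\<close> but not on its carrier, so it is the same in every subring
  (\<open>lc_consistent\<close>).\<close>

primrec lc :: "('a, 'm) ring_scheme => (nat => 'a) => (nat => 'a) => nat => 'a" where
 "lc R w b 0 = \<zero>[R]"
| "lc R w b (Suc n) = lc R w b n \<oplus>[R] b n **[R] w n"

lemma lc_consistent: "lc (R(|carrier := S, one := e|)) w b n = lc R w b n"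
 "lc (R(|carrier := S|)) w b n = lc R w b n"
 by (induction n) auto

lemma lc_cong: "(!!i. i < n ==> b i = c i) ==> (!!i. i < n ==> w i = v i) ==> lc R w b n = lc R v c n"
 by (induction n) auto

context ring
begin

lemma lc_closed [intro]:
 "(!!i. i < n ==> b i \<in> carrier R) ==> (!!i. i < n ==> w i \<in> carrier R) ==> lc R w b n \<in> carrier R"
 by (induction n) auto

lemma lc_add:
 assumes "!!i. i < n ==> b i \<in> carrier R" "!!i. i < n ==> c i \<in> carrier R"
  "!!i. i < n ==> w i \<in> carrier R"
 shows "lc R w b n \<oplus> lc R w c n = lc R w (%i. b i \<oplus> c i) n"
 using assms
proof (induction n)
 case (Suc n)
 have "lc R w b n \<in> carrier R" "lc R w c n \<in> carrier R"
  using Suc(2-4) by (auto intro!: lc_closed)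
 then show ?case using Suc by (simp add: l_distr a_ac Suc(1)[symmetric])
qed auto

lemma lc_lmult:
 assumes "!!i. i < n ==> b i \<in> carrier R" "!!i. i < n ==> w i \<in> carrier R" "x \<in> carrier R"
 shows "x ** lc R w b n = lc R w (%i. x ** b i) n"
 using assms
proof (induction n)
 case (Suc n)
 have "lc R w b n \<in> carrier R" using Suc(2-4) by (auto intro!: lc_closed)
 then show ?case using Suc by (simp add: r_distr m_assoc)
qed auto

lemma lc_rmult:
 assumes "!!i. i < n ==> b i \<in> carrier R" "!!i. i < n ==> w i \<in> carrier R" "x \<in> carrier R"
  "!!i. i < n ==> w i ** x = f i ** w i" "!!i. i < n ==> f i \<in> carrier R"
 shows "lc R w b n ** x = lc R w (%i. b i ** f i) n"
 using assms
proof (induction n)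
 case (Suc n)
 have "lc R w b n \<in> carrier R" using Suc(2-4) by (auto intro!: lc_closed)
 then show ?case using Suc by (simp add: l_distr m_assoc)
qed auto

lemma lc_zero:
 assumes "!!i. i < n ==> b i = \<zero>" "!!i. i < n ==> w i \<in> carrier R"
 shows "lc R w b n = \<zero>"
 using assms by (induction n) auto

lemma lc_single:
 assumes "!!i. i < n ==> w i \<in> carrier R" "j < n" "x \<in> carrier R"
 shows "lc R w (%i. if i = j then x else \<zero>) n = x ** w j"
 using assms
proof (induction n)
 case (Suc n)
 show ?case
 proof (cases "j = n")
  case True
  then have "lc R w (%i. if i = j then x else \<zero>) n = \<zero>"
   using Suc(2) by (intro lc_zero) auto
  then show ?thesis using True Suc by simp
 qed (use Suc in auto)
qed auto

lemma lc_hom: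
 assumes "h \<in> ring_hom R S" "ring S" "!!i. i < n ==> b i \<in> carrier R" "!!i. i < n ==> w i \<in> carrier R"
 shows "h (lc R w b n) = lc S (%i. h (w i)) (%i. h (b i)) n"
 using assms(3,4)
proof (induction n)
 case 0
 then show ?case using ring_hom_zero[OF assms(1) ring_axioms assms(2)] by simp
next
 case (Suc n)
 then show ?case
  using ring_hom_add[OF assms(1), of "lc R w b n" "b n ** w n"] ring_hom_mult[OF assms(1)]
  by (auto simp: lc_closed)
qed

lemma lc_mem:
 assumes "!!i. i < n ==> b i ** w i \<in> V" "\<zero> \<in> V" "!!u v. u \<in> V ==> v \<in> V ==> u \<oplus> v \<in> V"
 shows "lc R w b n \<in> V"
 using assms by (induction n) auto

text \<open>\<open>B\<close> is any set of left coefficients: a subfield in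
  \<open>exists_basis\<close>, the image of the noncommutative \<open>D\<close> or of the field
  \<open>E\<close> in crossed products.\<close>

definition lspan :: "'a set => (nat => 'a) => nat => 'a set" where
 "lspan B w n = {lc R w b n |b. \<forall>i<n. b i \<in> B}"

definition lindep :: "'a set => (nat => 'a) => nat => bool" where
 "lindep B w n \<longleftrightarrow> (\<forall>b. (\<forall>i<n. b i \<in> B) --> lc R w b n = \<zero> --> (\<forall>i<n. b i = \<zero>))"

lemma minus_eqI: "x \<in> carrier R ==> y \<in> carrier R ==> x \<oplus> y = z ==> z \<ominus> y = x"
 by (auto simp: minus_eq a_assoc r_neg)

lemma lspanI: "x = lc R w b n ==> \<forall>i<n. b i \<in> B ==> x \<in> lspan B w n"
 unfolding lspan_def by blast

lemma lindepD:
 "lindep B w n ==> \<forall>i<n. b i \<in> B ==> lc R w b n = \<zero> ==> i < n ==> b i = \<zero>"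
 unfolding lindep_def by blast

text \<open>Each new summand \<open>B w_n\<close> is a copy of \<open>B\<close>, and by independence
  it meets the span of the previous ones in zero.\<close>

lemma lspan_dimension:
 assumes K: "subfield K R" and B: "dimension d K B"
  and w: "!!i. i < n ==> w i \<in> carrier R" and ind: "lindep B w n"
 shows "dimension (d * n) K (lspan B w n)"
 using w ind
proof (induction n)
 case 0
 have "lspan B w 0 = {\<zero>}" by (auto simp: lspan_def)
 then show ?case by simp
next
 case (Suc n)
 note Bp = space_subgroup_props[OF K B]
 have bc: "b \<in> carrier R" if "b \<in> B" for b using that Bp by auto
 have ind': "lindep B w n"
  unfolding lindep_def
 proof (intro allI impI)
  fix b i assume b: "\<forall>i<n. b i \<in> B" "lc R w b n = \<zero>" "i < n"
  let ?b = "%i. if i < n then b i else \<zero>"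
  have "lc R w ?b n = lc R w b n" by (rule lc_cong) auto
  then have "lc R w ?b (Suc n) = \<zero>" using b Suc(2) by simp
  moreover have "\<forall>i<Suc n. ?b i \<in> B" using b Bp by auto
  ultimately show "b i = \<zero>" using lindepD[OF Suc(3), of ?b i] b(3) by simp
 qed
 have IH: "dimension (d * n) K (lspan B w n)" using Suc ind' by simp
 have inj: "b = \<zero>" if b: "b \<in> B" "b ** w n = \<zero>" for b
 proof -
  let ?b = "%i. if i = n then b else \<zero>"
  have "lc R w ?b (Suc n) = \<zero>" using lc_single[of "Suc n" w n b] Suc(2) b bc by simp
  moreover have "\<forall>i<Suc n. ?b i \<in> B" using b Bp by auto
  ultimately show ?thesis using lindepD[OF Suc(3), of ?b n] by simp
 qed
 have dn: "dimension d K ((%b. b ** w n) ` B)"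
  by (rule dimension_linear_inj[OF K B])
   (use Suc(2) bc inj subfieldE(3)[OF K] in "auto simp: l_distr m_assoc subset_iff")
 have int: "lspan B w n \<inter> (%b. b ** w n) ` B \<subseteq> {\<zero>}"
 proof
  fix x assume "x \<in> lspan B w n \<inter> (%b. b ** w n) ` B"
  then obtain b c where b: "\<forall>i<n. b i \<in> B" "x = lc R w b n" and c: "c \<in> B" "x = c ** w n"
   unfolding lspan_def by blast
  let ?b = "%i. if i < n then b i else \<ominus> c"
  have "lc R w ?b n = x" unfolding b(2) by (rule lc_cong) auto
  then have "lc R w ?b (Suc n) = \<zero>" using c bc[OF c(1)] Suc(2) by (simp add: l_minus r_neg)
  moreover have "\<forall>i<Suc n. ?b i \<in> B" using b c Bp by auto
  ultimately have "\<ominus> c = \<zero>" using lindepD[OF Suc(3), of ?b n] by simp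
  then have "c = \<zero>" using bc[OF c(1)] by simp
  then show "x \<in> {\<zero>}" using c Suc(2) by simp
 qed
 have "lspan B w (Suc n) = lspan B w n <+>[R] (%b. b ** w n) ` B"
 proof (intro equalityI subsetI)
  fix x assume "x \<in> lspan B w (Suc n)"
  then obtain b where "\<forall>i<Suc n. b i \<in> B" "x = lc R w b (Suc n)" unfolding lspan_def by blast
  then show "x \<in> lspan B w n <+>[R] (%b. b ** w n) ` B"
   unfolding mem_set_add_iff lspan_def
   by (intro bexI[of _ "lc R w b n"] bexI[of _ "b n ** w n"]) auto
 next
  fix x assume "x \<in> lspan B w n <+>[R] (%b. b ** w n) ` B"
  then obtain b c where b: "\<forall>i<n. b i \<in> B" "c \<in> B" "x = lc R w b n \<oplus> c ** w n"
   unfolding lspan_def mem_set_add_iff by blast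
  let ?b = "%i. if i < n then b i else c"
  have "lc R w ?b n = lc R w b n" by (rule lc_cong) auto
  then have "x = lc R w ?b (Suc n)" "\<forall>i<Suc n. ?b i \<in> B" using b by auto
  then show "x \<in> lspan B w (Suc n)" unfolding lspan_def by blast
 qed
 then show ?case using direct_sum_dimension[OF K IH dn int] by (simp add: add.commute)
qed

lemma exists_basis:
 assumes K: "subfield K R" and "dimension n K E"
 shows "\<exists>u. (\<forall>i<n. u i \<in> E) \<and> E = lspan K u n \<and> lindep K u n"
proof -
 note Kp = subringE[OF subfieldE(1)[OF K]]
 have Kc: "k \<in> carrier R" if "k \<in> K" for k using that Kp(1) by auto
 have "\<exists>u. (\<forall>i<n. u i \<in> carrier R) \<and> E = lspan K u n \<and> lindep K u n"
  if "dimension n K' E" "K' = K" for n K' E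
  using that
 proof (induction rule: dimension.induct)
  case (zero_dim K')
  then show ?case by (auto simp: lspan_def lindep_def)
 next
  case (Suc_dim v E n K')
  then obtain u where u: "\<forall>i<n. u i \<in> carrier R" "E = lspan K u n" "lindep K u n" by auto
  let ?u = "u(n := v)"
  have eq: "lc R ?u b n = lc R u b n" for b by (rule lc_cong) auto
  have "line_extension K v E = lspan K ?u (Suc n)"
  proof (intro equalityI subsetI)
   fix x assume "x \<in> line_extension K v E"
   then obtain k b where kb: "k \<in> K" "\<forall>i<n. b i \<in> K" "x = k ** v \<oplus> lc R u b n"
    unfolding line_extension_mem_iff u(2) lspan_def by blast
   have "lc R u b n \<in> carrier R" using kb u Kc by (intro lc_closed) auto
   moreover have "lc R u (b(n := k)) n = lc R u b n" by (rule lc_cong) auto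
   ultimately have "x = lc R ?u (b(n := k)) (Suc n)"
    using kb eq[of "b(n := k)"] Kc Suc_dim(1) by (simp add: a_comm)
   moreover have "\<forall>i<Suc n. (b(n := k)) i \<in> K" using kb by auto
   ultimately show "x \<in> lspan K ?u (Suc n)" unfolding lspan_def by blast
  next
   fix x assume "x \<in> lspan K ?u (Suc n)"
   then obtain b where b: "\<forall>i<Suc n. b i \<in> K" "x = lc R ?u b (Suc n)"
    unfolding lspan_def by blast
   have "lc R u b n \<in> carrier R" using b u Kc by (intro lc_closed) auto
   then have "x = b n ** v \<oplus> lc R u b n" using b eq Kc Suc_dim(1) by (simp add: a_comm)
   then show "x \<in> line_extension K v E"
    unfolding line_extension_mem_iff u(2) lspan_def using b
    by (intro bexI[of _ "b n"] bexI[of _ "lc R u b n"]) auto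
  qed
  moreover have "lindep K ?u (Suc n)"
   unfolding lindep_def
  proof (intro allI impI)
   fix b i assume b: "\<forall>i<Suc n. b i \<in> K" "lc R ?u b (Suc n) = \<zero>" "i < Suc n"
   have c: "lc R u b n \<in> carrier R" using b u Kc by (intro lc_closed) auto
   have 0: "lc R u b n \<oplus> b n ** v = \<zero>" using b eq by simp
   have bn: "b n = \<zero>"
   proof (rule ccontr)
    assume "b n ~= \<zero>"
    then have inv: "inv (b n) \<in> K" "inv (b n) ** b n = \<one>"
     using subfield_m_inv[OF K] b by auto
    have bv: "b n \<in> carrier R" "inv (b n) \<in> carrier R" "v \<in> carrier R"
     using b inv Kc Suc_dim(1) by auto
    have "b n ** v \<oplus> lc R u b n = \<zero>" using 0 c bv by (simp add: a_comm)
    then have "b n ** v = \<ominus> lc R u b n" using c bv minus_equality by (metis m_closed)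
    moreover have "v = inv (b n) ** (b n ** v)" using inv bv by (simp add: m_assoc[symmetric])
    ultimately have "v = inv (b n) ** (\<ominus> lc R u b n)" by simp
    also have "\<dots> = (\<ominus> (inv (b n))) ** lc R u b n"
     using inv Kc c by (simp add: l_minus r_minus)
    also have "\<dots> = lc R u (%i. (\<ominus> (inv (b n))) ** b i) n"
     using inv Kc b u by (intro lc_lmult) auto
    finally have "v \<in> E"
     unfolding u(2) by (rule lspanI) (use inv Kp b in auto)
    then show False using Suc_dim by simp
   qed
   then have "lc R u b n = \<zero>" using 0 c Suc_dim(1) by simp
   then have "i < n ==> b i = \<zero>" using lindepD[OF u(3), of b i] b(1) by simp
   then show "b i = \<zero>" using bn b(3) less_Suc_eq by auto
  qed
  moreover have "\<forall>i<Suc n. ?u i \<in> carrier R" using u(1) Suc_dim(1) by auto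
  ultimately show ?case unfolding \<open>K' = K\<close> by blast
 qed
 then obtain u where u: "\<forall>i<n. u i \<in> carrier R" "E = lspan K u n" "lindep K u n"
  using assms(2) by blast
 have "u i \<in> E" if "i < n" for i
 proof -
  have "u i = lc R u (%j. if j = i then \<one> else \<zero>) n"
   using lc_single[of n u i \<one>] that u by simp
  then show ?thesis unfolding u(2) by (rule lspanI) (use Kp in auto)
 qed
 then show ?thesis using u by blast
qed

lemma lc_unique:
 assumes "lindep B w n" "!!i. i < n ==> w i \<in> carrier R" "B \<subseteq> carrier R"
  "!!b c. b \<in> B ==> c \<in> B ==> b \<ominus> c \<in> B"
  "\<forall>i<n. b i \<in> B" "\<forall>i<n. c i \<in> B" "lc R w b n = lc R w c n" "i < n"
 shows "b i = c i"
proof -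
 have bc: "b i \<in> carrier R" "c i \<in> carrier R" if "i < n" for i using assms that by auto
 have "lc R w b n = lc R w (%i. b i \<ominus> c i) n \<oplus> lc R w c n"
  by (subst lc_add) (use assms(2) bc in "auto intro!: lc_cong simp: minus_eq a_assoc l_neg")
 moreover have "lc R w (%i. b i \<ominus> c i) n \<in> carrier R" "lc R w c n \<in> carrier R"
  using assms(2) bc by (auto intro!: lc_closed)
 ultimately have "lc R w (%i. b i \<ominus> c i) n = \<zero>"
  using assms(7) by (metis add.r_cancel_one)
 then have "b i \<ominus> c i = \<zero>"
  using lindepD[OF assms(1), of "%i. b i \<ominus> c i" i] assms(4,5,6,8) by simp
 then show ?thesis using bc[OF assms(8)] by (simp add: r_right_minus_eq)
qed

text \<open>The coordinate functions form a dual basis. They serve as test functionals on a larger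
  field and provide the structure constants of \<open>D\<close>.\<close>

lemma exists_coordinates:
 assumes K: "subfield K R" and E: "dimension n K E"
 shows "\<exists>u c. (\<forall>i<n. u i \<in> E) \<and> (\<forall>x\<in>E. \<forall>i<n. c i x \<in> K) \<and>
  (\<forall>x\<in>E. x = lc R u (%i. c i x) n) \<and>
  (\<forall>i<n. \<forall>x\<in>E. \<forall>y\<in>E. c i (x \<oplus> y) = c i x \<oplus> c i y) \<and>
  (\<forall>i<n. \<forall>x\<in>E. \<forall>k\<in>K. c i (k ** x) = k ** c i x) \<and>
  (\<forall>i<n. \<forall>j<n. c i (u j) = (if i = j then \<one> else \<zero>))"
proof -
 note Kp = subringE[OF subfieldE(1)[OF K]]
 note Ep = space_subgroup_props[OF K E]
 obtain u where u: "\<forall>i<n. u i \<in> E" "E = lspan K u n" "lindep K u n"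
  using exists_basis[OF K E] by blast
 have uc: "u i \<in> carrier R" if "i < n" for i using u Ep that by auto
 have Kc: "k \<in> carrier R" if "k \<in> K" for k using that Kp(1) by auto
 have "\<exists>b. (\<forall>i<n. b i \<in> K) \<and> x = lc R u b n" if "x \<in> E" for x
  using that unfolding u(2) lspan_def by blast
 then obtain b where b: "!!x. x \<in> E ==> (\<forall>i<n. b x i \<in> K) \<and> x = lc R u (b x) n" by metis
 have minus: "k \<ominus> l \<in> K" if "k \<in> K" "l \<in> K" for k l using that Kp by (simp add: minus_eq)
 have uniq: "b x i = d i" if "x \<in> E" "\<forall>i<n. d i \<in> K" "x = lc R u d n" "i < n" for x d i
  by (rule lc_unique[OF u(3) uc Kp(1) minus]) (use b that in auto)
 show ?thesis
 proof (intro exI[of _ u] exI[of _ "%i x. b x i"] conjI allI ballI impI)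
  show "b (x \<oplus> y) i = b x i \<oplus> b y i" if "i < n" "x \<in> E" "y \<in> E" for i x y
  proof (rule uniq[OF _ _ _ that(1)])
   have "x \<oplus> y = lc R u (b x) n \<oplus> lc R u (b y) n" using b that by simp
   then show "x \<oplus> y = lc R u (%i. b x i \<oplus> b y i) n"
    using lc_add[of n "b x" "b y" u] b that Kc uc by simp
  qed (use that Ep b Kp in auto)
  show "b (k ** x) i = k ** b x i" if "i < n" "x \<in> E" "k \<in> K" for i k x
  proof (rule uniq[OF _ _ _ that(1)])
   have "k ** x = k ** lc R u (b x) n" using b that by simp
   then show "k ** x = lc R u (%i. k ** b x i) n"
    using lc_lmult[of n "b x" u k] b that Kc uc by simp
  qed (use that Ep b Kp in auto)
  show "b (u j) i = (if i = j then \<one> else \<zero>)" if "i < n" "j < n" for i j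
  proof -
   have 1: "u j = lc R u (%i. if i = j then \<one> else \<zero>) n"
    using lc_single[of n u j \<one>] uc that by simp
   have 2: "u j \<in> E" "\<forall>i<n. (if i = j then \<one> else \<zero>) \<in> K" using that u(1) Kp by auto
   show ?thesis using uniq[OF 2 1 that(1)] .
  qed
 qed (use u b in auto)
qed

end

subsection \<open>Crossed products\<close>

text \<open>One frame for two algebras: \<open>D \<otimes> F\<close> with trivial \<open>phi\<close>
  and \<open>w\<close> a basis of \<open>F\<close>, and the cyclic algebra with \<open>phi i\<close>
  the \<open>i\<close>-th power of the automorphism and \<open>w i\<close> the powers of the
  generator. Center and ideals are both read off from the commutation rule with
  \<open>B\<close>.\<close>

locale crossed = ring A for A (structure) +
 fixes B :: "'a set" and w :: "nat => 'a" and phi :: "nat => 'a => 'a" and r :: nat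
 assumes B_subring: "subring B A"
  and B_inv: "!!b. b \<in> B ==> b ~= \<zero> ==> \<exists>c\<in>B. c ** b = \<one> \<and> b ** c = \<one>"
  and w_closed: "!!i. i < r ==> w i \<in> carrier A"
  and phi_closed: "!!i b. i < r ==> b \<in> B ==> phi i b \<in> B"
  and w_comm: "!!i b. i < r ==> b \<in> B ==> w i ** b = phi i b ** w i"
  and rep: "carrier A = lspan B w r"
  and ind: "lindep B w r"
begin

lemma B_car: "b \<in> B ==> b \<in> carrier A" using subringE(1)[OF B_subring] by auto

lemmas B_props = subringE[OF B_subring]

lemma B_minus: "b \<in> B ==> c \<in> B ==> b \<ominus> c \<in> B"
 using B_props by (simp add: minus_eq)

lemma coefs_unique:
 assumes "\<forall>i<r. b i \<in> B" "\<forall>i<r. c i \<in> B" "lc A w b r = lc A w c r" "i < r"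
 shows "b i = c i"
 using lc_unique[OF ind w_closed B_props(1) B_minus assms(1,2,3,4)] .

lemma lc_left:
 assumes "\<forall>i<r. b i \<in> B" "x \<in> B"
 shows "x ** lc A w b r = lc A w (%i. x ** b i) r" "\<forall>i<r. x ** b i \<in> B"
 using assms lc_lmult[of r b w x] B_car w_closed B_props by auto

lemma lc_right:
 assumes "\<forall>i<r. b i \<in> B" "x \<in> B"
 shows "lc A w b r ** x = lc A w (%i. b i ** phi i x) r" "\<forall>i<r. b i ** phi i x \<in> B"
 using assms lc_rmult[of r b w x "%i. phi i x"] B_car w_closed B_props phi_closed w_comm by auto

lemma commuting_coefs:
 assumes "\<forall>i<r. b i \<in> B" "x \<in> B" "lc A w b r ** x = x ** lc A w b r" "i < r"
 shows "x ** b i = b i ** phi i x"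
proof (rule coefs_unique[OF lc_left(2)[OF assms(1,2)] lc_right(2)[OF assms(1,2)] _ assms(4)])
 show "lc A w (%i. x ** b i) r = lc A w (%i. b i ** phi i x) r"
  using lc_left(1)[OF assms(1,2)] lc_right(1)[OF assms(1,2)] assms(3) by simp
qed

text \<open>An element of a nonzero ideal with the fewest nonzero coefficients.\<close>

lemma shortest_element:
 assumes I: "ideal I A" and a: "a \<in> I" "a ~= \<zero>"
 obtains b i\<^sub>0 where "\<forall>i<r. b i \<in> B" "lc A w b r \<in> I" "i\<^sub>0 < r" "b i\<^sub>0 = \<one>"
  "!!i x. i < r ==> x \<in> B ==> phi i\<^sub>0 x ** b i = b i ** phi i x"
proof -
 interpret I: ideal I A by fact
 define P where "P b m \<longleftrightarrow> (\<forall>i<r. b i \<in> B) \<and> lc A w b r \<in> I \<and> lc A w b r ~= \<zero> \<and>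
  card {i. i < r \<and> b i ~= \<zero>} = m" for b m
 have "a \<in> lspan B w r" using a I.Icarr rep by simp
 then have "\<exists>m b. P b m" unfolding P_def lspan_def using a by blast
 then obtain b where b: "P b (LEAST m. \<exists>b. P b m)"
  using LeastI_ex[of "%m. \<exists>b. P b m"] by blast
 have min: "card {i. i < r \<and> b i ~= \<zero>} \<le> card {i. i < r \<and> c i ~= \<zero>}"
  if "\<forall>i<r. c i \<in> B" "lc A w c r \<in> I" "lc A w c r ~= \<zero>" for c
 proof -
  have "(LEAST m. \<exists>b. P b m) \<le> card {i. i < r \<and> c i ~= \<zero>}"
   by (rule Least_le) (use that in "auto simp: P_def")
  then show ?thesis using b unfolding P_def by simp
 qed
 have bB: "\<forall>i<r. b i \<in> B" and bI: "lc A w b r \<in> I" and b0: "lc A w b r ~= \<zero>"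
  using b by (auto simp: P_def)
 obtain i0 where i0: "i0 < r" "b i0 ~= \<zero>" using b0 lc_zero[of r b w] w_closed by blast
 obtain c where c: "c \<in> B" "c ** b i0 = \<one>" using B_inv i0 bB by blast
 let ?b = "%i. c ** b i"
 have b': "\<forall>i<r. ?b i \<in> B" "lc A w ?b r \<in> I"
  using lc_left(2)[OF bB c(1)] I.I_l_closed[OF bI B_car[OF c(1)]] lc_left(1)[OF bB c(1)] by auto
 show ?thesis
 proof (rule that[OF b' i0(1) c(2)])
  fix i x assume ix: "i < r" "x \<in> B"
  \<comment> \<open>With \<open>a\<close> the shortest element, these are the coefficients of
    \<open>phi i0 x ** a - a ** x\<close>. It stays in the ideal and has lost the coefficient at
    \<open>i0\<close>, so it is zero.\<close>
  let ?d = "%i. phi i0 x ** ?b i \<ominus> ?b i ** phi i x"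
  note x0 = phi_closed[OF i0(1) ix(2)]
  have dB: "\<forall>i<r. ?d i \<in> B" using b' x0 phi_closed ix B_props B_minus by auto
  have "lc A w (%i. phi i0 x ** ?b i) r \<ominus> lc A w (%i. ?b i ** phi i x) r = lc A w ?d r"
  proof -
   have 1: "!!i. i < r ==> phi i0 x ** ?b i \<in> carrier A" "!!i. i < r ==> ?b i ** phi i x \<in> carrier A"
    using lc_left(2)[OF b'(1) x0] lc_right(2)[OF b'(1) ix(2)] B_car by blast+
   have "lc A w ?d r \<oplus> lc A w (%i. ?b i ** phi i x) r = lc A w (%i. phi i0 x ** ?b i) r"
    by (subst lc_add) (use dB B_car 1 w_closed in "auto intro!: lc_cong simp: minus_eq a_assoc l_neg")
   moreover have "lc A w ?d r \<in> carrier A" "lc A w (%i. ?b i ** phi i x) r \<in> carrier A"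
    using dB B_car 1 w_closed by (auto intro!: lc_closed)
   ultimately show ?thesis by (intro minus_eqI)
  qed
  then have eq: "lc A w ?d r = phi i0 x ** lc A w ?b r \<ominus> lc A w ?b r ** x"
   using lc_left(1)[OF b'(1) x0] lc_right(1)[OF b'(1) ix(2)] by simp
  have dI: "lc A w ?d r \<in> I"
   by (subst eq, subst a_minus_def, intro I.a_closed I.a_inv_closed I.I_l_closed[OF b'(2) B_car[OF x0]]
     I.I_r_closed[OF b'(2) B_car[OF ix(2)]])
  have "{i. i < r \<and> ?d i ~= \<zero>} \<subset> {i. i < r \<and> b i ~= \<zero>}"
  proof
   show "{i. i < r \<and> ?d i ~= \<zero>} \<subseteq> {i. i < r \<and> b i ~= \<zero>}"
    using c(1) x0 phi_closed[OF _ ix(2)] B_car by (auto simp: minus_eq)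
   have "?d i0 = \<zero>" unfolding c(2) using x0 B_car by (simp add: minus_eq r_neg)
   then show "{i. i < r \<and> ?d i ~= \<zero>} ~= {i. i < r \<and> b i ~= \<zero>}"
    using i0 by blast
  qed
  then have "card {i. i < r \<and> ?d i ~= \<zero>} < card {i. i < r \<and> b i ~= \<zero>}"
   by (intro psubset_card_mono) auto
  then have "lc A w ?d r = \<zero>" using min[OF dB dI] by force
  then have "?d i = \<zero>" using lindepD[OF ind dB _ ix(1)] by simp
  then show "phi i0 x ** ?b i = ?b i ** phi i x"
   using b' ix x0 phi_closed B_car B_props by (simp add: r_right_minus_eq)
 qed
qed

end

text \<open>Closure under products reduces to \<open>prod\<close>, since \<open>comm\<close> moves
  coefficients to the left of the \<open>w i\<close>.\<close>

lemma (in ring) crossed_subring: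
 assumes B: "subring B R"
  and B_inv: "!!b. b \<in> B ==> b ~= \<zero> ==> \<exists>c\<in>B. c ** b = \<one> \<and> b ** c = \<one>"
  and w: "!!i. i < r ==> w i \<in> carrier R"
  and phi: "!!i b. i < r ==> b \<in> B ==> phi i b \<in> B"
  and comm: "!!i b. i < r ==> b \<in> B ==> w i ** b = phi i b ** w i"
  and prod: "!!i j. i < r ==> j < r ==> w i ** w j \<in> lspan B w r"
  and one: "\<one> \<in> lspan B w r"
  and ind: "lindep B w r"
 shows "subring (lspan B w r) R" "B \<subseteq> lspan B w r"
  "crossed (R(|carrier := lspan B w r|)) B w phi r"
proof -
 let ?S = "lspan B w r"
 note Bp = subringE[OF B]
 have Bc: "b \<in> carrier R" if "b \<in> B" for b using that Bp(1) by auto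
 have Sc: "?S \<subseteq> carrier R" unfolding lspan_def using Bc w by (auto intro!: lc_closed)
 have addS: "x \<oplus> y \<in> ?S" if "x \<in> ?S" "y \<in> ?S" for x y
 proof -
  obtain b c where "\<forall>i<r. b i \<in> B" "x = lc R w b r" "\<forall>i<r. c i \<in> B" "y = lc R w c r"
   using \<open>x \<in> ?S\<close> \<open>y \<in> ?S\<close> unfolding lspan_def by blast
  then have "x \<oplus> y = lc R w (%i. b i \<oplus> c i) r" "\<forall>i<r. b i \<oplus> c i \<in> B"
   using lc_add[of r b c w] Bc w Bp by auto
  then show ?thesis unfolding lspan_def by blast
 qed
 have BS: "x ** y \<in> ?S" if x: "x \<in> B" and "y \<in> ?S" for x y
 proof -
  obtain c where "\<forall>i<r. c i \<in> B" "y = lc R w c r" using \<open>y \<in> ?S\<close> unfolding lspan_def by blast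
  then have "x ** y = lc R w (%i. x ** c i) r" "\<forall>i<r. x ** c i \<in> B"
   using lc_lmult[of r c w x] Bc w Bp x by auto
  then show ?thesis unfolding lspan_def by blast
 qed
 have SB: "y ** x \<in> ?S" if x: "x \<in> B" and "y \<in> ?S" for x y
 proof -
  obtain c where c: "\<forall>i<r. c i \<in> B" "y = lc R w c r" using \<open>y \<in> ?S\<close> unfolding lspan_def by blast
  then have "y ** x = lc R w (%i. c i ** phi i x) r" "\<forall>i<r. c i ** phi i x \<in> B"
   using lc_rmult[of r c w x "%i. phi i x"] Bc w Bp x phi comm by auto
  then show ?thesis unfolding lspan_def by blast
 qed
 have zS: "\<zero> \<in> ?S"
 proof -
  have "\<zero> = lc R w (%_. \<zero>) r" using lc_zero[of r "%_. \<zero>" w] w by simp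
  then show ?thesis unfolding lspan_def using Bp by blast
 qed
 have BsS: "B \<subseteq> ?S" using BS[OF _ one] Bc by force
 have Sw: "y ** w j \<in> ?S" if j: "j < r" and "y \<in> ?S" for y j
 proof -
  obtain c where c: "\<forall>i<r. c i \<in> B" "y = lc R w c r" using \<open>y \<in> ?S\<close> unfolding lspan_def by blast
  have "lc R w c n ** w j \<in> ?S" if "n \<le> r" for n
   using that
  proof (induction n)
   case (Suc n)
   have "lc R w c n \<in> carrier R" using Suc c Bc w by (intro lc_closed) auto
   moreover have "c n ** (w n ** w j) \<in> ?S" using BS prod c Suc j by simp
   ultimately show ?case
    using Suc c Bc w j addS by (simp add: l_distr m_assoc)
  qed (use w j zS in simp)
  then show ?thesis using c by simp
 qed
 have mulS: "x ** y \<in> ?S" if x: "x \<in> ?S" and "y \<in> ?S" for x y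
 proof -
  obtain c where c: "\<forall>i<r. c i \<in> B" "y = lc R w c r" using \<open>y \<in> ?S\<close> unfolding lspan_def by blast
  have xc: "x \<in> carrier R" using x Sc by auto
  have "x ** lc R w c n \<in> ?S" if "n \<le> r" for n
   using that
  proof (induction n)
   case (Suc n)
   have "lc R w c n \<in> carrier R" using Suc c Bc w by (intro lc_closed) auto
   moreover have "(x ** c n) ** w n \<in> ?S" using Sw SB c Suc x by simp
   ultimately show ?case
    using Suc c Bc w xc addS by (simp add: r_distr m_assoc)
  qed (use xc zS in simp)
  then show ?thesis using c by simp
 qed
 show sub: "subring ?S R"
 proof (rule subringI)
  show "\<ominus> h \<in> ?S" if "h \<in> ?S" for h
  proof -
   have "(\<ominus> \<one>) ** h \<in> ?S" using BS that Bp by simp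
   then show ?thesis using that Sc by (simp add: l_minus subset_iff)
  qed
 qed (use Sc addS mulS one in auto)
 show "B \<subseteq> ?S" by fact
 interpret A: ring "R(|carrier := ?S|)" using subring_is_ring[OF sub] .
 show "crossed (R(|carrier := ?S|)) B w phi r"
 proof (intro crossed.intro crossed_axioms.intro A.ring_axioms)
  show "subring B (R(|carrier := ?S|))"
   using A.ring_incl_imp_subring[of B] BsS subring_is_ring[OF B] by simp
  show "w i \<in> carrier (R(|carrier := ?S|))" if "i < r" for i
   using Sw[OF that one] w that by simp
  show "carrier (R(|carrier := ?S|)) = A.lspan B w r"
   unfolding A.lspan_def by (simp add: lspan_def lc_consistent)
  show "A.lindep B w r" using ind unfolding A.lindep_def lindep_def by (simp add: lc_consistent)
  show "\<exists>c\<in>B. c **[R(|carrier := ?S|)] b = \<one>[R(|carrier := ?S|)] \<and>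
    b **[R(|carrier := ?S|)] c = \<one>[R(|carrier := ?S|)]"
   if "b \<in> B" "b ~= \<zero>[R(|carrier := ?S|)]" for b using that B_inv by simp
 qed (simp_all add: phi comm)
qed

subsection \<open>Rings of operators\<close>

text \<open>The additive endomorphisms of \<open>G\<close>, cut off outside its carrier so that
  equality of operators is equality on the carrier. Algebras are built inside such a ring: relations
  are checked pointwise, associativity is that of composition, and linear independence is tested on
  suitable vectors.\<close>

definition op_ring :: "('a, 'm) ring_scheme => ('a => 'a) ring" where
 "op_ring G = (|carrier = {f. f \<in> carrier G \<rightarrow>\<^sub>E carrier G \<and>
   (\<forall>x\<in>carrier G. \<forall>y\<in>carrier G. f (x \<oplus>[G] y) = f x \<oplus>[G] f y)},
  mult = (%f g. restrict (%x. f (g x)) (carrier G)), one = restrict (%x. x) (carrier G),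
  zero = restrict (%x. \<zero>[G]) (carrier G), add = (%f g. restrict (%x. f x \<oplus>[G] g x) (carrier G))|)"

lemma op_ring_simps:
 "f \<in> carrier (op_ring G) ==> x \<in> carrier G ==> f x \<in> carrier G"
 "f \<in> carrier (op_ring G) ==> x \<in> carrier G ==> y \<in> carrier G ==>
   f (x \<oplus>[G] y) = f x \<oplus>[G] f y"
 "x \<in> carrier G ==> (f **[op_ring G] g) x = f (g x)"
 "x \<in> carrier G ==> (f \<oplus>[op_ring G] g) x = f x \<oplus>[G] g x"
 "x \<in> carrier G ==> \<one>[op_ring G] x = x"
 "x \<in> carrier G ==> \<zero>[op_ring G] x = \<zero>[G]"
 by (auto simp: op_ring_def)

lemma op_ring_closedI:
 "f \<in> carrier G \<rightarrow>\<^sub>E carrier G ==>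
  (!!x y. x \<in> carrier G ==> y \<in> carrier G ==> f (x \<oplus>[G] y) = f x \<oplus>[G] f y) ==>
  f \<in> carrier (op_ring G)"
 by (auto simp: op_ring_def)

lemma op_ring_ext:
 "f \<in> extensional (carrier G) ==> g \<in> extensional (carrier G) ==>
  (!!x. x \<in> carrier G ==> f x = g x) ==> f = g"
 by (rule extensionalityI)

lemma op_ring_extensional:
 "f \<in> carrier (op_ring G) ==> f \<in> extensional (carrier G)"
 "f **[op_ring G] g \<in> extensional (carrier G)" "f \<oplus>[op_ring G] g \<in> extensional (carrier G)"
 "\<one>[op_ring G] \<in> extensional (carrier G)" "\<zero>[op_ring G] \<in> extensional (carrier G)"
 by (auto simp: op_ring_def PiE_def)

lemma op_ring_is_ring:
 assumes "abelian_group G"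
 shows "ring (op_ring G)"
proof -
 interpret abelian_group G by fact
 note s = op_ring_simps[where G = G]
 note e = op_ring_extensional[where G = G]
 have c: "f \<in> carrier (op_ring G)"
  if "f \<in> extensional (carrier G)" "!!x. x \<in> carrier G ==> f x \<in> carrier G"
   "!!x y. x \<in> carrier G ==> y \<in> carrier G ==> f (x \<oplus>[G] y) = f x \<oplus>[G] f y" for f
  using that by (intro op_ring_closedI) (auto simp: PiE_def)
 have add: "f \<oplus>[op_ring G] g \<in> carrier (op_ring G)"
  if f: "f \<in> carrier (op_ring G)" and g: "g \<in> carrier (op_ring G)" for f g
  by (rule c) (simp_all add: e s(3-6) s(1)[OF f] s(1)[OF g] s(2)[OF f] s(2)[OF g] a_ac)
 have mul: "f **[op_ring G] g \<in> carrier (op_ring G)"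
  if f: "f \<in> carrier (op_ring G)" and g: "g \<in> carrier (op_ring G)" for f g
  by (rule c) (simp_all add: e s(3-6) s(1)[OF f] s(1)[OF g] s(2)[OF f] s(2)[OF g])
 have one: "\<one>[op_ring G] \<in> carrier (op_ring G)" and zero: "\<zero>[op_ring G] \<in> carrier (op_ring G)"
  by (auto simp: op_ring_def)
 have "abelian_group (op_ring G)"
 proof (rule abelian_groupI)
  fix f g h assume f: "f \<in> carrier (op_ring G)" and g: "g \<in> carrier (op_ring G)"
   and h: "h \<in> carrier (op_ring G)"
  note cl = s(1)[OF f] s(1)[OF g] s(1)[OF h]
  show "f \<oplus>[op_ring G] g \<oplus>[op_ring G] h = f \<oplus>[op_ring G] (g \<oplus>[op_ring G] h)"
   by (rule op_ring_ext[OF e(3) e(3)]) (simp add: s(4) cl a_assoc)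
  show "f \<oplus>[op_ring G] g = g \<oplus>[op_ring G] f"
   by (rule op_ring_ext[OF e(3) e(3)]) (simp add: s(4) cl a_comm)
  show "\<zero>[op_ring G] \<oplus>[op_ring G] f = f"
   by (rule op_ring_ext[OF e(3) e(1)[OF f]]) (simp add: s(4,6) cl)
  let ?g = "restrict (%x. \<ominus>[G] f x) (carrier G)"
  have "?g \<in> carrier (op_ring G)"
   by (rule c) (simp_all add: s(2)[OF f] cl minus_add)
  moreover have "?g \<oplus>[op_ring G] f = \<zero>[op_ring G]"
   by (rule op_ring_ext[OF e(3) e(5)]) (simp add: s(4,6) cl l_neg)
  ultimately show "\<exists>g\<in>carrier (op_ring G). g \<oplus>[op_ring G] f = \<zero>[op_ring G]" by blast
 qed (use add zero in auto)
 moreover have "Group.monoid (op_ring G)"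
 proof (rule monoidI)
  fix f g h assume f: "f \<in> carrier (op_ring G)" and g: "g \<in> carrier (op_ring G)"
   and h: "h \<in> carrier (op_ring G)"
  note cl = s(1)[OF f] s(1)[OF g] s(1)[OF h]
  show "f **[op_ring G] g **[op_ring G] h = f **[op_ring G] (g **[op_ring G] h)"
   by (rule op_ring_ext[OF e(2) e(2)]) (simp add: s(3) cl)
  show "\<one>[op_ring G] **[op_ring G] f = f" "f **[op_ring G] \<one>[op_ring G] = f"
   by (rule op_ring_ext[OF e(2) e(1)[OF f]], simp add: s(3,5) cl)+
 qed (use mul one in auto)
 ultimately show ?thesis
 proof (rule ringI)
  fix f g h assume f: "f \<in> carrier (op_ring G)" and g: "g \<in> carrier (op_ring G)"
   and h: "h \<in> carrier (op_ring G)"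
  note cl = s(1)[OF f] s(1)[OF g] s(1)[OF h]
  show "(f \<oplus>[op_ring G] g) **[op_ring G] h = f **[op_ring G] h \<oplus>[op_ring G] g **[op_ring G] h"
   by (rule op_ring_ext[OF e(2) e(3)]) (simp add: s(3,4) cl)
  show "h **[op_ring G] (f \<oplus>[op_ring G] g) = h **[op_ring G] f \<oplus>[op_ring G] h **[op_ring G] g"
   by (rule op_ring_ext[OF e(2) e(3)]) (simp add: s(3,4) cl s(2)[OF h])
 qed
qed

subsection \<open>Division algebras with a maximal center\<close>

definition cent :: "('a, 'm) ring_scheme => 'a set" where
 "cent R = {z \<in> carrier R. \<forall>x\<in>carrier R. z **[R] x = x **[R] z}"

lemma (in ring) dimension_consistent:
 assumes S: "subring S R" and K: "subfield K R" and "K \<subseteq> S"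
 shows "ring.dimension (R(|carrier := S|)) n K E \<longleftrightarrow> dimension n K E \<and> E \<subseteq> S"
proof -
 interpret S: ring "R(|carrier := S|)" by (rule subring_is_ring[OF S])
 note Sp = subringE[OF S] and Kp = subringE[OF subfieldE(1)[OF K]]
 have 1: "dimension n K E \<and> E \<subseteq> S" if "S.dimension n K E" "K \<subseteq> S" for n E K
  using that
 proof (induction rule: S.dimension.induct)
  case (zero_dim K) then show ?case using Sp by auto
 next
  case (Suc_dim v E n K)
  then have v: "v \<in> S" "v \<notin> E" "dimension n K E" "E \<subseteq> S" "K \<subseteq> S" by auto
  have "line_extension K v E \<subseteq> S"
  proof
   fix x assume "x \<in> line_extension K v E"
   then obtain k e where "k \<in> K" "e \<in> E" "x = k ** v \<oplus> e" unfolding line_extension_mem_iff by blast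
   then show "x \<in> S" using v Sp(6,7) by blast
  qed
  then show ?case
   using dimension.Suc_dim[of v E n K] v Sp(1) line_extension_consistent[OF S] by auto
 qed
 have 2: "S.dimension n K' E" if "dimension n K' E" "K' = K" "E \<subseteq> S" for n K' E
  using that
 proof (induction rule: dimension.induct)
  case (zero_dim K) then show ?case using S.zero_dim[of K] by simp
 next
  case (Suc_dim v E n K')
  have E0: "\<zero> \<in> E" "E \<subseteq> carrier R"
   using space_subgroup_props(1,2)[OF K] Suc_dim by auto
  have "v = \<one> ** v \<oplus> \<zero>" using Suc_dim by simp
  then have "v \<in> line_extension K v E" unfolding line_extension_mem_iff using Kp E0 by blast
  moreover have "E \<subseteq> line_extension K v E"
  proof
   fix x assume x: "x \<in> E"
   have "x = \<zero> ** v \<oplus> x" using Suc_dim(1) x E0 by auto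
   then show "x \<in> line_extension K v E" unfolding line_extension_mem_iff using Kp x by blast
  qed
  ultimately show ?case
   using Suc_dim S.dimension.Suc_dim[of v E n K] line_extension_consistent[OF S] by auto
 qed
 show ?thesis using 1[OF _ assms(3)] 2 by blast
qed

lemma (in skew_field) inv_ex:
 assumes "x \<in> carrier D" "x ~= \<zero>"
 shows "inv x \<in> carrier D" "x ** inv x = \<one>" "inv x ** x = \<one>" "inv x ~= \<zero>"
proof -
 have "x \<in> Units D" using assms skew_field_Units by simp
 then show "inv x \<in> carrier D" "x ** inv x = \<one>" "inv x ** x = \<one>" by auto
 then show "inv x ~= \<zero>" using one_not_zero assms by auto
qed

lemma (in skew_field) integral:
 assumes "x \<in> carrier D" "y \<in> carrier D" "x ** y = \<zero>"
 shows "x = \<zero> \<or> y = \<zero>"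
proof (rule disjCI)
 assume "y ~= \<zero>"
 note y = inv_ex[OF assms(2) this]
 have "x ** y ** inv y = x" using assms(1,2) y by (simp add: m_assoc)
 then show "x = \<zero>" using assms(3) y by simp
qed

lemma (in skew_field) commutative_subring_subfield:
 assumes S: "subring S D" and comm: "!!x y. x \<in> S ==> y \<in> S ==> x ** y = y ** x"
  and inv: "!!x. x \<in> S ==> x ~= \<zero> ==> inv x \<in> S"
 shows "subfield S D"
proof (rule subfieldI)
 note Sp = subringE[OF S]
 show "subcring S D" using subcringI[OF S comm] .
 have "x \<in> Units (D(|carrier := S|))" if "x \<in> S" "x ~= \<zero>" for x
  using that inv[OF that] inv_ex[of x] Sp(1) unfolding Units_def by auto
 moreover have "\<zero> \<notin> Units (D(|carrier := S|))"
  using Sp(1) one_not_zero unfolding Units_def by auto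
 ultimately show "Units (D(|carrier := S|)) = S - {\<zero>}"
  unfolding Units_def by auto
qed

lemma (in skew_field) inv_commute:
 assumes "x \<in> carrier D" "y \<in> carrier D" "x ~= \<zero>" "x ** y = y ** x"
 shows "inv x ** y = y ** inv x"
proof -
 note x = inv_ex[OF assms(1,3)]
 have "inv x ** y = inv x ** (y ** x) ** inv x" using x assms(1,2) by (simp add: m_assoc)
 also have "\<dots> = inv x ** (x ** y) ** inv x" using assms(4) by simp
 also have "\<dots> = (inv x ** x) ** y ** inv x" using x(1) assms(1,2) by (simp add: m_assoc)
 also have "\<dots> = y ** inv x" using x assms(2) by simp
 finally show ?thesis .
qed

lemma (in ring) centralizer_subring:
 assumes S: "S \<subseteq> carrier R"
 shows "subring {x \<in> carrier R. \<forall>s\<in>S. x ** s = s ** x} R"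
proof (rule subringI)
 let ?C = "{x \<in> carrier R. \<forall>s\<in>S. x ** s = s ** x}"
 have Sc: "s \<in> carrier R" if "s \<in> S" for s using S that by blast
 show "?C \<subseteq> carrier R" by blast
 show "\<one> \<in> ?C" using Sc by simp
 show "\<ominus> h \<in> ?C" if "h \<in> ?C" for h
  using that Sc by (simp add: l_minus r_minus)
 show "x ** y \<in> ?C" if xy: "x \<in> ?C" "y \<in> ?C" for x y
 proof -
  have "x ** y ** s = s ** (x ** y)" if s: "s \<in> S" for s
  proof -
   have c: "x \<in> carrier R" "y \<in> carrier R" "s \<in> carrier R"
    and e: "x ** s = s ** x" "y ** s = s ** y" using xy s Sc[OF s] by auto
   have "x ** y ** s = x ** (s ** y)" using c e(2) by (simp add: m_assoc)
   also have "\<dots> = (s ** x) ** y" unfolding e(1)[symmetric] using c by (simp add: m_assoc)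
   also have "\<dots> = s ** (x ** y)" using c by (simp add: m_assoc)
   finally show ?thesis .
  qed
  then show ?thesis using xy by simp
 qed
 show "x \<oplus> y \<in> ?C" if "x \<in> ?C" "y \<in> ?C" for x y
  using that Sc by (simp add: l_distr r_distr)
qed

lemma (in skew_field) centralizer_inv:
 assumes S: "S \<subseteq> carrier D" and x: "x \<in> {x \<in> carrier D. \<forall>s\<in>S. x ** s = s ** x}" "x ~= \<zero>"
 shows "inv x \<in> {x \<in> carrier D. \<forall>s\<in>S. x ** s = s ** x}"
proof -
 have "inv x ** s = s ** inv x" if "s \<in> S" for s
  using inv_commute[of x s] x S that by blast
 then show ?thesis using inv_ex(1) x by blast
qed

lemma (in skew_field) cent_subfield: "subfield (cent D) D"
proof (rule commutative_subring_subfield)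
 show "subring (cent D) D" using centralizer_subring[of "carrier D"] unfolding cent_def by simp
 show "x ** y = y ** x" if "x \<in> cent D" "y \<in> cent D" for x y using that unfolding cent_def by blast
 show "inv x \<in> cent D" if "x \<in> cent D" "x ~= \<zero>" for x
  using centralizer_inv[of "carrier D" x] that unfolding cent_def by blast
qed

definition scal :: "('a, 'b, 'm) module_scheme => 'a => 'b" where "scal D c = c \<odot>[D] \<one>[D]"

context finite_division_algebra
begin

lemma smult_scal: "c \<in> carrier K ==> x \<in> carrier D ==> c \<odot>[D] x = scal D c **[D] x"
 unfolding scal_def using smult_mult_left[of c "\<one>[D]" x] by simp

lemma scal_hom: "scal D \<in> ring_hom K D"
proof (rule ring_hom_memI)
 show "scal D x \<in> carrier D" if "x \<in> carrier K" for x using that by (simp add: scal_def)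
 show "scal D (x **[K] y) = scal D x **[D] scal D y" if "x \<in> carrier K" "y \<in> carrier K" for x y
  using that smult_assoc1[of x y "\<one>[D]"] smult_scal[of x "y \<odot>[D] \<one>[D]"] by (simp add: scal_def)
 show "scal D (x \<oplus>[K] y) = scal D x \<oplus>[D] scal D y" if "x \<in> carrier K" "y \<in> carrier K" for x y
  using that by (simp add: scal_def smult_l_distr)
 show "scal D \<one>[K] = \<one>[D]" by (simp add: scal_def)
qed

lemma scal_ring_hom_ring: "ring_hom_ring K D (scal D)"
 by (rule ring_hom_ringI2[OF R.ring_axioms D.ring_axioms scal_hom])

lemma scal_subfield: "subfield (scal D ` carrier K) D"
 using ring_hom_ring.img_is_subfield(2)[OF scal_ring_hom_ring carrier_is_subfield] D.one_not_zero
 by simp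

lemma scal_central: "scal D ` carrier K \<subseteq> cent D"
proof -
 have "scal D c **[D] x = x **[D] scal D c" if "c \<in> carrier K" "x \<in> carrier D" for c x
  using smult_scal[OF that] smult_mult_right[OF that(1,2) D.one_closed] that by (simp add: scal_def)
 then show ?thesis unfolding cent_def using ring_hom_closed[OF scal_hom] by auto
qed

text \<open>Passes from finite dimension as a vector space over the abstract field \<open>K\<close>
  to dimension over the image of \<open>scal D\<close>, a subfield of \<open>D\<close>. All degrees
  are counted in the latter sense.\<close>

lemma finite_dimension_scal: "D.finite_dimension (scal D ` carrier K) (carrier D)"
proof -
 obtain B where B: "finite B" "B \<subseteq> carrier D" "span B = carrier D"
  using finite_dimensional unfolding fin_dim_def by auto
 obtain bs where bs: "set bs = B" using B(1) List.finite_list by blast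
 let ?S = "D.Span (scal D ` carrier K) bs"
 have sub: "subalgebra (scal D ` carrier K) ?S D"
  using D.Span_is_subalgebra[OF scal_subfield] B bs by simp
 note S = D.subalgebraD[OF sub]
 have BS: "B \<subseteq> ?S" using D.Span_base_incl[OF scal_subfield] B bs by auto
 have "lincomb a B \<in> ?S" if a: "a \<in> B \<rightarrow> carrier K" for a
 proof -
  have "(\<Oplus>[D]v\<in>A. a v \<odot>[D] v) \<in> ?S" if "finite A" "A \<subseteq> B" for A
   using that
  proof induction
   case empty then show ?case using S(2) by simp
  next
   case (insert x A)
   have x: "a x \<in> carrier K" "x \<in> carrier D" "x \<in> ?S" using insert a B BS by auto
   have "a x \<odot>[D] x \<in> ?S" using S(6) x smult_scal[OF x(1,2)] by simp
   moreover have "(\<Oplus>[D]v\<in>insert x A. a v \<odot>[D] v) = a x \<odot>[D] x \<oplus>[D] (\<Oplus>[D]v\<in>A. a v \<odot>[D] v)"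
   proof (rule M.finsum_insert[OF insert(1,2)])
    show "(%v. a v \<odot>[D] v) \<in> A \<rightarrow> carrier D"
     using insert(4) a B(2) smult_closed by blast
   qed (use x in simp)
   ultimately show ?case using S(3) insert by simp
  qed
  then show ?thesis unfolding lincomb_def using B by simp
 qed
 then have "{lincomb a B |a. a \<in> B \<rightarrow> carrier K} \<subseteq> ?S" by blast
 then have "carrier D \<subseteq> ?S" using B(3) finite_span[OF B(1,2)] by simp
 then have "carrier D = ?S" using S(1) by auto
 then show ?thesis using D.Span_finite_dimension[OF scal_subfield, of bs] B bs by simp
qed

end

text \<open>The way back: a skew field with a homomorphism from \<open>K\<close> into its center
  becomes a \<open>K\<close>-algebra by multiplication with the image, and a finite list spanning it
  over the image spans it over \<open>K\<close>.\<close>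

lemma finite_division_algebraI:
 fixes C :: "('c, 'm) ring_scheme"
 assumes K: "field K" and C: "skew_field C" and g: "g \<in> ring_hom K C"
  and central: "g ` carrier K \<subseteq> cent C" and fin: "ring.finite_dimension C (g ` carrier K) (carrier C)"
 defines "E \<equiv> (|carrier = carrier C, mult = mult C, one = one C, zero = zero C, add = add C,
  smult = (%c x. g c **[C] x)|)"
 shows "finite_division_algebra K E" "!!c. c \<in> carrier K ==> scal E c = g c"
proof -
 interpret K: field K by fact
 interpret C: skew_field C by fact
 have gc: "g c \<in> carrier C" if "c \<in> carrier K" for c using ring_hom_closed[OF g that] .
 have E: "carrier E = carrier C" "mult E = mult C" "one E = one C" "zero E = zero C" "add E = add C"
  "smult E = (%c x. g c **[C] x)" by (simp_all add: E_def)
 have ag: "abelian_group E"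
  by (rule abelian_groupI) (use C.l_neg in \<open>auto simp: E C.a_ac intro!: bexI[of _ "\<ominus>[C] _"]\<close>)
 have mon: "Group.monoid E" by (rule monoidI) (auto simp: E C.m_assoc)
 have ringE: "ring E" by (rule ringI[OF ag mon]) (auto simp: E C.l_distr C.r_distr)
 have "Units E = Units C" unfolding Units_def E ..
 then have sf: "skew_field E"
  using ringE C.one_not_zero C.skew_field_Units by (simp add: skew_field_def skew_field_axioms_def E)
 have modE: "module K E"
  by (rule moduleI[OF K.is_cring ag])
   (use gc ring_hom_add[OF g] ring_hom_mult[OF g] ring_hom_one[OF g]
    in "auto simp: E C.l_distr C.r_distr C.m_assoc")
 interpret E: vectorspace K E using modE K.field_axioms by (simp add: vectorspace_def)
 interpret g: ring_hom_ring K C g by (rule ring_hom_ringI2[OF K.ring_axioms C.ring_axioms g])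
 have k0: "subfield (g ` carrier K) C"
  using g.img_is_subfield(2)[OF K.carrier_is_subfield] C.one_not_zero by simp
 have "E.fin_dim"
 proof -
  obtain n where "C.dimension n (g ` carrier K) (carrier C)" using fin by auto
  then obtain Us where Us: "set Us \<subseteq> carrier C" "C.Span (g ` carrier K) Us = carrier C"
   using C.exists_base[OF k0] by blast
  have Uc: "set Us \<subseteq> carrier E" using Us by (simp add: E)
  note S = E.span_is_submodule[OF Uc]
  have "subalgebra (g ` carrier K) (E.span (set Us)) C"
  proof (rule C.subalgebraI[OF k0])
   show "E.span (set Us) \<subseteq> carrier C" "\<zero>[C] \<in> E.span (set Us)"
    using LinearCombinations.submodule.subset[OF S] LinearCombinations.submodule.zero_closed[OF S]
    by (simp_all only: E)
   show "u \<oplus>[C] v \<in> E.span (set Us)" if "u \<in> E.span (set Us)" "v \<in> E.span (set Us)" for u v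
    using LinearCombinations.submodule.m_closed[OF S that] by (simp only: E)
   show "k **[C] v \<in> E.span (set Us)" if "k \<in> g ` carrier K" "v \<in> E.span (set Us)" for k v
    using that(1) LinearCombinations.submodule.smult_closed[OF S _ that(2)] by (auto simp only: E)
  qed
  then have "carrier C \<subseteq> E.span (set Us)"
   using C.subalgebra_Span_incl[OF k0] E.in_own_span[OF Uc] Us(2) by blast
  then have "E.span (set Us) = carrier E"
   using E.span_is_subset2[OF Uc] by (auto simp: E)
  then show ?thesis unfolding E.fin_dim_def using Uc by blast
 qed
 moreover have "x **[C] (g c **[C] y) = g c **[C] (x **[C] y)"
  if "c \<in> carrier K" "x \<in> carrier C" "y \<in> carrier C" for c x y
 proof -
  have "g c **[C] x = x **[C] g c" using central that(1,2) unfolding cent_def by auto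
  then show ?thesis using gc that by (metis C.m_assoc)
 qed
 ultimately have "finite_division_algebra_axioms K E"
  by (intro finite_division_algebra_axioms.intro) (use gc in "simp_all add: E C.m_assoc")
 then show "finite_division_algebra K E"
  using sf E.vectorspace_axioms by (simp add: finite_division_algebra_def)
 show "scal E c = g c" if "c \<in> carrier K" for c using gc that by (simp add: scal_def E)
qed

text \<open>\<open>n\<close> is the degree of the center over \<open>K\<close>, the quantity that is
  maximized.\<close>

definition cdim :: "('a, 'k) ring_scheme => ('a, 'b, 'm) module_scheme => nat => bool" where
 "cdim K D n \<longleftrightarrow> ring.dimension D n (scal D ` carrier K) (cent D)"

lemma (in finite_division_algebra) cdim_ex: "\<exists>n. cdim K D n"
proof -
 note Z = subringE[OF subfieldE(1)[OF D.cent_subfield]]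
 have "subalgebra (scal D ` carrier K) (cent D) D"
  by (rule D.subalgebraI[OF scal_subfield]) (use Z scal_central in auto)
 then show ?thesis
  using D.subalbegra_incl_imp_finite_dimension[OF scal_subfield finite_dimension_scal _ Z(1)]
  unfolding cdim_def by (auto simp: D.finite_dimension_def)
qed

lemma (in finite_division_algebra) cdim_unique: "cdim K D n ==> cdim K D m ==> n = m"
 unfolding cdim_def using D.dimension_is_inj[OF scal_subfield] .

text \<open>Makes the degree of the center a function on isomorphism classes, so that finitely many
  classes give finitely many degrees.\<close>

lemma cdim_iso:
 assumes D: "finite_division_algebra K D" and E: "finite_division_algebra K E"
  and f: "f \<in> algebra_iso K D E" and n: "cdim K D n"
 shows "cdim K E n"
proof -
 have sf: "skew_field D" "skew_field E" using D E by (simp_all add: finite_division_algebra_def)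
 have rings: "ring D" "ring E" using sf by (simp_all add: skew_field_def)
 have f': "f \<in> ring_hom D E" "bij_betw f (carrier D) (carrier E)" "f \<in> module_hom K D E"
  using f unfolding algebra_iso_def ring_iso_def by simp_all
 interpret f: ring_hom_ring D E f
  by (rule ring_hom_ringI2[OF rings f'(1)])
 have "f (scal D c) = scal E c" if "c \<in> carrier K" for c
  using f'(3) that by (simp add: scal_def module_hom_def f.hom_one)
 then have 1: "f ` scal D ` carrier K = scal E ` carrier K" unfolding image_image by (intro image_cong) auto
 have inj: "inj_on f (carrier D)" and sur: "f ` carrier D = carrier E"
  using f'(2) by (auto simp: bij_betw_def)
 have 2: "f ` cent D = cent E"
 proof
  show "f ` cent D \<subseteq> cent E"
   unfolding cent_def sur[symmetric] by (auto simp flip: f.hom_mult)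
  show "cent E \<subseteq> f ` cent D"
  proof
   fix y assume y: "y \<in> cent E"
   then obtain x where x: "x \<in> carrier D" "y = f x" unfolding cent_def sur[symmetric] by auto
   have "x **[D] z = z **[D] x" if "z \<in> carrier D" for z
    using y x that inj unfolding cent_def
    by (auto intro!: inj_onD[OF inj] simp: sur[symmetric])
   then show "y \<in> f ` cent D" using x unfolding cent_def by auto
  qed
 qed
 have "cent D \<subseteq> carrier D" unfolding cent_def by auto
 then have "inj_on f (cent D)" using inj inj_on_subset by blast
 then show ?thesis
  using f.inj_hom_dimension[OF finite_division_algebra.scal_subfield[OF D] _ _ n[unfolded cdim_def]] skew_field.one_not_zero[OF sf(2)]
  unfolding cdim_def 1 2 by simp
qed

locale maximal_center =
 fixes K :: "('a, 'k) ring_scheme" and D :: "('a, 'a list) module" (structure)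
 assumes K_field: "field K"
  and D_mem: "D \<in> noncomm_division_algebras K"
  and maximal: "!!E m n. E \<in> noncomm_division_algebras K ==> cdim K E m ==> cdim K D n ==> m \<le> n"

lemma exists_maximal_center:
 assumes K: "field K" and fin: "finite (noncomm_division_algebra_classes K)"
  and pos: "card (noncomm_division_algebra_classes K) > 0"
 shows "\<exists>D. maximal_center K D"
proof -
 let ?N = "noncomm_division_algebras K"
 let ?r = "{(D, E). D \<in> ?N \<and> E \<in> ?N \<and> algebra_iso K D E ~= {}}"
 have eq: "equiv ?N ?r" by (rule equiv_algebra_iso)
 define S where "S = {m. \<exists>D\<in>?N. cdim K D m}"
 define F :: "('a, 'a list) module set => nat" where "F C = (THE m. \<exists>D\<in>C. cdim K D m)" for C
 have fda: "finite_division_algebra K D" if "D \<in> ?N" for D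
  using that by (simp add: noncomm_division_algebras_def)
 have "S \<subseteq> F ` noncomm_division_algebra_classes K"
 proof
  fix m assume "m \<in> S"
  then obtain D where D: "D \<in> ?N" "cdim K D m" unfolding S_def by blast
  let ?C = "?r `` {D}"
  have "F ?C = m"
   unfolding F_def
  proof (rule the_equality)
   show "\<exists>D\<in>?C. cdim K D m" using D equiv_class_self[OF eq D(1)] by blast
   fix m' assume "\<exists>E\<in>?C. cdim K E m'"
   then obtain E f where E: "E \<in> ?N" "f \<in> algebra_iso K D E" "cdim K E m'" by auto
   have "cdim K E m" using cdim_iso[OF fda[OF D(1)] fda[OF E(1)] E(2) D(2)] .
   then show "m' = m" using finite_division_algebra.cdim_unique[OF fda[OF E(1)] E(3)] by simp
  qed
  moreover have "?C \<in> noncomm_division_algebra_classes K"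
   unfolding noncomm_division_algebra_classes_def using D(1) by (rule quotientI)
  ultimately show "m \<in> F ` noncomm_division_algebra_classes K" by blast
 qed
 then have finS: "finite S" using fin finite_surj by blast
 have "noncomm_division_algebra_classes K ~= {}" using pos by auto
 then obtain D where "D \<in> ?N"
  unfolding noncomm_division_algebra_classes_def quotient_def by auto
 then have "S ~= {}" using finite_division_algebra.cdim_ex[OF fda] unfolding S_def by blast
 then have "Max S \<in> S" using finS by simp
 then obtain D where D: "D \<in> ?N" "cdim K D (Max S)" unfolding S_def by blast
 have "maximal_center K D"
 proof (rule maximal_center.intro)
  fix E m n assume E: "E \<in> ?N" "cdim K E m" "cdim K D n"
  have "n = Max S" using finite_division_algebra.cdim_unique[OF fda[OF D(1)] E(3) D(2)] .
  moreover have "m \<in> S" using E unfolding S_def by blast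
  ultimately show "m \<le> n" using finS by simp
 qed (use K D(1) in simp_all)
 then show ?thesis ..
qed

sublocale maximal_center \<subseteq> D: skew_field D
 using D_mem by (simp add: noncomm_division_algebras_def finite_division_algebra_def)

context maximal_center
begin

abbreviation Z where "Z \<equiv> cent D"
abbreviation Zr where "Zr \<equiv> D(|carrier := Z|)"

lemma fda: "finite_division_algebra K D"
 using D_mem by (simp add: noncomm_division_algebras_def)

lemmas scal_subfield = finite_division_algebra.scal_subfield[OF fda]
lemmas scal_central = finite_division_algebra.scal_central[OF fda]
lemmas scal_hom = finite_division_algebra.scal_hom[OF fda]

lemma noncomm: "\<exists>x\<in>carrier D. \<exists>y\<in>carrier D. x ** y ~= y ** x"
 using D_mem by (simp add: noncomm_division_algebras_def noncommutative_def)

lemma Z_subfield: "subfield Z D" using D.cent_subfield .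

lemma Z_field: "field Zr" using D.subfield_iff(2)[OF Z_subfield] .

lemma Z_finite: "D.finite_dimension Z (carrier D)"
proof -
 obtain n where n: "D.dimension n (scal D ` carrier K) (carrier D)"
  using finite_division_algebra.finite_dimension_scal[OF fda] by auto
 show ?thesis
  by (rule D.dimension_larger_base[OF scal_subfield Z_subfield scal_central n
     D.carrier_is_subalgebra[OF subfieldE(3)[OF Z_subfield]]])
qed

text \<open>If \<open>C\<close> were noncommutative, it would compete with \<open>D\<close> and have
  a center of larger degree over \<open>K\<close>. The embedding \<open>h\<close> of
  \<open>Z\<close> is arbitrary; for centralizers it is the inclusion, and later it is also a
  Frobenius map.\<close>

theorem larger_center_commutative:
 fixes C :: "('c, 'm) ring_scheme" and h :: "'a list => 'c"
 assumes C: "skew_field C" and h: "h \<in> ring_hom Zr C" and central: "h ` Z \<subseteq> cent C"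
  and fin: "ring.finite_dimension C (h ` Z) (carrier C)"
  and y: "y \<in> cent C" "y \<notin> h ` Z"
  and ab: "a \<in> carrier C" "b \<in> carrier C"
 shows "a **[C] b = b **[C] a"
proof (rule ccontr)
 assume nc: "a **[C] b ~= b **[C] a"
 interpret C: skew_field C by fact
 interpret Zr: field Zr by (rule Z_field)
 interpret h: ring_hom_ring Zr C h by (rule ring_hom_ringI2[OF Zr.ring_axioms C.ring_axioms h])
 let ?k0 = "scal D ` carrier K"
 \<comment> \<open>The \<open>K\<close>-structure of \<open>C\<close> is the one that
   \<open>h\<close> carries over from \<open>D\<close>, so \<open>h\<close> preserves degrees over
   \<open>K\<close>.\<close>
 define g where "g = h \<circ> scal D"
 have k0Z: "?k0 \<subseteq> Z" by (rule scal_central)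
 have g: "g \<in> ring_hom K C"
 proof -
  have "scal D \<in> ring_hom K Zr" using scal_hom k0Z unfolding ring_hom_def by auto
  then show ?thesis unfolding g_def using h ring_hom_trans by blast
 qed
 have gk: "g ` carrier K = h ` ?k0" by (auto simp: g_def)
 have hZ: "subfield (h ` Z) C"
  using h.img_is_subfield(2)[OF Zr.carrier_is_subfield] C.one_not_zero by simp
 obtain n where n: "cdim K D n" using finite_division_algebra.cdim_ex[OF fda] by blast
 have k0: "subfield ?k0 Zr"
 proof -
  have "field (Zr(|carrier := ?k0|))" using D.subfield_iff(2)[OF scal_subfield] by simp
  then show ?thesis using Zr.subfield_iff(1) k0Z by simp
 qed
 have nZ: "Zr.dimension n ?k0 Z"
  using n D.dimension_consistent[OF subfieldE(1)[OF Z_subfield] scal_subfield k0Z]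
  unfolding cdim_def by simp
 have injh: "inj_on h Z"
  using h.img_is_subfield(1)[OF Zr.carrier_is_subfield] C.one_not_zero by simp
 have gks: "subfield (g ` carrier K) C"
  unfolding gk using h.img_is_subfield(2)[OF k0] C.one_not_zero by simp
 have nh: "C.dimension n (g ` carrier K) (h ` Z)"
  unfolding gk using h.inj_hom_dimension[OF k0 _ injh nZ] C.one_not_zero by simp
 have finK: "C.finite_dimension (g ` carrier K) (carrier C)"
  using C.telescopic_base_dim(1)[OF gks hZ C.finite_dimensionI[OF nh] fin] .
 have cenK: "g ` carrier K \<subseteq> cent C" unfolding gk using k0Z central by blast
 define E where "E = (|carrier = carrier C, mult = mult C, one = one C, zero = zero C, add = add C,
  smult = (%c x. g c **[C] x)|)"
 note E = finite_division_algebraI[OF K_field C g cenK finK, folded E_def]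
 have rE: "ring E" using E(1) by (simp add: finite_division_algebra_def skew_field_def)
 have scE: "scal E ` carrier K = g ` carrier K" using E(2) by (intro image_cong) auto
 have cE: "cent E = cent C" unfolding cent_def E_def by simp
 have "noncommutative E" unfolding noncommutative_def E_def using nc ab by auto
 \<comment> \<open>\<open>maximal\<close> speaks of algebras on lists, while \<open>C\<close> may
   have any type.\<close>
 then obtain E' f where E': "E' \<in> noncomm_division_algebras K" "f \<in> algebra_iso K E E'"
  using list_representative[OF E(1)] by blast
 obtain m where m: "cdim K E m" using finite_division_algebra.cdim_ex[OF E(1)] by blast
 have "cdim K E' m"
  using cdim_iso[OF E(1) _ E'(2) m] E'(1) by (simp add: noncomm_division_algebras_def)
 then have le: "m \<le> n" using maximal[OF E'(1) _ n] by blast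
 have mC: "C.dimension m (g ` carrier K) (cent C)"
 proof -
  have "ring_hom_ring E C (%x. x)"
   by (rule ring_hom_ringI2[OF rE C.ring_axioms])
    (auto simp: ring_hom_def E_def)
  then show ?thesis
   using ring_hom_ring.inj_hom_dimension[of E C "%x. x", OF _ finite_division_algebra.scal_subfield[OF E(1)] C.one_not_zero _
     m[unfolded cdim_def]] unfolding scE cE by simp
 qed
 obtain n' where n': "C.dimension n' (g ` carrier K) (h ` Z)" "n' \<le> m" "n' = m ==> h ` Z = cent C"
  using C.subspace_dimension[OF gks mC C.finite_dimension_imp_subalgebra[OF gks C.finite_dimensionI[OF nh]] central] by auto
 have "n' = n" using C.dimension_is_inj[OF gks n'(1) nh] .
 then have "h ` Z = cent C" using n' le by simp
 then show False using y by simp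
qed

end

subsection \<open>Splitting by larger fields\<close>

text \<open>\<open>W\<close> is a left vector space over the skew field \<open>B\<close>: every
  orbit \<open>B w\<close> of a nonzero \<open>w\<close> is a copy of \<open>B\<close>.\<close>

lemma (in ring) skew_subring_left_dvd:
 assumes K: "subfield K R" and B: "subring B R" "K \<subseteq> B" "dimension d K B"
  and B_inv: "!!b. b \<in> B ==> b ~= \<zero> ==> \<exists>c\<in>B. c ** b = \<one> \<and> b ** c = \<one>"
  and W: "dimension n K W" and cl: "!!b w. b \<in> B ==> w \<in> W ==> b ** w \<in> W"
 shows "d dvd n"
proof -
 note Bp = subringE[OF B(1)]
 have Wc: "w \<in> carrier R" if "w \<in> W" for w using that space_subgroup_props(1)[OF K W] by auto
 have Bc: "b \<in> carrier R" if "b \<in> B" for b using that Bp(1) by auto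
 have nz: "b = \<zero>" if "b \<in> B" "w \<in> W" "w ~= \<zero>" "b ** w = \<zero>" for b w
 proof (rule ccontr)
  assume "b ~= \<zero>"
  then obtain c where c: "c \<in> B" "c ** b = \<one>" using B_inv \<open>b \<in> B\<close> by blast
  have "w = c ** b ** w" using c Wc that by simp
  also have "\<dots> = \<zero>" using c(1) that Bc Wc by (simp add: m_assoc)
  finally show False using that by simp
 qed
 show ?thesis
 proof (rule dimension_dvd[OF K W, where B = B and act = "%b w. b ** w" and d = d])
  show "dimension d K ((%b. b ** w) ` B)" if w: "w \<in> W" "w ~= \<zero>" for w
   by (rule dimension_linear_inj[OF K B(3)])
    (use nz[OF _ w] Bc Wc[OF w(1)] B(2) in "auto simp: l_distr m_assoc subset_iff")
  show "w \<in> (%b. b ** w) ` B" if "w \<in> W" for w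
   using Bp(3) Wc[OF that] by (intro image_eqI[of _ _ \<one>]) auto
  show "b ** (c ** w) \<in> (%b. b ** w) ` B" if "b \<in> B" "c \<in> B" "w \<in> W" for b c w
   using Bp(6)[OF that(1,2)] Bc[OF that(1)] Bc[OF that(2)] Wc[OF that(3)]
   by (intro image_eqI[of _ _ "b ** c"]) (auto simp: m_assoc)
  show "\<exists>c\<in>B. c ** (b ** w) = w" if b: "b \<in> B" "w \<in> W" "b ** w ~= \<zero>" for b w
  proof -
   have "b ~= \<zero>" using b(3) Wc[OF b(2)] by auto
   then obtain c where "c \<in> B" "c ** b = \<one>" using B_inv b(1) by blast
   then show ?thesis using Bc b(1) Wc[OF b(2)] by (intro bexI[of _ c]) (auto simp: m_assoc[symmetric])
  qed
 qed (use Wc Bc cl in "auto simp: r_distr")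
qed

text \<open>\<open>central\<close> makes right multiplication \<open>K\<close>-linear. Products now
  act in reverse order, which the formulation of \<open>dimension_dvd\<close> by orbits
  admits.\<close>

lemma (in ring) skew_subring_right_dvd:
 assumes K: "subfield K R" and B: "subring B R" "K \<subseteq> B" "dimension d K B"
  and B_inv: "!!b. b \<in> B ==> b ~= \<zero> ==> \<exists>c\<in>B. c ** b = \<one> \<and> b ** c = \<one>"
  and central: "!!k x. k \<in> K ==> x \<in> carrier R ==> k ** x = x ** k"
  and W: "dimension n K W" and cl: "!!b w. b \<in> B ==> w \<in> W ==> w ** b \<in> W"
 shows "d dvd n"
proof -
 note Bp = subringE[OF B(1)]
 have Wc: "w \<in> carrier R" if "w \<in> W" for w using that space_subgroup_props(1)[OF K W] by auto
 have Bc: "b \<in> carrier R" if "b \<in> B" for b using that Bp(1) by auto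
 have nz: "b = \<zero>" if "b \<in> B" "w \<in> W" "w ~= \<zero>" "w ** b = \<zero>" for b w
 proof (rule ccontr)
  assume "b ~= \<zero>"
  then obtain c where c: "c \<in> B" "b ** c = \<one>" using B_inv \<open>b \<in> B\<close> by blast
  have "w = w ** (b ** c)" using c Wc that by simp
  also have "\<dots> = w ** b ** c" using c(1) \<open>b \<in> B\<close> Bc Wc[OF \<open>w \<in> W\<close>] by (simp add: m_assoc)
  also have "\<dots> = \<zero>" using c(1) that(4) Bc by simp
  finally show False using that by simp
 qed
 show ?thesis
 proof (rule dimension_dvd[OF K W, where B = B and act = "%b w. w ** b" and d = d])
  show "dimension d K ((%b. w ** b) ` B)" if w: "w \<in> W" "w ~= \<zero>" for w
  proof (rule dimension_linear_inj[OF K B(3)])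
   show "w ** (k ** u) = k ** (w ** u)" if "k \<in> K" "u \<in> B" for k u
   proof -
    have c: "k \<in> carrier R" "u \<in> carrier R" "w \<in> carrier R" using that Bc B(2) Wc[OF w(1)] by auto
    have "w ** (k ** u) = (w ** k) ** u" using c by (simp add: m_assoc)
    also have "w ** k = k ** w" using central[OF that(1) c(3)] by simp
    finally show ?thesis using c by (simp add: m_assoc)
   qed
  qed (use nz[OF _ w] Bc Wc[OF w(1)] in "auto simp: r_distr")
  show "w \<in> (%b. w ** b) ` B" if "w \<in> W" for w
   using Bp(3) Wc[OF that] by (intro image_eqI[of _ _ \<one>]) auto
  show "w ** c ** b \<in> (%b. w ** b) ` B" if "b \<in> B" "c \<in> B" "w \<in> W" for b c w
   using Bp(6)[OF that(2,1)] Bc[OF that(1)] Bc[OF that(2)] Wc[OF that(3)]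
   by (intro image_eqI[of _ _ "c ** b"]) (auto simp: m_assoc)
  show "\<exists>c\<in>B. w ** b ** c = w" if b: "b \<in> B" "w \<in> W" "w ** b ~= \<zero>" for b w
  proof -
   have "b ~= \<zero>" using b(3) Wc[OF b(2)] by auto
   then obtain c where "c \<in> B" "b ** c = \<one>" using B_inv b(1) by blast
   then show ?thesis using Bc b(1) Wc[OF b(2)] by (intro bexI[of _ c]) (auto simp: m_assoc)
  qed
 qed (use Wc Bc cl in "auto simp: l_distr")
qed

context maximal_center
begin

text \<open>The corner at a primitive idempotent is a skew field whose center contains
  \<open>F e\<close>, a proper extension of the image of \<open>Z\<close>. By maximality the corner
  is commutative, and \<open>corner_dims\<close> applies.\<close>

lemma split_idempotent:
 fixes A :: "('c, 'm) ring_scheme"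
 assumes A: "central_simple A F N" and h: "h \<in> ring_hom Zr A" and hF: "h ` Z \<subseteq> F" "h ` Z ~= F"
  and fin: "ring.finite_dimension A (h ` Z) F"
 obtains e k l where "e \<in> carrier A" "e ~= \<zero>[A]" "e **[A] e = e"
  "ring.dimension A k F (central_simple.Lid A e)" "ring.dimension A l F (central_simple.Rid A e)"
  "N = k * l"
proof -
 interpret A: central_simple A F N by fact
 interpret Zr: field Zr by (rule Z_field)
 interpret h: ring_hom_ring Zr A h by (rule ring_hom_ringI2[OF Zr.ring_axioms A.ring_axioms h])
 obtain e where e: "A.primitive_idem e" using A.exists_primitive_idem by blast
 note ep = A.e_props[OF e]
 define C where "C = A(|carrier := A.Cor e, one := e|)"
 have C: "carrier C = A.Cor e" "mult C = mult A" "one C = e" "zero C = zero A" "add C = add A"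
  by (simp_all add: C_def)
 have sf: "skew_field C" unfolding C_def by (rule A.corner_skew_field[OF e])
 interpret C: skew_field C by (rule sf)
 have hZ: "subfield (h ` Z) A"
  using h.img_is_subfield(2)[OF Zr.carrier_is_subfield] A.one_neq_zero by simp
 have hc: "h z \<in> F" "h z \<in> carrier A" if "z \<in> Z" for z using that hF A.F_carrier by auto
 have Fe: "f **[A] e \<in> A.Cor e" if "f \<in> F" for f
 proof -
  have fc: "f \<in> carrier A" "f **[A] e = e **[A] f"
   using that A.F_carrier A.central[OF that ep(1)] by auto
  have "f **[A] e **[A] e = f **[A] e" using fc(1) ep by (simp add: A.m_assoc)
  moreover have "e **[A] (f **[A] e) = f **[A] e"
   unfolding fc(2) using fc(1) ep by (simp add: A.m_assoc[symmetric])
  ultimately show ?thesis unfolding A.Cor_iff[OF e] using fc ep by simp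
 qed
 define g where "g z = h z **[A] e" for z
 have g: "g \<in> ring_hom Zr C"
 proof (rule ring_hom_memI)
  show "g x \<in> carrier C" if "x \<in> carrier Zr" for x using that Fe hc by (simp add: g_def C)
  fix x y assume "x \<in> carrier Zr" "y \<in> carrier Zr"
  then have xy: "x \<in> Z" "y \<in> Z" by auto
  note c = hc[OF xy(1)] hc[OF xy(2)]
  have "h y **[A] e = e **[A] h y" using A.central[OF c(3) ep(1)] .
  then have "h x **[A] e **[A] (h y **[A] e) = h x **[A] (h y **[A] (e **[A] e))"
   using c ep(1) by (metis A.m_assoc A.m_closed)
  then have "h x **[A] e **[A] (h y **[A] e) = h x **[A] h y **[A] e"
   using c ep by (simp add: A.m_assoc)
  then show "g (x **[Zr] y) = g x **[C] g y"
   using h.hom_mult[of x y] xy by (simp add: g_def C)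
  show "g (x \<oplus>[Zr] y) = g x \<oplus>[C] g y"
   using h.hom_add[of x y] xy c ep by (simp add: g_def C A.l_distr)
 next
  show "g \<one>[Zr] = \<one>[C]" using h.hom_one ep by (simp add: g_def C)
 qed
 have Fcen: "f **[A] e \<in> cent C" if fF: "f \<in> F" for f
 proof -
  have fc: "f \<in> carrier A" using fF A.F_carrier by auto
  have "f **[A] e **[A] x = x **[A] (f **[A] e)" if x: "x \<in> A.Cor e" for x
  proof -
   note xp = x[unfolded A.Cor_iff[OF e]]
   have "f **[A] e **[A] x = f **[A] x" using fc ep xp by (simp add: A.m_assoc)
   also have "\<dots> = f **[A] (x **[A] e)" using xp by simp
   also have "\<dots> = (f **[A] x) **[A] e" using fc ep(1) xp by (simp add: A.m_assoc)
   also have "f **[A] x = x **[A] f" using A.central[OF fF] xp by blast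
   finally show ?thesis using fc ep(1) xp by (simp add: A.m_assoc)
  qed
  then show ?thesis using Fe[OF fF] by (simp add: cent_def C)
 qed
 have gcen: "g ` Z \<subseteq> cent C" using Fcen hc by (auto simp: g_def)
 have finA: "A.finite_dimension (h ` Z) (carrier A)"
  using A.telescopic_base_dim(1)[OF hZ A.base fin A.finite_dimensionI[OF A.dim_A]] .
 have "subalgebra (h ` Z) (A.Cor e) A"
  unfolding A.Cor_eq[OF e] using A.subalgebra_inter[OF A.Lid_F[OF ep(1)] A.Rid_F[OF ep(1)]] hF(1)
  by (auto simp: subalgebra_def subalgebra_axioms_def)
 moreover have "A.Cor e \<subseteq> carrier A" using A.Cor_iff[OF e] by blast
 ultimately have "A.finite_dimension (h ` Z) (A.Cor e)"
  using A.subalbegra_incl_imp_finite_dimension[OF hZ finA] by blast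
 then obtain n where n: "A.dimension n (h ` Z) (A.Cor e)" by auto
 obtain u where u: "\<forall>i<n. u i \<in> A.Cor e" "A.Cor e = A.lspan (h ` Z) u n"
  using A.exists_basis[OF hZ n] by blast
 have gZ: "subfield (g ` Z) C"
  using ring_hom_ring.img_is_subfield(2)[OF ring_hom_ringI2[OF Zr.ring_axioms C.ring_axioms g]
    Zr.carrier_is_subfield] C.one_not_zero by simp
 \<comment> \<open>The unit of the corner is \<open>e\<close>, so its scalars are the products of
   \<open>e\<close> with the image of \<open>h\<close>; on the corner both act in the same
   way.\<close>
 have finC: "C.finite_dimension (g ` Z) (carrier C)"
 proof -
  let ?us = "map u [0..<n]" let ?S = "C.Span (g ` Z) ?us"
  have usC: "set ?us \<subseteq> carrier C" using u(1) by (auto simp: C)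
  note S = C.subalgebraD[OF C.Span_is_subalgebra[OF gZ usC]]
  have uS: "u i \<in> ?S" if "i < n" for i
   using C.Span_base_incl[OF gZ usC] that by auto
  have "A.Cor e \<subseteq> ?S"
  proof
   fix x assume "x \<in> A.Cor e"
   then obtain b where b: "\<forall>i<n. b i \<in> h ` Z" "x = lc A u b n"
    unfolding u(2) A.lspan_def by blast
   show "x \<in> ?S"
    unfolding b(2)
   proof (rule A.lc_mem)
    show "b i **[A] u i \<in> ?S" if i: "i < n" for i
    proof -
     obtain z where z: "z \<in> Z" "b i = h z" using b(1) i by blast
     have "g z **[C] u i \<in> ?S" using S(6)[OF _ uS[OF i]] z by blast
     moreover have "g z **[C] u i = b i **[A] u i"
      using u(1) i hc[OF z(1)] ep(1) by (simp add: g_def C z(2) A.Cor_iff[OF e] A.m_assoc)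
     ultimately show ?thesis by simp
    qed
   qed (use S(2,3) in "auto simp: C")
  qed
  then have "carrier C = ?S" using S(1) by (auto simp: C)
  then show ?thesis using C.Span_finite_dimension[OF gZ usC] by simp
 qed
 obtain f where f: "f \<in> F" "f \<notin> h ` Z" using hF by blast
 \<comment> \<open>Nonzero elements of \<open>F\<close> are invertible in \<open>A\<close>, so
   multiplication by \<open>e\<close> is injective on \<open>F\<close>.\<close>
 have fn: "f **[A] e \<notin> g ` Z"
 proof
  assume "f **[A] e \<in> g ` Z"
  then obtain z where z: "z \<in> Z" "f **[A] e = h z **[A] e" by (auto simp: g_def)
  let ?d = "f \<ominus>[A] h z"
  note Fp = subringE[OF subfieldE(1)[OF A.base]]
  have fc: "f \<in> carrier A" using f A.F_carrier by auto
  have d: "?d \<in> F" using f hc[OF z(1)] Fp by (simp add: A.minus_eq)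
  have "?d ~= \<zero>[A]" using f z fc hc[OF z(1)] by (auto simp: A.r_right_minus_eq)
  then have inv: "inv[A] ?d \<in> F" "inv[A] ?d **[A] ?d = \<one>[A]"
   using A.subfield_m_inv[OF A.base] d by auto
  have "?d **[A] e = \<zero>[A]"
   using z fc hc[OF z(1)] ep(1) by (simp add: A.minus_eq A.l_distr A.l_minus A.r_neg)
  then have "inv[A] ?d **[A] ?d **[A] e = \<zero>[A]"
   using inv(1) d A.F_carrier ep(1) by (simp add: A.m_assoc subset_iff)
  then show False using inv ep by simp
 qed
 have comm: "c **[A] d = d **[A] c" if "c \<in> A.Cor e" "d \<in> A.Cor e" for c d
  using larger_center_commutative[OF sf g gcen finC Fcen[OF f(1)] fn, of c d] that by (simp add: C)
 obtain k l where "A.dimension k F (A.Lid e)" "A.dimension l F (A.Rid e)" "N = k * l"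
  using A.corner_dims[OF e comm] by blast
 then show ?thesis using that ep by blast
qed

text \<open>The degree \<open>[D : Z]\<close>.\<close>

definition dl :: nat where "dl = (THE n. D.dimension n Z (carrier D))"

lemma dl: "D.dimension dl Z (carrier D)"
 unfolding dl_def using D.unique_dimension[OF Z_subfield Z_finite] by (rule theI')

lemma Z_carrier: "z \<in> Z ==> z \<in> carrier D" unfolding cent_def by simp
lemma Z_comm: "z \<in> Z ==> x \<in> carrier D ==> z ** x = x ** z" unfolding cent_def by simp
lemma Z_I: "z \<in> carrier D ==> (!!x. x \<in> carrier D ==> z ** x = x ** z) ==> z \<in> Z"
 unfolding cent_def by simp

text \<open>The centralizer of a noncentral element lies strictly between \<open>Z\<close> and \<open>D\<close>.\<close>

lemma dl_not_prime: "\<not> prime dl" "dl > 1"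
proof -
 obtain x y where xy: "x \<in> carrier D" "y \<in> carrier D" "x ** y ~= y ** x" using noncomm by blast
 define C where "C = {c \<in> carrier D. \<forall>s\<in>{x}. c ** s = s ** c}"
 have C: "c \<in> C \<longleftrightarrow> c \<in> carrier D \<and> c ** x = x ** c" for c by (simp add: C_def)
 have sub: "subring C D" unfolding C_def by (rule D.centralizer_subring) (use xy in simp)
 note Cp = subringE[OF sub]
 have ZC: "Z \<subseteq> C" using Z_carrier Z_comm xy by (auto simp: C)
 have subalg: "subalgebra Z C D"
  by (rule D.subalgebraI[OF Z_subfield Cp(1,2,7)]) (use Cp(6) ZC in blast)+
 obtain m where m: "D.dimension m Z C" "m = dl ==> C = carrier D"
  using D.subspace_dimension[OF Z_subfield dl subalg Cp(1)] by metis
 have "y \<notin> C" using xy C[of y] by simp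
 then have "m ~= dl" using m(2) xy(2) by blast
 have "m dvd dl"
 proof (rule D.skew_subring_left_dvd[OF Z_subfield sub ZC m(1) _ dl])
  show "\<exists>c\<in>C. c ** b = \<one> \<and> b ** c = \<one>" if b: "b \<in> C" "b ~= \<zero>" for b
  proof -
   have "inv b \<in> C" using D.centralizer_inv[of "{x}" b] b xy unfolding C_def by blast
   then show ?thesis using D.inv_ex[of b] b C by blast
  qed
 qed (use Cp(1) in auto)
 moreover have "m ~= 1"
 proof
  assume "m = 1"
  note one = D.dimension_one[OF Z_subfield]
  obtain n where n: "D.dimension n Z Z" "n = m ==> Z = C"
   using D.subspace_dimension[OF Z_subfield m(1) D.finite_dimension_imp_subalgebra[OF Z_subfield
      D.finite_dimensionI[OF one]] ZC] by metis
  have "n = 1" using D.dimension_is_inj[OF Z_subfield n(1) one] .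
  then have "Z = C" using n \<open>m = 1\<close> by simp
  then have "x \<in> Z" using xy C by auto
  then show False using Z_comm xy by auto
 qed
 ultimately show "\<not> prime dl" using \<open>m ~= dl\<close> prime_nat_iff by blast
 have "dl ~= 0"
 proof
  assume "dl = 0"
  then have "carrier D = {\<zero>}" using D.dimension_zero[OF Z_subfield] dl by simp
  then show False using D.one_not_zero by auto
 qed
 moreover have "dl ~= 1" using \<open>m dvd dl\<close> \<open>m ~= 1\<close> by auto
 ultimately show "dl > 1" by simp
qed

end

lemma (in ring) lc_delta:
 assumes "j < n" "!!i. i < n ==> d i \<in> carrier R"
 shows "lc R (%i. if i = j then \<one> else \<zero>) d n = d j"
 using assms
proof (induction n)
 case (Suc n)
 show ?case
 proof (cases "j = n")
  case True
  have "lc R (%i. if i = j then \<one> else \<zero>) d m = \<zero>" if "m \<le> n" for m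
   using that True Suc(3) by (induction m) auto
  then show ?thesis using True Suc by simp
 qed (use Suc in auto)
qed auto

context maximal_center
begin

text \<open>\<open>D \<otimes>\<^sub>Z F\<close> acts on the \<open>Z\<close>-linear maps \<open>F \<rightarrow> D\<close>: \<open>D\<close> by multiplying values, \<open>F\<close> by
 multiplying arguments.\<close>

context
 fixes F :: "('f, 'n) ring_scheme" and g :: "'a list => 'f" and r :: nat
 assumes F: "field F" and g: "g \<in> ring_hom Zr F"
  and r: "ring.dimension F r (g ` Z) (carrier F)"
begin

definition G :: "('f => 'a list) ring" where
 "G = (|carrier = {phi. phi \<in> carrier F \<rightarrow>\<^sub>E carrier D \<and>
   (\<forall>x\<in>carrier F. \<forall>y\<in>carrier F. phi (x \<oplus>[F] y) = phi x \<oplus> phi y) \<and>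
   (\<forall>z\<in>Z. \<forall>x\<in>carrier F. phi (g z **[F] x) = z ** phi x)},
  mult = undefined, one = undefined, zero = restrict (%x. \<zero>) (carrier F),
  add = (%phi psi. restrict (%x. phi x \<oplus> psi x) (carrier F))|)"

lemma F_ring: "ring F" using F by (simp add: field_def domain_def cring_def)
lemma g_closed: "z \<in> Z ==> g z \<in> carrier F" using ring_hom_closed[OF g] by simp

lemma G_D:
 assumes "phi \<in> carrier G"
 shows "phi \<in> extensional (carrier F)" "x \<in> carrier F ==> phi x \<in> carrier D"
  "x \<in> carrier F ==> y \<in> carrier F ==> phi (x \<oplus>[F] y) = phi x \<oplus> phi y"
  "z \<in> Z ==> x \<in> carrier F ==> phi (g z **[F] x) = z ** phi x"
 using assms by (auto simp: G_def PiE_def)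

lemma G_I:
 assumes "phi \<in> extensional (carrier F)" "!!x. x \<in> carrier F ==> phi x \<in> carrier D"
  "!!x y. x \<in> carrier F ==> y \<in> carrier F ==> phi (x \<oplus>[F] y) = phi x \<oplus> phi y"
  "!!z x. z \<in> Z ==> x \<in> carrier F ==> phi (g z **[F] x) = z ** phi x"
 shows "phi \<in> carrier G"
 using assms by (auto simp: G_def PiE_def)

lemma G_add: "x \<in> carrier F ==> (phi \<oplus>[G] psi) x = phi x \<oplus> psi x"
 "phi \<oplus>[G] psi \<in> extensional (carrier F)"
 "x \<in> carrier F ==> \<zero>[G] x = \<zero>" "\<zero>[G] \<in> extensional (carrier F)"
 by (simp_all add: G_def)

lemma G_group: "abelian_group G"
proof (rule abelian_groupI)
 interpret F: ring F by (rule F_ring)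
 note ext = extensionalityI[of _ "carrier F"]
 show "\<zero>[G] \<in> carrier G"
  by (rule G_I) (use g_closed Z_carrier in "simp_all add: G_add")
 fix phi psi \<chi> assume p: "phi \<in> carrier G" and q: "psi \<in> carrier G" and s: "\<chi> \<in> carrier G"
 note c = G_D(2)[OF p] G_D(2)[OF q] G_D(2)[OF s]
 show "phi \<oplus>[G] psi \<in> carrier G"
  by (rule G_I) (simp_all add: G_add c G_D(3)[OF p] G_D(3)[OF q] G_D(4)[OF p] G_D(4)[OF q]
    g_closed Z_carrier D.r_distr D.a_ac)
 show "phi \<oplus>[G] psi \<oplus>[G] \<chi> = phi \<oplus>[G] (psi \<oplus>[G] \<chi>)"
  by (rule ext) (simp_all add: G_add c D.a_assoc)
 show "phi \<oplus>[G] psi = psi \<oplus>[G] phi" by (rule ext) (simp_all add: G_add c D.a_comm)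
 show "\<zero>[G] \<oplus>[G] phi = phi" by (rule ext) (simp_all add: G_add c G_D(1)[OF p])
 let ?n = "restrict (%x. \<ominus> phi x) (carrier F)"
 have "?n \<in> carrier G"
  by (rule G_I) (simp_all add: c G_D(3)[OF p] G_D(4)[OF p] g_closed Z_carrier D.minus_add D.r_minus)
 moreover have "?n \<oplus>[G] phi = \<zero>[G]" by (rule ext) (simp_all add: G_add c D.l_neg)
 ultimately show "\<exists>y\<in>carrier G. y \<oplus>[G] phi = \<zero>[G]" by blast
qed

abbreviation R where "R \<equiv> op_ring G"

lemma R_ring: "ring R" by (rule op_ring_is_ring[OF G_group])

definition opD :: "'a list => ('f => 'a list) => 'f => 'a list" where
 "opD d = restrict (%phi. restrict (%x. d ** phi x) (carrier F)) (carrier G)"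
definition opF :: "'f => ('f => 'a list) => 'f => 'a list" where
 "opF y = restrict (%phi. restrict (%x. phi (y **[F] x)) (carrier F)) (carrier G)"

lemma op_apply:
 "phi \<in> carrier G ==> x \<in> carrier F ==> opD d phi x = d ** phi x"
 "phi \<in> carrier G ==> x \<in> carrier F ==> opF y phi x = phi (y **[F] x)"
 by (simp_all add: opD_def opF_def)

lemma op_G: "phi \<in> carrier G ==> d \<in> carrier D ==> opD d phi \<in> carrier G"
 "phi \<in> carrier G ==> y \<in> carrier F ==> opF y phi \<in> carrier G"
proof -
 interpret F: field F by (rule F)
 assume p: "phi \<in> carrier G"
 note c = G_D(2)[OF p]
 show "opD d phi \<in> carrier G" if d: "d \<in> carrier D"
 proof (rule G_I)
  show "opD d phi (g z **[F] x) = z ** opD d phi x" if "z \<in> Z" "x \<in> carrier F" for z x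
  proof -
   have "d ** (z ** phi x) = d ** z ** phi x" using that d c Z_carrier by (simp add: D.m_assoc)
   also have "d ** z = z ** d" using Z_comm that d by simp
   finally show ?thesis
    using that d c p Z_carrier g_closed by (simp add: op_apply G_D(4)[OF p] D.m_assoc)
  qed
 qed (use d p c in \<open>simp_all add: op_apply D.r_distr G_D(3)[OF p]\<close>, simp_all add: opD_def)
 show "opF y phi \<in> carrier G" if y: "y \<in> carrier F"
 proof (rule G_I)
  show "opF y phi (g z **[F] x) = z ** opF y phi x" if "z \<in> Z" "x \<in> carrier F" for z x
  proof -
   have "y **[F] (g z **[F] x) = g z **[F] (y **[F] x)"
    using that y g_closed by (simp add: F.m_lcomm)
   then show ?thesis using that y p g_closed by (simp add: op_apply G_D(4)[OF p])
  qed
 qed (use y p c in \<open>simp_all add: op_apply F.r_distr G_D(3)[OF p]\<close>, simp_all add: opF_def)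
qed

lemma op_R: "d \<in> carrier D ==> opD d \<in> carrier R" "y \<in> carrier F ==> opF y \<in> carrier R"
proof -
 interpret F: field F by (rule F)
 note ext = extensionalityI[of _ "carrier F"]
 show "opD d \<in> carrier R" if d: "d \<in> carrier D"
 proof (rule op_ring_closedI)
  show "opD d \<in> carrier G \<rightarrow>\<^sub>E carrier G" using op_G(1)[OF _ d] by (auto simp: opD_def)
  fix phi psi assume p: "phi \<in> carrier G" and q: "psi \<in> carrier G"
  have "phi \<oplus>[G] psi \<in> carrier G" using p q G_group by (simp add: abelian_monoid.a_closed abelian_group.axioms)
  then show "opD d (phi \<oplus>[G] psi) = opD d phi \<oplus>[G] opD d psi"
   by (intro ext[OF G_D(1)[OF op_G(1)]])
    (simp_all add: d p q op_apply G_add G_D(2)[OF p] G_D(2)[OF q] D.r_distr)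
 qed
 show "opF y \<in> carrier R" if y: "y \<in> carrier F"
 proof (rule op_ring_closedI)
  show "opF y \<in> carrier G \<rightarrow>\<^sub>E carrier G" using op_G(2)[OF _ y] by (auto simp: opF_def)
  fix phi psi assume p: "phi \<in> carrier G" and q: "psi \<in> carrier G"
  have "phi \<oplus>[G] psi \<in> carrier G" using p q G_group by (simp add: abelian_monoid.a_closed abelian_group.axioms)
  then show "opF y (phi \<oplus>[G] psi) = opF y phi \<oplus>[G] opF y psi"
   by (intro ext[OF G_D(1)[OF op_G(2)]]) (simp_all add: y p q op_apply G_add)
 qed
qed

lemma R_ext:
 assumes "f \<in> carrier R" "f' \<in> carrier R"
  "!!phi x. phi \<in> carrier G ==> x \<in> carrier F ==> f phi x = f' phi x"
 shows "f = f'"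
proof (rule extensionalityI[OF op_ring_extensional(1)[OF assms(1)] op_ring_extensional(1)[OF assms(2)]])
 show "f phi = f' phi" if "phi \<in> carrier G" for phi
  by (rule extensionalityI[of _ "carrier F"])
   (use that assms op_ring_simps(1)[OF _ that] G_D(1) in auto)
qed

lemma opD_hom: "opD \<in> ring_hom D R"
proof (rule ring_hom_memI)
 interpret R: ring R by (rule R_ring)
 show "opD d \<in> carrier R" if "d \<in> carrier D" for d using op_R that by blast
 fix x y assume xy: "x \<in> carrier D" "y \<in> carrier D"
 show "opD (x ** y) = opD x **[R] opD y"
  by (rule R_ext) (use xy op_R G_D(2) op_G in "simp_all add: op_apply op_ring_simps(3) D.m_assoc")
 show "opD (x \<oplus> y) = opD x \<oplus>[R] opD y"
  by (rule R_ext)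
   (use xy op_R G_D(2) op_G in "simp_all add: op_apply op_ring_simps(4) G_add D.l_distr")
next
 interpret R: ring R by (rule R_ring)
 show "opD \<one> = \<one>[R]"
  by (rule R_ext) (use op_R G_D(2) op_G in "simp_all add: op_apply op_ring_simps(5)")
qed

lemma opF_hom: "opF \<in> ring_hom F R"
proof (rule ring_hom_memI)
 interpret R: ring R by (rule R_ring)
 interpret F: field F by (rule F)
 show "opF d \<in> carrier R" if "d \<in> carrier F" for d using op_R that by blast
 fix x y assume xy: "x \<in> carrier F" "y \<in> carrier F"
 show "opF (x **[F] y) = opF x **[R] opF y"
 proof (rule R_ext)
  fix phi z assume pz: "phi \<in> carrier G" "z \<in> carrier F"
  have "x **[F] y **[F] z = y **[F] (x **[F] z)" using xy pz by (simp add: F.m_ac)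
  then show "opF (x **[F] y) phi z = (opF x **[R] opF y) phi z"
   using xy pz op_G by (simp add: op_apply op_ring_simps(3))
 qed (use xy op_R in auto)
 show "opF (x \<oplus>[F] y) = opF x \<oplus>[R] opF y"
  by (rule R_ext)
   (use xy op_R G_D(2,3) op_G in "simp_all add: op_apply op_ring_simps(4) G_add F.l_distr")
next
 interpret R: ring R by (rule R_ring)
 interpret F: field F by (rule F)
 show "opF \<one>[F] = \<one>[R]"
  by (rule R_ext) (use op_R G_D(2) op_G in "simp_all add: op_apply op_ring_simps(5)")
qed

lemma op_comm: "d \<in> carrier D ==> y \<in> carrier F ==> opD d **[R] opF y = opF y **[R] opD d"
proof -
 interpret R: ring R by (rule R_ring)
 interpret F: field F by (rule F)
 assume "d \<in> carrier D" "y \<in> carrier F"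
 then show ?thesis
  by (intro R_ext) (use op_R op_G in "simp_all add: op_apply op_ring_simps(3)")
qed

lemma op_Z: "z \<in> Z ==> opD z = opF (g z)"
 by (rule R_ext) (use op_R Z_carrier g_closed G_D(4) in "simp_all add: op_apply")

text \<open>For a basis \<open>u\<close> of \<open>F\<close> over \<open>Z\<close> the operators
  \<open>opF (u i)\<close> form a basis over the image of \<open>D\<close>, which commutes with
  them. Coefficients commuting with \<open>D\<close> lie in \<open>Z\<close>, so an element with
  such coefficients lies in \<open>F\<close>. This determines the center, and a shortest element of
  an ideal becomes a nonzero element of the field \<open>F\<close>.\<close>

lemma tensor_algebra:
 assumes r1: "r > 1"
 obtains A :: "(('f => 'a list) => 'f => 'a list) ring"
 where "ring A" "opD \<in> ring_hom D A" "opF \<in> ring_hom F A" "inj_on opD (carrier D)"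
  "!!d y. d \<in> carrier D ==> y \<in> carrier F ==> opD d **[A] opF y = opF y **[A] opD d"
  "central_simple A (opF ` carrier F) dl"
proof -
 interpret F: field F by (rule F)
 interpret R: ring R by (rule R_ring)
 interpret Zr: field Zr by (rule Z_field)
 interpret g: ring_hom_ring Zr F g by (rule ring_hom_ringI2[OF Zr.ring_axioms F.ring_axioms g])
 interpret oD: ring_hom_ring D R opD by (rule ring_hom_ringI2[OF D.ring_axioms R.ring_axioms opD_hom])
 interpret oF: ring_hom_ring F R opF by (rule ring_hom_ringI2[OF F.ring_axioms R.ring_axioms opF_hom])
 have gZ: "subfield (g ` Z) F"
  using g.img_is_subfield(2)[OF Zr.carrier_is_subfield] by simp
 have ginj: "inj_on g Z"
  using g.img_is_subfield(1)[OF Zr.carrier_is_subfield] by simp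
 define gi where "gi = inv_into Z g"
 have gi: "gi y \<in> Z" "g (gi y) = y" if "y \<in> g ` Z" for y
  using that by (auto simp: gi_def inv_into_into f_inv_into_f)
 have gig: "gi (g z) = z" if "z \<in> Z" for z using ginj that by (simp add: gi_def)
 have gi_add: "gi (x \<oplus>[F] y) = gi x \<oplus> gi y" and gi_mult: "gi (x **[F] y) = gi x ** gi y"
  if xy: "x \<in> g ` Z" "y \<in> g ` Z" for x y
 proof -
  note Zp = subringE[OF subfieldE(1)[OF Z_subfield]]
  have "g (gi x \<oplus> gi y) = x \<oplus>[F] y" "g (gi x ** gi y) = x **[F] y"
   using gi[OF xy(1)] gi[OF xy(2)] g.hom_add[of "gi x" "gi y"] g.hom_mult[of "gi x" "gi y"] by auto
  then show "gi (x \<oplus>[F] y) = gi x \<oplus> gi y" "gi (x **[F] y) = gi x ** gi y"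
   using gig[of "gi x \<oplus> gi y"] gig[of "gi x ** gi y"] Zp gi(1)[OF xy(1)] gi(1)[OF xy(2)] by auto
 qed
 obtain u c where u: "\<forall>i<r. u i \<in> carrier F" and c: "\<forall>x\<in>carrier F. \<forall>i<r. c i x \<in> g ` Z"
   "\<forall>x\<in>carrier F. x = lc F u (%i. c i x) r"
   "\<forall>i<r. \<forall>x\<in>carrier F. \<forall>y\<in>carrier F. c i (x \<oplus>[F] y) = c i x \<oplus>[F] c i y"
   "\<forall>i<r. \<forall>x\<in>carrier F. \<forall>k\<in>g ` Z. c i (k **[F] x) = k **[F] c i x"
   "\<forall>i<r. \<forall>j<r. c i (u j) = (if i = j then \<one>[F] else \<zero>[F])"
  using F.exists_coordinates[OF gZ r] by (elim exE conjE) (rule that)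
 note u = u[rule_format] and c = c[rule_format]
 \<comment> \<open>The dual basis, read as \<open>Z\<close>-linear maps from \<open>F\<close> to
   \<open>D\<close>: the vectors on which independence is tested.\<close>
 define phi where "phi j = restrict (%x. gi (c j x)) (carrier F)" for j
 have phi: "phi j \<in> carrier G" if j: "j < r" for j
 proof (rule G_I)
  show "phi j x \<in> carrier D" if "x \<in> carrier F" for x
   using gi(1)[OF c(1)[OF that j]] that Z_carrier by (simp add: phi_def)
  show "phi j (x \<oplus>[F] y) = phi j x \<oplus> phi j y" if "x \<in> carrier F" "y \<in> carrier F" for x y
   using that gi_add[OF c(1)[OF _ j] c(1)[OF _ j]] c(3)[OF j] by (simp add: phi_def)
  show "phi j (g z **[F] x) = z ** phi j x" if "z \<in> Z" "x \<in> carrier F" for z x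
   using that gi_mult[OF _ c(1)[OF _ j]] c(4)[OF j] g_closed gig by (simp add: phi_def)
 qed (simp add: phi_def)
 have gi01: "gi \<one>[F] = \<one>" "gi \<zero>[F] = \<zero>"
  using gig[of \<one>] gig[of \<zero>] g.hom_one g.hom_zero subringE[OF subfieldE(1)[OF Z_subfield]] by auto
 have phiu: "phi j (u i) = (if i = j then \<one> else \<zero>)" if "i < r" "j < r" for i j
  using c(5)[OF that(2,1)] u[OF that(1)] gi01 by (auto simp: phi_def)
 define B where "B = opD ` carrier D"
 define w where "w i = opF (u i)" for i
 have Bsub: "subring B R" unfolding B_def using oD.img_is_subring[OF D.carrier_is_subring] .
 have Binv: "\<exists>c\<in>B. c **[R] b = \<one>[R] \<and> b **[R] c = \<one>[R]" if b: "b \<in> B" "b ~= \<zero>[R]" for b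
 proof -
  obtain d where d: "d \<in> carrier D" "b = opD d" using b(1) by (auto simp: B_def)
  have "d ~= \<zero>" using b(2) d oD.hom_zero by auto
  note i = D.inv_ex[OF d(1) this]
  show ?thesis
   using oD.hom_mult[OF i(1) d(1)] oD.hom_mult[OF d(1) i(1)] i oD.hom_one d(2)
   by (intro bexI[of _ "opD (inv d)"]) (auto simp: B_def)
 qed
 have wc: "w i \<in> carrier R" if "i < r" for i using op_R(2) u that by (simp add: w_def)
 have comm: "w i **[R] b = b **[R] w i" if "i < r" "b \<in> B" for i b
  using op_comm u that by (auto simp: w_def B_def)
 have F_span: "opF y \<in> R.lspan B w r" if y: "y \<in> carrier F" for y
 proof -
  have "opF y = opF (lc F u (%i. c i y) r)" using c(2)[OF y] by simp
  also have "\<dots> = lc R (%i. opF (u i)) (%i. opF (c i y)) r"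
   by (rule F.lc_hom[OF opF_hom R.ring_axioms]) (use c(1)[OF y] u subfieldE(3)[OF gZ] in blast)+
  also have "\<dots> = lc R w (%i. opD (gi (c i y))) r"
   by (rule lc_cong) (use gi[OF c(1)[OF y]] op_Z in "auto simp: w_def")
  finally have eq: "opF y = lc R w (%i. opD (gi (c i y))) r" .
  show ?thesis
   by (rule R.lspanI[OF eq]) (use gi(1)[OF c(1)[OF y]] Z_carrier in "auto simp: B_def")
 qed
 have prod: "w i **[R] w j \<in> R.lspan B w r" if "i < r" "j < r" for i j
  using F_span[of "u i **[F] u j"] u[OF that(1)] u[OF that(2)] oF.hom_mult by (simp add: w_def)
 have one: "\<one>[R] \<in> R.lspan B w r"
  using F_span[of "\<one>[F]"] oF.hom_one by simp
 \<comment> \<open>At the argument \<open>1\<close> the operator \<open>opF (u i)\<close> becomes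
   evaluation at \<open>u i\<close>, so \<open>phi j\<close> singles out the \<open>j\<close>-th
   coefficient.\<close>
 have evalu: "lc R w (%i. opD (d i)) n phi' \<one>[F] = lc D (%i. phi' (u i)) d n"
  if "n \<le> r" "\<forall>i<r. d i \<in> carrier D" "phi' \<in> carrier G" for n d phi'
  using that(1)
 proof (induction n)
  case 0 then show ?case using that(3) by (simp add: op_ring_simps(6) G_add)
 next
  case (Suc n)
  then show ?case using that(2,3) u op_G wc[of n] op_R
   by (simp add: op_ring_simps(3,4) G_add op_apply w_def)
 qed
 have ind: "R.lindep B w r"
  unfolding R.lindep_def
 proof (intro allI impI)
  fix b j assume b: "\<forall>i<r. b i \<in> B" "lc R w b r = \<zero>[R]" "j < r"
  have "\<forall>i. \<exists>d. i < r --> d \<in> carrier D \<and> b i = opD d" using b(1) by (auto simp: B_def)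
  then obtain d where d: "!!i. i < r ==> d i \<in> carrier D \<and> b i = opD (d i)" by metis
  have "lc R w (%i. opD (d i)) r = \<zero>[R]"
   using b(2) lc_cong[of r b "%i. opD (d i)" w w R] d by simp
  then have "lc R w (%i. opD (d i)) r (phi j) \<one>[F] = \<zero>"
   using phi[OF b(3)] by (simp add: op_ring_simps(6) G_add)
  then have "lc D (%i. phi j (u i)) d r = \<zero>" using evalu[of r d "phi j"] d phi[OF b(3)] by simp
  moreover have "lc D (%i. phi j (u i)) d r = lc D (%i. if i = j then \<one> else \<zero>) d r"
   by (rule lc_cong) (use phiu b(3) in auto)
  ultimately have "d j = \<zero>" using D.lc_delta[OF b(3), of d] d by simp
  then show "b j = \<zero>[R]" using d[OF b(3)] oD.hom_zero by simp
 qed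
 have opD_inj: "d = \<zero>" if "d \<in> carrier D" "opD d = \<zero>[R]" for d
 proof -
  have u0: "0 < r" using r1 by simp
  have "opD d (phi 0) (u 0) = \<zero>" using that phi[OF u0] u[OF u0] by (simp add: op_ring_simps(6) G_add)
  then have "d ** phi 0 (u 0) = \<zero>" unfolding op_apply(1)[OF phi[OF u0] u[OF u0]] .
  then show ?thesis using phiu[OF u0 u0] that(1) by simp
 qed
 define S where "S = R.lspan B w r"
 define A where "A = R(|carrier := S|)"
 have id: "!!i b. i < r ==> b \<in> B ==> b \<in> B" .
 note cs = R.crossed_subring[where phi = "%_ b. b", OF Bsub Binv wc id comm prod one ind, folded S_def]
 have A: "carrier A = S" "mult A = mult R" "one A = one R" "zero A = zero R" "add A = add R"
  by (simp_all add: A_def)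
 have Asub: "subring S R" and BS: "B \<subseteq> S" using cs by auto
 interpret X: crossed A B w "%_ b. b" r using cs(3) unfolding A_def .
 have hD: "opD \<in> ring_hom D A"
  using opD_hom BS unfolding ring_hom_def A by (auto simp: B_def)
 have hF: "opF \<in> ring_hom F A"
  using opF_hom F_span unfolding ring_hom_def A by (auto simp: S_def)
 interpret aD: ring_hom_ring D A opD by (rule ring_hom_ringI2[OF D.ring_axioms X.ring_axioms hD])
 interpret aF: ring_hom_ring F A opF by (rule ring_hom_ringI2[OF F.ring_axioms X.ring_axioms hF])
 have nz: "\<one>[A] ~= \<zero>[A]"
  using opD_inj[of \<one>] D.one_not_zero oD.hom_one by (auto simp: A)
 have injD: "inj_on opD (carrier D)"
 proof (rule inj_onI)
  fix x y assume xy: "x \<in> carrier D" "y \<in> carrier D" "opD x = opD y"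
  have "opD (x \<ominus> y) = \<zero>[R]"
   using xy oD.hom_closed by (simp add: D.minus_eq R.r_neg)
  then show "x = y" using opD_inj[of "x \<ominus> y"] xy by (simp add: D.r_right_minus_eq)
 qed
 let ?F = "opF ` carrier F"
 have sF: "subfield ?F A"
  using aF.img_is_subfield(2)[OF F.carrier_is_subfield nz] .
 have sZ: "subfield (opD ` Z) A" using aD.img_is_subfield(2)[OF Z_subfield nz] .
 have dB: "X.dimension dl (opD ` Z) B"
  unfolding B_def using aD.inj_hom_dimension[OF Z_subfield nz injD dl] .
 have ZF: "opD ` Z \<subseteq> ?F" using op_Z g_closed by auto
 have OF: "opF ` g ` Z = opD ` Z" using op_Z by (simp add: image_image)
 have dF: "X.dimension r (opD ` Z) ?F"
  using aF.inj_hom_dimension[OF gZ nz aF.img_is_subfield(1)[OF F.carrier_is_subfield nz] r]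
  unfolding OF .
 have dA: "X.dimension (dl * r) (opD ` Z) (carrier A)"
  unfolding X.rep by (rule X.lspan_dimension[OF sZ dB X.w_closed X.ind])
 \<comment> \<open>The dimension over \<open>Z\<close> is counted twice, through \<open>D\<close>
   and through \<open>F\<close>; cancelling \<open>r\<close> gives \<open>N = dl\<close>.\<close>
 obtain N where N: "X.dimension N ?F (carrier A)"
  using X.dimension_larger_base[OF sZ sF ZF dA X.carrier_is_subalgebra[OF subfieldE(3)[OF sF]]] by auto
 have "X.dimension (r * N) (opD ` Z) (carrier A)" by (rule X.telescopic_base[OF sZ sF dF N])
 then have "r * N = dl * r" by (rule X.dimension_is_inj[OF sZ _ dA])
 then have "N = dl" using r1 by simp
 have cF: "y **[A] lc A w b r = lc A w b r **[A] y" if y: "y \<in> ?F" and b: "\<forall>i<r. b i \<in> B" for y b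
 proof -
  obtain f where f: "f \<in> carrier F" "y = opF f" using y by blast
  have yc: "y \<in> carrier A" using f aF.hom_closed by simp
  have 1: "w i **[A] y = y **[A] w i" if "i < r" for i
   using oF.hom_mult[OF u[OF that] f(1)] oF.hom_mult[OF f(1) u[OF that]] F.m_comm[OF u[OF that] f(1)]
   by (simp add: A f w_def)
  have 2: "b i **[A] y = y **[A] b i" if "i < r" for i
   using b that op_comm f by (auto simp: A B_def)
  have bc: "b i \<in> carrier A" if "i < r" for i using b that X.B_car by blast
  have "lc A w b n \<in> carrier A \<and> y **[A] lc A w b n = lc A w b n **[A] y" if "n \<le> r" for n
   using that
  proof (induction n)
   case (Suc n)
   have n: "n < r" using Suc by simp
   note c = bc[OF n] X.w_closed[OF n]
   have "y **[A] (b n **[A] w n) = (y **[A] b n) **[A] w n"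
    using c yc by (simp add: X.m_assoc)
   also have "\<dots> = b n **[A] (y **[A] w n)" unfolding 2[OF n, symmetric] using c yc by (simp add: X.m_assoc)
   also have "\<dots> = (b n **[A] w n) **[A] y" unfolding 1[OF n, symmetric] using c yc by (simp add: X.m_assoc)
   finally show ?case using Suc c yc by (simp add: X.l_distr X.r_distr)
  qed (use yc in simp)
  then show ?thesis by blast
 qed
 have Z_coefs: "lc A w b r \<in> ?F"
  if b: "\<forall>i<r. b i \<in> B" "!!x i. x \<in> B ==> i < r ==> x **[A] b i = b i **[A] x" for b
 proof -
  note Fp = subringE[OF subfieldE(1)[OF sF]]
  have "b i **[A] w i \<in> ?F" if i: "i < r" for i
  proof -
   obtain d where d: "d \<in> carrier D" "b i = opD d" using b(1) i by (auto simp: B_def)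
   have "d \<in> Z"
   proof (rule Z_I[OF d(1)])
    fix x assume x: "x \<in> carrier D"
    have "opD (x ** d) = opD (d ** x)"
     using b(2)[of "opD x" i] i x d aD.hom_mult by (simp add: B_def)
    then show "d ** x = x ** d" using inj_onD[OF injD] x d by simp
   qed
   then have "b i \<in> ?F" using d ZF by blast
   moreover have "w i \<in> ?F" using u i by (simp add: w_def)
   ultimately show ?thesis using Fp(6) by blast
  qed
  then show ?thesis by (intro X.lc_mem) (use Fp in auto)
 qed
 have CS: "central_simple A ?F dl"
 proof (intro central_simple.intro central_simple_axioms.intro X.ring_axioms sF)
  fix z assume z: "z \<in> carrier A" "!!a. a \<in> carrier A ==> z **[A] a = a **[A] z"
  obtain b where b: "\<forall>i<r. b i \<in> B" "z = lc A w b r" using z(1) unfolding X.rep X.lspan_def by blast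
  show "z \<in> ?F"
   unfolding b(2)
  proof (rule Z_coefs[OF b(1)])
   show "x **[A] b i = b i **[A] x" if "x \<in> B" "i < r" for x i
    using X.commuting_coefs[OF b(1) that(1) _ that(2)] z(2)[of x] X.B_car that b(2) by simp
  qed
 next
  fix z a assume z: "z \<in> ?F" "a \<in> carrier A"
  obtain b where b: "\<forall>i<r. b i \<in> B" "a = lc A w b r" using z(2) unfolding X.rep X.lspan_def by blast
  then show "z **[A] a = a **[A] z" using cF[OF z(1)] by simp
 next
  show "X.dimension dl ?F (carrier A)" using N \<open>N = dl\<close> by simp
 next
  fix I a assume I: "ideal I A" "a \<in> I" "a ~= \<zero>[A]"
  interpret I: ideal I A by (rule I(1))
  obtain b i0 where b: "\<forall>i<r. b i \<in> B" "lc A w b r \<in> I" "i0 < r" "b i0 = \<one>[A]"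
   "!!i x. i < r ==> x \<in> B ==> x **[A] b i = b i **[A] x"
   using X.shortest_element[OF I] by metis
  let ?a = "lc A w b r"
  have "?a \<in> ?F" using Z_coefs[OF b(1)] b(5) by blast
  moreover have "?a ~= \<zero>[A]" using X.lindepD[OF X.ind b(1) _ b(3)] b(4) nz by auto
  ultimately have "inv[A] ?a **[A] ?a = \<one>[A]" "inv[A] ?a \<in> carrier A"
   using X.subfield_m_inv[OF sF, of ?a] subfieldE(3)[OF sF] by auto
  then have "\<one>[A] \<in> I" using I.I_l_closed[OF b(2)] by metis
  then show "I = carrier A" using I.one_imp_carrier by simp
 qed
 show ?thesis
  by (rule that[OF X.ring_axioms hD hF injD _ CS]) (use op_comm in "simp add: A")
qed

text \<open>Splitting gives \<open>dl = k * l\<close> with \<open>A e\<close> of dimension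
  \<open>r * k\<close> and \<open>e A\<close> of dimension \<open>r * l\<close> over
  \<open>Z\<close>. Both are vector spaces over \<open>D\<close>, so \<open>k * l\<close> divides
  \<open>r * k\<close> and \<open>r * l\<close>, that is, \<open>l\<close> and \<open>k\<close>
  divide \<open>r\<close>. For prime \<open>r\<close>, since \<open>dl\<close> is neither
  \<open>1\<close> nor prime, \<open>k = l = r\<close> remains.\<close>

theorem larger_field_dvd:
 assumes r1: "r > 1"
 shows "prime p ==> p dvd dl ==> p dvd r"
  and "prime r ==> dl = r * r \<and> (\<exists>psi\<in>ring_hom F D. \<forall>z\<in>Z. psi (g z) = z)"
proof -
 interpret F: field F by (rule F)
 obtain A :: "(('f => 'a list) => 'f => 'a list) ring"
  where A: "ring A" "opD \<in> ring_hom D A" "opF \<in> ring_hom F A" "inj_on opD (carrier D)"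
  "!!d y. d \<in> carrier D ==> y \<in> carrier F ==> opD d **[A] opF y = opF y **[A] opD d"
  "central_simple A (opF ` carrier F) dl"
  using tensor_algebra[OF r1] by metis
 interpret A: central_simple A "opF ` carrier F" dl by (rule A(6))
 interpret aD: ring_hom_ring D A opD by (rule ring_hom_ringI2[OF D.ring_axioms A.ring_axioms A(2)])
 interpret aF: ring_hom_ring F A opF by (rule ring_hom_ringI2[OF F.ring_axioms A.ring_axioms A(3)])
 interpret Zr: field Zr by (rule Z_field)
 interpret g: ring_hom_ring Zr F g by (rule ring_hom_ringI2[OF Zr.ring_axioms F.ring_axioms g])
 let ?F = "opF ` carrier F" and ?Z = "opD ` Z" and ?B = "opD ` carrier D"
 have gZ: "subfield (g ` Z) F"
  using g.img_is_subfield(2)[OF Zr.carrier_is_subfield] by simp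
 have sZ: "subfield ?Z A" using aD.img_is_subfield(2)[OF Z_subfield A.one_neq_zero] .
 have dB: "A.dimension dl ?Z ?B"
  using aD.inj_hom_dimension[OF Z_subfield A.one_neq_zero A(4) dl] .
 have OF: "opF ` g ` Z = ?Z" using op_Z by (simp add: image_image)
 have injF: "inj_on opF (carrier F)"
  using aF.img_is_subfield(1)[OF F.carrier_is_subfield A.one_neq_zero] .
 have dF: "A.dimension r ?Z ?F"
  using aF.inj_hom_dimension[OF gZ A.one_neq_zero injF r] unfolding OF .
 have ZF: "?Z \<subseteq> ?F" using op_Z g_closed by auto
 have neq: "?Z ~= ?F"
 proof
  assume "?Z = ?F"
  then have "r = 1" using A.dimension_is_inj[OF sZ dF] A.dimension_one[OF sZ] by simp
  then show False using r1 by simp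
 qed
 have hZ: "opD \<in> ring_hom Zr A" using A(2) Z_carrier unfolding ring_hom_def by auto
 obtain e k l where e: "e \<in> carrier A" "e ~= \<zero>[A]" "e **[A] e = e"
  and k: "A.dimension k ?F (A.Lid e)" and l: "A.dimension l ?F (A.Rid e)" and kl: "dl = k * l"
  using split_idempotent[OF A(6) hZ ZF neq A.finite_dimensionI[OF dF]] by metis
 have kZ: "A.dimension (r * k) ?Z (A.Lid e)" by (rule A.telescopic_base[OF sZ A.base dF k])
 have lZ: "A.dimension (r * l) ?Z (A.Rid e)" by (rule A.telescopic_base[OF sZ A.base dF l])
 have Bsub: "subring ?B A" using aD.img_is_subring[OF D.carrier_is_subring] .
 have ZB: "?Z \<subseteq> ?B" using Z_carrier by auto
 have Binv: "\<exists>c\<in>?B. c **[A] b = \<one>[A] \<and> b **[A] c = \<one>[A]" if b: "b \<in> ?B" "b ~= \<zero>[A]" for b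
 proof -
  obtain d where d: "d \<in> carrier D" "b = opD d" using b(1) by auto
  have "d ~= \<zero>" using b(2) d aD.hom_zero by auto
  note i = D.inv_ex[OF d(1) this]
  show ?thesis
   using aD.hom_mult[OF i(1) d(1)] aD.hom_mult[OF d(1) i(1)] i aD.hom_one d(2)
   by (intro bexI[of _ "opD (inv d)"]) auto
 qed
 have BL: "b **[A] x \<in> A.Lid e" if "b \<in> ?B" "x \<in> A.Lid e" for b x
  using A.subalgebraD(6)[OF A.Lid_subalgebra[OF e(1)] _ that(2)] that(1) by auto
 have "dl dvd r * k"
  by (rule A.skew_subring_left_dvd[OF sZ Bsub ZB dB Binv kZ BL])
 moreover have "dl dvd r * l"
 proof (rule A.skew_subring_right_dvd[OF sZ Bsub ZB dB Binv _ lZ])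
  show "z **[A] x = x **[A] z" if "z \<in> ?Z" "x \<in> carrier A" for z x
   using A.central that ZF by blast
  show "w **[A] b \<in> A.Rid e" if b: "b \<in> ?B" "w \<in> A.Rid e" for b w
  proof -
   obtain a where a: "a \<in> carrier A" "w = e **[A] a" using b(2) unfolding A.Rid_def by blast
   have bc: "b \<in> carrier A" using b(1) by auto
   have "w **[A] b = e **[A] (a **[A] b)" using a e bc by (simp add: A.m_assoc)
   then show ?thesis unfolding A.Rid_def using a bc by blast
  qed
 qed
 moreover have "k > 0" "l > 0" using kl dl_not_prime(2) by (cases k; cases l; simp)+
 ultimately have lr: "l dvd r" and kr: "k dvd r"
  unfolding kl by (auto simp: mult.commute[of k l] mult.commute[of r])
 show "p dvd r" if "prime p" "p dvd dl"
 proof -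
  have "p dvd k \<or> p dvd l" using that kl prime_dvd_mult_iff[of p k l] by simp
  then show ?thesis using lr kr dvd_trans by blast
 qed
 assume pr: "prime r"
 have "k = 1 \<or> k = r" "l = 1 \<or> l = r" using pr lr kr by (auto simp: prime_nat_iff)
 moreover have "dl ~= 1" "dl ~= r" using dl_not_prime pr by auto
 ultimately have kl': "k = r" "l = r" using kl by auto
 have deq: "dl = r * r" using kl kl' by simp
 \<comment> \<open>For prime \<open>r\<close> the spaces \<open>D e\<close> and \<open>A e\<close>
   have the same dimension. So for \<open>y\<close> in \<open>F\<close> there is a unique
   \<open>psi y\<close> in \<open>D\<close> with \<open>y e = psi y e\<close>, and this is the
   embedding.\<close>
 have "(%b. b **[A] e) ` ?B \<subseteq> A.Lid e" using BL[OF _ A.Lid_self[OF e(1)]] by auto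
 moreover have dBe: "A.dimension dl ?Z ((%b. b **[A] e) ` ?B)"
 proof (rule A.dimension_linear_inj[OF sZ dB])
  have Bc: "b \<in> carrier A" if "b \<in> ?B" for b using that by auto
  show "b **[A] e \<in> carrier A" if "b \<in> ?B" for b using Bc[OF that] e by simp
  show "(u \<oplus>[A] v) **[A] e = u **[A] e \<oplus>[A] v **[A] e" if "u \<in> ?B" "v \<in> ?B" for u v
   using Bc[OF that(1)] Bc[OF that(2)] e by (simp add: A.l_distr)
  show "(z **[A] u) **[A] e = z **[A] (u **[A] e)" if "z \<in> ?Z" "u \<in> ?B" for z u
  proof -
   have "z \<in> carrier A" using that(1) ZB Bc by blast
   then show ?thesis using Bc[OF that(2)] e by (simp add: A.m_assoc)
  qed
  show "b = \<zero>[A]" if b: "b \<in> ?B" "b **[A] e = \<zero>[A]" for b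
  proof (rule ccontr)
   assume "b ~= \<zero>[A]"
   then obtain c where c: "c \<in> ?B" "c **[A] b = \<one>[A]" using Binv b(1) by blast
   have "c **[A] b **[A] e = \<zero>[A]" using b(2) Bc[OF c(1)] Bc[OF b(1)] e by (simp add: A.m_assoc)
   then show False using c e by simp
  qed
 qed
 moreover have "A.dimension dl ?Z (A.Lid e)" using kZ kl' deq by simp
 ultimately have full: "(%b. b **[A] e) ` ?B = A.Lid e"
  using A.subspace_dimension[OF sZ _ A.finite_dimension_imp_subalgebra[OF sZ A.finite_dimensionI[OF dBe]]]
   A.dimension_is_inj[OF sZ] by metis
 have "\<exists>d\<in>carrier D. opF y **[A] e = opD d **[A] e" if "y \<in> carrier F" for y
 proof -
  have "opF y **[A] e \<in> A.Lid e" unfolding A.Lid_def using that by auto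
  then show ?thesis unfolding full[symmetric] by auto
 qed
 then obtain psi where psi: "!!y. y \<in> carrier F ==> psi y \<in> carrier D"
  "!!y. y \<in> carrier F ==> opF y **[A] e = opD (psi y) **[A] e" by metis
 have uniq: "d = d'" if d: "d \<in> carrier D" "d' \<in> carrier D" "opD d **[A] e = opD d' **[A] e" for d d'
 proof (rule ccontr)
  assume "d ~= d'"
  then have n: "d \<ominus> d' ~= \<zero>" using d by (simp add: D.r_right_minus_eq)
  have dm: "d \<ominus> d' \<in> carrier D" using d by simp
  have "opD (d \<ominus> d') **[A] e = \<zero>[A]"
   using d e by (simp add: D.minus_eq A.l_distr A.l_minus A.r_neg)
  then have "opD (inv (d \<ominus> d')) **[A] (opD (d \<ominus> d') **[A] e) = \<zero>[A]"
   using D.inv_ex(1)[OF dm n] by simp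
  moreover have "opD (inv (d \<ominus> d')) **[A] (opD (d \<ominus> d') **[A] e) = opD (inv (d \<ominus> d') ** (d \<ominus> d')) **[A] e"
   using D.inv_ex(1)[OF dm n] dm e(1) aD.hom_mult[OF D.inv_ex(1)[OF dm n] dm] A.m_assoc aD.hom_closed
   by presburger
  ultimately show False using D.inv_ex(3)[OF dm n] e by simp
 qed
 have "psi \<in> ring_hom F D"
 proof (rule ring_hom_memI)
  fix x y assume xy: "x \<in> carrier F" "y \<in> carrier F"
  note c = psi(1)[OF xy(1)] psi(1)[OF xy(2)] psi(2)[OF xy(1)] psi(2)[OF xy(2)]
  show "psi (x \<oplus>[F] y) = psi x \<oplus> psi y"
  proof (rule uniq)
   have "opD (psi (x \<oplus>[F] y)) **[A] e = opF (x \<oplus>[F] y) **[A] e"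
    by (rule psi(2)[symmetric]) (use xy in simp)
   also have "\<dots> = opF x **[A] e \<oplus>[A] opF y **[A] e" using xy e by (simp add: A.l_distr)
   also have "\<dots> = opD (psi x \<oplus> psi y) **[A] e" using c e by (simp add: A.l_distr)
   finally show "opD (psi (x \<oplus>[F] y)) **[A] e = opD (psi x \<oplus> psi y) **[A] e" .
  qed (use psi(1) xy c in auto)
  \<comment> \<open>\<open>D\<close> commutes with \<open>F\<close> inside \<open>A\<close>, so the
    factors come out in reversed order; commutativity of \<open>F\<close> repairs this.\<close>
  show "psi (x **[F] y) = psi x ** psi y"
  proof (rule uniq)
   have "opD (psi (x **[F] y)) **[A] e = opF (y **[F] x) **[A] e"
    unfolding F.m_comm[OF xy] by (rule psi(2)[symmetric]) (use xy in simp)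
   also have "\<dots> = opF y **[A] (opF x **[A] e)" using xy e by (simp add: A.m_assoc)
   also have "\<dots> = (opF y **[A] opD (psi x)) **[A] e" unfolding c(3) using c(1) xy e by (simp add: A.m_assoc)
   also have "\<dots> = opD (psi x) **[A] (opF y **[A] e)"
    unfolding A(5)[OF c(1) xy(2), symmetric] using c(1) xy e by (simp add: A.m_assoc)
   also have "\<dots> = opD (psi x ** psi y) **[A] e" unfolding c(4) using c(1,2) e by (simp add: A.m_assoc)
   finally show "opD (psi (x **[F] y)) **[A] e = opD (psi x ** psi y) **[A] e" .
  qed (use psi(1) xy c in auto)
 next
  show "psi \<one>[F] = \<one>"
   by (rule uniq) (use psi(1) psi(2)[of "\<one>[F]"] in auto)
 qed (rule psi(1))
 moreover have "psi (g z) = z" if "z \<in> Z" for z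
  by (rule uniq) (use psi(1) psi(2)[of "g z"] g_closed that Z_carrier op_Z in auto)
 ultimately show "dl = r * r \<and> (\<exists>psi\<in>ring_hom F D. \<forall>z\<in>Z. psi (g z) = z)" using deq by blast
qed

end
end

subsection \<open>Cyclic algebras\<close>

text \<open>The product \<open>sg^(i-1)(b) ... sg(b) b\<close>, which is the norm of
  \<open>b\<close> when \<open>i\<close> is the order of \<open>sg\<close>. The recursion mirrors
  the step by which \<open>w e = b e\<close> implies that the \<open>i\<close>-th power of
  \<open>w\<close> acts on \<open>e\<close> as \<open>nrm E sg b i\<close>.\<close>

primrec nrm :: "('a, 'm) ring_scheme => ('a => 'a) => 'a => nat => 'a" where
 "nrm E sg b 0 = \<one>[E]"
| "nrm E sg b (Suc i) = sg (nrm E sg b i) **[E] b"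

text \<open>The cyclic algebra \<open>\<Oplus>\<^sub>i E w\<^sup>i\<close> with \<open>w e = \<sigma>(e) w\<close> and \<open>w\<^sup>p = a\<close> acts on the sequences
 \<open>phi\<close> in \<open>E\<close> with \<open>phi(j + p) = a phi(j)\<close>: \<open>w\<close> by shifting, \<open>e\<close> by \<open>phi \<mapsto> (j \<mapsto> sg\<^sup>j(e) phi(j))\<close>.\<close>

locale cyclic_algebra = E: field E for E :: "('f, 'n) ring_scheme" (structure) +
 fixes L :: "'f set" and sg :: "'f => 'f" and p :: nat and a y :: 'f
 assumes L: "subfield L E" and sg: "sg \<in> ring_hom E E"
  and fixed: "!!x. x \<in> carrier E ==> sg x = x \<longleftrightarrow> x \<in> L"
  and period: "!!x. x \<in> carrier E ==> (sg ^^ p) x = x"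
  and p: "prime p" and dim: "E.dimension p L (carrier E)"
  and a: "a \<in> L" "a ~= \<zero>" and y: "y \<in> carrier E"
  and conj: "inj_on (%i. (sg ^^ i) y) {..<p}"
begin

lemma p1: "p > 1" by (rule prime_gt_1_nat[OF p])
lemma a_car: "a \<in> carrier E" by (rule subsetD[OF subfieldE(3)[OF L] a(1)])
lemma s_closed: "x \<in> carrier E ==> (sg ^^ i) x \<in> carrier E"
 by (induction i) (auto simp: ring_hom_closed[OF sg])
lemma s_L: "x \<in> L ==> (sg ^^ i) x = x"
 using fixed subfieldE(3)[OF L] by (induction i) auto
lemma s_hom: "sg ^^ i \<in> ring_hom E E"
proof (induction i)
 case (Suc i)
 show ?case by (rule ring_hom_memI)
   (use Suc sg s_closed in "auto simp: ring_hom_mult ring_hom_add ring_hom_one ring_hom_closed")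
qed (auto simp: ring_hom_def)
lemma s_add: "(sg ^^ i) ((sg ^^ j) x) = (sg ^^ (i + j)) x" by (simp add: funpow_add)

definition V :: "(nat => 'f) ring" where
 "V = (|carrier = {phi. (\<forall>j. phi j \<in> carrier E) \<and> (\<forall>j. phi (j + p) = a ** phi j)},
  mult = undefined, one = undefined, zero = (%j. \<zero>), add = (%phi psi j. phi j \<oplus> psi j)|)"

lemma V_D: assumes "phi \<in> carrier V" shows "phi j \<in> carrier E" "phi (j + p) = a ** phi j"
 using assms by (auto simp: V_def)
lemma V_I: "(!!j. phi j \<in> carrier E) ==> (!!j. phi (j + p) = a ** phi j) ==> phi \<in> carrier V"
 by (auto simp: V_def)
lemma V_add: "(phi \<oplus>[V] psi) j = phi j \<oplus> psi j" "\<zero>[V] j = \<zero>" by (simp_all add: V_def)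

lemma V_group: "abelian_group V"
proof (rule abelian_groupI)
 show "\<zero>[V] \<in> carrier V" by (rule V_I) (use a_car in "auto simp: V_add")
 fix phi psi \<chi> assume p: "phi \<in> carrier V" and q: "psi \<in> carrier V" and s: "\<chi> \<in> carrier V"
 note c = V_D(1)[OF p] V_D(1)[OF q] V_D(1)[OF s]
 show "phi \<oplus>[V] psi \<in> carrier V"
  by (rule V_I) (use a_car c in "simp_all add: V_add V_D(2)[OF p] V_D(2)[OF q] E.r_distr")
 show "phi \<oplus>[V] psi \<oplus>[V] \<chi> = phi \<oplus>[V] (psi \<oplus>[V] \<chi>)"
  by (rule ext) (simp add: V_add c E.a_assoc)
 show "phi \<oplus>[V] psi = psi \<oplus>[V] phi" by (rule ext) (simp add: V_add c E.a_comm)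
 show "\<zero>[V] \<oplus>[V] phi = phi" by (rule ext) (simp add: V_add c)
 have "(%j. \<ominus> phi j) \<in> carrier V"
  by (rule V_I) (use a_car c in "simp_all add: V_D(2)[OF p] E.r_minus")
 moreover have "(%j. \<ominus> phi j) \<oplus>[V] phi = \<zero>[V]" by (rule ext) (simp add: V_add c E.l_neg)
 ultimately show "\<exists>y\<in>carrier V. y \<oplus>[V] phi = \<zero>[V]" by blast
qed

abbreviation R where "R \<equiv> op_ring V"

lemma R_ring: "ring R" by (rule op_ring_is_ring[OF V_group])

definition opE :: "'f => (nat => 'f) => nat => 'f" where
 "opE e = restrict (%phi j. (sg ^^ j) e ** phi j) (carrier V)"
definition w :: "nat => (nat => 'f) => nat => 'f" where
 "w i = restrict (%phi j. phi (j + i)) (carrier V)"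

lemma op_apply: "phi \<in> carrier V ==> opE e phi j = (sg ^^ j) e ** phi j"
 "phi \<in> carrier V ==> w i phi j = phi (j + i)" by (simp_all add: opE_def w_def)

lemma op_V: "phi \<in> carrier V ==> e \<in> carrier E ==> opE e phi \<in> carrier V"
 "phi \<in> carrier V ==> w i phi \<in> carrier V"
proof -
 assume p: "phi \<in> carrier V"
 note c = V_D(1)[OF p]
 show "w i phi \<in> carrier V"
 proof (rule V_I)
  fix j
  have "phi (j + p + i) = a ** phi (j + i)" using V_D(2)[OF p, of "j + i"] by (simp add: ac_simps)
  then show "w i phi (j + p) = a ** w i phi j" using p by (simp add: op_apply)
 qed (use p c in "simp add: op_apply")
 assume e: "e \<in> carrier E"
 show "opE e phi \<in> carrier V"
 proof (rule V_I)
  fix j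
  have "(sg ^^ (j + p)) e = (sg ^^ j) e" using period[OF e] by (simp add: funpow_add)
  then show "opE e phi (j + p) = a ** opE e phi j"
   using p c s_closed[OF e] a_car by (simp add: op_apply V_D(2)[OF p] E.m_lcomm)
 qed (use p c s_closed[OF e] in "simp add: op_apply")
qed

lemma V_a_closed: "phi \<in> carrier V ==> psi \<in> carrier V ==> phi \<oplus>[V] psi \<in> carrier V"
 using V_group by (simp add: abelian_monoid.a_closed abelian_group.axioms)

lemma op_R: "e \<in> carrier E ==> opE e \<in> carrier R" "w i \<in> carrier R"
proof -
 show "opE e \<in> carrier R" if e: "e \<in> carrier E"
 proof (rule op_ring_closedI)
  show "opE e \<in> carrier V \<rightarrow>\<^sub>E carrier V" using op_V(1)[OF _ e] by (auto simp: opE_def)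
  show "opE e (phi \<oplus>[V] psi) = opE e phi \<oplus>[V] opE e psi" if "phi \<in> carrier V" "psi \<in> carrier V" for phi psi
   by (rule ext) (use that V_a_closed V_D(1) s_closed[OF e] in
     \<open>simp add: op_apply V_add E.r_distr\<close>)
 qed
 show "w i \<in> carrier R"
 proof (rule op_ring_closedI)
  show "w i \<in> carrier V \<rightarrow>\<^sub>E carrier V" using op_V(2) by (auto simp: w_def)
  show "w i (phi \<oplus>[V] psi) = w i phi \<oplus>[V] w i psi" if "phi \<in> carrier V" "psi \<in> carrier V" for phi psi
   by (rule ext) (use that V_a_closed in "simp add: op_apply V_add")
 qed
qed

lemma R_ext:
 assumes "f \<in> carrier R" "f' \<in> carrier R" "!!phi j. phi \<in> carrier V ==> f phi j = f' phi j"
 shows "f = f'"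
proof (rule extensionalityI[OF op_ring_extensional(1)[OF assms(1)] op_ring_extensional(1)[OF assms(2)]])
 show "f phi = f' phi" if "phi \<in> carrier V" for phi
  by (rule ext) (rule assms(3)[OF that])
qed

lemma opE_hom: "opE \<in> ring_hom E R"
proof (rule ring_hom_memI)
 interpret R: ring R by (rule R_ring)
 fix x y assume xy: "x \<in> carrier E" "y \<in> carrier E"
 show "opE (x ** y) = opE x **[R] opE y"
  by (rule R_ext) (use xy op_R V_D(1) op_V s_closed in
    \<open>simp_all add: op_apply op_ring_simps(3) ring_hom_mult[OF s_hom] E.m_assoc\<close>)
 show "opE (x \<oplus> y) = opE x \<oplus>[R] opE y"
  by (rule R_ext) (use xy op_R V_D(1) op_V s_closed in
    \<open>simp_all add: op_apply op_ring_simps(4) V_add ring_hom_add[OF s_hom] E.l_distr\<close>)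
next
 interpret R: ring R by (rule R_ring)
 show "opE \<one> = \<one>[R]"
  by (rule R_ext) (use op_R V_D(1) in "simp_all add: op_apply op_ring_simps(5) ring_hom_one[OF s_hom]")
qed (rule op_R)

lemma w_comm: "e \<in> carrier E ==> w i **[R] opE e = opE ((sg ^^ i) e) **[R] w i"
proof -
 interpret R: ring R by (rule R_ring)
 assume "e \<in> carrier E"
 then show ?thesis
  by (intro R_ext) (use op_R op_V s_closed in "simp_all add: op_apply op_ring_simps(3) s_add")
qed

lemma w_add: "w i **[R] w j = w (i + j)"
proof -
 interpret R: ring R by (rule R_ring)
 show ?thesis
  by (rule R_ext) (use op_R op_V in "simp_all add: op_apply op_ring_simps(3) ac_simps")
qed

lemma w_0: "w 0 = \<one>[R]"
proof -
 interpret R: ring R by (rule R_ring)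
 show ?thesis by (rule R_ext) (use op_R in "simp_all add: op_apply op_ring_simps(5)")
qed

lemma w_p: "w p = opE a"
proof (rule R_ext[OF op_R(2) op_R(1)[OF a_car]])
 fix phi j assume "phi \<in> carrier V"
 then show "w p phi j = opE a phi j" unfolding op_apply[OF \<open>phi \<in> carrier V\<close>] s_L[OF a(1)] by (rule V_D(2))
qed

text \<open>The sequence with value \<open>1\<close> at \<open>k\<close> and \<open>0\<close> at the
  other indices below \<open>p\<close>; the powers of \<open>a\<close> are forced by the rule for a
  shift by \<open>p\<close>. These are the test vectors for independence of the
  \<open>w i\<close>.\<close>

definition eta :: "nat => nat => 'f" where
 "eta k j = (if j mod p = k then a [^] (j div p) else \<zero>)"

lemma eta: "eta k \<in> carrier V" "k < p ==> j < p ==> eta k j = (if j = k then \<one> else \<zero>)"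
proof -
 show "eta k \<in> carrier V"
  by (rule V_I) (use a_car p1 in "auto simp: eta_def E.m_comm")
 show "k < p ==> j < p ==> eta k j = (if j = k then \<one> else \<zero>)" by (simp add: eta_def)
qed

lemma opE_inj: "inj_on opE (carrier E)"
proof (rule inj_on_inverseI)
 show "opE e (eta 0) 0 = e" if "e \<in> carrier E" for e
  unfolding op_apply(1)[OF eta(1)] using eta(2)[of 0 0] p1 that by simp
qed

definition A where "A = R(|carrier := ring.lspan R (opE ` carrier E) w p|)"

text \<open>Commuting with \<open>y\<close>, whose conjugates are distinct, kills all coefficients
  but one. A central element therefore lies in \<open>E\<close>, and commuting with
  \<open>w 1\<close> puts it in the fixed field \<open>L\<close>. A shortest element of an ideal is
  a single \<open>w i0\<close>, which is invertible.\<close>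

lemma A_central_simple:
 "opE \<in> ring_hom E A" "central_simple A (opE ` L) (p * p)" "w 1 \<in> carrier A"
 "mult A = mult R" "carrier A \<subseteq> carrier R"
proof -
 interpret R: ring R by (rule R_ring)
 interpret oE: ring_hom_ring E R opE by (rule ring_hom_ringI2[OF E.ring_axioms R.ring_axioms opE_hom])
 define B where "B = opE ` carrier E"
 define iE where "iE = inv_into (carrier E) opE"
 have iE: "iE (opE e) = e" if "e \<in> carrier E" for e using opE_inj that by (simp add: iE_def)
 define phi where "phi i b = opE ((sg ^^ i) (iE b))" for i b
 have phi: "phi i (opE e) = opE ((sg ^^ i) e)" if "e \<in> carrier E" for i e using iE[OF that] by (simp add: phi_def)
 have Bsub: "subring B R" unfolding B_def using oE.img_is_subring[OF E.carrier_is_subring] .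
 have inv_e: "e ** inv e = \<one>" "inv e ** e = \<one>" "inv e \<in> carrier E" if "e \<in> carrier E" "e ~= \<zero>" for e
  using that E.field_Units by auto
 have Binv: "\<exists>c\<in>B. c **[R] b = \<one>[R] \<and> b **[R] c = \<one>[R]" if b: "b \<in> B" "b ~= \<zero>[R]" for b
 proof -
  obtain d where d: "d \<in> carrier E" "b = opE d" using b(1) by (auto simp: B_def)
  have "d ~= \<zero>" using b(2) d oE.hom_zero by auto
  note i = inv_e[OF d(1) this]
  show ?thesis
   using oE.hom_mult[OF i(3) d(1)] oE.hom_mult[OF d(1) i(3)] i oE.hom_one d(2)
   by (intro bexI[of _ "opE (inv d)"]) (auto simp: B_def)
 qed
 have wc: "w i \<in> carrier R" if "i < p" for i using op_R(2) .
 have wcl: "w i \<in> carrier R" for i using op_R(2) .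
 have phiB: "phi i b \<in> B" if "i < p" "b \<in> B" for i b
  using that phi s_closed by (auto simp: B_def)
 have comm: "w i **[R] b = phi i b **[R] w i" if "i < p" "b \<in> B" for i b
  using that w_comm phi by (auto simp: B_def)
 have single: "opE e **[R] w i \<in> R.lspan B w p" if "i < p" "e \<in> carrier E" for i e
 proof (rule R.lspanI)
  show "opE e **[R] w i = lc R w (%j. if j = i then opE e else \<zero>[R]) p"
   by (rule R.lc_single[OF wc that(1) op_R(1)[OF that(2)], symmetric])
  show "\<forall>j<p. (if j = i then opE e else \<zero>[R]) \<in> B"
   using that subringE(2)[OF Bsub] by (auto simp: B_def)
 qed
 have w_span: "w i \<in> R.lspan B w p" if "i < p" for i
  using single[OF that, of \<one>] oE.hom_one wcl by simp
 have prod: "w i **[R] w j \<in> R.lspan B w p" if ij: "i < p" "j < p" for i j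
 proof (cases "i + j < p")
  case True then show ?thesis using w_span by (simp add: w_add)
 next
  case False
  have "w i **[R] w j = opE a **[R] w (i + j - p)"
   using False by (simp add: w_add w_p[symmetric])
  then show ?thesis using single[of "i + j - p" a] ij False a_car by simp
 qed
 have one: "\<one>[R] \<in> R.lspan B w p" using w_span[of 0] w_0 p1 by simp
 have evalu: "lc R w (%i. opE (d i)) n phi' 0 = lc E phi' d n"
  if "n \<le> p" "\<forall>i<p. d i \<in> carrier E" "phi' \<in> carrier V" for n d phi'
  using that(1)
 proof (induction n)
  case 0 then show ?case using that(3) by (simp add: op_ring_simps(6) V_add)
 next
  case (Suc n)
  then show ?case using that(2,3) op_V op_R
   by (simp add: op_ring_simps(3,4) V_add op_apply)
 qed
 have Bd: "\<exists>d. \<forall>i<p. d i \<in> carrier E \<and> b i = opE (d i)" if b: "\<forall>i<p. b i \<in> B" for b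
 proof -
  have "\<forall>i. \<exists>d. i < p --> d \<in> carrier E \<and> b i = opE d" using b by (auto simp: B_def)
  then show ?thesis by metis
 qed
 have ind: "R.lindep B w p"
  unfolding R.lindep_def
 proof (intro allI impI)
  fix b j assume b: "\<forall>i<p. b i \<in> B" "lc R w b p = \<zero>[R]" "j < p"
  obtain d where d: "!!i. i < p ==> d i \<in> carrier E \<and> b i = opE (d i)" using Bd[OF b(1)] by blast
  have "lc R w (%i. opE (d i)) p = \<zero>[R]"
   using b(2) lc_cong[of p b "%i. opE (d i)" w w R] d by simp
  then have "lc R w (%i. opE (d i)) p (eta j) 0 = \<zero>"
   using eta(1) by (simp add: op_ring_simps(6) V_add)
  then have "lc E (eta j) d p = \<zero>" using evalu[of p d "eta j"] d eta(1) by simp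
  moreover have "lc E (eta j) d p = lc E (%i. if i = j then \<one> else \<zero>) d p"
   by (rule lc_cong) (use eta(2) b(3) in auto)
  ultimately have "d j = \<zero>" using E.lc_delta[OF b(3), of d] d by simp
  then show "b j = \<zero>[R]" using d[OF b(3)] oE.hom_zero by simp
 qed
 define S where "S = R.lspan B w p"
 note cs = R.crossed_subring[where phi = phi, OF Bsub Binv wc phiB comm prod one ind, folded S_def]
 have A: "carrier A = S" "mult A = mult R" "one A = one R" "zero A = zero R" "add A = add R"
  by (simp_all add: A_def S_def B_def)
 have Asub: "subring S R" and BS: "B \<subseteq> S" using cs by auto
 interpret X: crossed A B w phi p using cs(3) unfolding A_def B_def S_def .
 have hE: "opE \<in> ring_hom E A"
  using opE_hom BS unfolding ring_hom_def A by (auto simp: B_def)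
 interpret aE: ring_hom_ring E A opE by (rule ring_hom_ringI2[OF E.ring_axioms X.ring_axioms hE])
 have nz: "\<one>[A] ~= \<zero>[A]"
  using inj_onD[OF opE_inj, of \<one> \<zero>] oE.hom_one oE.hom_zero by (auto simp: A)
 let ?F = "opE ` L"
 have sF: "subfield ?F A" using aE.img_is_subfield(2)[OF L nz] .
 have dB: "X.dimension p ?F B"
  unfolding B_def using aE.inj_hom_dimension[OF L nz opE_inj dim] .
 have dA: "X.dimension (p * p) ?F (carrier A)"
  unfolding X.rep by (rule X.lspan_dimension[OF sF dB X.w_closed X.ind])
 text \<open>Distinctness of the conjugates of \<open>y\<close> leaves a single coefficient.\<close>
 have only: "b i = \<zero>[A]"
  if b: "\<forall>i<p. b i \<in> B" "i < p" "i0 < p" "i ~= i0" and c: "phi i0 (opE y) **[A] b i = b i **[A] phi i (opE y)"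
  for b i i0
 proof -
  obtain d where d: "!!i. i < p ==> d i \<in> carrier E \<and> b i = opE (d i)" using Bd[OF b(1)] by blast
  note dc = d[OF b(2), THEN conjunct1]
  note sc = s_closed[OF y]
  have "opE ((sg ^^ i0) y ** d i) = opE (d i ** (sg ^^ i) y)"
   using c d[OF b(2)] phi[OF y] sc aE.hom_mult by simp
  then have "(sg ^^ i0) y ** d i = (sg ^^ i) y ** d i"
   using inj_onD[OF opE_inj] dc sc E.m_comm by simp
  moreover have "(sg ^^ i0) y ~= (sg ^^ i) y" using inj_onD[OF conj, of i0 i] b by auto
  ultimately have "d i = \<zero>" using E.m_rcancel dc sc by blast
  then show ?thesis using d[OF b(2)] aE.hom_zero by simp
 qed
 have CS: "central_simple A ?F (p * p)"
 proof (intro central_simple.intro central_simple_axioms.intro X.ring_axioms sF dA)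
  fix z assume z: "z \<in> carrier A" "!!a. a \<in> carrier A ==> z **[A] a = a **[A] z"
  obtain b where b: "\<forall>i<p. b i \<in> B" "z = lc A w b p" using z(1) unfolding X.rep X.lspan_def by blast
  have yB: "opE y \<in> B" using y by (simp add: B_def)
  have "b i = \<zero>[A]" if i: "i < p" "i ~= 0" for i
  proof (rule only[OF b(1) i(1) _ i(2)])
   show "0 < p" using p1 by simp
   show "phi 0 (opE y) **[A] b i = b i **[A] phi i (opE y)"
    using X.commuting_coefs[OF b(1) yB _ i(1)] z(2)[OF X.B_car[OF yB]] phi[OF y] b(2) by simp
  qed
  then have "lc A w b p = lc A w (%i. if i = 0 then b 0 else \<zero>[A]) p" by (intro lc_cong) auto
  also have "\<dots> = b 0 **[A] w 0" by (rule X.lc_single[OF X.w_closed]) (use b(1) p1 X.B_car in auto)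
  also have "\<dots> = b 0" using X.B_car[of "b 0"] b(1) p1 w_0 X.r_one[of "b 0"] by (simp add: A)
  finally have z0: "z = b 0" using b(2) by simp
  obtain e where e: "e \<in> carrier E" "z = opE e" using b(1) p1 z0 by (force simp: B_def)
  \<comment> \<open>Evaluated on \<open>eta 1\<close> at index \<open>0\<close>, the two sides are
    \<open>sg e\<close> and \<open>e\<close>.\<close>
  have "w 1 **[R] opE e = opE e **[R] w 1" using z(2)[OF X.w_closed[OF p1]] e by (simp add: A)
  then have "(w 1 **[R] opE e) (eta 1) 0 = (opE e **[R] w 1) (eta 1) 0" by simp
  then have "sg e = e"
   using eta(1)[of 1] eta(2)[of 1 1] p1 op_V e s_closed[OF e(1), of 1] by (simp add: op_ring_simps(3) op_apply)
  then show "z \<in> ?F" using fixed e by blast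
 next
  fix z x assume z: "z \<in> ?F" "x \<in> carrier A"
  obtain b where b: "\<forall>i<p. b i \<in> B" "x = lc A w b p" using z(2) unfolding X.rep X.lspan_def by blast
  obtain c where c: "c \<in> L" "z = opE c" using z(1) by blast
  have cE: "c \<in> carrier E" using c subfieldE(3)[OF L] by blast
  have zB: "z \<in> B" using c cE by (simp add: B_def)
  have phiz: "phi i z = z" for i using phi[OF cE] s_L[OF c(1)] c(2) by simp
  have bz: "b i **[A] z = z **[A] b i" if i: "i < p" for i
  proof -
   obtain e where e: "e \<in> carrier E" "b i = opE e" using b(1) i by (force simp: B_def)
   show ?thesis using aE.hom_mult[OF e(1) cE] aE.hom_mult[OF cE e(1)] E.m_comm[OF e(1) cE] c(2) e(2) by simp
  qed
  show "z **[A] x = x **[A] z"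
   unfolding b(2) X.lc_left(1)[OF b(1) zB] X.lc_right(1)[OF b(1) zB]
   by (rule lc_cong) (use bz phiz in auto)
 next
  fix I x assume I: "ideal I A" "x \<in> I" "x ~= \<zero>[A]"
  interpret I: ideal I A by (rule I(1))
  obtain b i0 where b: "\<forall>i<p. b i \<in> B" "lc A w b p \<in> I" "i0 < p" "b i0 = \<one>[A]"
   "!!i x. i < p ==> x \<in> B ==> phi i0 x **[A] b i = b i **[A] phi i x"
   using X.shortest_element[OF I] by metis
  have yB: "opE y \<in> B" using y by (simp add: B_def)
  have "b i = \<zero>[A]" if i: "i < p" "i ~= i0" for i
   by (rule only[OF b(1) i(1) b(3) i(2) b(5)[OF i(1) yB]])
  then have "lc A w b p = lc A w (%i. if i = i0 then \<one>[A] else \<zero>[A]) p"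
   by (intro lc_cong) (auto simp: b(4))
  also have "\<dots> = \<one>[A] **[A] w i0" by (rule X.lc_single[OF X.w_closed b(3)]) simp_all
  finally have wI: "w i0 \<in> I" using b(2) X.w_closed[OF b(3)] by simp
  have wS: "w i \<in> carrier A" if "i \<le> p" for i
  proof (cases "i = p")
   case True then show ?thesis using w_p aE.hom_closed[OF a_car] by simp
  qed (use X.w_closed that in simp)
  \<comment> \<open>\<open>w (p - i0)\<close> completes \<open>w i0\<close> to \<open>w p\<close>,
    which is multiplication by the unit \<open>a\<close>. For \<open>i0 = 0\<close> the first factor
    is \<open>w p\<close> itself, which is why \<open>wS\<close> includes
    \<open>i = p\<close>.\<close>
  have "w (p - i0) **[A] w i0 \<in> I" using I.I_l_closed[OF wI wS[of "p - i0"]] by simp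
  then have "opE a \<in> I" using b(3) w_add[of "p - i0" i0] w_p by (simp add: A)
  then have "opE (inv a) **[A] opE a \<in> I"
   using I.I_l_closed aE.hom_closed inv_e(3)[OF a_car a(2)] by blast
  then have "\<one>[A] \<in> I"
   using aE.hom_mult[OF inv_e(3)[OF a_car a(2)] a_car] inv_e(2)[OF a_car a(2)] aE.hom_one by simp
  then show "I = carrier A" using I.one_imp_carrier by simp
 qed
 show "opE \<in> ring_hom E A" "central_simple A ?F (p * p)" "w 1 \<in> carrier A" "mult A = mult R"
  by (fact hE CS X.w_closed[OF p1] A(2))+
 show "carrier A \<subseteq> carrier R" unfolding A(1) by (rule subringE(1)[OF Asub])
qed

end

text \<open>The cyclic algebra over \<open>L\<close> splits, with \<open>p * p = k * l\<close>. The
  field \<open>E\<close> acts on \<open>A e\<close> and on \<open>e A\<close>, so \<open>p\<close>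
  divides both factors and both equal \<open>p\<close>; hence \<open>A e = E e\<close>. Writing
  \<open>w e = b e\<close> and iterating, the \<open>p\<close>-th power of \<open>w\<close>, which
  is \<open>a\<close>, becomes the norm of \<open>b\<close>.\<close>

theorem (in maximal_center) norms_of_larger_fields:
 fixes E :: "('f, 'n) ring_scheme"
 assumes E: "cyclic_algebra E L sg p a y" and g: "g \<in> ring_hom Zr E"
  and gL: "g ` Z \<subseteq> L" "g ` Z ~= L" and fin: "ring.finite_dimension E (g ` Z) L"
 obtains b where "b \<in> carrier E" "a = nrm E sg b p"
proof -
 interpret C: cyclic_algebra E L sg p a y by (rule E)
 define A where "A = C.A"
 note A = C.A_central_simple[folded A_def]
 interpret A: central_simple A "C.opE ` L" "p * p" by (rule A(2))
 interpret aE: ring_hom_ring E A C.opE by (rule ring_hom_ringI2[OF C.E.ring_axioms A.ring_axioms A(1)])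
 interpret R: ring C.R by (rule C.R_ring)
 interpret Zr: field Zr by (rule Z_field)
 interpret g: ring_hom_ring Zr E g by (rule ring_hom_ringI2[OF Zr.ring_axioms C.E.ring_axioms g])
 let ?h = "%z. C.opE (g z)" and ?F = "C.opE ` L" and ?B = "C.opE ` carrier E"
 have hZ: "?h \<in> ring_hom Zr A"
  by (rule ring_hom_memI) (use g.hom_mult g.hom_add g.hom_one g.hom_closed in simp_all)
 have LE: "L \<subseteq> carrier E" using subfieldE(3)[OF C.L] .
 have hF: "?h ` Z \<subseteq> ?F" "?h ` Z ~= ?F"
 proof -
  show "?h ` Z \<subseteq> ?F" using gL by auto
  obtain x where x: "x \<in> L" "x \<notin> g ` Z" using gL by blast
  have "C.opE x \<notin> ?h ` Z"
  proof
   assume "C.opE x \<in> ?h ` Z"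
   then obtain z where z: "z \<in> Z" "C.opE x = C.opE (g z)" by blast
   have "g z \<in> carrier E" using z(1) gL LE by blast
   then have "x = g z" using inj_onD[OF C.opE_inj z(2)] x LE by blast
   then show False using x z by blast
  qed
  then show "?h ` Z ~= ?F" using x by blast
 qed
 have gZ: "subfield (g ` Z) E"
  using g.img_is_subfield(2)[OF Zr.carrier_is_subfield C.E.one_not_zero] by simp
 obtain n where "C.E.dimension n (g ` Z) L" using fin C.E.finite_dimension_def by blast
 then have "A.dimension n (C.opE ` (g ` Z)) ?F"
  by (rule aE.inj_hom_dimension[OF gZ A.one_neq_zero inj_on_subset[OF C.opE_inj LE]])
 then have finF: "A.finite_dimension (?h ` Z) ?F" using A.finite_dimensionI by (simp add: image_image)
 obtain e k l where e: "e \<in> carrier A" "e ~= \<zero>[A]" "e **[A] e = e"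
  and k: "A.dimension k ?F (A.Lid e)" and l: "A.dimension l ?F (A.Rid e)" and kl: "p * p = k * l"
  using split_idempotent[OF A(2) hZ hF finF] by metis
 have Bsub: "subring ?B A" using aE.img_is_subring[OF C.E.carrier_is_subring] .
 have dB: "A.dimension p ?F ?B"
  using aE.inj_hom_dimension[OF C.L A.one_neq_zero C.opE_inj C.dim] .
 have FB: "?F \<subseteq> ?B" using LE by blast
 have Binv: "\<exists>c\<in>?B. c **[A] b = \<one>[A] \<and> b **[A] c = \<one>[A]" if b: "b \<in> ?B" "b ~= \<zero>[A]" for b
 proof -
  obtain d where d: "d \<in> carrier E" "b = C.opE d" using b(1) by auto
  have "d ~= \<zero>[E]" using b(2) d(2) aE.hom_zero by metis
  then have "d \<in> Units E" using d(1) by (simp add: C.E.field_Units)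
  then have i: "inv[E] d \<in> carrier E" "d **[E] inv[E] d = \<one>[E]" "inv[E] d **[E] d = \<one>[E]" by auto
  show ?thesis
   using aE.hom_mult[OF i(1) d(1)] aE.hom_mult[OF d(1) i(1)] i aE.hom_one d(2)
   by (intro bexI[of _ "C.opE (inv[E] d)"]) auto
 qed
 have Bc: "b \<in> carrier A" if "b \<in> ?B" for b using that aE.hom_closed by blast
 have BL: "b **[A] x \<in> A.Lid e" if "b \<in> ?B" "x \<in> A.Lid e" for b x
  using A.subalgebraD(6)[OF A.Lid_subalgebra[OF e(1)] Bc[OF that(1)] that(2)] .
 have "p dvd k" by (rule A.skew_subring_left_dvd[OF A.base Bsub FB dB Binv k BL])
 moreover have "p dvd l"
 proof (rule A.skew_subring_right_dvd[OF A.base Bsub FB dB Binv A.central l])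
  show "w **[A] b \<in> A.Rid e" if b: "b \<in> ?B" "w \<in> A.Rid e" for b w
  proof -
   obtain x where x: "x \<in> carrier A" "w = e **[A] x" using b(2) unfolding A.Rid_def by blast
   have "w **[A] b = e **[A] (x **[A] b)" using x e Bc[OF b(1)] by (simp add: A.m_assoc)
   then show ?thesis unfolding A.Rid_def using x Bc[OF b(1)] by blast
  qed
 qed
 ultimately have kp: "k = p"
 proof -
  assume "p dvd k" "p dvd l"
  then obtain k' l' where "k = p * k'" "l = p * l'" by (auto elim!: dvdE)
  then have "(p * p) * (k' * l') = (p * p) * 1" using kl by (simp add: ac_simps)
  then have "k' * l' = 1" using C.p1 by (subst (asm) mult_cancel1) auto
  then show "k = p" using \<open>k = p * k'\<close> by simp
 qed
 have dBe: "A.dimension p ?F ((%b. b **[A] e) ` ?B)"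
 proof (rule A.dimension_linear_inj[OF A.base dB])
  show "b **[A] e \<in> carrier A" if "b \<in> ?B" for b using Bc[OF that] e by simp
  show "(u \<oplus>[A] v) **[A] e = u **[A] e \<oplus>[A] v **[A] e" if "u \<in> ?B" "v \<in> ?B" for u v
   using Bc[OF that(1)] Bc[OF that(2)] e by (simp add: A.l_distr)
  show "(z **[A] u) **[A] e = z **[A] (u **[A] e)" if "z \<in> ?F" "u \<in> ?B" for z u
  proof -
   have "z \<in> carrier A" using that(1) FB Bc by blast
   then show ?thesis using Bc[OF that(2)] e by (simp add: A.m_assoc)
  qed
  show "b = \<zero>[A]" if b: "b \<in> ?B" "b **[A] e = \<zero>[A]" for b
  proof (rule ccontr)
   assume "b ~= \<zero>[A]"
   then obtain c where c: "c \<in> ?B" "c **[A] b = \<one>[A]" using Binv b(1) by blast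
   have "c **[A] b **[A] e = \<zero>[A]" using b(2) Bc[OF c(1)] Bc[OF b(1)] e by (simp add: A.m_assoc)
   then show False using c e by simp
  qed
 qed
 have "(%b. b **[A] e) ` ?B \<subseteq> A.Lid e" using BL[OF _ A.Lid_self[OF e(1)]] by blast
 then have full: "(%b. b **[A] e) ` ?B = A.Lid e"
  using A.subspace_dimension[OF A.base _ A.finite_dimension_imp_subalgebra[OF A.base A.finite_dimensionI[OF dBe]]]
   A.dimension_is_inj[OF A.base dBe] k kp by metis
 have "C.w 1 **[A] e \<in> A.Lid e" unfolding A.Lid_def using A(3) by blast
 then obtain b where b: "b \<in> carrier E" "C.w 1 **[A] e = C.opE b **[A] e" unfolding full[symmetric] by blast
 have nb: "nrm E sg b i \<in> carrier E" for i by (induction i) (use b(1) ring_hom_closed[OF C.sg] in auto)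
 have eR: "e \<in> carrier C.R" using e A(5) by blast
 have oR: "C.opE x \<in> carrier C.R" if "x \<in> carrier E" for x using C.op_R(1) that .
 have wR: "C.w i \<in> carrier C.R" for i using C.op_R(2) .
 have we: "C.w i **[C.R] e = C.opE (nrm E sg b i) **[C.R] e" for i
 proof (induction i)
  case 0
  then show ?case using C.w_0 ring_hom_one[OF C.opE_hom] by simp
 next
  case (Suc i)
  let ?n = "nrm E sg b i"
  have s: "sg ?n \<in> carrier E" using nb ring_hom_closed[OF C.sg] by blast
  have "C.w (Suc i) **[C.R] e = C.w 1 **[C.R] (C.w i **[C.R] e)"
   using C.w_add[of 1 i] wR eR R.m_assoc[of "C.w 1" "C.w i" e] by simp
  also have "\<dots> = (C.w 1 **[C.R] C.opE ?n) **[C.R] e" unfolding Suc using wR oR nb eR by (simp add: R.m_assoc)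
  also have "\<dots> = C.opE (sg ?n) **[C.R] (C.w 1 **[C.R] e)"
   unfolding C.w_comm[OF nb] using wR oR[OF s] eR by (simp add: R.m_assoc)
  also have "\<dots> = C.opE (sg ?n) **[C.R] (C.opE b **[C.R] e)" using b(2) A(4) by simp
  also have "\<dots> = C.opE (nrm E sg b (Suc i)) **[C.R] e"
   using oR[OF s] oR[OF b(1)] eR ring_hom_mult[OF C.opE_hom s b(1)] by (simp add: R.m_assoc del: aE.hom_mult)
  finally show ?case .
 qed
 have "C.opE a **[A] e = C.opE (nrm E sg b p) **[A] e" using we[of p] C.w_p A(4) by simp
 moreover have "x = x'" if x: "x \<in> carrier E" "x' \<in> carrier E" "C.opE x **[A] e = C.opE x' **[A] e" for x x'
 proof (rule ccontr)
  let ?d = "x \<ominus>[E] x'"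
  assume "x ~= x'"
  then have "?d ~= \<zero>[E]" using x(1,2) by (simp add: C.E.r_right_minus_eq)
  then have "?d \<in> Units E" using x(1,2) by (simp add: C.E.field_Units)
  then have i: "inv[E] ?d \<in> carrier E" "inv[E] ?d **[E] ?d = \<one>[E]" by auto
  have d: "?d \<in> carrier E" using x by simp
  have z: "C.opE ?d **[A] e = \<zero>[A]" using x e by (simp add: C.E.minus_eq A.l_distr A.l_minus A.r_neg)
  have "C.opE (inv[E] ?d) **[A] (C.opE ?d **[A] e) = (C.opE (inv[E] ?d) **[A] C.opE ?d) **[A] e"
   by (rule A.m_assoc[symmetric]) (use i d e aE.hom_closed in auto)
  also have "\<dots> = e" unfolding aE.hom_mult[OF i(1) d, symmetric] i(2) using e by simp
  finally show False using z e(2) aE.hom_closed[OF i(1)] by simp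
 qed
 ultimately have "a = nrm E sg b p" using C.a_car nb by blast
 then show ?thesis using that b(1) by blast
qed

subsection \<open>Products of linear factors\<close>

definition pl :: "('a, 'm) ring_scheme => 'a list => 'a list" where
 "pl R ys = foldr (%y p. [\<one>[R], \<ominus>[R] y] **[poly_ring R] p) ys [\<one>[R]]"

lemma pl_simps: "pl R [] = [\<one>[R]]"
 "pl R (y # ys) = [\<one>[R], \<ominus>[R] y] **[poly_ring R] pl R ys"
 by (simp_all add: pl_def)

context field
begin

lemma linear_factor: "y \<in> carrier R ==> [\<one>, \<ominus> y] \<in> carrier (poly_ring R)"
 unfolding poly_carrier by simp

lemma poly_set: "p \<in> carrier (poly_ring R) ==> set p \<subseteq> carrier R"
 by (metis carrier_is_subring polynomial_in_carrier univ_poly_carrier)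

lemma monic_mult:
 assumes "p \<in> carrier (poly_ring R)" "q \<in> carrier (poly_ring R)" "p ~= []" "q ~= []"
 shows "p **[poly_ring R] q ~= []"
  "lead_coeff (p **[poly_ring R] q) = lead_coeff p ** lead_coeff q"
  "degree (p **[poly_ring R] q) = degree p + degree q"
proof -
 note pq = assms(1,2)[unfolded univ_poly_carrier[symmetric]]
 show "p **[poly_ring R] q ~= []"
  using poly_mult_integral[OF carrier_is_subring pq] assms by (auto simp: univ_poly_mult)
 show "lead_coeff (p **[poly_ring R] q) = lead_coeff p ** lead_coeff q"
  using poly_mult_lead_coeff[OF carrier_is_subring pq] assms by (simp add: univ_poly_mult)
 show "degree (p **[poly_ring R] q) = degree p + degree q"
  using poly_mult_degree_eq[OF carrier_is_subring pq] assms by (simp add: univ_poly_mult)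
qed

lemma poly_ring_cring: "cring (poly_ring R)"
 using univ_poly_is_domain[OF carrier_is_subring] by (simp add: domain_def)

lemma pl_closed:
 assumes "set ys \<subseteq> carrier R"
 shows "pl R ys \<in> carrier (poly_ring R)" "pl R ys ~= []" "lead_coeff (pl R ys) = \<one>"
  "degree (pl R ys) = length ys"
proof -
 have "pl R ys \<in> carrier (poly_ring R) \<and> pl R ys ~= [] \<and> lead_coeff (pl R ys) = \<one> \<and>
  degree (pl R ys) = length ys"
  using assms
 proof (induction ys)
  case Nil
  then show ?case unfolding pl_simps poly_carrier by simp
 next
  case (Cons y ys)
  have y: "y \<in> carrier R" using Cons(2) by simp
  interpret P: cring "poly_ring R" by (rule poly_ring_cring)
  note IH = Cons(1)[OF order_trans[OF set_subset_Cons Cons(2)]]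
  show ?case
   unfolding pl_simps(2) using IH monic_mult[OF linear_factor[OF y], of "pl R ys"] linear_factor[OF y]
   by simp
 qed
 then show "pl R ys \<in> carrier (poly_ring R)" "pl R ys ~= []" "lead_coeff (pl R ys) = \<one>"
  "degree (pl R ys) = length ys" by auto
qed

lemma eval_mult:
 assumes "p \<in> carrier (poly_ring R)" "q \<in> carrier (poly_ring R)" "x \<in> carrier R"
 shows "eval (p **[poly_ring R] q) x = eval p x ** eval q x"
 using eval_poly_mult[OF poly_set[OF assms(1)] poly_set[OF assms(2)] assms(3)] by (simp add: univ_poly_mult)

lemma pl_eval_zero:
 assumes "set ys \<subseteq> carrier R" "x \<in> carrier R"
 shows "eval (pl R ys) x = \<zero> \<longleftrightarrow> x \<in> set ys"
 using assms(1)
proof (induction ys)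
 case Nil
 then show ?case using assms(2) by (simp add: pl_simps)
next
 case (Cons y ys)
 have y: "y \<in> carrier R" "set ys \<subseteq> carrier R" using Cons(2) by auto
 have "eval [\<one>, \<ominus> y] x = x \<ominus> y" using y assms(2) by (simp add: minus_eq)
 then have "eval (pl R (y # ys)) x = (x \<ominus> y) ** eval (pl R ys) x"
  unfolding pl_simps using eval_mult[OF linear_factor[OF y(1)] pl_closed(1)[OF y(2)] assms(2)] by simp
 moreover have "eval (pl R ys) x \<in> carrier R"
  using eval_in_carrier[OF poly_set[OF pl_closed(1)[OF y(2)]] assms(2)] .
 moreover have "x \<ominus> y = \<zero> \<longleftrightarrow> x = y" using y assms(2) by (simp add: r_right_minus_eq)
 ultimately show ?case using Cons(1)[OF y(2)] integral_iff[of "x \<ominus> y" "eval (pl R ys) x"] y assms(2) by auto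
qed

lemma const_term_pl:
 assumes "set ys \<subseteq> carrier R"
 shows "const_term (pl R ys) = foldr (%y c. \<ominus> y ** c) ys \<one>"
 using assms
proof (induction ys)
 case (Cons y ys)
 have y: "y \<in> carrier R" "set ys \<subseteq> carrier R" using Cons(2) by auto
 show ?case
  using Cons(1)[OF y(2)] eval_mult[OF linear_factor[OF y(1)] pl_closed(1)[OF y(2)] zero_closed] y(1)
  by (simp add: pl_simps const_term_def)
qed (simp add: pl_simps const_term_def)

lemma pl_append:
 assumes "set xs \<subseteq> carrier R" "set ys \<subseteq> carrier R"
 shows "pl R (xs @ ys) = pl R xs **[poly_ring R] pl R ys"
proof -
 interpret P: cring "poly_ring R" by (rule poly_ring_cring)
 show ?thesis
  using assms(1)
 proof (induction xs)
  case Nil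
  then show ?case using pl_closed(1)[OF assms(2)] univ_poly_one[of R "carrier R"] by (metis P.l_one append_Nil pl_simps(1))
 next
  case (Cons x xs)
  then show ?case
   using pl_closed(1)[OF assms(2)] pl_closed(1)[of xs] linear_factor[of x] by (simp add: pl_simps P.m_assoc)
 qed
qed

lemma pl_mset:
 assumes "mset xs = mset ys" "set xs \<subseteq> carrier R"
 shows "pl R xs = pl R ys"
 using assms
proof (induction xs arbitrary: ys)
 case (Cons x xs)
 interpret P: cring "poly_ring R" by (rule poly_ring_cring)
 have "x \<in> set ys" using Cons(2) by (metis list.set_intros(1) set_mset_mset)
 then obtain as bs where ys: "ys = as @ x # bs" by (meson split_list)
 have sub: "set as \<subseteq> carrier R" "set bs \<subseteq> carrier R" "x \<in> carrier R"
  using Cons(2,3) ys by (metis Un_subset_iff mset_eq_setD set_append set_subset_Cons subset_trans,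
   metis Un_subset_iff mset_eq_setD set_append set_subset_Cons subset_trans, simp)
 have "mset xs = mset (as @ bs)" using Cons(2) ys by simp
 then have "pl R xs = pl R (as @ bs)" using Cons(1)[of "as @ bs"] Cons(3) by simp
 then show ?case
  unfolding ys pl_append[OF sub(1), of "x # bs"]
  using sub pl_append[OF sub(1,2)] pl_append[OF sub(1), of "x # bs"] pl_closed(1)[OF sub(1)] pl_closed(1)[OF sub(2)]
   linear_factor[OF sub(3)] by (simp add: pl_simps P.m_ac)
qed simp

lemma degree_mono_factor:
 assumes "p = q **[poly_ring R] s" "q \<in> carrier (poly_ring R)" "s \<in> carrier (poly_ring R)"
  "p ~= []" "lead_coeff p = \<one>" "lead_coeff q = \<one>"
 shows "s ~= []" "lead_coeff s = \<one>" "degree p = degree q + degree s" "q ~= []"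
proof -
 interpret P: cring "poly_ring R" by (rule poly_ring_cring)
 show s: "s ~= []" using assms P.r_null[OF assms(2)] by (auto simp: univ_poly_zero)
 show q: "q ~= []" using assms P.l_null[OF assms(3)] by (auto simp: univ_poly_zero)
 show "degree p = degree q + degree s" unfolding assms(1) by (rule monic_mult(3)[OF assms(2,3) q s])
 have "lead_coeff s \<in> carrier R" using poly_set[OF assms(3)] s by (meson hd_in_set subsetD)
 then show "lead_coeff s = \<one>" using monic_mult(2)[OF assms(2,3) q s] assms by simp
qed

end

lemma (in algebraically_closed) exists_pl:
 assumes "p \<in> carrier (poly_ring L)" "p ~= []" "lead_coeff p = \<one>"
 shows "\<exists>ys. set ys \<subseteq> carrier L \<and> p = pl L ys"
 using assms
proof (induction "degree p" arbitrary: p)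
 case 0
 then have "p = [\<one>]" by (cases p) auto
 then show ?case by (intro exI[of _ "[]"]) (simp add: pl_simps)
next
 case (Suc n)
 have "roots p ~= {#}" using roots_over_carrier[OF Suc(3)] Suc(2) unfolding splitted_def by auto
 then obtain a where a: "a \<in> carrier L" "[\<one>, \<ominus> a] pdivides p" using not_empty_rootsE[OF Suc(3)] by metis
 then obtain q where q: "p = [\<one>, \<ominus> a] **[poly_ring L] q" "q \<in> carrier (poly_ring L)"
  unfolding pdivides_def factor_def by blast
 have c: "q ~= []" "lead_coeff q = \<one>" "degree p = 1 + degree q"
  using degree_mono_factor[OF q(1) linear_factor[OF a(1)] q(2) Suc(4,5)] by auto
 obtain ys where "set ys \<subseteq> carrier L" "q = pl L ys" using Suc(1)[OF _ q(2) c(1,2)] c(3) Suc(2)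
  by (metis add_left_cancel plus_1_eq_Suc)
 then show ?case using a q by (intro exI[of _ "a # ys"]) (simp add: pl_simps)
qed

lemma map_pl:
 assumes h: "h \<in> ring_hom R S" and R: "field R" and S: "field S" and ys: "set ys \<subseteq> carrier R"
 shows "map h (pl R ys) = pl S (map h ys)"
proof -
 interpret R: field R by (rule R)
 interpret S: field S by (rule S)
 interpret h: ring_hom_ring R S h by (rule ring_hom_ringI2[OF R.ring_axioms S.ring_axioms h])
 show ?thesis
  using ys
 proof (induction ys)
  case (Cons y ys)
  have y: "y \<in> carrier R" "set ys \<subseteq> carrier R" using Cons(2) by auto
  note f = R.linear_factor[OF y(1)] and c = R.pl_closed(1)[OF y(2)]
  interpret P: cring "poly_ring R" by (rule R.poly_ring_cring)
  have "map h (pl R (y # ys)) = S.normalize (map h (pl R (y # ys)))"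
   using polynomial_hom[OF h R S P.m_closed[OF f c]] S.normalize_polynomial
   by (metis pl_simps(2) univ_poly_carrier)
  also have "\<dots> = S.poly_mult (map h [\<one>[R], \<ominus>[R] y]) (map h (pl R ys))"
   unfolding pl_simps univ_poly_mult by (rule h.poly_mult_hom') (use f c R.poly_set in auto)
  finally show ?case using Cons(1)[OF y(2)] y by (simp add: pl_simps univ_poly_mult)
 qed (simp add: pl_simps)
qed

text \<open>Evaluation at \<open>t\<close> is multiplicative in a noncommutative ring when \<open>t\<close> commutes with the
 coefficients: everything happens in the bicommutant of these elements.\<close>

lemma (in ring) eval_mult_commuting:
 assumes h: "h \<in> ring_hom F R" and F: "field F" and t: "t \<in> carrier R"
  and comm: "!!x. x \<in> carrier F ==> t ** h x = h x ** t"
  and pq: "p \<in> carrier (poly_ring F)" "q \<in> carrier (poly_ring F)"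
 shows "eval (map h (p **[poly_ring F] q)) t = eval (map h p) t ** eval (map h q) t"
proof -
 interpret F: field F by (rule F)
 define S where "S = insert t (h ` carrier F)"
 define C1 where "C1 = {x \<in> carrier R. \<forall>s\<in>S. x ** s = s ** x}"
 define C where "C = {x \<in> carrier R. \<forall>s\<in>C1. x ** s = s ** x}"
 have hc: "h x \<in> carrier R" if "x \<in> carrier F" for x using ring_hom_closed[OF h that] .
 have hcomm: "h x ** h y = h y ** h x" if "x \<in> carrier F" "y \<in> carrier F" for x y
  using ring_hom_mult[OF h that] ring_hom_mult[OF h that(2,1)] F.m_comm[OF that] by simp
 have S: "S \<subseteq> carrier R" using t hc by (auto simp: S_def)
 have SC1: "S \<subseteq> C1"
 proof
  fix x assume x: "x \<in> S"
  have "x ** s = s ** x" if s: "s \<in> S" for s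
   using x s comm hcomm unfolding S_def by fastforce
  then show "x \<in> C1" using S x by (auto simp: C1_def)
 qed
 have C1: "C1 \<subseteq> carrier R" by (auto simp: C1_def)
 have SC: "S \<subseteq> C" using S by (auto simp: C_def C1_def)
 \<comment> \<open>As the generators commute with each other, they lie in their own commutant; so
   the bicommutant lies in the commutant and is commutative.\<close>
 have CC1: "C \<subseteq> C1" using SC1 by (auto simp: C_def C1_def)
 have Csub: "subring C R" unfolding C_def by (rule centralizer_subring[OF C1])
 interpret C: ring "R(|carrier := C|)" by (rule subring_is_ring[OF Csub])
 have Ccr: "cring (R(|carrier := C|))"
  by (intro cring.intro comm_monoid.intro comm_monoid_axioms.intro C.ring_axioms C.monoid_axioms)
   (use CC1 in "auto simp: C_def")
 interpret C: cring "R(|carrier := C|)" by (rule Ccr)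
 have hC: "h \<in> ring_hom F (R(|carrier := C|))"
  using h SC unfolding ring_hom_def S_def by auto
 interpret h: ring_hom_ring F "R(|carrier := C|)" h
  by (rule ring_hom_ringI2[OF F.ring_axioms C.ring_axioms hC])
 have tC: "t \<in> carrier (R(|carrier := C|))" using SC by (simp add: S_def)
 note sp = F.poly_set[OF pq(1)] F.poly_set[OF pq(2)]
 have sm: "set (map h u) \<subseteq> carrier (R(|carrier := C|))" if "set u \<subseteq> carrier F" for u
  using that h.hom_closed by auto
 have mp: "set (F.poly_mult p q) \<subseteq> carrier F" using F.poly_mult_in_carrier[OF sp] .
 have "C.eval (map h (F.poly_mult p q)) t = C.eval (C.normalize (map h (F.poly_mult p q))) t"
  using C.eval_normalize[OF sm[OF mp] tC] by simp
 also have "\<dots> = C.eval (C.poly_mult (map h p) (map h q)) t" unfolding h.poly_mult_hom'[OF sp] ..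
 also have "\<dots> = C.eval (map h p) t ** C.eval (map h q) t"
  using C.eval_poly_mult[OF sm[OF sp(1)] sm[OF sp(2)] tC] by simp
 finally show ?thesis unfolding eval_consistent[OF Csub] univ_poly_mult .
qed

text \<open>Turns a split polynomial at \<open>t\<close> into a product of factors
  \<open>t - h y\<close>. In operator rings this leads from an annihilating polynomial to an
  eigenvector.\<close>

lemma (in ring) eval_pl_commuting:
 assumes h: "h \<in> ring_hom F R" and F: "field F" and t: "t \<in> carrier R"
  and comm: "!!x. x \<in> carrier F ==> t ** h x = h x ** t" and ys: "set ys \<subseteq> carrier F"
 shows "eval (map h (pl F ys)) t = foldr (%y a. (t \<ominus> h y) ** a) ys \<one>"
 using ys
proof (induction ys)
 case Nil
 then show ?case using ring_hom_one[OF h] t by (simp add: pl_simps)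
next
 case (Cons y ys)
 interpret F: field F by (rule F)
 interpret h: ring_hom_ring F R h by (rule ring_hom_ringI2[OF F.ring_axioms ring_axioms h])
 have y: "y \<in> carrier F" "set ys \<subseteq> carrier F" using Cons(2) by auto
 have "eval (map h [\<one>[F], \<ominus>[F] y]) t = t \<ominus> h y" using t y by (simp add: minus_eq)
 moreover have "eval (map h (pl F (y # ys))) t
   = eval (map h [\<one>[F], \<ominus>[F] y]) t ** eval (map h (pl F ys)) t"
  unfolding pl_simps
  by (rule eval_mult_commuting[OF h F t comm F.linear_factor[OF y(1)] F.pl_closed(1)[OF y(2)]])
 ultimately show ?case using Cons(1)[OF y(2)] by (simp del: eval.simps list.map)
qed

context field
begin

lemma coeff_linear_factor_mult:
 assumes "y \<in> carrier R" "p \<in> carrier (poly_ring R)"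
 shows "coeff ([\<one>, \<ominus> y] **[poly_ring R] p) i =
  (if i = 0 then \<zero> else coeff p (i - 1)) \<ominus> y ** coeff p i"
proof -
 note p = poly_set[OF assms(2)]
 have 1: "set (map (%b. \<one> ** b) p @ [\<zero>]) \<subseteq> carrier R" "set (map (%b. \<ominus> y ** b) p) \<subseteq> carrier R"
  using p assms(1) by auto
 have m1: "map (%b. \<one> ** b) p = p" using p by (intro map_idI) auto
 have 2: "poly_mult [\<ominus> y] p = poly_add (map (%b. \<ominus> y ** b) p) []" by simp
 have c2: "coeff (poly_mult [\<ominus> y] p) i = \<ominus> y ** coeff p i"
  unfolding 2 using poly_add_coeff[OF 1(2), of "[]"] scalar_coeff[of "\<ominus> y" p] assms(1) p
  by (simp add: coeff_in_carrier)
 have s2: "set (poly_mult [\<ominus> y] p) \<subseteq> carrier R" by (rule poly_mult_in_carrier) (use assms p in auto)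
 have "coeff (poly_mult [\<one>, \<ominus> y] p) i = coeff (p @ [\<zero>]) i \<oplus> coeff (poly_mult [\<ominus> y] p) i"
  using poly_add_coeff[OF 1(1) s2] m1 by simp
 moreover have "coeff (p @ [\<zero>]) i = (if i = 0 then \<zero> else coeff p (i - 1))"
  using append_coeff[of p "[\<zero>]"] by (cases i) auto
 ultimately show ?thesis
  unfolding univ_poly_mult c2 using assms p by (simp add: minus_eq l_minus)
qed

text \<open>The binomial theorem, stated for the coefficients of \<open>(X - x)^n\<close>. It serves
  the Frobenius map as well as minimal polynomials with a single root.\<close>

lemma coeff_power_linear:
 assumes x: "x \<in> carrier R"
 shows "i \<le> n ==> coeff (pl R (replicate n x)) i = add_pow R (n choose i) ((\<ominus> x) [^] (n - i))"
proof (induction n arbitrary: i)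
 case 0
 then show ?case by (simp add: pl_simps)
next
 case (Suc n)
 let ?p = "pl R (replicate n x)"
 have sub: "set (replicate n x) \<subseteq> carrier R" using x by auto
 note p = pl_closed[OF sub]
 have hi: "coeff ?p i = \<zero>" if "i > n" for i using coeff_degree[of ?p i] p(4) that by simp
 have c: "coeff (pl R (replicate (Suc n) x)) i =
  (if i = 0 then \<zero> else coeff ?p (i - 1)) \<ominus> x ** coeff ?p i"
  using coeff_linear_factor_mult[OF x p(1)] by (simp add: pl_simps)
 show ?case
 proof (cases i)
  case 0
  then show ?thesis using c Suc(1)[of 0] x
   by (simp add: minus_eq l_minus[symmetric] m_comm)
 next
  case (Suc j)
  show ?thesis
  proof (cases "i \<le> n")
   case True
   have "\<ominus> x ** (add_pow R (n choose i) ((\<ominus> x) [^] (n - i))) = add_pow R (n choose i) ((\<ominus> x) [^] (n - j))"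
   proof -
    have "n - j = Suc (n - i)" using Suc True by simp
    then show ?thesis using x add_pow_rdistr[of "\<ominus> x" "(\<ominus> x) [^] (n - i)" "n choose i"] by (simp add: m_comm)
   qed
   then have "coeff (pl R (replicate (Suc n) x)) i =
    add_pow R (n choose j) ((\<ominus> x) [^] (n - j)) \<oplus> add_pow R (n choose i) ((\<ominus> x) [^] (n - j))"
    using c Suc True \<open>!!i. i \<le> n ==> coeff ?p i = _ i\<close> x by (simp add: minus_eq l_minus)
   then show ?thesis using Suc x by (simp add: add.nat_pow_mult)
  next
   case False
   then have "i = Suc n" using \<open>i \<le> Suc n\<close> by simp
   then show ?thesis using c hi[of "Suc n"] \<open>!!i. i \<le> n ==> coeff ?p i = _ i\<close>[of n] x by (simp add: minus_eq)
  qed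
 qed
qed

lemma eval_lc:
 assumes "set p \<subseteq> carrier R" "x \<in> carrier R"
 shows "eval p x = lc R (%i. x [^] i) (coeff p) (length p)"
 using assms(1)
proof (induction p)
 case (Cons c cs)
 have "lc R (%i. x [^] i) (coeff (c # cs)) (length cs) = lc R (%i. x [^] i) (coeff cs) (length cs)"
  by (rule lc_cong) auto
 then show ?case using Cons assms(2) eval_in_carrier[of cs x] by (simp add: a_comm)
qed simp

lemma eval_pl_replicate:
 assumes "x \<in> carrier R" "y \<in> carrier R"
 shows "eval (pl R (replicate n x)) y = (y \<ominus> x) [^] n"
proof (induction n)
 case (Suc n)
 have sub: "set (replicate n x) \<subseteq> carrier R" using assms by auto
 have "eval [\<one>, \<ominus> x] y = y \<ominus> x" using assms by (simp add: minus_eq)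
 then show ?case
  using Suc eval_mult[OF linear_factor[OF assms(1)] pl_closed(1)[OF sub] assms(2)] assms
  by (simp add: pl_simps m_comm del: eval.simps)
qed (use assms in "simp add: pl_simps")

text \<open>\<open>(X + y)^l\<close> is evaluated at \<open>x\<close>; the inner binomial
  coefficients are multiples of \<open>l\<close>.\<close>

lemma frobenius_add:
 fixes l :: nat
 assumes l: "prime l" "add_pow R l \<one> = \<zero>" and x: "x \<in> carrier R" "y \<in> carrier R"
 shows "(x \<oplus> y) [^] l = x [^] l \<oplus> y [^] l"
proof -
 have ch: "add_pow R m z = \<zero>" if "l dvd m" "z \<in> carrier R" for m z
 proof -
  obtain t where t: "m = l * t" using \<open>l dvd m\<close> by blast
  have "add_pow R m z = add_pow R t (add_pow R l z)" using that(2) using add.nat_pow_pow[of z t l] by (simp add: t mult.commute)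
  also have "add_pow R l z = \<zero>" using add_pow_ldistr[of \<one> z l] l(2) that(2) by simp
  finally show ?thesis by simp
 qed
 have l0: "l > 0" using l(1) prime_gt_0_nat by blast
 let ?p = "pl R (replicate l (\<ominus> y))"
 have sub: "set (replicate l (\<ominus> y)) \<subseteq> carrier R" using x by auto
 have len: "length ?p = Suc l" using pl_closed(2,4)[OF sub] by (metis Suc_pred' length_greater_0_conv length_replicate)
 have c: "coeff ?p i = (if i = 0 then y [^] l else if i = l then \<one> else \<zero>)" if "i \<le> l" for i
 proof -
  have "i = 0 \<or> i = l \<or> l dvd (l choose i)"
   using that dvd_choose_prime[of i l] l(1) by force
  then show ?thesis using coeff_power_linear[of "\<ominus> y" i l] that x l0 ch by auto
 qed
 have mid: "lc R (%i. x [^] i) (coeff ?p) m = y [^] l" if "0 < m" "m \<le> l" for m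
  using that
 proof (induction m)
  case (Suc m)
  then show ?case using c[of m] x by (cases "m = 0") auto
 qed simp
 have "eval ?p x = y [^] l \<oplus> x [^] l"
  using eval_lc[OF poly_set[OF pl_closed(1)[OF sub]] x(1)] mid[of l] c[of l] x l0 unfolding len by simp
 moreover have "x \<ominus> (\<ominus> y) = x \<oplus> y" using x by (simp add: minus_eq)
 ultimately show ?thesis using eval_pl_replicate[of "\<ominus> y" x l] x by (simp add: a_comm)
qed

lemma frobenius_hom:
 fixes l :: nat
 assumes l: "prime l" "add_pow R l \<one> = \<zero>"
 shows "(%x. x [^] l) \<in> ring_hom R R"
 by (rule ring_hom_memI) (simp_all add: frobenius_add[OF l] nat_pow_distrib)

lemma frobenius_inj:
 fixes l :: nat
 assumes l: "prime l" "add_pow R l \<one> = \<zero>" and x: "x \<in> carrier R" "y \<in> carrier R" "x [^] l = y [^] l"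
 shows "x = y"
 using non_trivial_field_hom_is_inj[OF frobenius_hom[OF l] field_axioms field_axioms] x
 unfolding inj_on_def by blast

end

subsection \<open>Finite extensions inside an algebraic closure\<close>

context algebraic_closure
begin

definition between :: "'a set => bool" where
 "between E \<longleftrightarrow> subfield E L \<and> K \<subseteq> E"

abbreviation sub where "sub E \<equiv> L(|carrier := E|)"

lemma K_sub: "subfield K L" by (rule subfield_axioms)

lemma betweenD:
 assumes "between E"
 shows "subfield E L" "K \<subseteq> E" "subring E L" "E \<subseteq> carrier L" "x \<in> E ==> x \<in> carrier L" "field (sub E)"
 using assms subfieldE(1,3)[of E L] subfieldE(3)[of E L, THEN subsetD] subfield_iff(2)[of E]
 unfolding between_def by auto

lemmas betweenE = subringE[OF betweenD(3)]

lemma between_K: "between K" using K_sub by (simp add: between_def)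
lemma between_L: "between (carrier L)"
 using K_sub carrier_is_subfield subfieldE(3) by (simp add: between_def)

lemma between_alg: "between E ==> x \<in> carrier L ==> (algebraic over E) x"
 using algebraic_mono[OF betweenD(2)] algebraic_extension by blast

lemma between_simple:
 assumes "between E" "x \<in> carrier L"
 shows "between (simple_extension E x)" "E \<subseteq> simple_extension E x" "x \<in> simple_extension E x"
  "dimension (degree (Irr E x)) E (simple_extension E x)"
proof -
 note E = betweenD[OF assms(1)]
 note alg = between_alg[OF assms]
 show 1: "E \<subseteq> simple_extension E x" using simple_extension_incl[OF E(4) assms(2)] .
 show "x \<in> simple_extension E x" using simple_extension_mem[OF E(3) assms(2)] .
 show "between (simple_extension E x)"
  using simple_extension_is_subfield[OF E(1) assms(2)] alg 1 E(2) unfolding between_def by blast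
 show "dimension (degree (Irr E x)) E (simple_extension E x)"
  by (rule dimension_simple_extension[OF E(1) assms(2) alg])
qed

lemma simple_extension_least:
 "between E ==> between F ==> E \<subseteq> F ==> x \<in> F ==> simple_extension E x \<subseteq> F"
 using simple_extension_subring_incl[OF betweenD(3)] by blast

lemma poly_sub_mono:
 "E \<subseteq> F ==> p \<in> carrier (E[X][L]) ==> p \<in> carrier (F[X][L])"
 unfolding poly_carrier by auto

lemma poly_coeffs: "p \<in> carrier (E[X][L]) ==> set p \<subseteq> E"
 unfolding poly_carrier by auto

lemma Irr_props:
 assumes "between E" "x \<in> carrier L"
 shows "Irr E x \<in> carrier (E[X][L])" "lead_coeff (Irr E x) = \<one>" "eval (Irr E x) x = \<zero>"
  "Irr E x ~= []" "Irr E x \<in> carrier (poly_ring L)" "degree (Irr E x) > 0"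
  "x \<notin> E ==> degree (Irr E x) > 1" "x \<in> E ==> degree (Irr E x) = 1"
proof -
 note E = betweenD[OF assms(1)]
 note I = IrrE[OF E(1) assms(2) between_alg[OF assms]]
 show 1: "Irr E x \<in> carrier (E[X][L])" "lead_coeff (Irr E x) = \<one>" "eval (Irr E x) x = \<zero>"
  using I by auto
 show ne: "Irr E x ~= []" using pirreducibleE(1)[OF E(3) I(1,2)] by simp
 show pL: "Irr E x \<in> carrier (poly_ring L)" by (rule poly_sub_mono[OF E(4) I(1)])
 show d0: "degree (Irr E x) > 0"
 proof (rule ccontr)
  assume "\<not> ?thesis"
  then have "Irr E x = [\<one>]" using ne 1(2) by (cases "Irr E x") auto
  then show False using 1(3) assms(2) by simp
 qed
 note d = between_simple[OF assms]
 have "x \<in> E" if "degree (Irr E x) = 1"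
 proof -
  have "simple_extension E x = E"
   using d(4) that dimension_one[OF E(1)] subspace_dimension[OF E(1) d(4) _ d(2)]
   by (metis dimension_is_inj[OF E(1)] finite_dimensionI finite_dimension_imp_subalgebra[OF E(1)])
  then show ?thesis using d(3) by simp
 qed
 then show "x \<notin> E ==> degree (Irr E x) > 1" using d0 by (cases "degree (Irr E x) = 1") auto
 show "degree (Irr E x) = 1" if "x \<in> E"
 proof -
  have "simple_extension E x = E"
   using simple_extension_least[OF assms(1,1) order_refl that] d(2) by blast
  then show ?thesis using d(4) dimension_one[OF E(1)] dimension_is_inj[OF E(1)] by metis
 qed
qed

lemma Irr_dvd:
 assumes "between E" "x \<in> carrier L" "p \<in> carrier (E[X][L])" "eval p x = \<zero>"
 obtains q where "q \<in> carrier (E[X][L])" "p = Irr E x **[poly_ring L] q"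
proof -
 note E = betweenD[OF assms(1)]
 note I = Irr_props[OF assms(1,2)]
 have "Irr E x pdivides p" by (rule Irr_minimal[OF E(1) assms(2) between_alg[OF assms(1,2)] assms(3,4)])
 then have "Irr E x divides[E[X][L]] p" unfolding pdivides_iff_shell[OF E(1) I(1) assms(3)] .
 then show ?thesis using that unfolding factor_def univ_poly_mult by blast
qed

lemma Irr_degree_le:
 assumes "between E" "x \<in> carrier L" "p \<in> carrier (E[X][L])" "eval p x = \<zero>" "p ~= []"
 shows "degree (Irr E x) \<le> degree p"
proof -
 note E = betweenD[OF assms(1)]
 note I = Irr_props[OF assms(1,2)]
 obtain q where q: "q \<in> carrier (E[X][L])" "p = Irr E x **[poly_ring L] q"
  using Irr_dvd[OF assms(1-4)] .
 interpret P: cring "poly_ring L" by (rule poly_ring_cring)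
 have q1: "q \<in> carrier (poly_ring L)" by (rule poly_sub_mono[OF E(4) q(1)])
 have "q ~= []" using q(2) assms(5) P.r_null[OF I(5)] by (auto simp: univ_poly_zero)
 then show ?thesis using monic_mult(3)[OF I(5) q1 I(4)] q(2) by simp
qed

text \<open>Sending \<open>p(x)\<close> to \<open>(h p)(x')\<close> is well defined when \<open>x'\<close> is a root of the image of the minimal
 polynomial.\<close>

theorem extend_hom:
 assumes E: "between E" and h: "h \<in> ring_hom (sub E) L" and x: "x \<in> carrier L" "x' \<in> carrier L"
  and root: "eval (map h (Irr E x)) x' = \<zero>"
 shows "\<exists>h'\<in>ring_hom (sub (simple_extension E x)) L. (\<forall>e\<in>E. h' e = h e) \<and> h' x = x'"
proof -
 note Ep = betweenD[OF E]
 interpret Er: field "sub E" by (rule Ep(6))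
 interpret h: ring_hom_ring "sub E" L h by (rule ring_hom_ringI2[OF Er.ring_axioms ring_axioms h])
 have PE: "univ_poly (sub E) = univ_poly L" by (rule univ_poly_consistent[OF Ep(3)])
 have EX: "poly_ring (sub E) = E[X][L]" using PE by simp
 interpret P: domain "E[X][L]" by (rule univ_poly_is_domain[OF Ep(3)])
 let ?Phi = "%p. eval (map h p) x'" and ?Psi = "%p. eval p x"
 have sh: "set (map h p) \<subseteq> carrier L" if "p \<in> carrier (E[X][L])" for p
  using poly_coeffs[OF that] h.hom_closed by auto
 have Psi: "?Psi \<in> ring_hom (E[X][L]) L" by (rule eval_is_hom[OF Ep(3) x(1)])
 have Phi: "?Phi \<in> ring_hom (E[X][L]) L"
 proof (rule ring_hom_memI)
  show "?Phi p \<in> carrier L" if "p \<in> carrier (E[X][L])" for p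
   by (rule eval_in_carrier[OF sh[OF that] x(2)])
  fix p q assume pq: "p \<in> carrier (E[X][L])" "q \<in> carrier (E[X][L])"
  show "?Phi (p **[E[X][L]] q) = ?Phi p ** ?Phi q"
   using eval_mult_commuting[OF h Ep(6) x(2), of p q] pq m_comm[OF x(2)] h.hom_closed
   unfolding EX by blast
  have a: "set (poly_add p q) \<subseteq> E"
   using poly_coeffs[OF P.a_closed[OF pq]] by (simp add: univ_poly_add)
  then have b: "set (map h (poly_add p q)) \<subseteq> carrier L" using h.hom_closed by auto
  have "?Phi (p \<oplus>[E[X][L]] q) = eval (normalize (map h (poly_add p q))) x'"
   unfolding univ_poly_add using eval_normalize[OF b x(2)] by simp
  also have "\<dots> = eval (poly_add (map h p) (map h q)) x'"
   using h.poly_add_hom'[of p q] poly_coeffs[OF pq(1)] poly_coeffs[OF pq(2)]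
   unfolding poly_add_consistent[OF Ep(3)] by simp
  also have "\<dots> = ?Phi p \<oplus> ?Phi q" by (rule eval_poly_add[OF sh[OF pq(1)] sh[OF pq(2)] x(2)])
  finally show "?Phi (p \<oplus>[E[X][L]] q) = ?Phi p \<oplus> ?Phi q" .
 next
  show "?Phi \<one>[E[X][L]] = \<one>" using h.hom_one x(2) by (simp add: univ_poly_one)
 qed
 interpret Psi: ring_hom_ring "E[X][L]" L ?Psi by (rule ring_hom_ringI2[OF P.ring_axioms ring_axioms Psi])
 interpret Phi: ring_hom_ring "E[X][L]" L ?Phi by (rule ring_hom_ringI2[OF P.ring_axioms ring_axioms Phi])
 have ker: "?Phi p = \<zero>" if p: "p \<in> carrier (E[X][L])" "?Psi p = \<zero>" for p
 proof -
  obtain q where q: "q \<in> carrier (E[X][L])" "p = Irr E x **[poly_ring L] q"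
   using Irr_dvd[OF E x(1) p] .
  have "?Phi p = ?Phi (Irr E x) ** ?Phi q"
   using Phi.hom_mult[OF Irr_props(1)[OF E x(1)] q(1)] q(2) by (simp add: univ_poly_mult)
  then show ?thesis using root Phi.hom_closed[OF q(1)] by simp
 qed
 have wd: "?Phi p = ?Phi q" if pq: "p \<in> carrier (E[X][L])" "q \<in> carrier (E[X][L])" "?Psi p = ?Psi q" for p q
 proof -
  have "?Psi (p \<ominus>[E[X][L]] q) = \<zero>"
   using pq Psi.hom_closed by (simp add: P.minus_eq r_neg)
  then have "?Phi (p \<ominus>[E[X][L]] q) = \<zero>" using ker pq by simp
  then have "?Phi p \<ominus> ?Phi q = \<zero>" using pq Phi.hom_closed by (simp add: P.minus_eq minus_eq)
  then show ?thesis using Phi.hom_closed[OF pq(1)] Phi.hom_closed[OF pq(2)] r_right_minus_eq by blast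
 qed
 let ?S = "simple_extension E x"
 have img: "?S = ?Psi ` carrier (E[X][L])" by (rule simple_extension_as_eval_img[OF Ep(4) x(1)])
 define pre where "pre u = (SOME p. p \<in> carrier (E[X][L]) \<and> ?Psi p = u)" for u
 have pre: "pre u \<in> carrier (E[X][L]) \<and> ?Psi (pre u) = u" if "u \<in> ?S" for u
 proof -
  obtain p where "u = ?Psi p" "p \<in> carrier (E[X][L])" using \<open>u \<in> ?S\<close> unfolding img by (rule imageE)
  then show ?thesis unfolding pre_def by (intro someI_ex[of "%p. p \<in> carrier (E[X][L]) \<and> ?Psi p = u"] exI[of _ p]) simp
 qed
 define h' where "h' u = ?Phi (pre u)" for u
 have h': "h' (?Psi p) = ?Phi p" if "p \<in> carrier (E[X][L])" for p
  unfolding h'_def by (rule wd) (use pre[of "?Psi p"] img that in auto)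
 have "h' \<in> ring_hom (sub ?S) L"
 proof (rule ring_hom_memI)
  show "h' u \<in> carrier L" if "u \<in> carrier (sub ?S)" for u
   unfolding h'_def using pre[of u] that Phi.hom_closed by simp
  fix u v assume uv: "u \<in> carrier (sub ?S)" "v \<in> carrier (sub ?S)"
  then obtain p q where p: "p \<in> carrier (E[X][L])" "u = ?Psi p" and q: "q \<in> carrier (E[X][L])" "v = ?Psi q"
   using img by auto
  show "h' (u **[sub ?S] v) = h' u ** h' v"
   using h'[OF P.m_closed[OF p(1) q(1)]] h'[OF p(1)] h'[OF q(1)] Psi.hom_mult[OF p(1) q(1)]
    Phi.hom_mult[OF p(1) q(1)] p(2) q(2) by simp
  show "h' (u \<oplus>[sub ?S] v) = h' u \<oplus> h' v"
   using h'[OF P.a_closed[OF p(1) q(1)]] h'[OF p(1)] h'[OF q(1)] Psi.hom_add[OF p(1) q(1)]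
    Phi.hom_add[OF p(1) q(1)] p(2) q(2) by simp
 next
  show "h' \<one>[sub ?S] = \<one>" using h'[OF P.one_closed] Psi.hom_one Phi.hom_one by simp
 qed
 moreover have "h' e = h e" if e: "e \<in> E" for e
 proof (cases "e = \<zero>")
  case True
  have "h \<zero> = \<zero>" using h.hom_zero by simp
  then show ?thesis using h'[OF P.zero_closed] True by (simp add: univ_poly_zero)
 next
  case False
  have "[e] \<in> carrier (E[X][L])" using e False unfolding poly_carrier by simp
  then show ?thesis using h'[of "[e]"] e Ep(5) h.hom_closed x by simp
 qed
 moreover have "h' x = x'"
 proof -
  have "[\<one>, \<zero>] \<in> carrier (E[X][L])"
   using subringE(2,3)[OF Ep(3)] unfolding poly_carrier by simp
  moreover have "h \<zero> = \<zero>" "h \<one> = \<one>" using h.hom_zero h.hom_one by simp_all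
  ultimately show ?thesis using h'[of "[\<one>, \<zero>]"] x by simp
 qed
 ultimately show ?thesis by blast
qed

end

section \<open>Characteristic, degrees and perfect base fields\<close>

lemma (in field) add_pow_one_mult:
 "add_pow R (a * b :: nat) \<one> = add_pow R a \<one> ** add_pow R b \<one>"
 using add.nat_pow_pow[of \<one> a b] add_pow_ldistr[of \<one> "add_pow R b \<one>" a] by (simp add: mult.commute)

lemma (in field) add_pow_one_left:
 "x \<in> carrier R ==> add_pow R (a :: nat) x = add_pow R a \<one> ** x"
 using add_pow_ldistr[of \<one> x a] by simp

lemma (in field) exists_characteristic:
 assumes "n > 0" "add_pow R (n :: nat) \<one> = \<zero>"
 shows "\<exists>q::nat. prime q \<and> add_pow R q \<one> = \<zero>"
 using assms
proof (induction n rule: less_induct)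
 case (less n)
 have "n ~= 1" using less(3) by auto
 then obtain q where q: "prime q" "q dvd n" using prime_factor_nat by blast
 then obtain m where m: "n = q * m" by auto
 have "add_pow R q \<one> ** add_pow R m \<one> = \<zero>" using less(3) add_pow_one_mult m by simp
 then consider "add_pow R q \<one> = \<zero>" | "add_pow R m \<one> = \<zero>"
  using integral[of "add_pow R q \<one>" "add_pow R m \<one>"] by auto
 then show ?case
 proof cases
  case 2
  have "m > 0" "m < n" using m less(2) prime_gt_1_nat[OF q(1)] by auto
  then show ?thesis using less(1) 2 by blast
 qed (use q in blast)
qed

lemma (in field) add_pow_one_coprime:
 assumes q: "prime q" "add_pow R (q :: nat) \<one> = \<zero>" and c: "\<not> q dvd c"
 shows "add_pow R c \<one> ~= \<zero>"
proof
 assume z: "add_pow R c \<one> = \<zero>"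
 have "coprime c q" using prime_imp_coprime[OF q(1) c] by (simp add: coprime_commute)
 then obtain u t where ut: "c * u = q * t + 1"
  using bezout_nat[of c q] c by (metis coprime_imp_gcd_eq_1 dvd_0_right)
 have "add_pow R (c * u) \<one> = \<zero>" using z add_pow_one_mult by simp
 moreover have "add_pow R (q * t + 1) \<one> = add_pow R (q * t) \<one> \<oplus> \<one>" by simp
 ultimately show False using ut q(2) add_pow_one_mult by simp
qed

context algebraic_closure
begin

lemma between_subalgebra: "between E ==> between F ==> E \<subseteq> F ==> subalgebra E F L"
 using subalgebraI[of E F] betweenD subringE(2,6,7)[of F L] by (metis subsetD)

lemma dimension_unique: "between E ==> dimension n E V ==> dimension m E V ==> n = m"
 using dimension_is_inj[OF betweenD(1)] by blast

lemma degree_tower: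
 assumes "between E" "between F" "E \<subseteq> F" "dimension n K F"
 obtains m l where "dimension m K E" "dimension l E F" "n = m * l"
proof -
 note E = betweenD[OF assms(1)] and F = betweenD[OF assms(2)]
 obtain m where m: "dimension m K E"
  using subspace_dimension[OF K_sub assms(4) between_subalgebra[OF between_K assms(1) E(2)] assms(3)] .
 obtain l where l: "dimension l E F"
  using dimension_larger_base[OF K_sub E(1,2) assms(4) between_subalgebra[OF assms(1,2,3)]] by auto
 have "n = m * l"
  by (rule dimension_unique[OF between_K assms(4) telescopic_base[OF K_sub E(1) m l]])
 then show ?thesis using that m l by blast
qed

lemma degree_one: "between E ==> between F ==> E \<subseteq> F ==> dimension 1 E F ==> E = F"
proof -
 assume a: "between E" "between F" "E \<subseteq> F" "dimension 1 E F"
 note E = betweenD[OF a(1)]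
 obtain m where m: "dimension m E E" "m = 1 ==> E = F"
  using subspace_dimension[OF E(1) a(4) between_subalgebra[OF a(1,1)] a(3)] by auto
 then show "E = F" using dimension_unique[OF a(1) m(1) dimension_one[OF E(1)]] by simp
qed

lemma degree_pos: "between E ==> between F ==> dimension n E F ==> n > 0"
proof (rule ccontr)
 assume a: "between E" "between F" "dimension n E F" "\<not> n > 0"
 then have "F = {\<zero>}" using dimension_zero[OF betweenD(1)[OF a(1)]] by simp
 moreover have "\<one> \<in> F" using betweenE(3)[OF a(2)] .
 ultimately show False by simp
qed

lemma between_hom_image:
 assumes E: "between E" and h: "h \<in> ring_hom (sub E) L" and fix_K: "!!k. k \<in> K ==> h k = k"
 shows "between (h ` E)" "inj_on h E" "dimension n K E ==> dimension n K (h ` E)"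
proof -
 note Ep = betweenD[OF E]
 interpret Er: field "sub E" by (rule Ep(6))
 interpret h: ring_hom_ring "sub E" L h by (rule ring_hom_ringI2[OF Er.ring_axioms ring_axioms h])
 have hK: "h ` K = K" using fix_K by simp
 show "between (h ` E)"
  using h.img_is_subfield(2)[OF Er.carrier_is_subfield one_not_zero] hK Ep(2) unfolding between_def by auto
 show inj: "inj_on h E" using h.img_is_subfield(1)[OF Er.carrier_is_subfield one_not_zero] by simp
 assume n: "dimension n K E"
 have "Er.dimension n K E" using n dimension_consistent[OF Ep(3) K_sub Ep(2)] by simp
 moreover have "subfield K (sub E)" using Er.subfield_iff(1)[of K] betweenD(6)[OF between_K] Ep(2) by simp
 ultimately show "dimension n K (h ` E)"
  using h.inj_hom_dimension[OF _ one_not_zero inj, of K n] hK by simp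
qed


text \<open>In characteristic zero no prime satisfies the premise, so one predicate covers all
  characteristics.\<close>

definition perfect :: bool where
 "perfect \<longleftrightarrow> (\<forall>q::nat. prime q --> add_pow L q \<one> = \<zero> --> (\<forall>a\<in>K. \<exists>b\<in>K. b [^] q = a))"

text \<open>The Frobenius map takes \<open>E\<close> to a subfield of degree \<open>n\<close> over
  the image of \<open>K\<close>, which is \<open>K\<close> again; by dimension this subfield is all
  of \<open>E\<close>.\<close>

lemma perfect_between:
 fixes q :: nat
 assumes perf: "perfect" and E: "between E" and n: "dimension n K E" and q: "prime q" "add_pow L q \<one> = \<zero>" and a: "a \<in> E"
 shows "\<exists>b\<in>E. b [^] q = a"
proof -
 note Ep = betweenD[OF E]
 let ?f = "%x. x [^] q"
 note f = frobenius_hom[OF q]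
 interpret f: ring_hom_ring L L ?f by (rule ring_hom_ringI2[OF ring_axioms ring_axioms f])
 have pow: "x [^] q \<in> F" if "between F" "x \<in> F" for x F
 proof -
  have "x [^] m \<in> F" for m :: nat
   using betweenE(3,6)[OF that(1)] that(2) by (induction m) auto
  then show ?thesis .
 qed
 have "?f ` K = K"
 proof
  show "?f ` K \<subseteq> K" using pow[OF between_K] by blast
  show "K \<subseteq> ?f ` K"
  proof
   fix a assume "a \<in> K"
   then obtain b where "b \<in> K" "b [^] q = a" using assms(1) q unfolding perfect_def by blast
   then show "a \<in> ?f ` K" by blast
  qed
 qed
 moreover have "inj_on ?f E" using frobenius_inj[OF q] Ep(5) by (intro inj_onI) blast
 ultimately have d: "dimension n K (?f ` E)" using f.inj_hom_dimension[OF K_sub one_not_zero _ n] by simp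
 have "?f ` E \<subseteq> E" using pow[OF E] by blast
 then have "?f ` E = E"
  using subspace_dimension[OF K_sub n finite_dimension_imp_subalgebra[OF K_sub finite_dimensionI[OF d]]]
   dimension_unique[OF between_K d] by metis
 then have "a \<in> ?f ` E" using a by simp
 then show ?thesis by blast
qed

lemma poly_coeff_mem:
 assumes "between E" "p \<in> carrier (E[X][L])"
 shows "coeff p i \<in> E"
proof (cases "i < length p")
 case True
 then show ?thesis using poly_coeffs[OF assms(2)] coeff_img_restrict[of p] by blast
next
 case False
 then show ?thesis using coeff_length[of p i] betweenE(2)[OF assms(1)] by simp
qed

lemma between_cancel:
 assumes "between E" "c \<in> E" "c ~= \<zero>" "z \<in> carrier L" "c ** z \<in> E"
 shows "z \<in> E"
proof -
 note E = betweenD[OF assms(1)]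
 have i: "inv c \<in> E" "inv c ** c = \<one>" using subfield_m_inv(1,3)[OF E(1), of c] assms(2,3) by auto
 have "inv c ** (c ** z) = z" using i E(5) assms(2,4) by (simp add: m_assoc[symmetric])
 then show ?thesis using subringE(6)[OF E(3) i(1) assms(5)] by simp
qed

lemma between_add_pow:
 assumes "between E" "x \<in> E"
 shows "add_pow L (n :: nat) x \<in> E"
 using betweenE(2,7)[OF assms(1)] assms(2) by (induction n) auto

text \<open>If \<open>x\<close> is the only root of its minimal polynomial \<open>(X - x)\<^sup>n\<close>, some coefficient of it shows
 that \<open>x\<^sup>r \<in> E\<close>, where \<open>r\<close> is the part of \<open>n\<close> at the characteristic.\<close>

theorem exists_other_root:
 assumes perf: "perfect" and E: "between E" and fin: "dimension d K E" and x: "x \<in> carrier L" "x \<notin> E"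
 shows "\<exists>x'\<in>carrier L. x' ~= x \<and> eval (Irr E x) x' = \<zero>"
proof (rule ccontr)
 assume only: "\<not> ?thesis"
 note Ep = betweenD[OF E]
 note I = Irr_props[OF E x(1)]
 obtain ys where ys: "set ys \<subseteq> carrier L" "Irr E x = pl L ys" using exists_pl[OF I(5,4,2)] by blast
 define n where "n = length ys"
 have "y = x" if "y \<in> set ys" for y
  using only pl_eval_zero[OF ys(1), of y] that ys by auto
 then have "ys = replicate n x" unfolding n_def by (simp add: replicate_eqI)
 then have irr: "Irr E x = pl L (replicate n x)" using ys(2) by simp
 have n1: "n > 1" using I(7)[OF x(2)] pl_closed(4)[OF ys(1)] ys(2) by (simp add: n_def)
 have nx: "\<ominus> x \<in> carrier L" using x by simp
 \<comment> \<open>The coefficient of index \<open>n - r\<close> in \<open>(X - x)^n\<close> is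
   \<open>n choose r\<close> times \<open>(- x)^r\<close>.\<close>
 have key: "(\<ominus> x) [^] r \<in> E" if "r \<le> n" "add_pow L (n choose r) \<one> ~= \<zero>" for r
 proof (rule between_cancel[OF E _ that(2)])
  have "coeff (Irr E x) (n - r) \<in> E" using poly_coeff_mem[OF E I(1)] .
  then have "add_pow L (n choose r) ((\<ominus> x) [^] r) \<in> E"
   using coeff_power_linear[OF x(1), of "n - r" n] irr that(1) binomial_symmetric[OF that(1)] by simp
  then show "add_pow L (n choose r) \<one> ** (\<ominus> x) [^] r \<in> E" using add_pow_one_left[of "(\<ominus> x) [^] r"] nx by simp
  show "add_pow L (n choose r) \<one> \<in> E" using between_add_pow[OF E] subringE(3)[OF Ep(3)] by blast
 qed (use nx in simp)
 have neg: False if "\<ominus> x \<in> E"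
  using subringE(5)[OF Ep(3) that] x by simp
 show False
 proof (cases "add_pow L n \<one> = \<zero>")
  case False
  then have "(\<ominus> x) [^] (1::nat) \<in> E" using key[of 1] n1 by simp
  then show False using neg nx by simp
 next
  case True
  then obtain q :: nat where q: "prime q" "add_pow L q \<one> = \<zero>" using exists_characteristic[of n] n1 by auto
  \<comment> \<open>With \<open>q^e\<close> the exact power of \<open>q\<close> in \<open>n\<close>,
    the number \<open>n choose q^e\<close> is prime to \<open>q\<close>.\<close>
  define e where "e = multiplicity q n"
  obtain m where m: "n = q ^ e * m" "\<not> q dvd m"
   using multiplicity_decompose'[of n q] q(1) n1 e_def by (metis not_prime_unit not_one_less_zero)
  have m0: "m > 0" using m n1 by (cases m) auto
  have "multiplicity q (n choose q ^ e) = multiplicity q m"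
   using const_p_fac[OF m0 q(1)] m(1) by simp
  then have "multiplicity q (n choose q ^ e) = 0" using m(2) by (simp add: not_dvd_imp_multiplicity_0)
  moreover have qn: "q ^ e \<le> n" using m m0 by simp
  ultimately have "\<not> q dvd (n choose q ^ e)"
   using q(1) by (metis multiplicity_eq_zero_iff zero_less_binomial less_numeral_extra(3) not_prime_unit)
  then have "(\<ominus> x) [^] (q ^ e) \<in> E" using key[OF qn] add_pow_one_coprime[OF q] by blast
  \<comment> \<open>Perfectness of \<open>E\<close> extracts one \<open>q\<close>-th root at a time;
    by injectivity of the Frobenius map it is the given one.\<close>
  moreover have "z \<in> E" if "z [^] (q ^ j) \<in> E" "z \<in> carrier L" for z j
   using that
  proof (induction j arbitrary: z)
   case (Suc j)
   have "(z [^] q) [^] (q ^ j) \<in> E" using Suc(2,3) by (simp add: nat_pow_pow)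
   then have "z [^] q \<in> E" using Suc by simp
   then obtain b where b: "b \<in> E" "b [^] q = z [^] q" using perfect_between[OF assms(1) E fin q] by blast
   then have "b = z" using frobenius_inj[OF q] Suc(3) Ep(5) by blast
   then show ?case using b(1) by simp
  qed simp
  ultimately show False using neg nx by blast
 qed
qed

end

subsection \<open>Galois theory\<close>

context algebraic_closure
begin

definition hom_over :: "'a set => ('a => 'a) => bool" where
 "hom_over F h \<longleftrightarrow> h \<in> ring_hom (sub F) L \<and> (\<forall>k\<in>K. h k = k)"

lemma hom_overD:
 assumes "hom_over F h"
 shows "h \<in> ring_hom (sub F) L" "k \<in> K ==> h k = k" "x \<in> F ==> h x \<in> carrier L"
  "x \<in> F ==> y \<in> F ==> h (x ** y) = h x ** h y"
  "x \<in> F ==> y \<in> F ==> h (x \<oplus> y) = h x \<oplus> h y"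
 using assms unfolding hom_over_def ring_hom_def by auto

lemma hom_over_ring:
 assumes "between F" "hom_over F h"
 shows "ring_hom_ring (sub F) L h"
 using ring_hom_ringI2[OF _ ring_axioms hom_overD(1)[OF assms(2)]] betweenD(6)[OF assms(1)]
 by (simp add: field_def domain_def cring_def)

lemma hom_over_inj: "between F ==> hom_over F h ==> inj_on h F"
 using between_hom_image(2)[of F h] hom_overD by blast

lemma hom_over_mono: "hom_over F h ==> E \<subseteq> F ==> hom_over E h"
 unfolding hom_over_def ring_hom_def by (auto simp: subset_iff)

lemma hom_over_id: "between F ==> hom_over F (%x. x)"
 using betweenD(4)[of F] unfolding hom_over_def ring_hom_def by auto

lemma hom_over_comp:
 "hom_over F h ==> hom_over F g ==> (!!x. x \<in> F ==> h x \<in> F) ==> hom_over F (%x. g (h x))"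
 unfolding hom_over_def ring_hom_def by auto

lemma hom_over_onto:
 assumes "between F" "hom_over F h" "!!x. x \<in> F ==> h x \<in> F" "dimension n K F"
 shows "h ` F = F"
proof -
 have "dimension n K (h ` F)" using between_hom_image(3)[OF assms(1) _ _ assms(4)] hom_overD[OF assms(2)] by blast
 then show ?thesis
  using subspace_dimension[OF K_sub assms(4) finite_dimension_imp_subalgebra[OF K_sub finite_dimensionI]]
   dimension_unique[OF between_K] assms(3) by (metis image_subsetI)
qed

lemma hom_over_root:
 assumes "between F" "hom_over F h" "x \<in> F" "p \<in> carrier (K[X][L])" "eval p x = \<zero>"
 shows "eval p (h x) = \<zero>"
proof -
 interpret h: ring_hom_ring "sub F" L h by (rule hom_over_ring[OF assms(1,2)])
 have s: "set p \<subseteq> K" by (rule poly_coeffs[OF assms(4)])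
 have "map h p = p" using s hom_overD(2)[OF assms(2)] by (intro map_idI) blast
 moreover have "ring.eval (sub F) p x = eval p x" using eval_consistent[OF betweenD(3)[OF assms(1)]] by simp
 moreover have "h \<zero> = \<zero>" using h.hom_zero by simp
 moreover have "set p \<subseteq> carrier (sub F)" using s betweenD(2)[OF assms(1)] by auto
 ultimately show ?thesis using h.eval_hom'[of x p] assms(3,5) by simp
qed

lemma hom_over_simple_image:
 assumes "between E" "x \<in> carrier L" "hom_over (simple_extension E x) h" "between F"
  "!!e. e \<in> E ==> h e \<in> F" "h x \<in> F" "u \<in> simple_extension E x"
 shows "h u \<in> F"
proof -
 note S = between_simple[OF assms(1,2)]
 interpret h: ring_hom_ring "sub (simple_extension E x)" L h by (rule hom_over_ring[OF S(1) assms(3)])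
 note F = betweenE(2,6,7)[OF assms(4)]
 show ?thesis
  using assms(7)
 proof induction
  case zero
  show ?case using h.hom_zero F by simp
 next
  case (lin k1 k2)
  have k: "k1 \<in> simple_extension E x" "k2 \<in> simple_extension E x" using lin S(2) by auto
  have "k1 ** x \<in> simple_extension E x"
   using betweenE(6)[OF S(1) k(1) S(3)] .
  then have "h (k1 ** x \<oplus> k2) = h k1 ** h x \<oplus> h k2"
   using hom_overD(4,5)[OF assms(3)] k S(3) by simp
  then show ?case using F lin assms(5,6) by simp
 qed
qed

lemma hom_over_agree:
 assumes "between E" "x \<in> carrier L" "hom_over (simple_extension E x) h" "hom_over (simple_extension E x) g"
  "!!e. e \<in> E ==> h e = g e" "h x = g x" "u \<in> simple_extension E x"
 shows "h u = g u"
proof -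
 note S = between_simple[OF assms(1,2)]
 interpret h: ring_hom_ring "sub (simple_extension E x)" L h by (rule hom_over_ring[OF S(1) assms(3)])
 interpret g: ring_hom_ring "sub (simple_extension E x)" L g by (rule hom_over_ring[OF S(1) assms(4)])
 show ?thesis
  using assms(7)
 proof induction
  case zero
  show ?case using h.hom_zero g.hom_zero by simp
 next
  case (lin k1 k2)
  have k: "k1 \<in> simple_extension E x" "k2 \<in> simple_extension E x" using lin S(2) by auto
  have "k1 ** x \<in> simple_extension E x"
   using betweenE(6)[OF S(1) k(1) S(3)] .
  then show ?case
   using hom_overD(4,5)[OF assms(3)] hom_overD(4,5)[OF assms(4)] k S(3) lin assms(5,6) by simp
 qed
qed

lemma extend_hom_over:
 assumes E: "between E" and h: "hom_over E h" and x: "x \<in> carrier L"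
 obtains h' where "hom_over (simple_extension E x) h'" "\<forall>e\<in>E. h' e = h e"
proof -
 note Ep = betweenD[OF E]
 note I = Irr_props[OF E x]
 have "map h (Irr E x) \<in> carrier (poly_ring L)"
  using polynomial_hom[OF hom_overD(1)[OF h] Ep(6) field_axioms] I(1) univ_poly_consistent[OF Ep(3)] by simp
 moreover have "lead_coeff (map h (Irr E x)) = \<one>"
  using I(2,4) ring_hom_one[OF hom_overD(1)[OF h]] by (simp add: hd_map)
 ultimately obtain ys where ys: "set ys \<subseteq> carrier L" "map h (Irr E x) = pl L ys"
  using exists_pl[of "map h (Irr E x)"] I(4) by auto
 have "length ys > 0" using pl_closed(4)[OF ys(1)] ys(2) I(6) by (metis length_map)
 then obtain x' where x': "x' \<in> set ys" by (cases ys) auto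
 then have "x' \<in> carrier L" "eval (map h (Irr E x)) x' = \<zero>" using pl_eval_zero[OF ys(1)] ys by auto
 then obtain h' where h': "h' \<in> ring_hom (sub (simple_extension E x)) L" "\<forall>e\<in>E. h' e = h e"
  using extend_hom[OF E hom_overD(1)[OF h] x] by blast
 then have "hom_over (simple_extension E x) h'" using hom_overD(2)[OF h] Ep(2) unfolding hom_over_def by auto
 then show ?thesis using that h'(2) by blast
qed

lemma move_to_root:
 assumes E: "between E" and x: "x \<in> carrier L" "x' \<in> carrier L" "eval (Irr E x) x' = \<zero>"
 obtains h where "hom_over (simple_extension E x) h" "\<forall>e\<in>E. h e = e" "h x = x'"
proof -
 have "map (%x. x) (Irr E x) = Irr E x" by simp
 then obtain h where "h \<in> ring_hom (sub (simple_extension E x)) L" "\<forall>e\<in>E. h e = e" "h x = x'"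
  using extend_hom[OF E hom_overD(1)[OF hom_over_id[OF E]] x(1,2)] x(3) by auto
 then show ?thesis using that betweenD(2)[OF E] unfolding hom_over_def by blast
qed

lemma sub_minus: "between F ==> x \<in> F ==> \<ominus>[sub F] x = \<ominus> x"
proof -
 assume F: "between F" "x \<in> F"
 interpret F: field "sub F" by (rule betweenD(6)[OF F(1)])
 have "\<ominus> x \<in> F" using betweenE(5)[OF F(1) F(2)] .
 then show ?thesis using F.minus_equality[of "\<ominus> x" x] F betweenD(5)[OF F] by (simp add: l_neg)
qed

text \<open>The polynomial with the orbit of a primitive element as roots is invariant.\<close>

theorem orbit_degree:
 assumes F: "between F" "F = simple_extension K y" and y: "y \<in> carrier L"
  and HF: "\<forall>h\<in>H. hom_over F h \<and> h ` F \<subseteq> F"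
  and Orbit: "finite Orb" "y \<in> Orb" "Orb \<subseteq> (%h. h y) ` H" "\<forall>h\<in>H. h ` Orb \<subseteq> Orb"
 shows "between {x \<in> F. \<forall>h\<in>H. h x = x}" "dimension (card Orb) {x \<in> F. \<forall>h\<in>H. h x = x} F"
proof -
 note Fp = betweenD[OF F(1)]
 have H: "hom_over F h" "x \<in> F ==> h x \<in> F" if "h \<in> H" for h x using HF that by auto
 have Orb: "finite Orb" "y \<in> Orb" "Orb \<subseteq> (%h. h y) ` H" "h \<in> H ==> x \<in> Orb ==> h x \<in> Orb" for h x
  using Orbit by auto
 let ?E = "{x \<in> F. \<forall>h\<in>H. h x = x}"
 have yF: "y \<in> F" unfolding F(2) using between_simple(3)[OF between_K y] .
 have OF: "Orb \<subseteq> F" using Orb(3) H(2) yF by auto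
 note sF = subringE[OF Fp(3)]
 have hz: "h \<zero> = \<zero>" "h \<one> = \<one>" "x \<in> F ==> h (\<ominus> x) = \<ominus> h x" if "h \<in> H" for h x
 proof -
  interpret h: ring_hom_ring "sub F" L h by (rule hom_over_ring[OF F(1) H(1)[OF that]])
  show z: "h \<zero> = \<zero>" using h.hom_zero by simp
  show "h \<one> = \<one>" using h.hom_one by simp
  assume x: "x \<in> F"
  have "h (x \<oplus> \<ominus> x) = h x \<oplus> h (\<ominus> x)" using hom_overD(5)[OF H(1)[OF that] x sF(5)[OF x]] .
  then have "h x \<oplus> h (\<ominus> x) = \<zero>" using z x Fp(5) by (simp add: r_neg)
  then show "h (\<ominus> x) = \<ominus> h x"
   using hom_overD(3)[OF H(1)[OF that]] x sF(5)[OF x] minus_equality[of "h (\<ominus> x)" "h x"] by (simp add: a_comm)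
 qed
 show E: "between ?E"
  unfolding between_def
 proof
  show "K \<subseteq> ?E" using Fp(2) hom_overD(2)[OF H(1)] by auto
  show "subfield ?E L"
  proof (rule subfieldI')
   show "subring ?E L"
   proof (rule subringI)
    show "?E \<subseteq> carrier L" using Fp(4) by blast
    show "\<one> \<in> ?E" using sF(3) hz(2) by blast
    show "\<ominus> u \<in> ?E" if u: "u \<in> ?E" for u
    proof -
     have "h (\<ominus> u) = \<ominus> u" if h: "h \<in> H" for h
     proof -
      have "h u = u" "u \<in> F" using u h by blast+
      then show ?thesis using hz(3)[OF h, of u] by simp
     qed
     then show ?thesis using sF(5) u by blast
    qed
    show "u ** v \<in> ?E" if uv: "u \<in> ?E" "v \<in> ?E" for u v
    proof -
     have "h (u ** v) = u ** v" if h: "h \<in> H" for h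
     proof -
      have "h u = u" "h v = v" "u \<in> F" "v \<in> F" using uv h by blast+
      then show ?thesis using hom_overD(4)[OF H(1)[OF h], of u v] by simp
     qed
     then show ?thesis using sF(6) uv by blast
    qed
    show "u \<oplus> v \<in> ?E" if uv: "u \<in> ?E" "v \<in> ?E" for u v
    proof -
     have "h (u \<oplus> v) = u \<oplus> v" if h: "h \<in> H" for h
     proof -
      have "h u = u" "h v = v" "u \<in> F" "v \<in> F" using uv h by blast+
      then show ?thesis using hom_overD(5)[OF H(1)[OF h], of u v] by simp
     qed
     then show ?thesis using sF(7) uv by blast
    qed
   qed
   fix x assume x: "x \<in> ?E - {\<zero>}"
   have i: "inv x \<in> F" "x ** inv x = \<one>" using subfield_m_inv[OF Fp(1), of x] x by auto
   have "h (inv x) = inv x" if h: "h \<in> H" for h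
   proof -
    have "h x = x" using x h by blast
    then have "x ** h (inv x) = \<one>" using hom_overD(4)[OF H(1)[OF h], of x "inv x"] i hz(2)[OF h] x by simp
    then have "x ** h (inv x) = x ** inv x" using i by simp
    then show ?thesis using m_lcancel[of x "h (inv x)" "inv x"] x Fp(5) H(2)[OF h i(1)] i(1) by simp
   qed
   then show "inv x \<in> ?E" using i by simp
  qed
 qed
 note Ep = betweenD[OF E]
 have FE: "F = simple_extension ?E y"
 proof
  have "K \<subseteq> simple_extension ?E y" by (rule order_trans[OF Ep(2) between_simple(2)[OF E y]])
  then have "simple_extension K y \<subseteq> simple_extension ?E y"
   by (rule simple_extension_least[OF between_K between_simple(1)[OF E y] _ between_simple(3)[OF E y]])
  then show "F \<subseteq> simple_extension ?E y" by (rule ord_eq_le_trans[OF F(2)])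
  show "simple_extension ?E y \<subseteq> F" by (rule simple_extension_least[OF E F(1)]) (use yF in auto)
 qed
 note I = Irr_props[OF E y]
 obtain os where os: "set os = Orb" "distinct os" using finite_distinct_list[OF Orb(1)] by blast
 have osF: "set os \<subseteq> carrier (sub F)" using os(1) OF by simp
 have osL: "set os \<subseteq> carrier L" using osF Fp(4) by auto
 have plF: "pl (sub F) os = pl L os"
  using univ_poly_consistent[OF Fp(3)] osF
 proof (induction os)
  case (Cons x xs)
  have "\<ominus>[sub F] x = \<ominus> x"
   using sub_minus[OF F(1)] Cons(3) by simp
  then show ?case using Cons by (simp add: pl_simps univ_poly_mult poly_mult_consistent[OF Fp(3)])
 qed (simp add: pl_simps)
 \<comment> \<open>\<open>h\<close> is injective and maps the finite orbit into itself, so it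
   permutes the roots and fixes the coefficients.\<close>
 have fixc: "map h (pl L os) = pl L os" if h: "h \<in> H" for h
 proof -
  have inj: "inj_on h Orb" using hom_over_inj[OF F(1) H(1)[OF h]] OF inj_on_subset by blast
  have im: "h ` Orb = Orb" using endo_inj_surj[OF Orb(1) _ inj] Orb(4)[OF h] by blast
  have "mset (map h os) = mset os"
  proof (rule set_eq_iff_mset_eq_distinct[THEN iffD1])
   show "distinct (map h os)" using os inj by (simp add: distinct_map)
   show "set (map h os) = set os" using im os(1) by simp
  qed (rule os)
  have "set (map h os) \<subseteq> carrier L" using im os(1) osL by simp
  have "map h (pl L os) = pl L (map h os)"
   using map_pl[OF hom_overD(1)[OF H(1)[OF h]] Fp(6) field_axioms osF] plF by simp
  also have "\<dots> = pl L os" by (rule pl_mset) fact+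
  finally show ?thesis .
 qed
 have "set (pl L os) \<subseteq> ?E"
 proof
  fix c assume c: "c \<in> set (pl L os)"
  have "field (sub F)" by (rule Fp(6))
  then have "c \<in> F" using field.poly_set[OF Fp(6) field.pl_closed(1)[OF Fp(6) osF]] c plF by auto
  moreover have "h c = c" if "h \<in> H" for h
  proof -
   have "map h (pl L os) = map (%x. x) (pl L os)" using fixc[OF that] by simp
   then show ?thesis using c by (simp only: map_eq_conv)
  qed
  ultimately show "c \<in> ?E" by blast
 qed
 then have pE: "pl L os \<in> carrier (?E[X][L])"
  using pl_closed(3)[OF osL] unfolding poly_carrier by simp
 have le: "degree (Irr ?E y) \<le> length os"
  using Irr_degree_le[OF E y pE _ pl_closed(2)[OF osL]] pl_eval_zero[OF osL y] os Orb(2) pl_closed(4)[OF osL] by simp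
 obtain zs where zs: "set zs \<subseteq> carrier L" "Irr ?E y = pl L zs" using exists_pl[OF I(5,4,2)] by blast
 \<comment> \<open>Conversely, every orbit point is a conjugate of \<open>y\<close> over the fixed
   field, so the degree is at least the size of the orbit.\<close>
 have "Orb \<subseteq> set zs"
 proof
  fix x assume "x \<in> Orb"
  then obtain h where h: "h \<in> H" "x = h y" using Orb(3) by blast
  interpret h: ring_hom_ring "sub F" L h by (rule hom_over_ring[OF F(1) H(1)[OF h(1)]])
  have s: "set (Irr ?E y) \<subseteq> ?E" by (rule poly_coeffs[OF I(1)])
  have "map h (Irr ?E y) = Irr ?E y" using s h(1) by (intro map_idI) blast
  moreover have "ring.eval (sub F) (Irr ?E y) y = \<zero>" using eval_consistent[OF Fp(3)] I(3) by simp
  moreover have "set (Irr ?E y) \<subseteq> carrier (sub F)" using s by auto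
  ultimately have "eval (Irr ?E y) x = \<zero>" using h.eval_hom'[of y "Irr ?E y"] yF h hz(1)[OF h(1)] by simp
  then show "x \<in> set zs" using pl_eval_zero[OF zs(1)] zs(2) h hom_overD(3)[OF H(1)[OF h(1)] yF] by simp
 qed
 then have "card Orb \<le> length zs" using card_mono[of "set zs" Orb] card_length[of zs] by simp
 then have "degree (Irr ?E y) = card Orb" using le pl_closed(4)[OF zs(1)] zs(2) os distinct_card by fastforce
 then show "dimension (card Orb) ?E F" using between_simple(4)[OF E y] FE by simp
qed

end

context algebraic_closure
begin

lemma conjugates_finite:
 assumes "y \<in> carrier L"
 shows "finite {x \<in> carrier L. eval (Irr K y) x = \<zero>}"
proof -
 note I = Irr_props[OF between_K assms]
 obtain ys where ys: "set ys \<subseteq> carrier L" "Irr K y = pl L ys" using exists_pl[OF I(5,4,2)] by blast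
 then have "{x \<in> carrier L. eval (Irr K y) x = \<zero>} \<subseteq> set ys" using pl_eval_zero[OF ys(1)] by auto
 then show ?thesis by (rule finite_subset) simp
qed

lemma hom_over_conjugate:
 assumes "between F" "hom_over F h" "y \<in> F"
 shows "eval (Irr K y) (h y) = \<zero>"
 using hom_over_root[OF assms(1,2,3)] Irr_props(1,3)[OF between_K betweenD(5)[OF assms(1,3)]] by blast

text \<open>\<open>s\<close> moves \<open>y\<close>, so the fixed field of its powers is a proper
  subfield, which for prime degree is \<open>K\<close>. By \<open>orbit_degree\<close> the orbit of
  \<open>y\<close> then has exactly \<open>q\<close> points, so its period is \<open>q\<close>, and
  \<open>s ^^ q\<close> fixes the generator \<open>y\<close> and with it all of
  \<open>M\<close>.\<close>

theorem cyclic_prime_degree: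
 assumes y: "y \<in> carrier L" and M: "M = simple_extension K y" "dimension q K M" "prime q"
  and s: "hom_over M s" "!!x. x \<in> M ==> s x \<in> M" "s y ~= y"
 shows "x \<in> M ==> (s ^^ q) x = x" "x \<in> M ==> s x = x \<longleftrightarrow> x \<in> K"
  "inj_on (%i. (s ^^ i) y) {..<q}"
proof -
 have Mb: "between M" and yM: "y \<in> M" unfolding M(1) using between_simple[OF between_K y] by auto
 have cl: "(s ^^ i) x \<in> M" if "x \<in> M" for i x using that s(2) by (induction i) auto
 have hom: "hom_over M (s ^^ i)" for i
 proof (induction i)
  case 0
  show ?case using hom_over_id[OF Mb] by (simp add: id_def)
 next
  case (Suc i)
  have "hom_over M (%x. s ((s ^^ i) x))" by (rule hom_over_comp[OF Suc s(1) cl])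
  then show ?case by (simp add: comp_def)
 qed
 let ?H = "range (%i. s ^^ i)" and ?O = "range (%i. (s ^^ i) y)"
 let ?E = "{x \<in> M. \<forall>h\<in>?H. h x = x}"
 have "?O \<subseteq> {x \<in> carrier L. eval (Irr K y) x = \<zero>}"
  using hom_over_conjugate[OF Mb hom yM] cl[OF yM] betweenD(5)[OF Mb] by blast
 then have fin: "finite ?O" using conjugates_finite[OF y] finite_subset by blast
 have y0: "y \<in> ?O" using range_eqI[of y "%i. (s ^^ i) y" 0] by simp
 have step: "(s ^^ i) x \<in> ?O" if xO: "x \<in> ?O" for i x
 proof -
  obtain j where "x = (s ^^ j) y" using xO by blast
  then have "(s ^^ i) x = (s ^^ (i + j)) y" by (simp add: funpow_add)
  then show ?thesis by blast
 qed
 have H: "\<forall>h\<in>?H. hom_over M h \<and> h ` M \<subseteq> M" "\<forall>h\<in>?H. h ` ?O \<subseteq> ?O"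
  using hom cl step by auto
 have OH: "?O \<subseteq> (%h. h y) ` ?H" by auto
 note od = orbit_degree[OF Mb M(1) y H(1) fin y0 OH H(2)]
 have Eeq: "x \<in> ?E \<longleftrightarrow> x \<in> M \<and> s x = x" for x
 proof
  assume x: "x \<in> ?E"
  have "(s ^^ 1) x = x" using x by blast
  then show "x \<in> M \<and> s x = x" using x by simp
 next
  assume x: "x \<in> M \<and> s x = x"
  have "(s ^^ i) x = x" for i by (induction i) (use x in auto)
  then show "x \<in> ?E" using x by auto
 qed
 have EM: "?E \<subseteq> M" by blast
 obtain m l where ml: "dimension m K ?E" "dimension l ?E M" "q = m * l"
  using degree_tower[OF od(1) Mb EM M(2)] .
 have l: "l = card ?O" by (rule dimension_unique[OF od(1) ml(2) od(2)])
 have "y \<notin> ?E" using Eeq s(3) by blast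
 then have "?E ~= M" using yM by blast
 then have "l ~= 1" using degree_one[OF od(1) Mb EM] ml(2) by blast
 moreover have "m = 1 \<or> l = 1" using prime_product[of m l] ml(3) M(3) by simp
 ultimately have lm: "l = q" "m = 1" using ml(3) by auto
 have KE: "K = ?E" using degree_one[OF between_K od(1) betweenD(2)[OF od(1)]] ml(1) lm(2) by simp
 show "x \<in> M ==> s x = x \<longleftrightarrow> x \<in> K" using KE Eeq by blast
 have q0: "q > 0" using M(3) prime_gt_0_nat by blast
 \<comment> \<open>Among \<open>q + 1\<close> iterates two agree. Their distance \<open>d\<close> is
   at most \<open>q\<close>; since the first \<open>d\<close> iterates exhaust the orbit, it is not
   less.\<close>
 have "\<not> inj_on (%i. (s ^^ i) y) {..q}"
 proof
  assume "inj_on (%i. (s ^^ i) y) {..q}"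
  then have "card ((%i. (s ^^ i) y) ` {..q}) = Suc q" by (simp add: card_image)
  moreover have "card ((%i. (s ^^ i) y) ` {..q}) \<le> card ?O" by (rule card_mono[OF fin]) blast
  ultimately show False using l lm by simp
 qed
 then obtain i j where ij: "i < j" "j \<le> q" "(s ^^ i) y = (s ^^ j) y"
  unfolding inj_on_def by (metis atMost_iff linorder_neqE_nat)
 define d where "d = j - i"
 have "(s ^^ i) ((s ^^ d) y) = (s ^^ (i + d)) y" by (simp add: funpow_add)
 then have "(s ^^ i) ((s ^^ d) y) = (s ^^ i) y" using ij by (simp add: d_def)
 then have dy: "(s ^^ d) y = y" using inj_onD[OF hom_over_inj[OF Mb hom]] cl[OF yM] yM by blast
 have mult: "(s ^^ (k * d)) y = y" for k by (induction k) (simp_all add: funpow_add dy)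
 have "?O \<subseteq> (%i. (s ^^ i) y) ` {..<d}"
 proof
  fix x assume "x \<in> ?O"
  then obtain n where n: "x = (s ^^ n) y" by blast
  have "(s ^^ (n mod d + n div d * d)) y = (s ^^ (n mod d)) ((s ^^ (n div d * d)) y)"
   by (simp only: funpow_add comp_apply)
  then have "(s ^^ n) y = (s ^^ (n mod d)) ((s ^^ (n div d * d)) y)" by simp
  then have "x = (s ^^ (n mod d)) y" using n mult by simp
  moreover have "n mod d < d" using ij by (simp add: d_def)
  ultimately show "x \<in> (%i. (s ^^ i) y) ` {..<d}" by blast
 qed
 then have "card ?O \<le> d" using card_mono[of "(%i. (s ^^ i) y) ` {..<d}" ?O] card_image_le[of "{..<d}" "%i. (s ^^ i) y"]
  by simp
 then have dq: "d = q" using l lm ij by (simp add: d_def)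
 have im: "(%i. (s ^^ i) y) ` {..<q} = ?O" using \<open>?O \<subseteq> (%i. (s ^^ i) y) ` {..<d}\<close> dq by blast
 show "inj_on (%i. (s ^^ i) y) {..<q}"
  by (rule eq_card_imp_inj_on) (use im l lm in auto)
 assume x: "x \<in> M"
 have "(s ^^ q) x = (%x. x) x"
 proof (rule hom_over_agree[OF between_K y, folded M(1), OF hom hom_over_id[OF Mb] _ _ x])
  show "(s ^^ q) e = e" if "e \<in> K" for e using hom_overD(2)[OF hom that] .
  show "(s ^^ q) y = y" using dy dq by simp
 qed
 then show "(s ^^ q) x = x" .
qed

text \<open>\<open>F\<close> is \<open>K(zs)\<close>; the last clause gives normality once
  \<open>zs\<close> is closed under conjugation. \<open>F'\<close> is left free because in the
  induction the target has to be the final field, not the current one.\<close>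

lemma normal_closure:
 assumes "set zs \<subseteq> carrier L"
 shows "\<exists>F n. between F \<and> dimension n K F \<and> set zs \<subseteq> F \<and>
  (\<forall>h F'. hom_over F h --> between F' --> h ` set zs \<subseteq> F' --> h ` F \<subseteq> F')"
 using assms
proof (induction zs)
 case Nil
 have "h ` K \<subseteq> F'" if "hom_over K h" "between F'" for h F'
  using hom_overD(2)[OF that(1)] betweenD(2)[OF that(2)] by auto
 then show ?case using between_K dimension_one[OF K_sub] by (intro exI[of _ K] exI[of _ 1]) auto
next
 case (Cons z zs)
 then obtain F n where F: "between F" "dimension n K F" "set zs \<subseteq> F"
  "!!h F'. hom_over F h ==> between F' ==> h ` set zs \<subseteq> F' ==> h ` F \<subseteq> F'" by auto
 have z: "z \<in> carrier L" using Cons(2) by simp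
 note S = between_simple[OF F(1) z]
 let ?S = "simple_extension F z"
 have "h ` ?S \<subseteq> F'" if h: "hom_over ?S h" "between F'" "h ` set (z # zs) \<subseteq> F'" for h F'
 proof -
  have "h ` F \<subseteq> F'" by (rule F(4)[OF hom_over_mono[OF h(1) S(2)] h(2)]) (use h(3) in simp)
  then have "h u \<in> F'" if "u \<in> ?S" for u
   using hom_over_simple_image[OF F(1) z h(1,2) _ _ that] h(3) by auto
  then show ?thesis by blast
 qed
 moreover have "dimension (n * degree (Irr F z)) K ?S"
  by (rule telescopic_base[OF K_sub betweenD(1)[OF F(1)] F(2) S(4)])
 ultimately show ?case using S F(3) by (intro exI[of _ ?S] exI[of _ "n * degree (Irr F z)"]) auto
qed

lemma finite_between:
 assumes "finite K" "between E" "dimension n K E"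
 shows "finite E"
proof -
 obtain u where u: "E = lspan K u n" using exists_basis[OF K_sub assms(3)] by blast
 have "E \<subseteq> (%b. lc L u b n) ` ({..<n} \<rightarrow>\<^sub>E K)"
 proof
  fix x assume "x \<in> E"
  then obtain b where b: "x = lc L u b n" "\<forall>i<n. b i \<in> K" unfolding u lspan_def by blast
  have "x = lc L u (restrict b {..<n}) n" unfolding b(1) by (rule lc_cong) auto
  moreover have "restrict b {..<n} \<in> {..<n} \<rightarrow>\<^sub>E K" using b(2) by auto
  ultimately show "x \<in> (%b. lc L u b n) ` ({..<n} \<rightarrow>\<^sub>E K)" by blast
 qed
 then show ?thesis by (rule finite_subset) (use assms(1) in "simp add: finite_PiE")
qed

text \<open>The generator is \<open>w = y + c z\<close>. If \<open>z\<close> were not in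
  \<open>K(w)\<close>, an embedding over \<open>K(w)\<close> would send \<open>z\<close> to another
  conjugate and \<open>y\<close> to some conjugate; as it fixes \<open>w\<close>, this determines
  \<open>c\<close> as one of finitely many quotients, which are excluded.\<close>

lemma two_generators:
 assumes perf: "perfect" and inf: "infinite K" and yz: "y \<in> carrier L" "z \<in> carrier L"
 obtains w where "w \<in> carrier L" "y \<in> simple_extension K w" "z \<in> simple_extension K w"
  "\<forall>E. between E --> y \<in> E --> z \<in> E --> w \<in> E"
proof -
 let ?R = "%y. {x \<in> carrier L. eval (Irr K y) x = \<zero>}"
 let ?bad = "(%(y', z'). (y' \<ominus> y) ** inv (z \<ominus> z')) ` (?R y \<times> ?R z)"
 have "finite ?bad" using conjugates_finite yz by simp
 then obtain c where c: "c \<in> K" "c \<notin> ?bad" using inf by (meson ex_new_if_finite finite_subset subsetI)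
 have cL: "c \<in> carrier L" using c(1) betweenD(5)[OF between_K] by blast
 define w where "w = y \<oplus> c ** z"
 have w: "w \<in> carrier L" using yz cL by (simp add: w_def)
 note E = between_simple[OF between_K w]
 let ?E = "simple_extension K w"
 note sE = subringE[OF betweenD(3)[OF E(1)]]
 have "z \<in> ?E"
 proof (rule ccontr)
  assume "z \<notin> ?E"
  then obtain z' where z': "z' \<in> carrier L" "z' ~= z" "eval (Irr ?E z) z' = \<zero>"
   using exists_other_root[OF perf E(1,4) yz(2)] by blast
  obtain h where h: "hom_over (simple_extension ?E z) h" "\<forall>e\<in>?E. h e = e" "h z = z'"
   using move_to_root[OF E(1) yz(2) z'(1,3)] .
  note S = between_simple[OF E(1) yz(2)]
  note sS = subringE[OF betweenD(3)[OF S(1)]]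
  have cS: "c \<in> simple_extension ?E z" "w \<in> simple_extension ?E z"
   using S(2) E(2,3) c(1) by auto
  have czS: "c ** z \<in> simple_extension ?E z" using sS(6) cS(1) S(3) by blast
  have "y = w \<oplus> (\<ominus> (c ** z))" using yz cL by (simp add: w_def a_assoc r_neg)
  then have yS: "y \<in> simple_extension ?E z" using sS(5)[OF czS] sS(7)[OF cS(2)] by simp
  have "h w = h y \<oplus> h (c ** z)" unfolding w_def by (rule hom_overD(5)[OF h(1) yS czS])
  also have "h (c ** z) = c ** z'"
   using hom_overD(4)[OF h(1) cS(1) S(3)] hom_overD(2)[OF h(1) c(1)] h(3) by simp
  finally have eq: "y \<oplus> c ** z = h y \<oplus> c ** z'" using bspec[OF h(2) E(3)] by (simp add: w_def)
  have hy: "h y \<in> ?R y" using hom_over_conjugate[OF S(1) h(1) yS] hom_overD(3)[OF h(1) yS] by blast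
  have hz: "z' \<in> ?R z" using hom_over_conjugate[OF S(1) h(1) S(3)] h(3) z'(1) by auto
  have d: "z \<ominus> z' ~= \<zero>" using z' yz by (simp add: r_right_minus_eq)
  have dc: "z \<ominus> z' \<in> carrier L" using z' yz by simp
  have hyL: "h y \<in> carrier L" using hy by blast
  have "c ** (z \<ominus> z') = h y \<ominus> y"
  proof -
   have "c ** (z \<ominus> z') = (y \<oplus> c ** z) \<ominus> y \<ominus> c ** z'" using yz cL z'(1) by algebra
   also have "\<dots> = h y \<ominus> y" unfolding eq using yz cL z'(1) hyL by algebra
   finally show ?thesis .
  qed
  moreover have iv: "inv (z \<ominus> z') \<in> carrier L" "(z \<ominus> z') ** inv (z \<ominus> z') = \<one>"
   using d dc field_Units by auto
  ultimately have "c = (h y \<ominus> y) ** inv (z \<ominus> z')"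
   using cL dc by (metis m_assoc r_one)
  then have "c \<in> ?bad" using hy hz by (intro image_eqI[of _ _ "(h y, z')"]) auto
  then show False using c(2) by blast
 qed
 moreover from this have "y \<in> ?E"
 proof -
  assume z: "z \<in> ?E"
  have cz: "c ** z \<in> ?E" using sE(6) z E(2) c(1) by blast
  have "y = w \<oplus> (\<ominus> (c ** z))" using yz cL by (simp add: w_def a_assoc r_neg)
  then show ?thesis using sE(5)[OF cz] sE(7)[OF E(3)] by simp
 qed
 moreover have "w \<in> E" if "between E" "y \<in> E" "z \<in> E" for E
  using betweenE(6,7)[OF that(1)] that(2,3) c(1) betweenD(2)[OF that(1)]
  unfolding w_def by blast
 ultimately show ?thesis using that w by blast
qed

end

context algebraic_closure
begin

text \<open>Take an element of maximal degree; a further generator would produce a larger one.\<close>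

theorem primitive_element:
 assumes perf: "perfect" and E: "between E" "dimension n K E"
 obtains y where "y \<in> E" "E = simple_extension K y"
proof (cases "finite K")
 case True
 \<comment> \<open>Over a finite \<open>K\<close> the field \<open>E\<close> is finite, and a
   generator of its cyclic multiplicative group generates the extension.\<close>
 then have fin: "finite (carrier (sub E))" using finite_between E by simp
 interpret F: field "sub E" by (rule betweenD(6)[OF E(1)])
 obtain y where y: "y \<in> carrier (Multiplicative_Group.mult_of (sub E))" "carrier (Multiplicative_Group.mult_of (sub E)) = {y [^][sub E] i |i::nat. i \<in> UNIV}"
  using F.finite_field_mult_group_has_gen[OF fin] by (rule bexE)
 have yE: "y \<in> E" using y(1) by simp
 note S = between_simple[OF between_K betweenD(5)[OF E(1) yE]]
 note sS = subringE[OF betweenD(3)[OF S(1)]]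
 have pow: "y [^][sub E] i \<in> simple_extension K y" for i :: nat
  using sS S(3) by (induction i) auto
 have "E \<subseteq> simple_extension K y"
 proof
  fix x assume x: "x \<in> E"
  show "x \<in> simple_extension K y"
  proof (cases "x = \<zero>")
   case False
   then have "x \<in> carrier (Multiplicative_Group.mult_of (sub E))" using x by simp
   then have "x \<in> {y [^][sub E] i |i::nat. i \<in> UNIV}" unfolding y(2)[symmetric] .
   then obtain i :: nat where "x = y [^][sub E] i" by (elim CollectE exE conjE)
   then show ?thesis using pow[of i] by (simp only:)
  qed (use sS in simp)
 qed
 moreover have "simple_extension K y \<subseteq> E"
  by (rule simple_extension_least[OF between_K E(1) betweenD(2)[OF E(1)] yE])
 ultimately show ?thesis using that yE by blast
next
 case False
 define deg where "deg x = degree (Irr K x)" for x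
 have sub: "simple_extension K x \<subseteq> E" if "x \<in> E" for x
  by (rule simple_extension_least[OF between_K E(1) betweenD(2)[OF E(1)] that])
 have bound: "deg x \<le> n" if x: "x \<in> E" for x
 proof -
  note S = between_simple[OF between_K betweenD(5)[OF E(1) x]]
  obtain m where "dimension m K (simple_extension K x)" "m \<le> n"
   using subspace_dimension[OF K_sub E(2) between_subalgebra[OF between_K S(1,2)] sub[OF x]] .
  then show ?thesis using dimension_unique[OF between_K S(4)] by (simp add: deg_def)
 qed
 have "\<zero> \<in> E" using betweenE(2)[OF E(1)] .
 then have "\<exists>x. x \<in> E \<and> (\<forall>y. y \<in> E --> deg y \<le> deg x)"
  by (rule ex_has_greatest_nat[of "%x. x \<in> E" _ _ "Suc n"]) (use bound in "simp add: le_imp_less_Suc")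
 then obtain y where y: "y \<in> E" "!!x. x \<in> E ==> deg x \<le> deg y" by (elim exE conjE) simp
 have yL: "y \<in> carrier L" using betweenD(5)[OF E(1) y(1)] .
 note Y = between_simple[OF between_K yL]
 have "z \<in> simple_extension K y" if z: "z \<in> E" for z
 proof -
  have zL: "z \<in> carrier L" using betweenD(5)[OF E(1) z] .
  obtain w where w: "w \<in> carrier L" "y \<in> simple_extension K w" "z \<in> simple_extension K w"
    "\<forall>E. between E --> y \<in> E --> z \<in> E --> w \<in> E"
   using two_generators[OF perf False yL zL] .
  note W = between_simple[OF between_K w(1)]
  have wE: "w \<in> E" using w(4) E(1) y(1) z by blast
  have "simple_extension K w = simple_extension K y"
  proof -
   have inc: "simple_extension K y \<subseteq> simple_extension K w"
    by (rule simple_extension_least[OF between_K W(1,2) w(2)])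
   obtain m where m: "dimension m K (simple_extension K y)" "m \<le> degree (Irr K w)"
    "m = degree (Irr K w) ==> simple_extension K y = simple_extension K w"
    using subspace_dimension[OF K_sub W(4) between_subalgebra[OF between_K Y(1,2)] inc] by blast
   have "m = deg y" using dimension_unique[OF between_K m(1) Y(4)] by (simp add: deg_def)
   then show ?thesis using m y(2)[OF wE] by (simp add: deg_def)
  qed
  then show ?thesis using w(3) by simp
 qed
 then have "E = simple_extension K y" using sub[OF y(1)] by blast
 then show ?thesis using that y(1) by blast
qed

text \<open>Automorphisms are cut off outside \<open>F\<close>, so that they are determined by their
  values on \<open>F\<close> and the group laws hold as equations between functions.\<close>

definition gal :: "'a set => ('a => 'a) monoid" where
 "gal F = (|carrier = {h \<in> extensional F. hom_over F h \<and> h ` F = F},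
  mult = (%g h. restrict (%x. g (h x)) F), one = restrict (%x. x) F|)"

lemma hom_over_cong: "hom_over F h ==> between F ==> (!!x. x \<in> F ==> g x = h x) ==> hom_over F g"
 using subringE(3,6,7)[OF betweenD(3), of F] betweenD(2)[of F]
 unfolding hom_over_def ring_hom_def by (auto simp: Pi_iff subset_iff)

lemma gal_group:
 assumes F: "between F"
 shows "group (gal F)"
proof (rule groupI)
 have car: "h \<in> carrier (gal F) \<longleftrightarrow> h \<in> extensional F \<and> hom_over F h \<and> h ` F = F" for h
  by (simp add: gal_def)
 have mult: "g **[gal F] h = restrict (%x. g (h x)) F" for g h by (simp add: gal_def)
 have one: "\<one>[gal F] = restrict (%x. x) F" by (simp add: gal_def)
 note sF = subringE[OF betweenD(3)[OF F]]
 show "\<one>[gal F] \<in> carrier (gal F)"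
  unfolding car one using hom_over_cong[OF hom_over_id[OF F] F, of "restrict (%x. x) F"] by simp
 fix g assume g: "g \<in> carrier (gal F)"
 have gF: "g x \<in> F" if "x \<in> F" for x using g that unfolding car by auto
 show "\<one>[gal F] **[gal F] g = g"
  unfolding mult one by (rule extensionalityI[of _ F]) (use g gF car in auto)
 show "\<exists>k\<in>carrier (gal F). k **[gal F] g = \<one>[gal F]"
 proof
  let ?k = "restrict (inv_into F g) F"
  have gim: "g ` F = F" and gh: "hom_over F g" using g car by auto
  have ginj: "inj_on g F" by (rule hom_over_inj[OF F gh])
  have kF: "?k x \<in> F" "g (?k x) = x" if "x \<in> F" for x
   using that gim inv_into_into[of x g F] f_inv_into_f[of x g F] by auto
  have kg: "?k (g x) = x" if "x \<in> F" for x using that gF ginj by simp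
  have "hom_over F ?k"
   unfolding hom_over_def
  proof
   show "?k \<in> ring_hom (sub F) L"
   proof (rule ring_hom_memI)
    show "?k x \<in> carrier L" if "x \<in> carrier (sub F)" for x
     using kF(1)[of x] that betweenD(5)[OF F] by simp
    fix x y assume xy: "x \<in> carrier (sub F)" "y \<in> carrier (sub F)"
    then have k: "?k x \<in> F" "?k y \<in> F" "g (?k x) = x" "g (?k y) = y" using kF by auto
    have "?k (g (?k x ** ?k y)) = ?k x ** ?k y" by (rule kg[OF sF(6)[OF k(1,2)]])
    then show "?k (x **[sub F] y) = ?k x ** ?k y"
     unfolding hom_overD(4)[OF gh k(1,2)] k by simp
    have "?k (g (?k x \<oplus> ?k y)) = ?k x \<oplus> ?k y" by (rule kg[OF sF(7)[OF k(1,2)]])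
    then show "?k (x \<oplus>[sub F] y) = ?k x \<oplus> ?k y"
     unfolding hom_overD(5)[OF gh k(1,2)] k by simp
   next
    show "?k \<one>[sub F] = \<one>"
     using kg[OF sF(3)] hom_overD(2)[OF gh, of \<one>] betweenE(3)[OF between_K] by simp
   qed
   show "\<forall>x\<in>K. ?k x = x"
   proof
    fix x assume x: "x \<in> K"
    have "x \<in> F" using x betweenD(2)[OF F] by blast
    then show "?k x = x" using kg[of x] hom_overD(2)[OF gh x] by simp
   qed
  qed
  moreover have "?k ` F = F"
  proof
   show "?k ` F \<subseteq> F" using kF(1) by blast
   show "F \<subseteq> ?k ` F"
   proof
    fix x assume x: "x \<in> F"
    show "x \<in> ?k ` F" by (rule image_eqI[of _ _ "g x"]) (rule kg[OF x, symmetric], rule gF[OF x])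
   qed
  qed
  ultimately show "?k \<in> carrier (gal F)" unfolding car by simp
  show "?k **[gal F] g = \<one>[gal F]"
   unfolding mult one by (rule extensionalityI[of _ F]) (use kg in auto)
 qed
 fix h assume h: "h \<in> carrier (gal F)"
 have hF: "h x \<in> F" if "x \<in> F" for x using h that unfolding car by auto
 have "hom_over F (%x. g (h x))"
  by (rule hom_over_comp) (use g h hF car in auto)
 then have "hom_over F (restrict (%x. g (h x)) F)" by (rule hom_over_cong[OF _ F]) simp
 moreover have "restrict (%x. g (h x)) F ` F = F"
 proof -
  have "restrict (%x. g (h x)) F ` F = g ` (h ` F)" by auto
  then show ?thesis using g h car by simp
 qed
 ultimately show "g **[gal F] h \<in> carrier (gal F)" unfolding car mult by simp
 fix k assume k: "k \<in> carrier (gal F)"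
 have kF: "k x \<in> F" if "x \<in> F" for x using k that unfolding car by auto
 show "g **[gal F] h **[gal F] k = g **[gal F] (h **[gal F] k)"
  unfolding mult by (rule extensionalityI[of _ F]) (use kF in auto)
qed

text \<open>\<open>p ^ a\<close> is any power of \<open>p\<close> dividing the degree, and
  \<open>E\<close> is the fixed field of a subgroup of that order. The full power gives
  \<open>E\<close> of degree prime to \<open>p\<close>; if \<open>N\<close> is a power of
  \<open>p\<close>, one factor less gives degree \<open>p\<close>; and \<open>a = 1\<close> makes
  \<open>F\<close> of degree \<open>p\<close> over \<open>E\<close>. All three are used.\<close>

theorem galois_sylow:
 assumes perf: "perfect" and F: "between F" "dimension N K F"
  and nrm: "\<forall>h. hom_over F h --> h ` F \<subseteq> F"
  and p: "prime p" "N = p ^ a * m"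
 obtains E where "between E" "E \<subseteq> F" "dimension m K E" "dimension (p ^ a) E F"
proof -
 have normal: "h x \<in> F" if "hom_over F h" "x \<in> F" for h x using nrm that by blast
 obtain y where y: "y \<in> F" "F = simple_extension K y" using primitive_element[OF perf F] .
 have yL: "y \<in> carrier L" using betweenD(5)[OF F(1) y(1)] .
 have car: "h \<in> carrier (gal F) \<longleftrightarrow> h \<in> extensional F \<and> hom_over F h \<and> h ` F = F" for h
  by (simp add: gal_def)
 interpret G: group "gal F" by (rule gal_group[OF F(1)])
 have inj: "inj_on (%h. h y) (carrier (gal F))"
 proof (rule inj_onI)
  fix h g assume hg: "h \<in> carrier (gal F)" "g \<in> carrier (gal F)" "h y = g y"
  have hh: "hom_over F h" "hom_over F g" using hg car by auto
  show "h = g"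
  proof (rule extensionalityI[of _ F])
   show "h x = g x" if "x \<in> F" for x
    by (rule hom_over_agree[where h = h and g = g, OF between_K yL, folded y(2), OF hh _ hg(3) that])
     (simp add: hom_overD(2)[OF hh(1)] hom_overD(2)[OF hh(2)])
  qed (use hg car in auto)
 qed
 have roots: "(%h. h y) ` carrier (gal F) \<subseteq> {x \<in> carrier L. eval (Irr K y) x = \<zero>}"
  using hom_over_conjugate[OF F(1) _ y(1)] hom_overD(3)[OF _ y(1)] car by auto
 have finO: "finite ((%h. h y) ` carrier (gal F))" using roots conjugates_finite[OF yL] finite_subset by blast
 have finG: "finite (carrier (gal F))" using finO inj finite_imageD by blast
 have fixed: "between {x \<in> F. \<forall>h\<in>H. h x = x}" "dimension (card H) {x \<in> F. \<forall>h\<in>H. h x = x} F"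
  if H: "subgroup H (gal F)" for H
 proof -
  interpret H: subgroup H "gal F" by (rule H)
  let ?O = "(%h. h y) ` H"
  have HG: "H \<subseteq> carrier (gal F)" by (rule H.subset)
  have 1: "\<forall>h\<in>H. hom_over F h \<and> h ` F \<subseteq> F" using HG car by blast
  have 2: "finite ?O" using finO HG by (meson finite_subset image_mono)
  have 3: "y \<in> ?O"
  proof (rule image_eqI)
   show "y = \<one>[gal F] y" using y(1) by (simp add: gal_def)
  qed (rule H.one_closed)
  have 4: "\<forall>h\<in>H. h ` ?O \<subseteq> ?O"
  proof (intro ballI subsetI)
   fix h x assume h: "h \<in> H" "x \<in> h ` ?O"
   then obtain g where g: "g \<in> H" "x = h (g y)" by blast
   have "x = (h **[gal F] g) y" using y(1) g(2) by (simp add: gal_def)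
   then show "x \<in> ?O" using H.m_closed[OF h(1) g(1)] by blast
  qed
  have "card ?O = card H" using card_image[OF inj_on_subset[OF inj HG]] .
  then show "between {x \<in> F. \<forall>h\<in>H. h x = x}" "dimension (card H) {x \<in> F. \<forall>h\<in>H. h x = x} F"
   using orbit_degree[where H = H and Orb = ?O, OF F(1) y(2) yL 1 2 3 order_refl 4] by auto
 qed
 let ?G = "carrier (gal F)"
 \<comment> \<open>An element outside \<open>K\<close> is moved to another conjugate by an embedding
   of \<open>K(x)\<close>. It extends over the generator \<open>y\<close>, and normality makes its
   restriction to \<open>F\<close> an automorphism.\<close>
 have "x \<in> K" if x: "x \<in> F" "\<forall>h\<in>?G. h x = x" for x
 proof (rule ccontr)
  assume xK: "x \<notin> K"
  have xL: "x \<in> carrier L" using betweenD(5)[OF F(1) x(1)] .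
  obtain x' where x': "x' \<in> carrier L" "x' ~= x" "eval (Irr K x) x' = \<zero>"
   using exists_other_root[OF perf between_K dimension_one[OF K_sub] xL xK] by blast
  obtain h where h: "hom_over (simple_extension K x) h" "h x = x'"
   using move_to_root[OF between_K xL x'(1,3)] by metis
  note S = between_simple[OF between_K xL]
  obtain h' where h': "hom_over (simple_extension (simple_extension K x) y) h'"
   "\<forall>e\<in>simple_extension K x. h' e = h e"
   using extend_hom_over[OF S(1) h(1) yL] .
  note T = between_simple[OF S(1) yL]
  have "K \<subseteq> simple_extension (simple_extension K x) y" using betweenD(2)[OF T(1)] .
  then have "simple_extension K y \<subseteq> simple_extension (simple_extension K x) y"
   by (rule simple_extension_least[OF between_K T(1) _ T(3)])
  then have hF: "hom_over F h'" unfolding y(2)[symmetric] by (rule hom_over_mono[OF h'(1)])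
  have r: "hom_over F (restrict h' F)" by (rule hom_over_cong[OF hF F(1)]) simp
  have "restrict h' F ` F = F" by (rule hom_over_onto[OF F(1) r _ F(2)]) (use normal[OF hF] in simp)
  then have "restrict h' F \<in> ?G" using r car by simp
  then have "restrict h' F x = x" using x(2) by blast
  then have "h' x = x" using x(1) by simp
  then show False using bspec[OF h'(2) S(3)] h(2) x'(2) by simp
 qed
 moreover have "h x = x" if "h \<in> ?G" "x \<in> K" for h x
 proof -
  have "hom_over F h" using that(1) car by simp
  then show ?thesis by (rule hom_overD(2)[OF _ that(2)])
 qed
 ultimately have "{x \<in> F. \<forall>h\<in>?G. h x = x} = K" using betweenD(2)[OF F(1)] by auto
 then have "dimension (card ?G) K F" using fixed(2)[OF G.subgroup_self] by simp
 then have "order (gal F) = p ^ a * m"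
  using dimension_unique[OF between_K _ F(2)] p(2) by (simp add: order_def)
 then obtain H where H: "subgroup H (gal F)" "card H = p ^ a"
  using sylow_thm[OF p(1) G.is_group _ finG] by blast
 let ?E = "{x \<in> F. \<forall>h\<in>H. h x = x}"
 have EF: "?E \<subseteq> F" by blast
 obtain m' l where ml: "dimension m' K ?E" "dimension l ?E F" "N = m' * l"
  using degree_tower[OF fixed(1)[OF H(1)] F(1) EF F(2)] .
 have "l = p ^ a" using dimension_unique[OF fixed(1)[OF H(1)] ml(2) fixed(2)[OF H(1)]] H(2) by simp
 then have "m' = m" using ml(3) p(2) prime_gt_0_nat[OF p(1)] by simp
 then show ?thesis using that[OF fixed(1)[OF H(1)] EF] ml(1,2) \<open>l = p ^ a\<close> by simp
qed

end

section \<open>Base fields all of whose proper extensions have degree divisible by a fixed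
  prime\<close>

context algebraic_closure
begin

lemma normal_over:
 assumes z: "z \<in> carrier L"
 obtains F N where "between F" "dimension N K F" "z \<in> F" "\<forall>h. hom_over F h --> h ` F \<subseteq> F"
proof -
 note I = Irr_props[OF between_K z]
 obtain zs where zs: "set zs \<subseteq> carrier L" "Irr K z = pl L zs" using exists_pl[OF I(5,4,2)] by blast
 obtain F N where F: "between F" "dimension N K F" "set zs \<subseteq> F"
  "\<forall>h F'. hom_over F h --> between F' --> h ` set zs \<subseteq> F' --> h ` F \<subseteq> F'"
  using normal_closure[OF zs(1)] by (elim exE conjE)
 have mem: "x \<in> set zs \<longleftrightarrow> x \<in> carrier L \<and> eval (Irr K z) x = \<zero>" for x
  using pl_eval_zero[OF zs(1)] zs by auto
 have zF: "z \<in> F" using mem[of z] I(3) z F(3) by auto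
 have "h ` F \<subseteq> F" if h: "hom_over F h" for h
 proof -
  have "h ` set zs \<subseteq> set zs"
  proof
   fix x assume "x \<in> h ` set zs"
   then obtain u where u: "u \<in> set zs" "x = h u" by blast
   have uF: "u \<in> F" using u F(3) by blast
   have "eval (Irr K z) (h u) = \<zero>"
    by (rule hom_over_root[OF F(1) h uF I(1)]) (use u mem in simp)
   then show "x \<in> set zs" using mem hom_overD(3)[OF h uF] u(2) by simp
  qed
  then have "h ` set zs \<subseteq> F" using F(3) by blast
  then show ?thesis using F(4) h F(1) by blast
 qed
 then show ?thesis using that F(1,2) zF by blast
qed

context
 fixes p :: nat
 assumes perf: "perfect" and p: "prime p"
  and dvd_degrees: "!!E n. between E ==> dimension n K E ==> n ~= 1 ==> p dvd n"
begin

text \<open>The fixed field of a Sylow subgroup for \<open>p\<close> has degree prime to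
  \<open>p\<close> over \<open>K\<close>, hence is \<open>K\<close>.\<close>

lemma normal_degree:
 assumes F: "between F" "dimension N K F" "\<forall>h. hom_over F h --> h ` F \<subseteq> F"
 obtains a where "N = p ^ a"
proof -
 have N0: "N > 0" by (rule degree_pos[OF between_K F(1,2)])
 obtain m where m: "N = p ^ multiplicity p N * m" "\<not> p dvd m"
  using multiplicity_decompose'[of N p] N0 p by (metis not_prime_unit less_numeral_extra(3))
 obtain E where E: "between E" "dimension m K E"
  using galois_sylow[OF perf F p m(1)] by metis
 have "m = 1" using dvd_degrees[OF E] m(2) by blast
 then show ?thesis using that m(1) by simp
qed

theorem prime_power_degrees:
 assumes E: "between E" "dimension n K E"
 obtains k where "n = p ^ k"
proof -
 obtain z where z: "z \<in> E" "E = simple_extension K z" using primitive_element[OF perf E] .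
 obtain F N where F: "between F" "dimension N K F" "z \<in> F" "\<forall>h. hom_over F h --> h ` F \<subseteq> F"
  using normal_over[OF betweenD(5)[OF E(1) z(1)]] .
 obtain a where a: "N = p ^ a" using normal_degree[OF F(1,2,4)] .
 have "E \<subseteq> F" unfolding z(2) by (rule simple_extension_least[OF between_K F(1) betweenD(2)[OF F(1)] F(3)])
 then obtain m l where "dimension m K E" "N = m * l" using degree_tower[OF E(1) F(1) _ F(2)] by metis
 then have "n dvd p ^ a" using dimension_unique[OF between_K E(2)] a by auto
 then show ?thesis using that divides_primepow_nat[OF p] by blast
qed

theorem exists_prime_degree:
 assumes "K ~= carrier L"
 obtains y where "y \<in> carrier L" "y \<notin> K" "dimension p K (simple_extension K y)"
proof -
 obtain z where z: "z \<in> carrier L" "z \<notin> K" using assms betweenD(4)[OF between_K] by blast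
 obtain F N where F: "between F" "dimension N K F" "z \<in> F" "\<forall>h. hom_over F h --> h ` F \<subseteq> F"
  using normal_over[OF z(1)] .
 obtain a where a: "N = p ^ a" using normal_degree[OF F(1,2,4)] .
 have "a ~= 0"
 proof
  assume "a = 0"
  then have "K = F" using degree_one[OF between_K F(1) betweenD(2)[OF F(1)]] F(2) a by simp
  then show False using z F(3) by simp
 qed
 then have N: "N = p ^ (a - 1) * p" using a by (cases a) auto
 obtain M where M: "between M" "dimension p K M"
  using galois_sylow[OF perf F(1,2,4) p N] by metis
 obtain y where y: "y \<in> M" "M = simple_extension K y" using primitive_element[OF perf M] .
 have "y \<notin> K"
 proof
  assume "y \<in> K"
  then have "M = K" using simple_extension_least[OF between_K between_K order_refl] y(2) betweenD(2)[OF M(1)] by blast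
  then have "p = 1" using dimension_unique[OF between_K M(2)] dimension_one[OF K_sub] by simp
  then show False using p by simp
 qed
 then show ?thesis using that betweenD(5)[OF M(1) y(1)] y(2) M(2) by blast
qed

text \<open>A second conjugate \<open>y'\<close> of \<open>y\<close> is a root of the minimal
  polynomial divided by \<open>X - y\<close>, so its degree over \<open>K(y)\<close> is less than
  \<open>p\<close>. This degree is also a power of \<open>p\<close>, so \<open>y'\<close> lies in
  \<open>K(y)\<close>, and sending \<open>y\<close> to \<open>y'\<close> is an automorphism.\<close>

theorem exists_cyclic:
 assumes "K ~= carrier L"
 obtains y s where "y \<in> carrier L" "dimension p K (simple_extension K y)"
  "hom_over (simple_extension K y) s" "s ` simple_extension K y \<subseteq> simple_extension K y" "s y ~= y"
proof -
 obtain y where y: "y \<in> carrier L" "y \<notin> K" "dimension p K (simple_extension K y)"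
  using exists_prime_degree[OF assms] .
 let ?M = "simple_extension K y"
 note M = between_simple[OF between_K y(1)]
 obtain y' where y': "y' \<in> carrier L" "y' ~= y" "eval (Irr K y) y' = \<zero>"
  using exists_other_root[OF perf between_K dimension_one[OF K_sub] y(1,2)] by blast
 obtain s where s: "hom_over ?M s" "s y = y'"
  using move_to_root[OF between_K y(1) y'(1,3)] by metis
 note I = Irr_props[OF between_K y(1)] and J = Irr_props[OF M(1) y(1)]
 have dp: "degree (Irr K y) = p" using dimension_unique[OF between_K M(4) y(3)] .
 obtain q where q: "q \<in> carrier (?M[X][L])" "Irr K y = Irr ?M y **[poly_ring L] q"
  using Irr_dvd[OF M(1) y(1) poly_sub_mono[OF M(2) I(1)] I(3)] .
 have qL: "q \<in> carrier (poly_ring L)" by (rule poly_sub_mono[OF betweenD(4)[OF M(1)] q(1)])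
 note f = degree_mono_factor[OF q(2) J(5) qL I(4,2) J(2)]
 have J1: "degree (Irr ?M y) = 1" by (rule J(8)[OF M(3)])
 have ne: "eval (Irr ?M y) y' ~= \<zero>"
 proof
  assume z: "eval (Irr ?M y) y' = \<zero>"
  obtain ys where ys: "set ys \<subseteq> carrier L" "Irr ?M y = pl L ys" using exists_pl[OF J(5,4,2)] by blast
  have "length ys = 1" using pl_closed(4)[OF ys(1)] ys(2) J1 by simp
  moreover have "y \<in> set ys" "y' \<in> set ys" using pl_eval_zero[OF ys(1)] ys(2) J(3) z y(1) y'(1) by auto
  ultimately show False using y'(2) by (cases ys) auto
 qed
 have "eval (Irr ?M y) y' ** eval q y' = \<zero>" using eval_mult[OF J(5) qL y'(1)] q(2) y'(3) by simp
 then have "eval q y' = \<zero>"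
  using ne integral[of "eval (Irr ?M y) y'" "eval q y'"]
   eval_in_carrier[OF poly_set[OF J(5)] y'(1)] eval_in_carrier[OF poly_set[OF qL] y'(1)] by blast
 then have "degree (Irr ?M y') \<le> degree q" by (rule Irr_degree_le[OF M(1) y'(1) q(1) _ f(1)])
 then have lt: "degree (Irr ?M y') < p" using f(3) dp J1 by simp
 note M' = between_simple[OF M(1) y'(1)]
 have "dimension (p * degree (Irr ?M y')) K (simple_extension ?M y')"
  by (rule telescopic_base[OF K_sub betweenD(1)[OF M(1)] y(3) M'(4)])
 then obtain k where k: "p * degree (Irr ?M y') = p ^ k" using prime_power_degrees[OF M'(1)] by metis
 have p1: "p > 1" using p prime_gt_1_nat by blast
 have "k ~= 0" using k p1 by (intro notI) (auto simp: nat_mult_eq_1_iff)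
 then have d: "degree (Irr ?M y') = p ^ (k - 1)" using k p1 by (cases k) auto
 have "k - 1 = 0"
 proof (rule ccontr)
  assume "k - 1 ~= 0"
  then have "p ^ 1 \<le> p ^ (k - 1)" using p1 by (intro power_increasing) auto
  then show False using lt d by simp
 qed
 then have "degree (Irr ?M y') = 1" using d by simp
 then have "y' \<in> ?M" using Irr_props(7)[OF M(1) y'(1)] by fastforce
 have "s ` ?M \<subseteq> ?M"
 proof
  fix x assume "x \<in> s ` ?M"
  then obtain u where u: "u \<in> ?M" "x = s u" by blast
  have "s u \<in> ?M"
   by (rule hom_over_simple_image[OF between_K y(1) s(1) M(1) _ _ u(1)])
    (use s(2) \<open>y' \<in> ?M\<close> hom_overD(2)[OF s(1)] M(2) in auto)
  then show "x \<in> ?M" using u(2) by simp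
 qed
 then show ?thesis using that y(1,3) s y'(2) by blast
qed

end

end

subsection \<open>Radicals and norms\<close>

context ring
begin

text \<open>The list of \<open>n\<close> ones is \<open>1 + X + ... + X^(n-1)\<close>. In a field
  where \<open>n\<close> is nonzero, its roots are the \<open>n\<close>-th roots of unity other than
  \<open>1\<close>.\<close>

lemma eval_replicate_one:
 assumes "x \<in> carrier R"
 shows "eval (replicate n \<one>) x ** (x \<ominus> \<one>) = x [^] n \<ominus> \<one>"
proof (induction n)
 case 0
 then show ?case using assms by (simp add: minus_eq r_neg)
next
 case (Suc n)
 have c: "eval (replicate n \<one>) x \<in> carrier R" by (rule eval_in_carrier) (use assms in auto)
 have "eval (replicate (Suc n) \<one>) x ** (x \<ominus> \<one>) = x [^] n ** (x \<ominus> \<one>) \<oplus> eval (replicate n \<one>) x ** (x \<ominus> \<one>)"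
  using c assms by (simp add: l_distr)
 also have "\<dots> = x [^] n ** (x \<ominus> \<one>) \<oplus> (x [^] n \<ominus> \<one>)" using Suc by simp
 also have "\<dots> = x [^] Suc n \<ominus> \<one>"
 proof -
  have "u ** (x \<ominus> \<one>) \<oplus> (u \<ominus> \<one>) = u ** x \<ominus> \<one>" if "u \<in> carrier R" for u
  proof -
   have "u ** (x \<ominus> \<one>) = u ** x \<ominus> u" using that assms by (simp add: minus_eq r_distr r_minus)
   moreover have "u ** x \<ominus> u \<oplus> (u \<ominus> \<one>) = u ** x \<ominus> \<one>" using that assms by algebra
   ultimately show ?thesis by simp
  qed
  then show ?thesis using assms by simp
 qed
 finally show ?case .
qed

lemma eval_one_replicate_one: "eval (replicate n \<one>) \<one> = add_pow R n \<one>"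
 by (induction n) (simp_all add: a_comm)

end

context field
begin

lemma nrm_closed:
 assumes "!!x. x \<in> S ==> s x \<in> S" "b \<in> S" "subring S R"
 shows "nrm R s b i \<in> S"
 using subringE(3,6)[OF assms(3)] assms(1,2) by (induction i) auto

lemma pow_nonzero: "x \<in> carrier R ==> x ~= \<zero> ==> x [^] (n :: nat) ~= \<zero>"
 by (induction n) (auto simp: integral_iff)

lemma replicate_one_poly: "replicate (Suc n) \<one> \<in> carrier (poly_ring R)"
 unfolding poly_carrier by auto

definition pure :: "nat => 'a => 'a list" where
 "pure n c = \<one> # replicate (n - 1) \<zero> @ [\<ominus> c]"

lemma pure_props:
 assumes "n > 0" "c \<in> carrier R" "x \<in> carrier R"
 shows "pure n c \<in> carrier (poly_ring R)" "degree (pure n c) = n" "lead_coeff (pure n c) = \<one>"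
  "eval (pure n c) x = x [^] n \<ominus> c" "pure n c ~= []"
proof -
 show "pure n c \<in> carrier (poly_ring R)"
  using assms unfolding poly_carrier pure_def by auto
 show "degree (pure n c) = n" using assms by (simp add: pure_def)
 have e: "eval (replicate m \<zero> @ [\<ominus> c]) x = \<ominus> c" for m
  using assms by (induction m) auto
 show "eval (pure n c) x = x [^] n \<ominus> c"
  using assms e[of "n - 1"] by (simp add: pure_def minus_eq)
qed (simp_all add: pure_def)

end

context algebraic_closure
begin

text \<open>Lets every result with base \<open>K\<close> be applied with an intermediate field as
  base.\<close>

lemma closure_between: "between E ==> algebraic_closure L E"
 by (intro algebraic_closure.intro algebraic_closure_axioms.intro field_axioms betweenD(1) between_alg
   roots_over_carrier poly_sub_mono[OF betweenD(4)])

lemma pure_mem: "between E ==> c \<in> E ==> pure n c \<in> carrier (E[X][L])"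
 using subringE(2,3,5)[OF betweenD(3)] unfolding poly_carrier pure_def by auto

lemma exists_unity_root:
 assumes p: "prime p" and c: "add_pow L (p::nat) \<one> ~= \<zero>"
 obtains zt where "zt \<in> carrier L" "zt ~= \<one>" "zt [^] p = \<one>"
proof -
 have p1: "p > 1" using p prime_gt_1_nat by blast
 then obtain n where n: "p = Suc n" "n > 0" by (cases p) auto
 have "\<exists>ys. set ys \<subseteq> carrier L \<and> replicate p \<one> = pl L ys"
  by (rule exists_pl) (use replicate_one_poly[of n] in "simp_all add: n(1)")
 then obtain ys where ys: "set ys \<subseteq> carrier L" "replicate p \<one> = pl L ys" by blast
 have "length ys = n" using pl_closed(4)[OF ys(1)] ys(2) n by (metis diff_Suc_1 length_replicate)
 then obtain z where z: "z \<in> set ys" using n(2) by (cases ys) auto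
 have zL: "z \<in> carrier L" using z ys(1) by blast
 have e: "eval (replicate p \<one>) z = \<zero>" using pl_eval_zero[OF ys(1) zL] z ys(2) by simp
 have "z [^] p \<ominus> \<one> = \<zero>" using eval_replicate_one[OF zL, of p] e zL by simp
 then have "z [^] p = \<one>" using zL by (simp add: r_right_minus_eq)
 moreover have "z ~= \<one>" using e eval_one_replicate_one[of p] c by metis
 ultimately show ?thesis using that zL by blast
qed

text \<open>Each root of the minimal polynomial is \<open>x\<close> times a root of unity in
  \<open>E\<close>, so its constant term puts \<open>x^d\<close> into \<open>E\<close>, where
  \<open>d\<close> is the degree. If \<open>d < p\<close>, then \<open>d\<close> and
  \<open>p\<close> are coprime, and \<open>x\<close> itself would lie in \<open>E\<close>.\<close>

lemma degree_radical:
 assumes E: "between E" and p: "prime (p::nat)" and x: "x \<in> carrier L" "x \<notin> E" "x [^] p \<in> E"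
  and unity: "!!r. r \<in> carrier L ==> r [^] p = \<one> ==> r \<in> E"
 shows "degree (Irr E x) = p" "Irr E x = pure p (x [^] p)"
proof -
 note sE = subringE[OF betweenD(3)[OF E]]
 have p0: "p > 0" using p prime_gt_0_nat by blast
 have x0: "x ~= \<zero>" using x(2) sE(2) by blast
 note I = Irr_props[OF E x(1)]
 let ?f = "pure p (x [^] p)"
 have cL: "x [^] p \<in> carrier L" using x by simp
 note f = pure_props[OF p0 cL]
 have fx: "eval ?f x = \<zero>" using f(4)[OF x(1)] x(1) by (simp add: r_right_minus_eq)
 obtain q where q: "q \<in> carrier (E[X][L])" "?f = Irr E x **[poly_ring L] q"
  using Irr_dvd[OF E x(1) pure_mem[OF E x(3)] fx] .
 have qL: "q \<in> carrier (poly_ring L)" by (rule poly_sub_mono[OF betweenD(4)[OF E] q(1)])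
 note dm = degree_mono_factor[OF q(2) I(5) qL f(5)[OF x(1)] f(3)[OF x(1)] I(2)]
 define d where "d = degree (Irr E x)"
 have dp: "d \<le> p" using dm(3) f(2)[OF x(1)] d_def by simp
 obtain ys where ys: "set ys \<subseteq> carrier L" "Irr E x = pl L ys" using exists_pl[OF I(5,4,2)] by blast
 have len: "length ys = d" using pl_closed(4)[OF ys(1)] ys(2) d_def by simp
 have xi: "inv x \<in> carrier L" "inv x ** x = \<one>" using x0 x(1) field_Units by auto
 have root: "y ** inv x \<in> E" if y: "y \<in> set ys" for y
 proof -
  have yL: "y \<in> carrier L" using y ys by blast
  have "eval (Irr E x) y = \<zero>" using pl_eval_zero[OF ys(1) yL] y ys(2) by simp
  then have "eval ?f y = \<zero>"
   using q(2) eval_mult[OF I(5) qL yL] eval_in_carrier[OF poly_set[OF qL] yL] by simp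
  then have yp: "y [^] p = x [^] p" using f(4)[OF yL] yL x(1) by (simp add: r_right_minus_eq)
  have "(y ** inv x) [^] p = y [^] p ** inv x [^] p" using yL xi by (simp add: nat_pow_distrib)
  also have "\<dots> = (inv x ** x) [^] p" using yp x(1) xi(1) by (simp add: nat_pow_distrib m_comm)
  finally show ?thesis using unity[of "y ** inv x"] yL xi by simp
 qed
 have prod: "\<exists>u\<in>E. u ~= \<zero> \<and> foldr (%y c. \<ominus> y ** c) zs \<one> = u ** x [^] length zs"
  if "set zs \<subseteq> set ys" "\<zero> \<notin> set zs" for zs
  using that
 proof (induction zs)
  case Nil
  show ?case using sE(3) by (intro bexI[of _ \<one>]) auto
 next
  case (Cons z zs)
  then obtain u where u: "u \<in> E" "u ~= \<zero>" "foldr (%y c. \<ominus> y ** c) zs \<one> = u ** x [^] length zs" by auto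
  have zL: "z \<in> carrier L" "z ~= \<zero>" using Cons(2,3) ys by auto
  have uL: "u \<in> carrier L" using u betweenD(5)[OF E] by blast
  let ?v = "\<ominus> (z ** inv x) ** u"
  have v: "?v \<in> E" using root[of z] Cons(2) u(1) sE(5,6) by simp
  have zz: "z = z ** inv x ** x" using zL xi x(1) by (simp add: m_assoc)
  have "?v ~= \<zero>"
  proof
   assume "?v = \<zero>"
   then have "\<ominus> (z ** inv x) = \<zero>" using integral[of "\<ominus> (z ** inv x)" u] u(2) uL zL xi by auto
   moreover have "z ** inv x = \<ominus> (\<ominus> (z ** inv x))" using zL xi by simp
   ultimately have "z ** inv x = \<zero>" by simp
   then show False using zz zL x(1) by simp
  qed
  moreover have "\<ominus> z ** (u ** x [^] length zs) = ?v ** x [^] Suc (length zs)"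
  proof -
   have "\<ominus> (z ** inv x ** x) ** (u ** w) = \<ominus> (z ** inv x) ** u ** (w ** x)" if "w \<in> carrier L" for w
    using zL xi x(1) uL that by algebra
   then show ?thesis using zz x(1) by simp
  qed
  ultimately show ?case using v u(3) by (intro bexI[of _ ?v]) auto
 qed
 have nz: "\<zero> \<notin> set ys"
 proof
  assume "\<zero> \<in> set ys"
  then have "eval (Irr E x) \<zero> = \<zero>" using pl_eval_zero[OF ys(1), of \<zero>] ys(2) by simp
  then have "eval ?f \<zero> = \<zero>"
   using q(2) eval_mult[OF I(5) qL, of \<zero>] eval_in_carrier[OF poly_set[OF qL], of \<zero>] by simp
  then have "\<zero> = x [^] p" using f(4)[of \<zero>] x(1) p0 by (simp add: r_right_minus_eq nat_pow_zero)
  then show False using x0 x(1) by (metis pow_nonzero)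
 qed
 obtain u where u: "u \<in> E" "u ~= \<zero>" "const_term (Irr E x) = u ** x [^] d"
  using prod[of ys] nz const_term_pl[OF ys(1)] ys(2) len by auto
 have "const_term (Irr E x) \<in> E"
  using const_term_simprules_shell(1)[OF betweenD(3)[OF E] I(1)] .
 then have xd: "x [^] d \<in> E" using between_cancel[OF E u(1,2)] u(3) x(1) by simp
 have pow: "z [^] n \<in> E" if "z \<in> E" for z and n :: nat
  using sE(3,6) that by (induction n) auto
 have "d = p"
 proof (rule ccontr)
  assume "d ~= p"
  moreover have "d > 0" using I(6) d_def by simp
  ultimately have "\<not> p dvd d" using dp by (auto dest: dvd_imp_le)
  then have "coprime d p" using prime_imp_coprime[OF p] by (simp add: coprime_commute)
  then obtain i j where ij: "d * i = p * j + 1" using bezout_nat[of d p] \<open>d > 0\<close>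
   by (metis coprime_imp_gcd_eq_1 not_gr_zero)
  have "x [^] (d * i) \<in> E" using pow[OF xd, of i] x(1) by (simp add: nat_pow_pow)
  moreover have "x [^] (d * i) = (x [^] p) [^] j ** x" using ij x(1) by (simp add: nat_pow_pow)
  moreover have "(x [^] p) [^] j \<in> E" "(x [^] p) [^] j ~= \<zero>"
   using pow[OF x(3)] x0 x(1) by (auto simp: pow_nonzero)
  ultimately show False using between_cancel[OF E, of "(x [^] p) [^] j" x] x(1,2) by simp
 qed
 then show 1: "degree (Irr E x) = p" by (simp add: d_def)
 then have "degree q = 0" using dm(3) f(2)[OF x(1)] by simp
 then have q1: "q = [\<one>]" using dm(1,2) by (cases q) auto
 interpret P: cring "poly_ring L" by (rule poly_ring_cring)
 show "Irr E x = pure p (x [^] p)"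
  using q(2) P.r_one[OF I(5)] unfolding q1 by (simp add: univ_poly_one)
qed

end

lemma nrm_consistent: "nrm (R(|carrier := S|)) s b i = nrm R s b i"
 by (induction i) simp_all

context algebraic_closure
begin

lemma hom_over_ring_hom: "between F ==> hom_over F s ==> s ` F \<subseteq> F ==> s \<in> ring_hom (sub F) (sub F)"
 using hom_overD(1)[of F s] unfolding ring_hom_def by auto

lemma cyclic_algebra_sub:
 assumes y: "y \<in> carrier L" and F: "F = simple_extension K y" "dimension q K F" "prime q"
  and s: "hom_over F s" "s ` F \<subseteq> F" "s y ~= y" and a: "a \<in> K" "a ~= \<zero>"
 shows "cyclic_algebra (sub F) K s q a y"
proof -
 have Fb: "between F" and yF: "y \<in> F" unfolding F(1) using between_simple[OF between_K y] by auto
 note Fp = betweenD[OF Fb]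
 interpret Fr: field "sub F" by (rule Fp(6))
 have s': "s x \<in> F" if "x \<in> F" for x using s(2) that by blast
 note c = cyclic_prime_degree[OF y F s(1) s' s(3)]
 show ?thesis
 proof (intro cyclic_algebra.intro cyclic_algebra_axioms.intro Fr.field_axioms F(3))
  show "subfield K (sub F)" using Fr.subfield_iff(1)[of K] betweenD(6)[OF between_K] Fp(2) by simp
  show "s \<in> ring_hom (sub F) (sub F)" by (rule hom_over_ring_hom[OF Fb s(1,2)])
  show "s x = x \<longleftrightarrow> x \<in> K" if "x \<in> carrier (sub F)" for x using c(2) that by simp
  show "(s ^^ q) x = x" if "x \<in> carrier (sub F)" for x using c(1) that by simp
  show "Fr.dimension q K (carrier (sub F))" using F(2) dimension_consistent[OF Fp(3) K_sub Fp(2)] by simp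
  show "inj_on (%i. (s ^^ i) y) {..<q}" by (rule c(3))
 qed (use a yF in simp_all)
qed

lemma hom_over_nrm:
 assumes F: "between F" and h: "hom_over F h" "h ` F \<subseteq> F" and s: "hom_over F s" "s ` F \<subseteq> F"
  and comm: "!!x. x \<in> F ==> h (s x) = s (h x)" and b: "b \<in> F"
 shows "h (nrm L s b i) = nrm L s (h b) i"
proof (induction i)
 case 0
 show ?case using hom_overD(2)[OF h(1)] betweenE(3)[OF between_K] by simp
next
 case (Suc i)
 have n: "nrm L s b i \<in> F" by (rule nrm_closed[OF _ b betweenD(3)[OF F]]) (use s(2) in blast)
 then have sn: "s (nrm L s b i) \<in> F" using s(2) by blast
 show ?case using hom_overD(4)[OF h(1) sn b] comm[OF n] Suc by simp
qed

lemma nrm_mult: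
 assumes F: "between F" and s: "hom_over F s" "s ` F \<subseteq> F" and bc: "b \<in> F" "c \<in> F"
 shows "nrm L s (b ** c) i = nrm L s b i ** nrm L s c i"
proof (induction i)
 case (Suc i)
 have n: "nrm L s z i \<in> F" if "z \<in> F" for z by (rule nrm_closed[OF _ that betweenD(3)[OF F]]) (use s(2) in blast)
 then have sn: "s (nrm L s z i) \<in> carrier L" if "z \<in> F" for z using s(2) that betweenD(5)[OF F] by blast
 have "s (nrm L s (b ** c) i) = s (nrm L s b i) ** s (nrm L s c i)"
  unfolding Suc by (rule hom_overD(4)[OF s(1) n[OF bc(1)] n[OF bc(2)]])
 then show ?case using sn[OF bc(1)] sn[OF bc(2)] bc betweenD(5)[OF F] by (simp add: m_ac)
qed simp

text \<open>\<open>alt\<close> is the recursion that adds the factor at the other end. Comparing the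
  two recursions at step \<open>q\<close> gives \<open>s N ** b = N ** b\<close> for the norm
  \<open>N\<close>, which leaves \<open>b = \<zero>\<close> as a separate case.\<close>

lemma nrm_fixed:
 assumes F: "between F" and s: "hom_over F s" "s ` F \<subseteq> F" and period: "!!x. x \<in> F ==> (s ^^ q) x = x"
  and b: "b \<in> F"
 shows "s (nrm L s b q) = nrm L s b q"
proof -
 have n: "nrm L s b i \<in> F" for i by (rule nrm_closed[OF _ b betweenD(3)[OF F]]) (use s(2) in blast)
 have cl: "(s ^^ i) b \<in> F" for i using b s(2) by (induction i) auto
 have alt: "nrm L s b (Suc i) = (s ^^ i) b ** nrm L s b i" for i
 proof (induction i)
  case 0
  have "s \<one> = \<one>" using hom_overD(2)[OF s(1)] betweenE(3)[OF between_K] by simp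
  then show ?case using b betweenD(5)[OF F] by simp
 next
  case (Suc i)
  have "s (nrm L s b (Suc i)) = s ((s ^^ i) b) ** s (nrm L s b i)"
   unfolding Suc by (rule hom_overD(4)[OF s(1) cl n])
  then have "nrm L s b (Suc (Suc i)) = s ((s ^^ i) b) ** s (nrm L s b i) ** b" by simp
  also have "\<dots> = (s ^^ Suc i) b ** nrm L s b (Suc i)"
   using hom_overD(3)[OF s(1) n] cl[of "Suc i"] b betweenD(5)[OF F] by (simp add: m_assoc)
  finally show ?case .
 qed
 show ?thesis
 proof (cases "b = \<zero>")
  case False
  have "s (nrm L s b q) ** b = nrm L s b q ** b"
   using alt[of q] period[OF b] n[of q] b betweenD(5)[OF F] by (simp add: m_comm)
  then show ?thesis using m_rcancel[OF False] b n[of q] hom_overD(3)[OF s(1) n[of q]] betweenD(5)[OF F] by simp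
 next
  case True
  interpret s: ring_hom_ring "sub F" L s by (rule hom_over_ring[OF F s(1)])
  have z: "s \<zero> = \<zero>" using s.hom_zero by simp
  have "nrm L s \<zero> (Suc i) = \<zero>" for i
   using n hom_overD(3)[OF s(1)] True by simp
  then show ?thesis
  proof (cases q)
   case 0
   then show ?thesis using hom_overD(2)[OF s(1)] betweenE(3)[OF between_K] by simp
  next
   case (Suc i)
   then show ?thesis using \<open>!!i. nrm L s \<zero> (Suc i) = \<zero>\<close>[of i] True z by simp
  qed
 qed
qed

lemma nrm_root:
 assumes F: "between F" and s: "hom_over F s" and x: "x \<in> F" "s x = zt ** x" and z: "zt \<in> K"
 shows "nrm L s x i = zt [^] (\<Sum>j<i. j) ** x [^] i"
proof (induction i)
 case (Suc i)
 have xL: "x \<in> carrier L" and zL: "zt \<in> carrier L" using x betweenD(5)[OF F] z betweenD(5)[OF between_K] by auto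
 have zp: "zt [^] m \<in> K" for m :: nat
  using betweenE(3,6)[OF between_K] z by (induction m) auto
 have xp: "x [^] m \<in> F" for m :: nat
  using betweenE(3,6)[OF F] x by (induction m) auto
 have sx: "s (x [^] m) = zt [^] m ** x [^] m" for m :: nat
 proof (induction m)
  case 0
  show ?case using hom_overD(2)[OF s] betweenE(3)[OF between_K] by simp
 next
  case (Suc m)
  show ?case using hom_overD(4)[OF s xp[of m] x(1)] Suc x(2) xL zL by (simp add: m_ac)
 qed
 have zF: "zt [^] m \<in> F" for m :: nat using zp betweenD(2)[OF F] by blast
 have "s (zt [^] (\<Sum>j<i. j) ** x [^] i) = zt [^] (\<Sum>j<i. j) ** (zt [^] i ** x [^] i)"
  using hom_overD(4)[OF s zF xp] hom_overD(2)[OF s zp] sx by simp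
 then show ?case unfolding nrm.simps Suc using xL zL by (simp add: nat_pow_mult[symmetric] m_ac)
qed simp

end

text \<open>The exponent \<open>0 + ... + (p - 1)\<close> is a multiple of \<open>p\<close> for odd
  \<open>p\<close>; for \<open>p = 2\<close> it is \<open>1\<close>, and \<open>z\<close> is
  \<open>-1\<close>. This sign is what singles out \<open>p = 2\<close>.\<close>

lemma (in field) unity_power_sum:
 fixes p :: nat
 assumes p: "prime p" and z: "z \<in> carrier R" "z ~= \<one>" "z [^] p = \<one>" and c: "c \<in> carrier R"
 shows "z [^] (\<Sum>j<p. j) ** c = (if p = 2 then \<ominus> c else c)"
proof (cases "p = 2")
 case True
 have "(z \<ominus> \<one>) ** (z \<oplus> \<one>) = z ** z \<ominus> \<one>" using z(1) by algebra
 also have "\<dots> = \<zero>" using z(1,3) True by (simp add: numeral_2_eq_2 r_right_minus_eq)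
 finally have "z \<oplus> \<one> = \<zero>"
  using integral[of "z \<ominus> \<one>" "z \<oplus> \<one>"] z(1,2) by (simp add: r_right_minus_eq)
 then have m: "z = \<ominus> \<one>" using minus_equality[of z \<one>] z(1) by simp
 have "(\<Sum>j<p. j) = 1" using True by (simp add: numeral_2_eq_2)
 then show ?thesis using m c True by (simp add: l_minus)
next
 case False
 then have "odd p" using p primes_dvd_imp_eq two_is_prime_nat by blast
 then obtain t where t: "p = 2 * t + 1" by (rule oddE)
 have "(\<Sum>j<2 * t + 1. j) = (2 * t + 1) * t" by (induction t) (simp_all add: algebra_simps)
 then have "z [^] (\<Sum>j<p. j) = (z [^] p) [^] t" using t z(1) by (simp only: nat_pow_pow)
 then show ?thesis using z c False by simp
qed

context algebraic_closure
begin

text \<open>\<open>x\<close> is a norm from \<open>E = M(x)\<close> to \<open>K(x)\<close>. Applying to this equation the norm of \<open>E / M\<close>,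
 which commutes with \<open>s\<close>, turns it into a norm equation for \<open>M / K\<close>.\<close>

theorem radical_norm:
 fixes p :: nat
 assumes perf: perfect and p: "prime p" and y: "y \<in> carrier L" and M: "M = simple_extension K y" "dimension p K M"
  and s: "hom_over M s" "s ` M \<subseteq> M" "s y ~= y"
  and unity: "!!r. r \<in> carrier L ==> r [^] p = \<one> ==> r \<in> K"
  and norms: "!!E F sg q a z n. between E ==> E ~= K ==> dimension n K E ==> between F ==>
   cyclic_algebra (sub F) E sg q a z ==> \<exists>b\<in>F. a = nrm L sg b q"
  and x: "x \<in> carrier L" "x \<notin> M" "x [^] p \<in> K"
 shows "\<exists>b\<in>M. nrm L s b p = (if p = 2 then \<ominus> (x [^] p) else x [^] p)"
proof -
 have p0: "p > 0" "p > 1" using p prime_gt_0_nat prime_gt_1_nat by auto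
 have Mb: "between M" and yM: "y \<in> M" unfolding M(1) using between_simple[OF between_K y] by auto
 note KM = betweenD(2)[OF Mb]
 \<comment> \<open>\<open>F\<close> has degree \<open>p * p\<close> over \<open>K\<close>, with
   linearly disjoint subfields \<open>L1\<close> and \<open>M\<close> of degree \<open>p\<close>.
   The automorphisms \<open>S\<close> over \<open>L1\<close> and \<open>tau\<close> over
   \<open>M\<close> will act on it.\<close>
 define L1 where "L1 = simple_extension K x"
 define F where "F = simple_extension M x"
 have xK: "x \<notin> K" using x(2) KM by blast
 have x0: "x ~= \<zero>" using xK betweenE(2)[OF between_K] by blast
 note S1 = between_simple[OF between_K x(1), folded L1_def]
 note S2 = between_simple[OF Mb x(1), folded F_def]
 have xpM: "x [^] p \<in> M" using x(3) KM by blast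
 have uM: "r \<in> M" if "r \<in> carrier L" "r [^] p = \<one>" for r using unity[OF that] KM by blast
 have dL1: "dimension p K L1" using S1(4) degree_radical(1)[OF between_K p x(1) xK x(3) unity] by simp
 have dF: "dimension p M F" using S2(4) degree_radical(1)[OF Mb p x(1,2) xpM uM] by simp
 have IM: "Irr M x = pure p (x [^] p)" by (rule degree_radical(2)[OF Mb p x(1,2) xpM uM])
 have dKF: "dimension (p * p) K F" by (rule telescopic_base[OF K_sub betweenD(1)[OF Mb] M(2) dF])
 have KF: "K \<subseteq> F" using betweenD(2)[OF S2(1)] .
 have L1F: "L1 \<subseteq> F" unfolding L1_def by (rule simple_extension_least[OF between_K S2(1) KF S2(3)])
 have yF: "y \<in> F" using yM S2(2) by blast
 have dL1F: "dimension p L1 F"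
 proof -
  obtain m l where ml: "dimension m K L1" "dimension l L1 F" "p * p = m * l"
   using degree_tower[OF S1(1) S2(1) L1F dKF] .
  have "m = p" by (rule dimension_unique[OF between_K ml(1) dL1])
  then show ?thesis using ml p0 by simp
 qed
 note T = between_simple[OF S1(1) y]
 have FL1: "F = simple_extension L1 y"
 proof
  show "simple_extension L1 y \<subseteq> F" by (rule simple_extension_least[OF S1(1) S2(1) L1F yF])
  have "M \<subseteq> simple_extension L1 y"
   unfolding M(1) by (rule simple_extension_least[OF between_K T(1) betweenD(2)[OF T(1)] T(3)])
  moreover have "x \<in> simple_extension L1 y" using T(2) S1(3) by blast
  ultimately show "F \<subseteq> simple_extension L1 y" unfolding F_def by (rule simple_extension_least[OF Mb T(1)])
 qed
 have sy: "s y \<in> M" "s y \<in> carrier L" using s(2) yM betweenD(5)[OF Mb] by auto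
 note IK = Irr_props[OF between_K y] and IL = Irr_props[OF S1(1) y]
 \<comment> \<open>Both minimal polynomials have degree \<open>p\<close> and one divides the other;
   hence \<open>s\<close> extends to \<open>F\<close> over \<open>L1\<close>.\<close>
 have "Irr K y = Irr L1 y"
 proof -
  obtain q where q: "q \<in> carrier (L1[X][L])" "Irr K y = Irr L1 y **[poly_ring L] q"
   using Irr_dvd[OF S1(1) y poly_sub_mono[OF S1(2) IK(1)] IK(3)] .
  have qL: "q \<in> carrier (poly_ring L)" by (rule poly_sub_mono[OF betweenD(4)[OF S1(1)] q(1)])
  note dm = degree_mono_factor[OF q(2) IL(5) qL IK(4,2) IL(2)]
  have "degree (Irr K y) = p" using dimension_unique[OF between_K between_simple(4)[OF between_K y]] M by simp
  moreover have "degree (Irr L1 y) = p" using dimension_unique[OF S1(1) T(4)] dL1F FL1 by simp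
  ultimately have "degree q = 0" using dm(3) by simp
  then have q1: "q = [\<one>]" using dm(1,2) by (cases q) auto
  interpret P: cring "poly_ring L" by (rule poly_ring_cring)
  show ?thesis using q(2) P.r_one[OF IL(5)] unfolding q1 by (simp add: univ_poly_one)
 qed
 then have "eval (Irr L1 y) (s y) = \<zero>" using hom_over_conjugate[OF Mb s(1) yM] by simp
 then obtain S where S: "hom_over F S" "\<forall>e\<in>L1. S e = e" "S y = s y"
  using move_to_root[OF S1(1) y sy(2)] unfolding FL1 by blast
 have SM: "S m = s m" if "m \<in> M" for m
  by (rule hom_over_agree[where h = S and g = s, OF between_K y, folded M(1), OF hom_over_mono[OF S(1) S2(2)] s(1) _ S(3) that])
   (simp add: hom_overD(2)[OF S(1)] hom_overD(2)[OF s(1)])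
 have Sx: "S x = x" using S(2) S1(3) by blast
 have SF: "S ` F \<subseteq> F"
 proof
  fix z assume "z \<in> S ` F"
  then obtain u where u: "u \<in> F" "z = S u" by blast
  have "S u \<in> F"
   by (rule hom_over_simple_image[OF Mb x(1) S(1)[unfolded F_def] S2(1) _ _ u(1)[unfolded F_def]])
    (use SM s(2) S2(2,3) Sx in auto)
  then show "z \<in> F" using u(2) by simp
 qed
 \<comment> \<open>The parameter of the algebra is \<open>x\<close> itself, which is available over
   \<open>L1\<close> but not over \<open>K\<close>.\<close>
 have "cyclic_algebra (sub F) L1 S p x y"
 proof (rule algebraic_closure.cyclic_algebra_sub[OF closure_between[OF S1(1)] y FL1 dL1F p])
  show "algebraic_closure.hom_over L L1 F S"
   unfolding algebraic_closure.hom_over_def[OF closure_between[OF S1(1)]] using S(1,2) by (simp add: hom_over_def)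
 qed (use SF S(3) s(3) S1(3) x0 in auto)
 moreover have "L1 ~= K" using xK S1(3) by blast
 ultimately obtain b where b: "b \<in> F" "x = nrm L S b p" using norms[OF S1(1) _ dL1 S2(1)] by blast
 have nF: "nrm L S b i \<in> F" for i by (rule nrm_closed[OF _ b(1) betweenD(3)[OF S2(1)]]) (use SF in blast)
 \<comment> \<open>A multiplicative map to \<open>M\<close> that commutes with \<open>S\<close>
   carries a norm equation for \<open>F\<close> over \<open>L1\<close> down to one for
   \<open>M\<close> over \<open>K\<close>. It will be the norm of \<open>F\<close> over
   \<open>M\<close>.\<close>
 have finish: "nrm L s (rho b) p = rho x \<and> rho b \<in> M"
  if r: "!!u. u \<in> F ==> rho u \<in> M" "!!u v. u \<in> F ==> v \<in> F ==> rho (u ** v) = rho u ** rho v"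
   "!!u. u \<in> F ==> S (rho u) = rho (S u)" "rho \<one> = \<one>" for rho
 proof -
  have "nrm L s (rho b) i = rho (nrm L S b i)" for i
  proof (induction i)
   case (Suc i)
   have Sn: "S (nrm L S b i) \<in> F" using SF nF by blast
   have "rho (nrm L S b (Suc i)) = S (rho (nrm L S b i)) ** rho b"
    using r(2)[OF Sn b(1)] r(3)[OF nF] by simp
   also have "S (rho (nrm L S b i)) = s (nrm L s (rho b) i)" using SM[OF r(1)[OF nF]] Suc by simp
   finally show ?case by simp
  qed (use r(4) in simp)
  then show ?thesis using b(2) r(1)[OF b(1)] by metis
 qed
 \<comment> \<open>In characteristic \<open>p\<close> perfectness would put the \<open>p\<close>-th
   root \<open>x\<close> into \<open>K\<close>.\<close>
 have False: "add_pow L p \<one> ~= \<zero>"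
 proof
  assume z: "add_pow L p \<one> = \<zero>"
  then obtain b where b: "b \<in> K" "b [^] p = x [^] p" using perf p x(3) unfolding perfect_def by blast
  have "b = x" by (rule frobenius_inj[OF p z betweenD(5)[OF between_K b(1)] x(1) b(2)])
  then show False using b(1) xK by simp
 qed
 obtain zt where z: "zt \<in> carrier L" "zt ~= \<one>" "zt [^] p = \<one>" using exists_unity_root[OF p False] .
 have zK: "zt \<in> K" by (rule unity[OF z(1,3)])
 have zx: "zt ** x \<in> carrier L" "zt ** x \<in> F" "zt ** x ~= x"
 proof -
  show "zt ** x \<in> carrier L" using z x by simp
  have "zt \<in> F" using zK KF by blast
  then show "zt ** x \<in> F" using betweenE(6)[OF S2(1) _ S2(3)] by blast
  show "zt ** x ~= x" using m_rcancel[OF x0 x(1) z(1), of \<one>] z(2) x(1) by simp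
 qed
 have "eval (Irr M x) (zt ** x) = \<zero>"
  unfolding IM using pure_props(4)[OF p0(1) _ zx(1), of "x [^] p"] z x(1)
  by (simp add: nat_pow_distrib r_right_minus_eq)
 then obtain tau where tau: "hom_over F tau" "\<forall>e\<in>M. tau e = e" "tau x = zt ** x"
  using move_to_root[OF Mb x(1) zx(1)] unfolding F_def by blast
 have tauF: "tau ` F \<subseteq> F"
 proof
  fix v assume "v \<in> tau ` F"
  then obtain u where u: "u \<in> F" "v = tau u" by blast
  have "tau u \<in> F"
   by (rule hom_over_simple_image[OF Mb x(1) tau(1)[unfolded F_def] S2(1) _ _ u(1)[unfolded F_def]])
    (use tau(2,3) S2(2) zx in auto)
  then show "v \<in> F" using u(2) by simp
 qed
 have tauF': "tau u \<in> F" if "u \<in> F" for u using tauF that by blast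
 have tauh: "algebraic_closure.hom_over L M F tau"
  unfolding algebraic_closure.hom_over_def[OF closure_between[OF Mb]] using tau(1,2) by (simp add: hom_over_def)
 have taux: "tau x ~= x" using zx tau(3) by simp
 note cy = algebraic_closure.cyclic_prime_degree[where s = tau, OF closure_between[OF Mb] x(1) F_def dF p tauh tauF' taux]
 have cy1: "(tau ^^ p) u = u" if "u \<in> F" for u by (rule cy(1)) (use that in simp_all)
 have cy2: "tau u = u \<longleftrightarrow> u \<in> M" if "u \<in> F" for u by (rule cy(2)) (use that in simp_all)
 have comm: "S (tau u) = tau (S u)" if u: "u \<in> F" for u
 proof (rule hom_over_agree[where h = "%u. S (tau u)" and g = "%u. tau (S u)", OF Mb x(1), folded F_def, OF _ _ _ _ u])
  show "hom_over F (%u. S (tau u))" by (rule hom_over_comp[OF tau(1) S(1) tauF'])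
  show "hom_over F (%u. tau (S u))" by (rule hom_over_comp[OF S(1) tau(1)]) (use SF in blast)
  show "S (tau e) = tau (S e)" if e: "e \<in> M" for e
  proof -
   have "s e \<in> M" using s(2) e by blast
   then show ?thesis using tau(2) SM[OF e] e by simp
  qed
  have "S (zt ** x) = zt ** x"
   using hom_overD(4)[OF S(1) _ S2(3), of zt] hom_overD(2)[OF S(1) zK] Sx zK KF by auto
  then show "S (tau x) = tau (S x)" using tau(3) Sx by simp
 qed
 let ?rho = "%u. nrm L tau u p"
 have rhoF: "?rho u \<in> F" if "u \<in> F" for u
  by (rule nrm_closed[OF _ that betweenD(3)[OF S2(1)]]) (rule tauF')
 have tau1: "tau \<one> = \<one>" using hom_overD(2)[OF tau(1)] betweenE(3)[OF between_K] by simp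
 have "nrm L s (?rho b) p = ?rho x \<and> ?rho b \<in> M"
 proof (rule finish)
  show "?rho u \<in> M" if u: "u \<in> F" for u
   using cy2[OF rhoF[OF u]] nrm_fixed[OF S2(1) tau(1) tauF cy1 u] by simp
  show "?rho (u ** v) = ?rho u ** ?rho v" if "u \<in> F" "v \<in> F" for u v
   by (rule nrm_mult[OF S2(1) tau(1) tauF that])
  show "S (?rho u) = ?rho (S u)" if "u \<in> F" for u
   by (rule hom_over_nrm[OF S2(1) S(1) SF tau(1) tauF comm that])
  have "nrm L tau \<one> i = \<one>" for i by (induction i) (simp_all add: tau1)
  then show "?rho \<one> = \<one>" .
 qed
 moreover have "?rho x = (if p = 2 then \<ominus> (x [^] p) else x [^] p)"
 proof -
  have e: "?rho x = zt [^] (\<Sum>j<p. j) ** x [^] p" by (rule nrm_root[OF S2(1) tau(1) S2(3) tau(3) zK])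
  show ?thesis unfolding e by (rule unity_power_sum[OF p z]) (use x in simp)
 qed
 ultimately show ?thesis by (intro bexI[of _ "?rho b"]) auto
qed

end

subsection \<open>Subfields of the division algebra\<close>

lemma (in skew_field) skew_subring:
 assumes S: "subring S D" and inv: "!!x. x \<in> S ==> x ~= \<zero> ==> inv x \<in> S"
 shows "skew_field (D(|carrier := S|))"
proof -
 interpret S: ring "D(|carrier := S|)" by (rule subring_is_ring[OF S])
 have Sc: "S \<subseteq> carrier D" by (rule subringE(1)[OF S])
 show ?thesis
 proof (intro skew_field.intro skew_field_axioms.intro S.ring_axioms)
  show "\<one>[D(|carrier := S|)] ~= \<zero>[D(|carrier := S|)]" using one_not_zero by simp
  have "x \<in> Units (D(|carrier := S|))" if x: "x \<in> S" "x ~= \<zero>" for x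
   using inv[OF x] inv_ex[of x] x Sc unfolding Units_def by auto
  moreover have "x ~= \<zero>" if "x \<in> Units (D(|carrier := S|))" for x
   using that one_not_zero Sc unfolding Units_def by auto
  moreover have "Units (D(|carrier := S|)) \<subseteq> S" unfolding Units_def by auto
  ultimately show "Units (D(|carrier := S|)) = carrier (D(|carrier := S|)) - {\<zero>[D(|carrier := S|)]}" by auto
 qed
qed

lemma op_ring_minus:
 assumes G: "abelian_group G" and f: "f \<in> carrier (op_ring G)" "h \<in> carrier (op_ring G)" and v: "v \<in> carrier G"
 shows "(f \<ominus>[op_ring G] h) v = f v \<ominus>[G] h v"
proof -
 interpret A: ring "op_ring G" by (rule op_ring_is_ring[OF G])
 interpret G: abelian_group G by (rule G)
 have "f \<ominus>[op_ring G] h \<oplus>[op_ring G] h = f" using f by (simp add: A.minus_eq A.a_assoc A.l_neg)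
 then have "(f \<ominus>[op_ring G] h) v \<oplus>[G] h v = f v" using op_ring_simps(4)[OF v, of "f \<ominus>[op_ring G] h" h] by simp
 moreover have c: "(f \<ominus>[op_ring G] h) v \<in> carrier G" "h v \<in> carrier G"
  using op_ring_simps(1)[OF _ v] f by simp_all
 ultimately have "f v \<ominus>[G] h v = (f \<ominus>[op_ring G] h) v \<oplus>[G] h v \<oplus>[G] (\<ominus>[G] h v)"
  by (simp add: G.minus_eq)
 also have "\<dots> = (f \<ominus>[op_ring G] h) v"
  using c by (simp add: G.a_assoc G.r_neg)
 finally show ?thesis by simp
qed

text \<open>Factors are applied to \<open>v\<close> one after the other; the last nonzero vector
  reached before the result vanishes is killed by the next factor \<open>t - H y\<close>.\<close>

lemma op_ring_eigenvector:
 assumes G: "abelian_group G" and t: "t \<in> carrier (op_ring G)"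
  and H: "!!y. y \<in> set ys ==> H y \<in> carrier (op_ring G)"
  and v: "v \<in> carrier G" "v ~= \<zero>[G]"
  and z: "foldr (%y a. (t \<ominus>[op_ring G] H y) **[op_ring G] a) ys \<one>[op_ring G] v = \<zero>[G]"
 shows "\<exists>u y. u \<in> carrier G \<and> u ~= \<zero>[G] \<and> y \<in> set ys \<and> t u = H y u"
 using H z
proof (induction ys)
 case Nil
 then show ?case using v by (simp add: op_ring_simps(5))
next
 case (Cons y ys)
 interpret A: ring "op_ring G" by (rule op_ring_is_ring[OF G])
 interpret G: abelian_group G by (rule G)
 let ?P = "%ys. foldr (%y a. (t \<ominus>[op_ring G] H y) **[op_ring G] a) ys \<one>[op_ring G]"
 have P: "?P zs \<in> carrier (op_ring G)" if "set zs \<subseteq> set (y # ys)" for zs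
  using that by (induction zs) (auto simp: t Cons(2))
 have Pv: "?P ys v \<in> carrier G" by (rule op_ring_simps(1)[OF P v(1)]) auto
 have step: "?P (x # xs) v = t (?P xs v) \<ominus>[G] H x (?P xs v)" if "set (x # xs) \<subseteq> set (y # ys)" for x xs
 proof -
  have "?P xs v \<in> carrier G" by (rule op_ring_simps(1)[OF P v(1)]) (use that in auto)
  then show ?thesis using op_ring_simps(3)[OF v(1)] op_ring_minus[OF G t Cons(2), of x] that by simp
 qed
 show ?case
 proof (cases "?P ys v = \<zero>[G]")
  case True
  then have "\<exists>u z. u \<in> carrier G \<and> u ~= \<zero>[G] \<and> z \<in> set ys \<and> t u = H z u"
   using Cons(1)[OF Cons(2)] by simp
  then show ?thesis by auto
 next
  case False
  let ?u = "?P ys v"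
  have y: "H y \<in> carrier (op_ring G)" using Cons(2) by simp
  have "t ?u \<ominus>[G] H y ?u = \<zero>[G]" using step[of y ys] Cons(3) by simp
  then have e: "t ?u = H y ?u"
   using op_ring_simps(1)[OF t Pv] op_ring_simps(1)[OF y Pv]
    G.minus_equality[of "t ?u" "\<ominus>[G] H y ?u"] by (simp add: G.minus_eq)
  have "y \<in> set (y # ys)" by simp
  show ?thesis by (intro exI[of _ ?u] exI[of _ y] conjI) fact+
 qed
qed

context maximal_center
begin

text \<open>The centralizer of a noncentral \<open>z\<close> is a skew field with \<open>z\<close>
  in its center, so by maximality it is commutative. This is a test for centrality: commuting with
  two elements that do not commute.\<close>

theorem centralizes_noncommuting:
 assumes z: "z \<in> carrier D" and a: "a \<in> carrier D" "a ** z = z ** a" and b: "b \<in> carrier D" "b ** z = z ** b"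
  and ab: "a ** b ~= b ** a"
 shows "z \<in> Z"
proof (rule ccontr)
 assume nz: "z \<notin> Z"
 define C where "C = {x \<in> carrier D. \<forall>s\<in>{z}. x ** s = s ** x}"
 have C: "subring C D" unfolding C_def by (rule D.centralizer_subring) (use z in simp)
 have inv: "inv x \<in> C" if "x \<in> C" "x ~= \<zero>" for x
  using D.centralizer_inv[OF _ that(1)[unfolded C_def] that(2)] z unfolding C_def by simp
 have ZC: "Z \<subseteq> C" using Z_carrier Z_comm z by (auto simp: C_def)
 have sk: "skew_field (D(|carrier := C|))" by (rule D.skew_subring[OF C inv])
 obtain n where n: "D.dimension n Z C"
 proof -
  assume t: "!!n. D.dimension n Z C ==> thesis"
  have "subalgebra Z C D"
   by (rule D.subalgebraI[OF Z_subfield]) (use subringE(1,2,6,7)[OF C] ZC in blast)+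
  then show ?thesis using D.subspace_dimension[OF Z_subfield dl _ subringE(1)[OF C]] t by metis
 qed
 interpret CR: skew_field "D(|carrier := C|)" by (rule sk)
 have fin: "CR.finite_dimension ((%x. x) ` Z) (carrier (D(|carrier := C|)))"
  using n D.dimension_consistent[OF C Z_subfield ZC] CR.finite_dimensionI by simp
 have "a **[D(|carrier := C|)] b = b **[D(|carrier := C|)] a"
 proof (rule larger_center_commutative[where h = "%x. x", OF sk _ _ fin])
  show "(%x. x) \<in> ring_hom Zr (D(|carrier := C|))" using ZC unfolding ring_hom_def by auto
  show "(%x. x) ` Z \<subseteq> cent (D(|carrier := C|))"
   using ZC Z_comm subringE(1)[OF C] unfolding cent_def[of "D(|carrier := C|)"] by auto
  show "z \<in> cent (D(|carrier := C|))" using z unfolding cent_def[of "D(|carrier := C|)"] by (auto simp: C_def)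
  show "z \<notin> (%x. x) ` Z" using nz by simp
 qed (use a b in "simp_all add: C_def")
 then show False using ab by simp
qed

end

context algebraic_closure
begin

lemma pl_sub:
 assumes F: "between F" and "set os \<subseteq> F"
 shows "pl (sub F) os = pl L os"
 using assms(2)
proof (induction os)
 case (Cons x xs)
 then show ?case
  using sub_minus[OF F] univ_poly_consistent[OF betweenD(3)[OF F]]
  by (simp add: pl_simps univ_poly_mult poly_mult_consistent[OF betweenD(3)[OF F]])
qed (simp add: pl_simps)

end

context maximal_center
begin

text \<open>Otherwise adjoin \<open>a\<close> and the structure constants of \<open>D\<close> to the \<open>l\<close>-th powers of \<open>Z\<close>. The span
 of a basis of \<open>D\<close> over the resulting field \<open>W\<close> is a noncommutative division algebra, finite over
 \<open>Z\<close> via the Frobenius map, whose center contains \<open>a\<close>.\<close>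

lemma frobenius_onto:
 fixes l :: nat
 assumes l: "prime l" "add_pow Zr l \<one> = \<zero>" and a: "a \<in> Z"
 shows "\<exists>b\<in>Z. b [^][Zr] l = a"
proof (rule ccontr)
 assume na: "\<not> ?thesis"
 interpret Zr: field Zr by (rule Z_field)
 have l0: "l > 0" using l(1) prime_gt_0_nat by blast
 define f where "f = (%z. z [^][Zr] l)"
 have f: "f \<in> ring_hom Zr Zr" unfolding f_def by (rule Zr.frobenius_hom) (use l in simp_all)
 interpret f: ring_hom_ring Zr Zr f by (rule ring_hom_ringI2[OF Zr.ring_axioms Zr.ring_axioms f])
 have fZ: "f z \<in> Z" if "z \<in> Z" for z using f.hom_closed that by simp
 have Fl: "subfield (f ` Z) Zr"
  using f.img_is_subfield(2)[OF Zr.carrier_is_subfield] D.one_not_zero by simp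
 note sFl = subringE[OF subfieldE(1)[OF Fl]]
 have alg: "(Zr.algebraic over (f ` Z)) z" if z: "z \<in> Z" for z
 proof (rule Zr.algebraicI[of "Zr.pure l (f z)"])
  have zc: "z \<in> carrier Zr" "f z \<in> carrier Zr" using z fZ by auto
  note P = Zr.pure_props[OF l0 zc(2,1)]
  show "Zr.pure l (f z) ~= []" by (rule P(5))
  show "Zr.eval (Zr.pure l (f z)) z = \<zero>[Zr]"
   unfolding P(4) using zc(2) Zr.r_right_minus_eq[OF zc(2) zc(2)] by (simp add: f_def)
  have "f z \<in> f ` Z" using z by simp
  from sFl(5)[OF this] show "Zr.pure l (f z) \<in> carrier ((f ` Z)[X][Zr])"
   using sFl(2,3) D.one_not_zero unfolding poly_carrier Zr.pure_def by auto
 qed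
 obtain u c where uc: "\<forall>i<dl. u i \<in> carrier D" "\<forall>x\<in>carrier D. \<forall>i<dl. c i x \<in> Z"
  "\<forall>x\<in>carrier D. x = lc D u (%i. c i x) dl"
  "\<forall>i<dl. \<forall>x\<in>carrier D. \<forall>y\<in>carrier D. c i (x \<oplus> y) = c i x \<oplus> c i y"
  "\<forall>i<dl. \<forall>x\<in>carrier D. \<forall>k\<in>Z. c i (k ** x) = k ** c i x"
  "\<forall>i<dl. \<forall>j<dl. c i (u j) = (if i = j then \<one> else \<zero>)"
  using D.exists_coordinates[OF Z_subfield dl] by (elim exE conjE)
 \<comment> \<open>Besides \<open>a\<close>, the coordinates of \<open>1\<close> and of all products
   of basis elements: with these in \<open>W\<close>, the \<open>W\<close>-span of the basis is a
   ring containing \<open>W\<close>.\<close>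
 let ?S = "insert a ((%i. c i \<one>) ` {..<dl} \<union> (%(i, j, m). c i (u j ** u m)) ` ({..<dl} \<times> {..<dl} \<times> {..<dl}))"
 have "finite ?S" by simp
 then obtain xs where xs: "set xs = ?S" using finite_list by blast
 have xsZ: "set xs \<subseteq> carrier Zr" unfolding xs using a uc(1,2) by auto
 define W where "W = Zr.finite_extension (f ` Z) xs"
 have W: "subfield W Zr" "Zr.finite_dimension (f ` Z) W"
  unfolding W_def using Zr.finite_extension_is_subfield[OF Fl xsZ] Zr.finite_extension_finite_dimension(1)[OF Fl xsZ]
   alg xsZ by auto
 have xsW: "set xs \<subseteq> W" unfolding W_def by (rule Zr.finite_extension_mem[OF subfieldE(1)[OF Fl] xsZ])
 have fW: "f ` Z \<subseteq> W" unfolding W_def by (rule Zr.finite_extension_incl[OF subfieldE(3)[OF Fl] xsZ])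
 have WZ: "W \<subseteq> Z" using subfieldE(3)[OF W(1)] by simp
 have ZD: "Z \<subseteq> carrier D" using Z_carrier by blast
 have Fd: "subfield (f ` Z) D" and Wd: "subfield W D"
  using Zr.subfield_iff(2)[OF Fl] Zr.subfield_iff(2)[OF W(1)] fW WZ ZD by (auto intro!: D.subfield_iff(1))
 note sW = subringE[OF subfieldE(1)[OF Wd]]
 define D0 where "D0 = {x \<in> carrier D. \<forall>i<dl. c i x \<in> W}"
 have D0D: "D0 \<subseteq> carrier D" by (auto simp: D0_def)
 have D0c: "x \<in> carrier D" "x = lc D u (%i. c i x) dl" "i < dl ==> c i x \<in> W" if "x \<in> D0" for x i
  using that uc(3) by (auto simp: D0_def)
 have D0u: "u j \<in> D0" if "j < dl" for j using that uc(1,6) sW(2,3) by (auto simp: D0_def)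
 have D0add: "x \<oplus> y \<in> D0" if "x \<in> D0" "y \<in> D0" for x y using that uc(4) sW(7) by (auto simp: D0_def)
 have D0s: "w ** x \<in> D0" if "w \<in> W" "x \<in> D0" for w x
  using that uc(5) sW(6) WZ ZD by (auto simp: D0_def subset_iff)
 have "c i \<one> \<in> W" if "i < dl" for i by (rule subsetD[OF xsW]) (use that in "simp add: xs")
 then have D01: "\<one> \<in> D0" by (simp add: D0_def)
 have D00: "\<zero> \<in> D0" using D0s[OF sW(2) D01] by simp
 have D0uu: "u j ** u m \<in> D0" if "j < dl" "m < dl" for j m
 proof -
  have "c i (u j ** u m) \<in> W" if i: "i < dl" for i
  proof (rule subsetD[OF xsW])
   have "c i (u j ** u m) \<in> (%(i, j, m). c i (u j ** u m)) ` ({..<dl} \<times> {..<dl} \<times> {..<dl})"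
    by (rule image_eqI[of _ _ "(i, j, m)"]) (use i \<open>j < dl\<close> \<open>m < dl\<close> in simp_all)
   then show "c i (u j ** u m) \<in> set xs" unfolding xs by (intro insertI2 UnI2)
  qed
  then show ?thesis using uc(1) that by (simp add: D0_def)
 qed
 have dist: "x ** lc D v b n = lc D (%m. x ** v m) b n \<and> lc D v b n ** x = lc D (%m. v m ** x) b n \<and> lc D v b n \<in> carrier D"
  if x: "x \<in> carrier D" and b: "\<forall>i<n. b i \<in> Z" and v: "\<forall>i<n. v i \<in> carrier D" for x v b n
  using b v
 proof (induction n)
  case (Suc n)
  have n: "b n \<in> Z" "b n \<in> carrier D" "v n \<in> carrier D" using Suc(2,3) Z_carrier by auto
  have "x ** (b n ** v n) = b n ** (x ** v n)" using x n Z_comm[OF n(1) x] by (simp add: D.m_assoc[symmetric])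
  then show ?case using Suc n x by (simp add: D.r_distr D.l_distr D.m_assoc)
 qed (use x in simp)
 have lcD0: "lc D v b dl \<in> D0" if "!!i. i < dl ==> b i \<in> W" "!!i. i < dl ==> v i \<in> D0" for v b
  by (rule D.lc_mem) (use that D0s D00 D0add in auto)
 have cZ: "\<forall>i<dl. c i x \<in> Z" if "x \<in> carrier D" for x using uc(2) that by blast
 have D0ux: "u j ** y \<in> D0" if j: "j < dl" and y: "y \<in> D0" for j y
 proof -
  have "u j ** lc D u (%i. c i y) dl = lc D (%m. u j ** u m) (%i. c i y) dl"
   using dist[OF _ cZ[OF D0c(1)[OF y]] uc(1)] uc(1) j by blast
  then show ?thesis using lcD0[of "%i. c i y" "%m. u j ** u m"] D0c(2,3)[OF y] D0uu[OF j] by simp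
 qed
 have D0mult: "x ** y \<in> D0" if x: "x \<in> D0" and y: "y \<in> D0" for x y
 proof -
  have "lc D u (%i. c i x) dl ** y = lc D (%m. u m ** y) (%i. c i x) dl"
   using dist[OF D0c(1)[OF y] cZ[OF D0c(1)[OF x]] uc(1)] by blast
  then show ?thesis using lcD0[of "%i. c i x" "%m. u m ** y"] D0c(2,3)[OF x] D0ux[OF _ y] by simp
 qed
 have D0sub: "subring D0 D"
 proof (rule D.subringI[OF D0D D01 _ D0mult D0add])
  show "\<ominus> x \<in> D0" if "x \<in> D0" for x
   using D0s[OF sW(5)[OF sW(3)] that] D0c(1)[OF that] by (simp add: D.l_minus)
 qed
 have WD0: "W \<subseteq> D0" using D0s[OF _ D01] WZ ZD by (auto simp: subset_iff)
 have c0: "c i \<zero> = \<zero>" if "i < dl" for i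
  using uc(5)[rule_format, OF that D.one_closed subringE(2)[OF subfieldE(1)[OF Z_subfield]]] uc(2) that Z_carrier by simp
 have cl: "c i (lc D u b n) = (if i < n then b i else \<zero>)" if i: "i < dl" and b: "\<forall>j<n. b j \<in> Z" "n \<le> dl" for i b n
  using b
 proof (induction n)
  case (Suc n)
  have n: "b n \<in> Z" "b n \<in> carrier D" "u n \<in> carrier D" "n < dl" using Suc(2,3) Z_carrier uc(1) by auto
  have lcD: "lc D u b n \<in> carrier D" using dist[OF D.one_closed, of n b u] Suc(2,3) uc(1) by auto
  have "c i (lc D u b (Suc n)) = c i (lc D u b n) \<oplus> b n ** c i (u n)" using uc(4,5) i n lcD by simp
  then show ?case using Suc uc(6) i n Z_carrier by (auto simp: less_Suc_eq)
 qed (use c0[OF i] in simp)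
 have D0span: "D0 = D.lspan W u dl"
 proof
  show "D0 \<subseteq> D.lspan W u dl"
  proof
   fix x assume x: "x \<in> D0"
   show "x \<in> D.lspan W u dl" by (rule D.lspanI[OF D0c(2)[OF x]]) (use D0c(3)[OF x] in blast)
  qed
  show "D.lspan W u dl \<subseteq> D0" unfolding D.lspan_def using lcD0 D0u by auto
 qed
 have ind: "D.lindep W u dl"
  unfolding D.lindep_def
 proof (intro allI impI)
  fix b i assume b: "\<forall>i<dl. b i \<in> W" "lc D u b dl = \<zero>" "i < dl"
  have "\<forall>j<dl. b j \<in> Z" using b(1) WZ by blast
  from cl[OF b(3) this order_refl] show "b i = \<zero>" using b(2,3) c0[OF b(3)] by simp
 qed
 obtain d where "Zr.dimension d (f ` Z) W" using W(2) Zr.finite_dimension_def by blast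
 then have d: "D.dimension d (f ` Z) W"
  using D.dimension_consistent[OF subfieldE(1)[OF Z_subfield] Fd] fW WZ by blast
 have n: "D.dimension (d * dl) (f ` Z) D0"
  unfolding D0span by (rule D.lspan_dimension[OF Fd d _ ind]) (use uc(1) in blast)
 \<comment> \<open>Left multiplication by \<open>x\<close> is an injective linear map of the
   finite-dimensional space \<open>D0\<close> into itself, hence onto, so \<open>1\<close> is
   reached.\<close>
 have inv: "inv x \<in> D0" if x: "x \<in> D0" "x ~= \<zero>" for x
 proof -
  have xc: "x \<in> carrier D" using x D0D by blast
  have ks: "x ** (z ** v) = z ** (x ** v)" "z \<in> W" if "z \<in> f ` Z" "v \<in> D0" for z v
  proof -
   show zW: "z \<in> W" using that(1) fW by blast
   then have z: "z \<in> Z" "z \<in> carrier D" "v \<in> carrier D" using WZ ZD that(2) D0D by blast+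
   show "x ** (z ** v) = z ** (x ** v)" using xc z Z_comm[OF z(1) xc] by (simp add: D.m_assoc[symmetric])
  qed
  let ?V = "(%v. x ** v) ` D0"
  have dV: "D.dimension (d * dl) (f ` Z) ?V"
  proof (rule D.dimension_linear_inj[OF Fd n])
   fix v assume v: "v \<in> D0"
   then have vc: "v \<in> carrier D" using D0D by blast
   show "x ** v \<in> carrier D" using xc vc by simp
   show "x ** (v \<oplus> v') = x ** v \<oplus> x ** v'" if "v' \<in> D0" for v'
    by (rule D.r_distr[OF vc D0c(1)[OF that] xc])
   show "x ** (z ** v) = z ** (x ** v)" if "z \<in> f ` Z" for z by (rule ks(1)[OF that v])
   show "v = \<zero>" if "x ** v = \<zero>" using D.integral[OF xc vc that] x(2) by blast
  qed
  have sub: "subalgebra (f ` Z) ?V D"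
  proof (rule D.subalgebraI[OF Fd])
   show "?V \<subseteq> carrier D" using xc D0D by auto
   show "\<zero> \<in> ?V" using D00 xc by (intro image_eqI[of _ _ \<zero>]) simp_all
   fix v w assume v: "v \<in> ?V"
   then obtain v' where v': "v' \<in> D0" "v = x ** v'" by blast
   show "z ** v \<in> ?V" if "z \<in> f ` Z" for z
    unfolding v'(2) ks(1)[OF that v'(1), symmetric] by (rule imageI[OF D0s[OF ks(2)[OF that v'(1)] v'(1)]])
   assume "w \<in> ?V"
   then obtain w' where w': "w' \<in> D0" "w = x ** w'" by blast
   have "v \<oplus> w = x ** (v' \<oplus> w')"
    unfolding v'(2) w'(2) using D.r_distr[OF D0c(1)[OF v'(1)] D0c(1)[OF w'(1)] xc] by simp
   then show "v \<oplus> w \<in> ?V" using D0add[OF v'(1) w'(1)] by blast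
  qed
  have incl: "?V \<subseteq> D0" using D0mult[OF x(1)] by blast
  have "\<exists>m. D.dimension m (f ` Z) ?V \<and> (m = d * dl --> ?V = D0)"
  proof (rule D.subspace_dimension[OF Fd n sub incl])
   fix m assume "D.dimension m (f ` Z) ?V" "m \<le> d * dl" "m = d * dl ==> ?V = D0"
   then show ?thesis by (intro exI[of _ m] conjI impI)
  qed
  then obtain m where m: "D.dimension m (f ` Z) ?V" "m = d * dl --> ?V = D0" by blast
  have "m = d * dl" by (rule D.dimension_is_inj[OF Fd m(1) dV])
  then have "\<one> \<in> ?V" using m(2) D01 by simp
  then obtain v where v: "v \<in> D0" "\<one> = x ** v" by blast
  note i = D.inv_ex[OF xc x(2)]
  have "inv x = inv x ** (x ** v)" unfolding v(2)[symmetric] using i(1) by simp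
  also have "\<dots> = v" using i xc D0c(1)[OF v(1)] by (simp add: D.m_assoc[symmetric])
  finally show ?thesis using v(1) by simp
 qed
 have sk: "skew_field (D(|carrier := D0|))" by (rule D.skew_subring[OF D0sub inv])
 interpret C: skew_field "D(|carrier := D0|)" by (rule sk)
 have fin: "C.finite_dimension (f ` Z) (carrier (D(|carrier := D0|)))"
  using n D.dimension_consistent[OF D0sub Fd] fW WD0 C.finite_dimensionI by simp
 \<comment> \<open>Here \<open>Z\<close> is embedded by the Frobenius map, whose image misses the
   central element \<open>a\<close>. So \<open>D0\<close> is commutative, and since it contains the
   basis \<open>u\<close>, so is \<open>D\<close>.\<close>
 have comm: "u j ** u m = u m ** u j" if "j < dl" "m < dl" for j m
 proof -
  have "u j **[D(|carrier := D0|)] u m = u m **[D(|carrier := D0|)] u j"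
  proof (rule larger_center_commutative[where h = f, OF sk _ _ fin])
   show "f \<in> ring_hom Zr (D(|carrier := D0|))" using f fW WD0 unfolding ring_hom_def by auto
   show "f ` Z \<subseteq> cent (D(|carrier := D0|))"
    using fW WD0 WZ Z_comm D0D unfolding cent_def[of "D(|carrier := D0|)"] by (auto simp: subset_iff)
   show "a \<in> cent (D(|carrier := D0|))"
    using xsW xs WD0 Z_comm[OF a] D0D unfolding cent_def[of "D(|carrier := D0|)"] by (auto simp: subset_iff)
   show "a \<notin> f ` Z" using na unfolding f_def by blast
  qed (use D0u that in simp_all)
  then show ?thesis by simp
 qed
 have swap: "x ** y = y ** x" if xy: "x \<in> carrier D" "y \<in> carrier D" "!!m. m < dl ==> x ** u m = u m ** x" for x y
 proof -
  note d = dist[OF xy(1) cZ[OF xy(2)] uc(1)]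
  have "x ** lc D u (%i. c i y) dl = lc D (%m. x ** u m) (%i. c i y) dl" by (rule conjunct1[OF d])
  also have "\<dots> = lc D (%m. u m ** x) (%i. c i y) dl" by (rule lc_cong[OF refl xy(3)])
  also have "\<dots> = lc D u (%i. c i y) dl ** x" by (rule conjunct1[OF conjunct2[OF d], symmetric])
  finally show ?thesis unfolding uc(3)[rule_format, OF xy(2), symmetric] .
 qed
 have xu: "x ** u m = u m ** x" if "x \<in> carrier D" "m < dl" for x m
  by (rule swap[symmetric]) (use uc(1) comm that in auto)
 obtain x y where "x \<in> carrier D" "y \<in> carrier D" "x ** y ~= y ** x" using noncomm by blast
 then show False using swap[of x y] xu by simp
qed

end

section \<open>The center inside its algebraic closure\<close>

locale center_closure = maximal_center K D + O: algebraic_closure W "g ` cent D"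
 for K :: "('a, 'k) ring_scheme" and D :: "('a, 'a list) module" (structure)
  and W :: "('w, 'v) ring_scheme" and g :: "'a list => 'w" +
 assumes g: "g \<in> ring_hom (D(|carrier := cent D|)) W"
begin

abbreviation k where "k \<equiv> g ` Z"

lemma g_inj: "inj_on g Z"
 using non_trivial_field_hom_is_inj[OF g Z_field O.field_axioms] by simp

lemma g_sub: "O.between F ==> g \<in> ring_hom Zr (O.sub F)"
 using g O.betweenD(2)[of F] unfolding ring_hom_def by auto

theorem perfect: "O.perfect"
 unfolding O.perfect_def
proof (intro allI impI ballI)
 fix q :: nat and a
 assume q: "prime q" "add_pow W q \<one>[W] = \<zero>[W]" and a: "a \<in> k"
 interpret Zr: field Zr by (rule Z_field)
 interpret g: ring_hom_ring Zr W g by (rule ring_hom_ringI2[OF Zr.ring_axioms O.ring_axioms g])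
 have gadd: "g (add_pow Zr n \<one>) = add_pow W n \<one>[W] \<and> add_pow Zr n \<one> \<in> Z" for n :: nat
  using subringE(2,3,7)[OF subfieldE(1)[OF Z_subfield]] g.hom_zero g.hom_one g.hom_add
  by (induction n) (simp_all add: add_pow_def nat_pow_def)
 have "add_pow Zr q \<one> = \<zero>"
  using inj_onD[OF g_inj, of "add_pow Zr q \<one>" \<zero>] gadd[of q] q(2) g.hom_zero
   subringE(2)[OF subfieldE(1)[OF Z_subfield]] by simp
 moreover obtain z where z: "z \<in> Z" "a = g z" using a by blast
 ultimately have "\<exists>b\<in>Z. b [^][Zr] q = z" by (intro frobenius_onto[OF q(1)])
 then obtain b where b: "b \<in> Z" "b [^][Zr] q = z" by (elim bexE)
 have "g b [^][W] q = g (b [^][Zr] q)" using g.hom_nat_pow[of b q] b(1) by simp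
 then show "\<exists>b\<in>k. b [^][W] q = a" using b z(2) by blast
qed

lemma degree_dvd:
 assumes "O.between E" "O.dimension n k E" "n ~= 1" "prime p" "p dvd dl"
 shows "p dvd n"
proof -
 note E = O.betweenD[OF assms(1)]
 have d: "ring.dimension (O.sub E) n k (carrier (O.sub E))"
  using O.dimension_consistent[OF E(3) O.K_sub E(2)] assms(2) by simp
 have "n > 1" using O.degree_pos[OF O.between_K assms(1,2)] assms(3) by simp
 then show ?thesis using larger_field_dvd(1)[OF E(6) g_sub[OF assms(1)] d _ assms(4,5)] by blast
qed

lemma embed_prime_degree:
 assumes "O.between E" "O.dimension p k E" "prime p"
 shows "dl = p * p" "\<exists>psi\<in>ring_hom (O.sub E) D. \<forall>z\<in>Z. psi (g z) = z"
proof -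
 note E = O.betweenD[OF assms(1)]
 have d: "ring.dimension (O.sub E) p k (carrier (O.sub E))"
  using O.dimension_consistent[OF E(3) O.K_sub E(2)] assms(2) by simp
 have "p > 1" using assms(3) prime_gt_1_nat by blast
 then have "dl = p * p \<and> (\<exists>psi\<in>ring_hom (O.sub E) D. \<forall>z\<in>Z. psi (g z) = z)"
  using larger_field_dvd(2)[OF E(6) g_sub[OF assms(1)] d _ assms(3)] by blast
 then show "dl = p * p" "\<exists>psi\<in>ring_hom (O.sub E) D. \<forall>z\<in>Z. psi (g z) = z" by blast+
qed

lemma norms:
 assumes E: "O.between E" "E ~= k" "O.dimension n k E" and F: "O.between F"
  and c: "cyclic_algebra (O.sub F) E sg q a z"
 shows "\<exists>b\<in>F. a = nrm W sg b q"
proof -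
 interpret F: field "O.sub F" by (rule O.betweenD(6)[OF F])
 have "subfield E (O.sub F)" by (rule cyclic_algebra.L[OF c])
 then have EF: "E \<subseteq> F" using subfieldE(3) by fastforce
 have "F.dimension n k E" using O.dimension_consistent[OF O.betweenD(3)[OF F] O.K_sub O.betweenD(2)[OF F]] E(3) EF by simp
 then have fin: "F.finite_dimension k E" by (rule F.finite_dimensionI)
 obtain b where "b \<in> carrier (O.sub F)" "a = nrm (O.sub F) sg b q"
  by (rule norms_of_larger_fields[OF c g_sub[OF F] O.betweenD(2)[OF E(1)] E(2)[symmetric] fin])
 then show ?thesis unfolding nrm_consistent by auto
qed

lemma replicate_one_mem: "O.between E ==> replicate (Suc n) \<one>[W] \<in> carrier (E[X][W])"
 using subringE(3)[OF O.betweenD(3)] unfolding poly_carrier by auto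

text \<open>The degree of \<open>r\<close> is below \<open>p\<close>, and unless it is
  \<open>1\<close> it is a multiple of \<open>p\<close>.\<close>

lemma low_degree:
 assumes p: "prime p" "p dvd dl" and r: "r \<in> carrier W"
  and P: "P \<in> carrier (k[X][W])" "O.eval P r = \<zero>[W]" "P ~= []" "degree P < p"
 shows "r \<in> k"
proof -
 note S = O.between_simple[OF O.between_K r] and I = O.Irr_props[OF O.between_K r]
 have "degree (O.Irr k r) < p" using O.Irr_degree_le[OF O.between_K r P(1-3)] P(4) by simp
 then have "degree (O.Irr k r) = 1"
  using degree_dvd[OF S(1,4) _ p] I(6) by (metis dvd_imp_le leD)
 then show ?thesis using I(7) by fastforce
qed

lemma unity:
 fixes p :: nat
 assumes p: "prime p" "p dvd dl" and r: "r \<in> carrier W" "r [^][W] p = \<one>[W]"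
 shows "r \<in> k"
proof (cases "r = \<one>[W]")
 case True
 then show ?thesis using O.betweenE(3)[OF O.between_K] by simp
next
 case False
 obtain m where m: "p = Suc m" using prime_gt_0_nat[OF p(1)] by (cases p) auto
 let ?q = "replicate p \<one>[W]"
 have "O.eval ?q r **[W] (r \<ominus>[W] \<one>[W]) = \<zero>[W]"
  using O.eval_replicate_one[OF r(1), of p] r by (simp add: O.r_right_minus_eq)
 moreover have "O.eval ?q r \<in> carrier W" by (rule O.eval_in_carrier) (use r in auto)
 moreover have "r \<ominus>[W] \<one>[W] ~= \<zero>[W]" using False r by (simp add: O.r_right_minus_eq)
 ultimately have "O.eval ?q r = \<zero>[W]" using O.integral[of "O.eval ?q r"] r by blast
 then show ?thesis
  by (rule low_degree[OF p r(1), rotated]) (use replicate_one_mem[OF O.between_K, of m] m in auto)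
qed

text \<open>The polynomial splits over \<open>Z\<close>, so its value at \<open>w\<close> is a
  product of elements \<open>w - y\<close> with \<open>y\<close> in \<open>Z\<close>. As
  \<open>D\<close> has no zero divisors, one of them is zero.\<close>

lemma central_root:
 assumes w: "w \<in> carrier D" and P: "P \<in> carrier (poly_ring Zr)" "lead_coeff P = \<one>" "P ~= []" "D.eval P w = \<zero>"
  and roots: "!!y. y \<in> carrier W ==> O.eval (map g P) y = \<zero>[W] ==> y \<in> k"
 shows "w \<in> Z"
proof -
 interpret Zr: field Zr by (rule Z_field)
 have PZ: "set P \<subseteq> Z" using Zr.poly_set[OF P(1)] by simp
 have lc: "lead_coeff (map g P) = \<one>[W]" using P(2,3) ring_hom_one[OF g] by (cases P) auto
 moreover have "set (map g P) \<subseteq> carrier W" using PZ O.betweenD(4)[OF O.between_K] by auto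
 ultimately have gP: "map g P \<in> carrier (poly_ring W)"
  using P(3) unfolding poly_carrier by auto
 obtain ys where ys: "set ys \<subseteq> carrier W" "map g P = pl W ys"
  using O.exists_pl[OF gP _ lc] P(3) by blast
 have yk: "y \<in> k" if "y \<in> set ys" for y
 proof (rule roots)
  show yO: "y \<in> carrier W" using that ys by blast
  show "O.eval (map g P) y = \<zero>[W]" using O.pl_eval_zero[OF ys(1) yO] ys(2) that by simp
 qed
 define zs where "zs = map (inv_into Z g) ys"
 have zs: "set zs \<subseteq> Z" "ys = map g zs"
 proof -
  show "set zs \<subseteq> Z" using inv_into_into[of _ g Z] yk by (auto simp: zs_def)
  have "map g zs = map (%y. y) ys"
   unfolding zs_def map_map by (rule map_cong[OF refl]) (simp add: f_inv_into_f yk)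
  then show "ys = map g zs" by simp
 qed
 have zsc: "set zs \<subseteq> carrier Zr" using zs by simp
 have "map g (pl Zr zs) = map g P"
  using map_pl[OF g Z_field O.field_axioms zsc] ys(2) zs(2) by simp
 moreover have "set (pl Zr zs) \<subseteq> Z" using Zr.poly_set[OF Zr.pl_closed(1)[OF zsc]] by simp
 ultimately have plz: "pl Zr zs = P"
  by (intro map_inj_on[of g] inj_on_subset[OF g_inj]) (use PZ in auto)
 have id: "(%x. x) \<in> ring_hom Zr D" using Z_carrier unfolding ring_hom_def by auto
 have "foldr (%y a. (w \<ominus> y) ** a) zs \<one> = \<zero>"
  using D.eval_pl_commuting[OF id Z_field w _ zsc] Z_comm[OF _ w] plz P(4) by simp
 moreover have "\<exists>y\<in>set vs. w = y" if "set vs \<subseteq> Z" "foldr (%y a. (w \<ominus> y) ** a) vs \<one> = \<zero>" for vs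
  using that
 proof (induction vs)
  case Nil
  then show ?case using D.one_not_zero by simp
 next
  case (Cons v vs)
  have v: "v \<in> carrier D" using Cons(2) Z_carrier by simp
  let ?f = "foldr (%y a. (w \<ominus> y) ** a) vs \<one>"
  have "?f \<in> carrier D" using Cons(2) Z_carrier w by (induction vs) auto
  then consider "w \<ominus> v = \<zero>" | "?f = \<zero>" using D.integral[of "w \<ominus> v" ?f] Cons(3) v w by auto
  then show ?case using Cons v w by cases (auto simp: D.r_right_minus_eq)
 qed
 ultimately show ?thesis using zs(1) by auto
qed

lemma central_unity:
 fixes p :: nat
 assumes p: "prime p" "p dvd dl" and w: "w \<in> carrier D" "w [^] p = \<one>"
 shows "w \<in> Z"
proof (cases "w = \<one>")
 case True
 then show ?thesis using subringE(3)[OF subfieldE(1)[OF Z_subfield]] by simp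
next
 case False
 obtain m where m: "p = Suc m" using prime_gt_0_nat[OF p(1)] by (cases p) auto
 interpret Zr: field Zr by (rule Z_field)
 have ev: "D.eval (replicate p \<one>) w = \<zero>"
 proof -
  have 1: "D.eval (replicate p \<one>) w ** (w \<ominus> \<one>) = \<zero>"
   using D.eval_replicate_one[OF w(1), of p] w by (simp add: D.r_right_minus_eq)
  have 2: "D.eval (replicate p \<one>) w \<in> carrier D" by (rule D.eval_in_carrier) (use w in auto)
  have 3: "w \<ominus> \<one> ~= \<zero>" "w \<ominus> \<one> \<in> carrier D" using False w by (simp_all add: D.r_right_minus_eq)
  show ?thesis using D.integral[OF 2 3(2) 1] 3(1) by blast
 qed
 show ?thesis
 proof (rule central_root[OF w(1) _ _ _ ev])
  fix y assume y: "y \<in> carrier W" "O.eval (map g (replicate p \<one>)) y = \<zero>[W]"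
  then have "y [^][W] p \<ominus>[W] \<one>[W] = \<zero>[W]"
   using O.eval_replicate_one[OF y(1), of p] ring_hom_one[OF g] by simp
  then show "y \<in> k" using unity[OF p y(1)] y(1) by (simp add: O.r_right_minus_eq)
 qed (use Zr.replicate_one_poly[of m] m in simp_all)
qed

text \<open>A form of the Skolem-Noether theorem. On \<open>D\<close>, left multiplication
  \<open>t\<close> by \<open>psi y\<close> is a root of the minimal polynomial of \<open>y\<close>,
  which factors with right multiplications by images of conjugates as roots. The factor for
  \<open>y\<close> itself does not kill \<open>v\<close>, so another conjugate \<open>y'\<close>
  occurs as an eigenvalue.\<close>

theorem intertwiner:
 assumes y: "y \<in> carrier W" and E: "O.between E" "y \<in> E"
  and psi: "psi \<in> ring_hom (O.sub E) D" "!!z. z \<in> Z ==> psi (g z) = z"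
  and zs: "set zs \<subseteq> E" "O.Irr k y = pl W (zs @ [y])"
  and v: "v \<in> carrier D" "psi y ** v ~= v ** psi y"
 obtains u y' where "u \<in> carrier D" "u ~= \<zero>" "y' \<in> set zs" "psi y ** u = u ** psi y'"
proof -
 note Ep = O.betweenD[OF E(1)]
 interpret Er: field "O.sub E" by (rule Ep(6))
 interpret psi: ring_hom_ring "O.sub E" D psi by (rule ring_hom_ringI2[OF Er.ring_axioms D.ring_axioms psi(1)])
 have G: "abelian_group D" by (rule D.abelian_group_axioms)
 let ?R = "op_ring D"
 interpret R: ring ?R by (rule op_ring_is_ring[OF G])
 define lop where "lop d = restrict (%v. d ** v) (carrier D)" for d
 define rop where "rop c = restrict (%v. v ** psi c) (carrier D)" for c
 have psic: "psi c \<in> carrier D" if "c \<in> E" for c using psi.hom_closed that by simp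
 have lopR: "lop d \<in> carrier ?R" if "d \<in> carrier D" for d
  by (rule op_ring_closedI) (use that in "auto simp: lop_def D.r_distr")
 have ropR: "rop c \<in> carrier ?R" if "c \<in> E" for c
  by (rule op_ring_closedI) (use psic[OF that] in "auto simp: rop_def D.l_distr")
 have lv: "lop d v = d ** v" "rop c v = v ** psi c" if "v \<in> carrier D" for d c v
  using that by (simp_all add: lop_def rop_def)
 have Rext: "a = b" if "a \<in> carrier ?R" "b \<in> carrier ?R" "!!v. v \<in> carrier D ==> a v = b v" for a b
  by (rule op_ring_ext[OF op_ring_extensional(1)[OF that(1)] op_ring_extensional(1)[OF that(2)] that(3)])
 have lop_hom: "lop \<in> ring_hom D ?R"
 proof (rule ring_hom_memI)
  fix a b assume ab: "a \<in> carrier D" "b \<in> carrier D"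
  show "lop (a ** b) = lop a **[?R] lop b"
   by (rule Rext) (use ab lopR in "simp_all add: op_ring_simps(3) lv D.m_assoc")
  show "lop (a \<oplus> b) = lop a \<oplus>[?R] lop b"
   by (rule Rext) (use ab lopR in "simp_all add: op_ring_simps(4) lv D.l_distr")
 next
  show "lop \<one> = \<one>[?R]" by (rule Rext) (use lopR in "simp_all add: op_ring_simps(5) lv")
 qed (rule lopR)
 \<comment> \<open>Right multiplications reverse products, which does no harm as \<open>E\<close> is
   commutative.\<close>
 have rop_hom: "rop \<in> ring_hom (O.sub E) ?R"
 proof (rule ring_hom_memI)
  show "rop c \<in> carrier ?R" if "c \<in> carrier (O.sub E)" for c using ropR that by simp
  fix a b assume ab: "a \<in> carrier (O.sub E)" "b \<in> carrier (O.sub E)"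
  have abE: "a \<in> E" "b \<in> E" using ab by auto
  note c = psic[OF abE(1)] psic[OF abE(2)]
  have "a **[W] b \<in> E" "a \<oplus>[W] b \<in> E" using subringE(6,7)[OF Ep(3)] abE by auto
  moreover have "psi (a **[W] b) = psi b ** psi a" "psi (a \<oplus>[W] b) = psi a \<oplus> psi b"
   using psi.hom_mult[OF ab(2,1)] psi.hom_add[OF ab] Er.m_comm[OF ab] by simp_all
  ultimately show "rop (a **[O.sub E] b) = rop a **[?R] rop b" "rop (a \<oplus>[O.sub E] b) = rop a \<oplus>[?R] rop b"
   by (intro Rext; use ropR abE c in "simp add: op_ring_simps(3,4) lv D.m_assoc D.r_distr")+
 next
  have "psi \<one>[W] = \<one>" using psi.hom_one by simp
  then show "rop \<one>[O.sub E] = \<one>[?R]"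
   by (intro Rext) (use ropR[OF subringE(3)[OF Ep(3)]] in "simp_all add: op_ring_simps(5) lv")
 qed
 define t where "t = lop (psi y)"
 have t: "t \<in> carrier ?R" unfolding t_def by (rule lopR[OF psic[OF E(2)]])
 have comm: "t **[?R] rop c = rop c **[?R] t" if "c \<in> carrier (O.sub E)" for c
 proof -
  have c: "c \<in> E" using that by simp
  show ?thesis
   by (rule Rext) (use t ropR[OF c] psic[OF c] psic[OF E(2)] in
     \<open>simp_all add: op_ring_simps(3) lv t_def D.m_assoc\<close>)
 qed
 have ysE: "set (zs @ [y]) \<subseteq> carrier (O.sub E)" using zs(1) E(2) by simp
 note I = O.Irr_props[OF O.between_K y]
 have Ik: "set (O.Irr k y) \<subseteq> k" by (rule O.poly_coeffs[OF I(1)])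
 let ?P = "%ys A. foldr (%y a. (t \<ominus>[?R] rop y) **[?R] a) ys A"
 \<comment> \<open>The coefficients are central in \<open>D\<close>, so left and right
   multiplication by them agree.\<close>
 have "map rop (O.Irr k y) = map (%c. lop (psi c)) (O.Irr k y)"
 proof (rule map_cong[OF refl])
  fix c assume "c \<in> set (O.Irr k y)"
  then obtain z where z: "z \<in> Z" "c = g z" using Ik by blast
  have cE: "c \<in> E" using z O.betweenD(2)[OF E(1)] by blast
  show "rop c = lop (psi c)"
   by (rule Rext) (use ropR[OF cE] lopR[OF psic[OF cE]] z psi(2) Z_comm in "simp_all add: lv")
 qed
 moreover have "R.eval (map (%c. lop (psi c)) (O.Irr k y)) t = \<zero>[?R]"
 proof -
  have h: "(%c. lop (psi c)) \<in> ring_hom (O.sub E) ?R"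
   using ring_hom_trans[OF psi(1) lop_hom] by (simp add: comp_def)
  interpret h: ring_hom_ring "O.sub E" ?R "%c. lop (psi c)"
   by (rule ring_hom_ringI2[OF Er.ring_axioms R.ring_axioms h])
  have "Er.eval (O.Irr k y) y = \<zero>[W]" using O.eval_consistent[OF Ep(3)] I(3) by simp
  moreover have "set (O.Irr k y) \<subseteq> carrier (O.sub E)" using Ik Ep(2) by auto
  moreover have "lop (psi \<zero>[W]) = \<zero>[?R]" using h.hom_zero by simp
  ultimately show ?thesis using h.eval_hom'[of y "O.Irr k y"] E(2) unfolding t_def by simp
 qed
 ultimately have "R.eval (map rop (O.Irr k y)) t = \<zero>[?R]" by (simp only:)
 moreover have "pl (O.sub E) (zs @ [y]) = pl W (zs @ [y])" by (rule O.pl_sub[OF E(1)]) (use ysE in simp)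
 ultimately have "R.eval (map rop (pl (O.sub E) (zs @ [y]))) t = \<zero>[?R]" unfolding zs(2) by (simp only:)
 then have "?P (zs @ [y]) \<one>[?R] = \<zero>[?R]"
  using R.eval_pl_commuting[OF rop_hom Ep(6) t comm ysE] by simp
 moreover have PR: "?P vs A \<in> carrier ?R" if "set vs \<subseteq> E" "A \<in> carrier ?R" for vs A
  using that t ropR by (induction vs) auto
 have shift: "?P vs A = ?P vs \<one>[?R] **[?R] A" if "set vs \<subseteq> E" "A \<in> carrier ?R" for vs A
  using that
 proof (induction vs)
  case (Cons c vs)
  then show ?case using PR[of vs "\<one>[?R]"] t ropR[of c] by (simp add: R.m_assoc)
 qed simp
 have tr: "t \<ominus>[?R] rop y \<in> carrier ?R" using t ropR[OF E(2)] by simp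
 \<comment> \<open>As \<open>y\<close> is last in the list, its factor acts first and produces the
   vector \<open>v1\<close> from \<open>v\<close>.\<close>
 have "?P (zs @ [y]) \<one>[?R] = ?P zs ((t \<ominus>[?R] rop y) **[?R] \<one>[?R])" by (simp only: foldr_append foldr_Cons foldr_Nil comp_apply id_apply)
 then have "?P (zs @ [y]) \<one>[?R] = ?P zs \<one>[?R] **[?R] (t \<ominus>[?R] rop y)"
  unfolding R.r_one[OF tr] shift[OF zs(1) tr] .
 ultimately have "(?P zs \<one>[?R] **[?R] (t \<ominus>[?R] rop y)) v = \<zero>"
  using op_ring_simps(6)[OF v(1)] by simp
 moreover define v1 where "v1 = psi y ** v \<ominus> v ** psi y"
 have v1: "(t \<ominus>[?R] rop y) v = v1"
  using op_ring_minus[OF G t ropR[OF E(2)] v(1)] v(1) by (simp add: v1_def t_def lv)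
 ultimately have z: "?P zs \<one>[?R] v1 = \<zero>" using op_ring_simps(3)[OF v(1)] by simp
 have v1c: "v1 \<in> carrier D" "v1 ~= \<zero>"
  using v psic[OF E(2)] by (simp_all add: v1_def D.r_right_minus_eq)
 have rz: "rop c \<in> carrier ?R" if "c \<in> set zs" for c using ropR zs(1) that by blast
 have "\<exists>u y. u \<in> carrier D \<and> u ~= \<zero> \<and> y \<in> set zs \<and> t u = rop y u"
  by (rule op_ring_eigenvector[OF G t rz v1c z])
 then obtain u y' where u: "u \<in> carrier D" "u ~= \<zero>" "y' \<in> set zs" "t u = rop y' u" by (elim exE conjE)
 have 4: "psi y ** u = u ** psi y'" using u(1,4) by (simp add: t_def lv)
 show ?thesis by (rule that[OF u(1-3) 4])
qed

end

lemma (in algebraic_closure) exists_radical: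
 assumes "(n::nat) > 0" "c \<in> carrier L"
 obtains x where "x \<in> carrier L" "x [^] n = c"
proof -
 note f = pure_props[OF assms zero_closed]
 obtain ys where ys: "set ys \<subseteq> carrier L" "pure n c = pl L ys" using exists_pl[OF f(1,5,3)] by blast
 have "length ys = n" using pl_closed(4)[OF ys(1)] ys(2) f(2) by simp
 then obtain x where x: "x \<in> set ys" using assms(1) by (cases ys) auto
 then have xc: "x \<in> carrier L" using ys(1) by blast
 have "eval (pure n c) x = \<zero>" using pl_eval_zero[OF ys(1) xc] ys(2) x by simp
 then have "x [^] n = c" using pure_props(4)[OF assms xc] xc assms(2) by (simp add: r_right_minus_eq)
 then show ?thesis using that xc by blast
qed

context center_closure
begin

text \<open>The values of the norm form of \<open>M\<close> never reach \<open>u\<^sup>p\<close>: otherwise rescaling \<open>u\<close> by an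
 element of \<open>M\<close> yields a noncentral \<open>p\<close>-th root of unity.\<close>

lemma intertwiner_not_norm:
 fixes p :: nat
 assumes p: "prime p" "p dvd dl" and y: "y \<in> carrier W" and M: "M = O.simple_extension k y"
  and s: "O.hom_over M s" "s ` M \<subseteq> M" "s y ~= y" "!!x. x \<in> M ==> (s ^^ p) x = x"
  and psi: "psi \<in> ring_hom (O.sub M) D" "!!z. z \<in> Z ==> psi (g z) = z"
  and u: "u \<in> carrier D" "u ~= \<zero>" "psi y ** u = u ** psi (s y)"
 obtains a where "a \<in> k" "a ~= \<zero>[W]" "!!b. b \<in> M ==> nrm W s b p ~= a"
proof -
 have Mb: "O.between M" and yM: "y \<in> M" unfolding M using O.between_simple[OF O.between_K y] by auto
 note Mp = O.betweenD[OF Mb]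
 interpret Mr: field "O.sub M" by (rule Mp(6))
 interpret psi: ring_hom_ring "O.sub M" D psi by (rule ring_hom_ringI2[OF Mr.ring_axioms D.ring_axioms psi(1)])
 interpret s: ring_hom_ring "O.sub M" W s by (rule O.hom_over_ring[OF Mb s(1)])
 note sM = subringE[OF Mp(3)]
 have sc: "s m \<in> M" if "m \<in> M" for m using s(2) that by blast
 have psic: "psi m \<in> carrier D" if "m \<in> M" for m using psi.hom_closed that by simp
 have psim: "psi (m **[W] n) = psi m ** psi n" "psi (m \<oplus>[W] n) = psi m \<oplus> psi n" if "m \<in> M" "n \<in> M" for m n
  using psi.hom_mult[of m n] psi.hom_add[of m n] that by simp_all
 have psicomm: "psi m ** psi n = psi n ** psi m" if "m \<in> M" "n \<in> M" for m n
  using psim(1)[OF that] psim(1)[OF that(2,1)] O.m_comm[of m n] that Mp(5) by simp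
 have psiinj: "m = n" if "m \<in> M" "n \<in> M" "psi m = psi n" for m n
 proof -
  have "inj_on psi (carrier (O.sub M))"
   using psi.img_is_subfield(1)[OF Mr.carrier_is_subfield D.one_not_zero] .
  then show ?thesis using that by (auto dest: inj_onD)
 qed
 have psi0: "psi \<zero>[W] = \<zero>" "psi \<one>[W] = \<one>" using psi.hom_zero psi.hom_one by simp_all
 have s0: "s \<zero>[W] = \<zero>[W]" using s.hom_zero by simp
 have uM: "psi m ** u = u ** psi (s m)" if "m \<in> M" for m
  using that unfolding M
 proof induction
  case zero
  show ?case using u(1) s0 psi0 by simp
 next
  case (lin k1 k2)
  have k: "k1 \<in> M" "k2 \<in> M" using lin M Mp(2) by auto
  have sk2: "s k2 = k2" by (rule O.hom_overD(2)[OF s(1) lin(2)])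
  obtain z where z: "z \<in> Z" "k2 = g z" using lin(2) by blast
  have z2: "psi k2 ** u = u ** psi k2" using psi(2)[OF z(1)] z Z_comm[OF z(1) u(1)] by simp
  have k1y: "k1 **[W] y \<in> M" using sM(6)[OF k(1) yM] .
  have e1: "psi (k1 **[W] y \<oplus>[W] k2) = psi k1 ** psi y \<oplus> psi k2" using psim k yM k1y by simp
  have e2: "s (k1 **[W] y \<oplus>[W] k2) = s k1 **[W] s y \<oplus>[W] k2"
   using O.hom_overD(4,5)[OF s(1)] k yM k1y sk2 by simp
  have e3: "psi (s k1 **[W] s y \<oplus>[W] k2) = psi (s k1) ** psi (s y) \<oplus> psi k2"
   using psim sc[OF k(1)] sc[OF yM] k(2) sM(6) by simp
  note c = psic[OF k(1)] psic[OF k(2)] psic[OF yM] psic[OF sc[OF k(1)]] psic[OF sc[OF yM]]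
  have "(psi k1 ** psi y \<oplus> psi k2) ** u = psi k1 ** (psi y ** u) \<oplus> psi k2 ** u"
   using c u(1) by (simp add: D.l_distr D.m_assoc)
  also have "\<dots> = (psi k1 ** u) ** psi (s y) \<oplus> u ** psi k2" using u(3) z2 c u(1) by (simp add: D.m_assoc)
  also have "\<dots> = u ** (psi (s k1) ** psi (s y) \<oplus> psi k2)"
   using lin(3) c u(1) by (simp add: D.r_distr D.m_assoc)
  finally show ?case unfolding e1 e2 e3 .
 qed
 define v where "v = inv u"
 have v: "v \<in> carrier D" "v ~= \<zero>" "u ** v = \<one>" "v ** u = \<one>" using D.inv_ex[OF u(1,2)] by (simp_all add: v_def)
 have vM: "v ** psi m = psi (s m) ** v" if m: "m \<in> M" for m
 proof -
  note c = psic[OF m] psic[OF sc[OF m]]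
  have "v ** psi m = v ** (psi m ** u) ** v" using c u v by (simp add: D.m_assoc)
  also have "\<dots> = (v ** u) ** psi (s m) ** v" unfolding uM[OF m] using c u(1) v(1) by (simp add: D.m_assoc)
  finally show ?thesis using v c by simp
 qed
 have pw: "w [^] i ** psi m = psi ((s ^^ i) m) ** w [^] i \<and> (s ^^ i) m \<in> M"
  if w: "w \<in> carrier D" "!!m. m \<in> M ==> w ** psi m = psi (s m) ** w" and m: "m \<in> M" for w m and i :: nat
  using m
 proof (induction i arbitrary: m)
  case 0
  then show ?case using psic by simp
 next
  case (Suc i)
  note ih = Suc(1)[OF sc[OF Suc(2)]]
  have c: "psi m \<in> carrier D" "psi (s m) \<in> carrier D" "psi ((s ^^ i) (s m)) \<in> carrier D"
   using psic Suc(2) sc ih by auto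
  have "w [^] Suc i ** psi m = w [^] i ** (w ** psi m)" using w(1) c by (simp add: D.m_assoc)
  also have "\<dots> = (w [^] i ** psi (s m)) ** w" unfolding w(2)[OF Suc(2)] using w(1) c by (simp add: D.m_assoc)
  also have "\<dots> = psi ((s ^^ i) (s m)) ** (w [^] i ** w)" using ih w(1) c by (simp add: D.m_assoc)
  finally show ?case using ih by (simp add: funpow_swap1)
 qed
 have nc: "psi y ** w ~= w ** psi y"
  if w: "w \<in> carrier D" "w ~= \<zero>" "w ** psi y = psi (s y) ** w" for w
 proof
  assume e: "psi y ** w = w ** psi y"
  note c = psic[OF yM] psic[OF sc[OF yM]] D.inv_ex(1,2)[OF w(1,2)]
  have "psi y ** w ** inv w = psi (s y) ** w ** inv w" using e w(3) by simp
  then have "psi y = psi (s y)" using c w(1) by (simp add: D.m_assoc)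
  then show False using psiinj[OF yM sc[OF yM]] s(3) by simp
 qed
 \<comment> \<open>Conjugation by \<open>v\<close> induces \<open>s\<close> on the image of
   \<open>M\<close>, so the \<open>p\<close>-th power commutes with \<open>psi y\<close> as well as
   with \<open>v\<close>. These two do not commute, so the power is central.\<close>
 let ?a = "v [^] p"
 have aZ: "?a \<in> Z"
 proof (rule centralizes_noncommuting[of _ "psi y" v])
  show "?a \<in> carrier D" using v(1) by simp
  show "psi y ** ?a = ?a ** psi y" using pw[OF v(1) vM yM, of p] s(4)[OF yM] by simp
  show "v ** ?a = ?a ** v" using v(1) D.nat_pow_comm[of v 1 p] by simp
  show "psi y ** v ~= v ** psi y" by (rule nc[OF v(1,2) vM[OF yM]])
 qed (use v psic[OF yM] in auto)
 have a0: "w [^] i ~= \<zero>" if "w \<in> carrier D" "w ~= \<zero>" for w and i :: nat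
  using that
 proof (induction i)
  case (Suc i)
  then show ?case using D.integral[of "w [^] i" w] by auto
 qed (use D.one_not_zero in simp)
 have gaM: "g ?a \<in> M" using aZ Mp(2) by blast
 have ga: "psi (g ?a) = ?a" by (rule psi(2)[OF aZ])
 have ga0: "g ?a ~= \<zero>[W]"
 proof
  assume "g ?a = \<zero>[W]"
  then show False using ga psi0(1) a0[OF v(1,2), of p] by simp
 qed
 have "nrm W s b p ~= g ?a" if b: "b \<in> M" for b
 proof
  assume eq: "nrm W s b p = g ?a"
  have n: "nrm W s b i \<in> M" for i by (rule O.nrm_closed[OF sc b Mp(3)])
  have b0: "b ~= \<zero>[W]"
  proof
   assume "b = \<zero>[W]"
   moreover obtain m where "p = Suc m" using prime_gt_0_nat[OF p(1)] by (cases p) auto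
   ultimately have "nrm W s b p = \<zero>[W]" using Mp(5)[OF sc[OF n]] by simp
   then show False using eq ga0 by simp
  qed
  have "psi b ~= \<zero>" using psiinj[OF b sM(2)] b0 psi0 by auto
  note bi = D.inv_ex[OF psic[OF b] this]
  \<comment> \<open>Dividing \<open>v\<close> by \<open>psi b\<close> leaves its action on the image
    of \<open>M\<close> unchanged and divides its \<open>p\<close>-th power by the norm of
    \<open>b\<close>, here \<open>?a\<close> itself.\<close>
  define w where "w = inv (psi b) ** v"
  have w: "w \<in> carrier D" using bi v by (simp add: w_def)
  have bw: "psi b ** w = v" using bi v(1) psic[OF b] D.m_assoc[of "psi b" "inv (psi b)" v] by (simp add: w_def)
  have wM: "w ** psi m = psi (s m) ** w" if m: "m \<in> M" for m
  proof -
   note c = psic[OF m] psic[OF sc[OF m]] bi(1) v(1)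
   have i: "inv (psi b) ** psi (s m) = psi (s m) ** inv (psi b)"
    by (rule D.inv_commute[OF psic[OF b] c(2) \<open>psi b ~= \<zero>\<close> psicomm[OF b sc[OF m]]])
   have "w ** psi m = inv (psi b) ** (v ** psi m)" using c by (simp add: w_def D.m_assoc)
   also have "\<dots> = inv (psi b) ** psi (s m) ** v" unfolding vM[OF m] using c by (simp add: D.m_assoc)
   finally show ?thesis unfolding i using c by (simp add: w_def D.m_assoc)
  qed
  have "v [^] i = psi (nrm W s b i) ** w [^] i" for i :: nat
  proof (induction i)
   case 0
   show ?case using psi0 by simp
  next
   case (Suc i)
   have sn: "s (nrm W s b i) \<in> M" by (rule sc[OF n])
   note c = psic[OF n[of i]] psic[OF sn] psic[OF b] w
   have "v [^] Suc i = v ** v [^] i" using v(1) D.nat_pow_Suc2 by simp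
   also have "\<dots> = (psi b ** w) ** (psi (nrm W s b i) ** w [^] i)" using Suc bw by simp
   also have "\<dots> = psi b ** (w ** psi (nrm W s b i)) ** w [^] i" using c by (simp add: D.m_assoc)
   also have "\<dots> = (psi b ** psi (s (nrm W s b i))) ** (w ** w [^] i)"
    unfolding wM[OF n] using c by (simp add: D.m_assoc)
   also have "\<dots> = psi (nrm W s b (Suc i)) ** w [^] Suc i"
    unfolding psicomm[OF b sn] using psim(1)[OF sn b] w D.nat_pow_Suc2 by simp
   finally show ?case .
  qed
  from this[of p] have "?a = ?a ** w [^] p" unfolding eq ga .
  then have "inv ?a ** ?a = inv ?a ** (?a ** w [^] p)" by simp
  moreover note ai = D.inv_ex[OF D.nat_pow_closed[OF v(1), of p] a0[OF v(1,2)]]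
  ultimately have "w [^] p = \<one>" using w v(1) by (simp add: D.m_assoc[symmetric])
  then have wZ: "w \<in> Z" by (rule central_unity[OF p w])
  have "w ~= \<zero>" using bw v(2) psic[OF b] by auto
  then show False using nc[OF w _ wM[OF yM]] Z_comm[OF wZ psic[OF yM]] by simp
 qed
 then show ?thesis using that[of "g ?a"] aZ ga0 by blast
qed

text \<open>\<open>M\<close> embeds into \<open>D\<close>, which yields a non-norm \<open>a\<close>.
  A \<open>p\<close>-th root \<open>x\<close> of \<open>a\<close>, or of \<open>- a\<close> if
  \<open>p = 2\<close>, must lie in \<open>k\<close>: outside \<open>M\<close> it would make
  \<open>a\<close> a norm by \<open>radical_norm\<close>, and in \<open>M\<close> but outside
  \<open>k\<close> its own norm is \<open>a\<close>. In \<open>k\<close> its norm is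
  \<open>x^p\<close>, which is \<open>a\<close> for odd \<open>p\<close>. For \<open>p = 2\<close>
  the norm is \<open>- a\<close>, so \<open>-1\<close> is no norm either.\<close>

theorem cyclic_extension:
 fixes p :: nat
 assumes p: "prime p" and y: "y \<in> carrier W" and M: "M = O.simple_extension k y" "O.dimension p k M"
  and s: "O.hom_over M s" "s ` M \<subseteq> M" "s y ~= y"
 shows "p = 2" "b \<in> M ==> s b **[W] b ~= \<ominus>[W] \<one>[W]"
proof -
 have Mb: "O.between M" and yM: "y \<in> M" unfolding M(1) using O.between_simple[OF O.between_K y] by auto
 note Mp = O.betweenD[OF Mb]
 have p0: "p > 0" using p prime_gt_0_nat by blast
 have sc: "s m \<in> M" if "m \<in> M" for m using s(2) that by blast
 have cy: "x \<in> M ==> (s ^^ p) x = x" "inj_on (%i. (s ^^ i) y) {..<p}" for x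
  using O.cyclic_prime_degree[where s = s, OF y M p s(1) _ s(3)] sc by blast+
 note em = embed_prime_degree[OF Mb M(2) p]
 have pd: "p dvd dl" using em(1) by simp
 obtain psi where psi: "psi \<in> ring_hom (O.sub M) D" "!!z. z \<in> Z ==> psi (g z) = z" using em(2) by blast
 have homi: "O.hom_over M (s ^^ i) \<and> (s ^^ i) ` M \<subseteq> M" for i
 proof (induction i)
  case 0
  show ?case using O.hom_over_id[OF Mb] by (simp add: id_def)
 next
  case (Suc i)
  have "O.hom_over M (%x. s ((s ^^ i) x))" by (rule O.hom_over_comp[OF _ s(1)]) (use Suc in blast)+
  moreover have "s ` (s ^^ i) ` M \<subseteq> M" using Suc s(2) by blast
  ultimately show ?case by (simp add: comp_def image_comp)
 qed
 note I = O.Irr_props[OF O.between_K y]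
 obtain ys where ys: "set ys \<subseteq> carrier W" "O.Irr k y = pl W ys" using O.exists_pl[OF I(5,4,2)] by blast
 have len: "length ys = p"
  using O.pl_closed(4)[OF ys(1)] ys(2) O.dimension_unique[OF O.between_K O.between_simple(4)[OF O.between_K y]] M by simp
 have mem: "x \<in> set ys \<longleftrightarrow> x \<in> carrier W \<and> O.eval (O.Irr k y) x = \<zero>[W]" for x
  using O.pl_eval_zero[OF ys(1)] ys by auto
 let ?C = "(%i. (s ^^ i) y) ` {..<p}"
 have sub: "?C \<subseteq> set ys"
 proof
  fix x assume "x \<in> ?C"
  then obtain i where x: "x = (s ^^ i) y" by blast
  have h: "O.hom_over M (s ^^ i)" using homi by blast
  have "(s ^^ i) y \<in> M" using homi[of i] yM by blast
  then show "x \<in> set ys" unfolding mem x using O.hom_over_conjugate[OF Mb h yM] Mp(5) by simp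
 qed
 have "card ?C = p" using card_image[OF cy(2)] by simp
 then have setys: "set ys = ?C" and dist: "distinct ys"
  using sub len card_length[of ys] card_subset_eq[OF finite_set sub] card_distinct[of ys]
  by (metis card_mono finite_set le_antisym)+
 have yys: "y \<in> set ys" using mem y I(3) by simp
 \<comment> \<open>The conjugates of \<open>y\<close> other than \<open>y\<close>; placing
   \<open>y\<close> last is the form required by \<open>intertwiner\<close>.\<close>
 define zs where "zs = remove1 y ys"
 have zsy: "y \<notin> set zs" using dist by (simp add: zs_def)
 have "mset (zs @ [y]) = mset ys" using yys by (simp add: zs_def)
 then have irr: "O.Irr k y = pl W (zs @ [y])" using ys O.pl_mset[of ys "zs @ [y]"] by simp
 have zsM: "set zs \<subseteq> M"
 proof -
  have "?C \<subseteq> M" using homi yM by blast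
  then show ?thesis using setys set_remove1_subset[of y ys] by (auto simp: zs_def)
 qed
 interpret Mr: field "O.sub M" by (rule Mp(6))
 interpret psi: ring_hom_ring "O.sub M" D psi by (rule ring_hom_ringI2[OF Mr.ring_axioms D.ring_axioms psi(1)])
 have psiinj: "inj_on psi M" using psi.img_is_subfield(1)[OF Mr.carrier_is_subfield D.one_not_zero] by simp
 have psiy: "psi y \<in> carrier D" using psi.hom_closed yM by simp
 have "psi y \<notin> Z"
 proof
  assume z: "psi y \<in> Z"
  have "g (psi y) \<in> M" using z Mp(2) by blast
  then have "g (psi y) = y" using inj_onD[OF psiinj, of "g (psi y)" y] psi(2)[OF z] yM by simp
  then have "y \<in> k" using z by (metis image_eqI)
  then show False using s(3) O.hom_overD(2)[OF s(1)] by blast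
 qed
 then obtain v where v: "v \<in> carrier D" "psi y ** v ~= v ** psi y" using Z_I[OF psiy] by blast
 obtain u y' where u: "u \<in> carrier D" "u ~= \<zero>" "y' \<in> set zs" "psi y ** u = u ** psi y'"
  by (rule intertwiner[OF y Mb yM psi zsM irr v])
 have "y' \<in> ?C" using u(3) setys set_remove1_subset[of y ys] by (auto simp: zs_def)
 then obtain j where j: "j < p" "y' = (s ^^ j) y" by blast
 \<comment> \<open>Only some nontrivial power of \<open>s\<close> is known to be induced by an
   element of \<open>D\<close>; for \<open>p = 2\<close> it has to be \<open>s\<close>.\<close>
 define sg where "sg = s ^^ j"
 have sg: "O.hom_over M sg" "sg ` M \<subseteq> M" "sg y ~= y"
  using homi[of j] u(3) zsy j(2) by (auto simp: sg_def)
 have sgc: "sg m \<in> M" if "m \<in> M" for m using sg(2) that by blast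
 have csg: "(sg ^^ p) x = x" if "x \<in> M" for x
  by (rule O.cyclic_prime_degree(1)[where s = sg, OF y M p sg(1) _ sg(3) that]) (rule sgc)
 have fsg: "sg x = x \<longleftrightarrow> x \<in> k" if "x \<in> M" for x
  by (rule O.cyclic_prime_degree(2)[where s = sg, OF y M p sg(1) _ sg(3) that]) (rule sgc)
 have u4: "psi y ** u = u ** psi (sg y)" using u(4) j(2) by (simp add: sg_def)
 obtain a where a: "a \<in> k" "a ~= \<zero>[W]" "!!b. b \<in> M ==> nrm W sg b p ~= a"
  using intertwiner_not_norm[OF p pd y M(1) sg csg psi u(1,2) u4] by metis
 have ac: "a \<in> carrier W" using O.betweenD(5)[OF O.between_K a(1)] .
 \<comment> \<open>The sign compensates the one in the norm of a \<open>p\<close>-th root, so that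
   the value obtained is \<open>a\<close>.\<close>
 define a' where "a' = (if p = 2 then \<ominus>[W] a else a)"
 have a': "a' \<in> k" "(if p = 2 then \<ominus>[W] a' else a') = a"
  using O.betweenE(5)[OF O.between_K a(1)] a(1) ac by (auto simp: a'_def)
 have a'c: "a' \<in> carrier W" using O.betweenD(5)[OF O.between_K a'(1)] .
 obtain x where x: "x \<in> carrier W" "x [^][W] p = a'" using O.exists_radical[OF p0 a'c] .
 have un: "r \<in> k" if "r \<in> carrier W" "r [^][W] p = \<one>[W]" for r by (rule unity[OF p pd that])
 have xM: "x \<in> M"
 proof (rule ccontr)
  assume nx: "x \<notin> M"
  have "\<exists>b\<in>M. nrm W sg b p = (if p = 2 then \<ominus>[W] (x [^][W] p) else x [^][W] p)"
   by (rule O.radical_norm[OF perfect p y M sg un _ x(1) nx]) (use norms x(2) a'(1) in auto)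
  then show False using a(3) a'(2) x(2) by auto
 qed
 have xk: "x \<in> k"
 proof (rule ccontr)
  assume nk: "x \<notin> k"
  have x0: "x ~= \<zero>[W]" using nk O.betweenE(2)[OF O.between_K] by blast
  have xi: "inv[W] x \<in> carrier W" "x **[W] inv[W] x = \<one>[W]" "inv[W] x **[W] x = \<one>[W]"
   using x0 x(1) O.field_Units by auto
  have sx: "sg x \<in> carrier W" using sgc[OF xM] Mp(5) by blast
  define z where "z = sg x **[W] inv[W] x"
  have zc: "z \<in> carrier W" using sx xi by (simp add: z_def)
  have zx: "sg x = z **[W] x" using sx xi x(1) by (simp add: z_def O.m_assoc)
  have "sg (x [^][W] i) = sg x [^][W] i \<and> x [^][W] i \<in> M" for i :: nat
  proof (induction i)
   case 0
   show ?case
    using O.hom_overD(2)[OF sg(1)] O.betweenE(3)[OF O.between_K] subringE(3)[OF Mp(3)] by simp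
  next
   case (Suc i)
   then show ?case using O.hom_overD(4)[OF sg(1) _ xM] subringE(6)[OF Mp(3) _ xM] by simp
  qed
  then have "sg x [^][W] p = x [^][W] p" using x(2) O.hom_overD(2)[OF sg(1) a'(1)] by metis
  then have "z [^][W] p = (x **[W] inv[W] x) [^][W] p"
   using sx xi(1) x(1) by (simp add: z_def O.nat_pow_distrib)
  then have z1: "z [^][W] p = \<one>[W]" using xi by simp
  have z2: "z ~= \<one>[W]" using fsg[OF xM] nk zx x(1) by auto
  have "nrm W sg x p = z [^][W] (\<Sum>j<p. j) **[W] x [^][W] p"
   by (rule O.nrm_root[OF Mb sg(1) xM zx un[OF zc z1]])
  also have "\<dots> = (if p = 2 then \<ominus>[W] (x [^][W] p) else x [^][W] p)"
   by (rule O.unity_power_sum[OF p zc z2 z1]) (use x a'c in simp)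
  finally have "nrm W sg x p = a" unfolding x(2) a'(2) .
  then show False using a(3)[OF xM] by blast
 qed
 have sgx: "sg x = \<one>[W] **[W] x" using fsg[OF xM] xk x(1) by simp
 have nx: "nrm W sg x p = x [^][W] p"
  using O.nrm_root[OF Mb sg(1) xM sgx O.betweenE(3)[OF O.between_K], of p] x(1) by simp
 show p2: "p = 2"
 proof (rule ccontr)
  assume "p ~= 2"
  then have "nrm W sg x p = a" using nx x(2) a'(2) by simp
  then show False using a(3)[OF xM] by blast
 qed
 have j1: "j = 1"
 proof -
  have "j ~= 0"
  proof
   assume "j = 0"
   then show False using sg(3) by (simp add: sg_def)
  qed
  then show ?thesis using j(1) p2 by simp
 qed
 assume b: "b \<in> M"
 show "s b **[W] b ~= \<ominus>[W] \<one>[W]"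
 proof
  assume e: "s b **[W] b = \<ominus>[W] \<one>[W]"
  have ssg: "sg = s" using j1 by (simp add: sg_def)
  have "s \<one>[W] = \<one>[W]" using O.hom_overD(2)[OF s(1)] O.betweenE(3)[OF O.between_K] by simp
  then have "nrm W sg b p = \<ominus>[W] \<one>[W]"
   using e Mp(5)[OF b] unfolding p2 ssg by (simp add: numeral_2_eq_2)
  then have "nrm W sg (x **[W] b) p = \<ominus>[W] a'"
   using O.nrm_mult[OF Mb sg(1,2) xM b, of p] nx x a'c by (simp add: O.r_minus)
  then show False using a(3)[OF subringE(6)[OF Mp(3) xM b]] a'(2) p2 by simp
 qed
qed

end

lemma (in ring) minus_add_cancel:
 assumes "a \<in> carrier R" "b \<in> carrier R" "c \<in> carrier R"
 shows "(a \<oplus> c) \<ominus> (b \<oplus> c) = a \<ominus> b"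
proof -
 have "c \<oplus> (\<ominus> b \<oplus> \<ominus> c) = \<ominus> b" using assms by (simp add: a_lcomm[of c] r_neg)
 then show ?thesis using assms by (simp add: minus_eq minus_add a_assoc)
qed

context center_closure
begin

lemma centralizer_subfield:
 assumes x: "x \<in> carrier D" "x \<notin> Z"
 shows "subfield {c \<in> carrier D. \<forall>s\<in>{x}. c ** s = s ** c} D" "Z \<subseteq> {c \<in> carrier D. \<forall>s\<in>{x}. c ** s = s ** c}"
proof -
 let ?C = "{c \<in> carrier D. \<forall>s\<in>{x}. c ** s = s ** c}"
 have xD: "{x} \<subseteq> carrier D" using x by simp
 show "subfield ?C D"
 proof (rule D.commutative_subring_subfield)
  show "subring ?C D" by (rule D.centralizer_subring[OF xD])
  show "a ** b = b ** a" if "a \<in> ?C" "b \<in> ?C" for a b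
   using centralizes_noncommuting[OF x(1), of a b] x(2) that by auto
  show "inv a \<in> ?C" if "a \<in> ?C" "a ~= \<zero>" for a by (rule D.centralizer_inv[OF xD that])
 qed
 show "Z \<subseteq> ?C" using Z_carrier Z_comm x by auto
qed

text \<open>A noncentral \<open>x\<close> lies in its centralizer, a field finite over
  \<open>Z\<close>. If \<open>Z\<close> were algebraically closed, the minimal polynomial of
  \<open>x\<close> would have all its roots in \<open>Z\<close>, and \<open>central_root\<close>
  would make \<open>x\<close> central.\<close>

lemma not_closed: "k ~= carrier W"
proof
 assume all: "k = carrier W"
 obtain x y where xy: "x \<in> carrier D" "y \<in> carrier D" "x ** y ~= y ** x" using noncomm by blast
 have x: "x \<notin> Z" using xy Z_comm by blast
 define F where "F = {c \<in> carrier D. \<forall>s\<in>{x}. c ** s = s ** c}"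
 have F: "subfield F D" "Z \<subseteq> F" unfolding F_def by (rule centralizer_subfield[OF xy(1) x])+
 have xF: "x \<in> F" using xy by (simp add: F_def)
 note sF = subfieldE(1)[OF F(1)]
 interpret Fr: field "D(|carrier := F|)" by (rule D.subfield_iff(2)[OF F(1)])
 have Zs: "subfield Z (D(|carrier := F|))"
  by (rule Fr.subfield_iff(1)) (use Z_field F(2) in simp_all)
 have "subalgebra Z F D"
  by (rule D.subalgebraI[OF Z_subfield]) (use subringE(1,2,6,7)[OF sF] F(2) in blast)+
 then obtain n where "D.dimension n Z F"
  using D.subspace_dimension[OF Z_subfield dl _ subringE(1)[OF sF]] by metis
 then have "Fr.finite_dimension Z F"
  using D.dimension_consistent[OF sF Z_subfield F(2)] Fr.finite_dimensionI by simp
 then have alg: "(Fr.algebraic over Z) x"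
  using Fr.finite_dimension_imp_algebraic[OF Zs _ _ xF] Fr.carrier_is_subring by simp
 have xc: "x \<in> carrier (D(|carrier := F|))" using xF by simp
 note I = Fr.IrrE[OF Zs xc alg]
 have "x \<in> Z"
 proof (rule central_root[OF xy(1)])
  show "Fr.Irr Z x \<in> carrier (poly_ring Zr)"
   using I(1) unfolding poly_carrier by simp
  show "lead_coeff (Fr.Irr Z x) = \<one>" using I(3) by simp
  show "Fr.Irr Z x ~= []" using Fr.pirreducibleE(1)[OF subfieldE(1)[OF Zs] I(1,2)] by simp
  show "D.eval (Fr.Irr Z x) x = \<zero>" using I(4) D.eval_consistent[OF sF] by simp
 qed (use all in auto)
 then show False using x by simp
qed

end

section \<open>Adjoining a square root of -1\<close>

context algebraic_closure
begin

context
 fixes i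
 assumes i: "i \<in> carrier L" "i ** i = \<ominus> \<one>" "i \<notin> K"
begin

text \<open>In characteristic two the only square root of \<open>-1\<close> is \<open>1\<close>,
  which lies in \<open>K\<close>.\<close>

lemma one_not_minus_one: "\<one> ~= \<ominus> \<one>"
proof
 assume e: "\<one> = \<ominus> \<one>"
 have "(i \<oplus> \<one>) ** (i \<ominus> \<one>) = i ** i \<ominus> \<one>" using i(1) by algebra
 also have "\<dots> = \<zero>" unfolding i(2) using e by (simp add: r_right_minus_eq)
 finally have "i \<oplus> \<one> = \<zero> \<or> i \<ominus> \<one> = \<zero>" by (rule integral) (use i(1) in simp_all)
 then have "i = \<ominus> \<one> \<or> i = \<one>" using i(1) minus_equality[of i \<one>] by (auto simp: r_right_minus_eq)
 then show False using i(3) e betweenE(3)[OF between_K] by auto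
qed

lemma double_eq_zero: "x \<in> carrier L ==> x \<oplus> x = \<zero> ==> x = \<zero>"
proof (rule ccontr)
 assume x: "x \<in> carrier L" "x \<oplus> x = \<zero>" "x ~= \<zero>"
 have "(\<one> \<oplus> \<one>) ** x = x \<oplus> x" using x(1) by algebra
 then have "\<one> \<oplus> \<one> = \<zero>" using integral[of "\<one> \<oplus> \<one>" x] x by simp
 then show False using one_not_minus_one minus_equality[of \<one> \<one>] by simp
qed

lemma square_unity: "r \<in> carrier L ==> r [^] (2::nat) = \<one> ==> r \<in> K"
proof -
 assume r: "r \<in> carrier L" "r [^] (2::nat) = \<one>"
 have "(r \<oplus> \<one>) ** (r \<ominus> \<one>) = r ** r \<ominus> \<one>" using r(1) by algebra
 also have "\<dots> = \<zero>" using r by (simp add: numeral_2_eq_2 r_right_minus_eq)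
 finally have "r \<oplus> \<one> = \<zero> \<or> r \<ominus> \<one> = \<zero>" by (rule integral) (use r(1) in simp_all)
 then have "r = \<ominus> \<one> \<or> r = \<one>" using r(1) minus_equality[of r \<one>] by (auto simp: r_right_minus_eq)
 then show ?thesis using betweenE(3,5)[OF between_K] by auto
qed

lemma quadratic_extension:
 assumes x: "x \<in> carrier L" "x \<notin> K" "x ** x \<in> K"
 shows "dimension 2 K (simple_extension K x)"
  "\<exists>s. hom_over (simple_extension K x) s \<and> s ` simple_extension K x \<subseteq> simple_extension K x \<and> s x = \<ominus> x \<and> s x ~= x"
proof -
 have x2: "x [^] (2::nat) = x ** x" using x by (simp add: numeral_2_eq_2)
 note M = between_simple[OF between_K x(1)] and I = Irr_props[OF between_K x(1)]
 have x2K: "x [^] (2::nat) \<in> K" using x x2 by simp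
 have dr: "degree (Irr K x) = 2" "Irr K x = pure 2 (x [^] (2::nat))"
  using degree_radical[OF between_K two_is_prime_nat x(1,2) x2K square_unity] by auto
 then show "dimension 2 K (simple_extension K x)" using M(4) by simp
 have mx: "\<ominus> x \<in> carrier L" using x by simp
 have "(\<ominus> x) [^] (2::nat) = x [^] (2::nat)" using x(1) by (simp add: numeral_2_eq_2 l_minus r_minus)
 then have "eval (Irr K x) (\<ominus> x) = \<zero>"
  unfolding dr(2) using pure_props(4)[of 2 "x [^] (2::nat)" "\<ominus> x"] x(1) by (simp add: r_right_minus_eq)
 then obtain s where s: "hom_over (simple_extension K x) s" "s x = \<ominus> x"
  using move_to_root[OF between_K x(1) mx] by blast
 have sx: "s x \<in> simple_extension K x" using s(2) betweenE(5)[OF M(1) M(3)] by simp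
 have "s ` simple_extension K x \<subseteq> simple_extension K x"
  using hom_over_simple_image[OF between_K x(1) s(1) M(1) _ sx] hom_overD(2)[OF s(1)] M(2) by auto
 note sM = this
 have sx2: "s x ~= x"
 proof
  assume "s x = x"
  then have "x = \<zero>" using double_eq_zero[OF x(1)] s(2) r_neg[OF x(1)] by simp
  then show False using x(2) betweenE(2)[OF between_K] by simp
 qed
 show "\<exists>s. hom_over (simple_extension K x) s \<and> s ` simple_extension K x \<subseteq> simple_extension K x \<and> s x = \<ominus> x \<and> s x ~= x"
  by (rule exI[of _ s], intro conjI) (rule s sM sx2)+
qed

lemma Ki_elements:
 assumes "z \<in> simple_extension K i"
 shows "\<exists>u\<in>K. \<exists>v\<in>K. z = u \<oplus> v ** i"
proof -
 note sK = subringE[OF betweenD(3)[OF between_K]]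
 show ?thesis using assms
 proof (induction rule: simple_extension.induct)
  case zero
  show ?case using sK(2) i(1) by (intro bexI[of _ \<zero>]) auto
 next
  case (lin z c)
  then obtain u v where uv: "u \<in> K" "v \<in> K" "z = u \<oplus> v ** i" by blast
  have car: "u \<in> carrier L" "v \<in> carrier L" "c \<in> carrier L" using uv lin betweenD(5)[OF between_K] by auto
  have "z ** i \<oplus> c = v ** (i ** i) \<oplus> c \<oplus> u ** i" unfolding uv(3) using car i(1) by algebra
  also have "\<dots> = (c \<ominus> v) \<oplus> u ** i" unfolding i(2) using car i(1) by algebra
  finally have e: "z ** i \<oplus> c = (c \<ominus> v) \<oplus> u ** i" .
  have cv: "c \<ominus> v \<in> K" unfolding minus_eq by (rule sK(7)[OF lin(2) sK(5)[OF uv(2)]])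
  show ?case by (intro bexI[of _ "c \<ominus> v"] bexI[of _ u] e cv uv(1))
 qed
qed

text \<open>The link between norms from \<open>K(i)\<close> and sums of two squares.\<close>

lemma conjugation:
 obtains s where "hom_over (simple_extension K i) s" "s ` simple_extension K i \<subseteq> simple_extension K i"
  "s i ~= i" "\<forall>u\<in>K. \<forall>v\<in>K. s (u \<oplus> v ** i) = u \<ominus> v ** i"
  "\<forall>u\<in>K. \<forall>v\<in>K. s (u \<oplus> v ** i) ** (u \<oplus> v ** i) = u ** u \<oplus> v ** v"
proof -
 have "i ** i \<in> K" unfolding i(2) using betweenE(3,5)[OF between_K] by simp
 then obtain s where s: "hom_over (simple_extension K i) s" "s ` simple_extension K i \<subseteq> simple_extension K i"
  "s i = \<ominus> i" "s i ~= i"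
  using quadratic_extension(2)[OF i(1,3)] by blast
 note M = between_simple[OF between_K i(1)]
 have f: "s (u \<oplus> v ** i) = u \<ominus> v ** i" if uv: "u \<in> K" "v \<in> K" for u v
 proof -
  have m: "u \<in> simple_extension K i" "v \<in> simple_extension K i" "v ** i \<in> simple_extension K i"
   using uv M(2,3) betweenE(6)[OF M(1)] by auto
  have c: "u \<in> carrier L" "v \<in> carrier L" using uv betweenD(5)[OF between_K] by auto
  have "s (u \<oplus> v ** i) = u \<oplus> v ** (\<ominus> i)"
   using hom_overD(5)[OF s(1) m(1,3)] hom_overD(4)[OF s(1) m(2) M(3)] hom_overD(2)[OF s(1)] uv s(3) by simp
  then show ?thesis using c i(1) by (simp add: minus_eq r_minus)
 qed
 have n: "s (u \<oplus> v ** i) ** (u \<oplus> v ** i) = u ** u \<oplus> v ** v" if uv: "u \<in> K" "v \<in> K" for u v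
 proof -
  have c: "u \<in> carrier L" "v \<in> carrier L" using uv betweenD(5)[OF between_K] by auto
  have "(u \<ominus> v ** i) ** (u \<oplus> v ** i) = u ** u \<ominus> v ** v ** (i ** i)" using c i(1) by algebra
  also have "\<dots> = u ** u \<oplus> v ** v" unfolding i(2) using c by algebra
  finally show ?thesis unfolding f[OF uv] .
 qed
 show ?thesis by (rule that[OF s(1,2,4)]; intro ballI; rule f n; assumption)
qed

text \<open>Conjugation maps \<open>w\<close> to a square root of the same element of
  \<open>K\<close>, that is, to \<open>w\<close> or to \<open>- w\<close>.\<close>

lemma square_root_cases:
 assumes w: "w \<in> simple_extension K i" "w ** w \<in> K"
 shows "\<exists>v\<in>K. w = v \<or> w = v ** i"
proof -
 obtain u v where uv: "u \<in> K" "v \<in> K" "w = u \<oplus> v ** i" using Ki_elements[OF w(1)] by blast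
 obtain s where s: "hom_over (simple_extension K i) s" "\<forall>u\<in>K. \<forall>v\<in>K. s (u \<oplus> v ** i) = u \<ominus> v ** i"
  using conjugation by metis
 have c: "u \<in> carrier L" "v \<in> carrier L" using uv betweenD(5)[OF between_K] by auto
 have sw: "s w = u \<ominus> v ** i" using s(2) uv by blast
 have wc: "w \<in> carrier L" "s w \<in> carrier L" using uv sw c i(1) by simp_all
 have "s w ** s w = w ** w"
  using hom_overD(4)[OF s(1) w(1) w(1)] hom_overD(2)[OF s(1) w(2)] by simp
 moreover have "(s w \<ominus> w) ** (s w \<oplus> w) = s w ** s w \<ominus> w ** w" using wc by algebra
 ultimately have "(s w \<ominus> w) ** (s w \<oplus> w) = \<zero>" using wc by (simp add: r_right_minus_eq)
 then consider "s w \<ominus> w = \<zero>" | "s w \<oplus> w = \<zero>" using integral[of "s w \<ominus> w" "s w \<oplus> w"] wc by auto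
 then show ?thesis
 proof cases
  case 1
  have "v ** i \<oplus> v ** i = \<ominus> (s w \<ominus> w)" unfolding sw unfolding uv(3) using c i(1) by algebra
  then have "v ** i \<oplus> v ** i = \<zero>" using 1 by simp
  then have "v ** i = \<zero>" using double_eq_zero[of "v ** i"] c i(1) by simp
  then show ?thesis using uv c by auto
 next
  case 2
  have "u \<oplus> u = s w \<oplus> w" unfolding sw unfolding uv(3) using c i(1) by algebra
  then have "u = \<zero>" using 2 double_eq_zero[OF c(1)] by simp
  then show ?thesis using uv c i(1) by auto
 qed
qed

end

end

context center_closure
begin

text \<open>\<open>cyclic_extension\<close> is applied to the cyclic extension that exists for a
  prime divisor of \<open>dl\<close>. An element of \<open>k\<close> is fixed by the automorphism,
  so its norm is its square.\<close>

lemma quadratic_case: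
 shows "2 dvd dl" "b \<in> k ==> b **[W] b ~= \<ominus>[W] \<one>[W]"
proof -
 obtain p where p: "prime p" "p dvd dl" using prime_factor_nat[of dl] dl_not_prime(2) by auto
 have "2 dvd dl \<and> (\<forall>b\<in>k. b **[W] b ~= \<ominus>[W] \<one>[W])"
 proof (rule O.exists_cyclic[OF perfect p(1) _ not_closed])
  show "p dvd n" if "O.between E" "O.dimension n k E" "n ~= 1" for E n using degree_dvd[OF that p] .
 next
  fix y s assume y: "y \<in> carrier W" "O.dimension p k (O.simple_extension k y)"
   and s: "O.hom_over (O.simple_extension k y) s" "s ` O.simple_extension k y \<subseteq> O.simple_extension k y" "s y ~= y"
  note c = cyclic_extension[OF p(1) y(1) refl y(2) s]
  have "b **[W] b ~= \<ominus>[W] \<one>[W]" if b: "b \<in> k" for b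
   using c(2)[of b] O.between_simple(2)[OF O.between_K y(1)] O.hom_overD(2)[OF s(1) b] b by auto
  then show "2 dvd dl \<and> (\<forall>b\<in>k. b **[W] b ~= \<ominus>[W] \<one>[W])" using p(2) c(1) by simp
 qed
 then show "2 dvd dl" "b \<in> k ==> b **[W] b ~= \<ominus>[W] \<one>[W]" by blast+
qed

lemma exists_i: "\<exists>i\<in>carrier W. i **[W] i = \<ominus>[W] \<one>[W] \<and> i \<notin> k"
proof -
 obtain i where i: "i \<in> carrier W" "i [^][W] (2::nat) = \<ominus>[W] \<one>[W]"
  using O.exists_radical[of 2 "\<ominus>[W] \<one>[W]"] by auto
 then have "i **[W] i = \<ominus>[W] \<one>[W]" by (simp add: numeral_2_eq_2)
 then show ?thesis using i(1) quadratic_case(2) by blast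
qed

context
 fixes i
 assumes i: "i \<in> carrier W" "i **[W] i = \<ominus>[W] \<one>[W]" "i \<notin> k"
begin

lemmas sk = subringE[OF O.betweenD(3)[OF O.between_K]]
lemmas kc = O.betweenD(5)[OF O.between_K]
lemmas Mi = O.between_simple[OF O.between_K i(1)]
lemmas sM = subringE[OF O.betweenD(3)[OF Mi(1)]]

lemma dim_i: "O.dimension 2 k (O.simple_extension k i)"
 by (rule O.quadratic_extension(1)[OF i i(1,3)]) (use i(2) sk(3,5) in simp)

text \<open>A sum of two squares is a norm from \<open>k(i)\<close>, to which
  \<open>cyclic_extension\<close> applies.\<close>

lemma sum_of_squares:
 assumes uv: "u \<in> k" "v \<in> k"
 shows "u **[W] u \<oplus>[W] v **[W] v ~= \<ominus>[W] \<one>[W]"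
proof -
 obtain s where s: "O.hom_over (O.simple_extension k i) s" "s ` O.simple_extension k i \<subseteq> O.simple_extension k i"
  "s i ~= i" "\<forall>u\<in>k. \<forall>v\<in>k. s (u \<oplus>[W] v **[W] i) **[W] (u \<oplus>[W] v **[W] i) = u **[W] u \<oplus>[W] v **[W] v"
  by (rule O.conjugation[OF i])
 have "u \<oplus>[W] v **[W] i \<in> O.simple_extension k i"
  using uv Mi(2) sM(7)[OF _ sM(6)[OF _ Mi(3)]] by blast
 from cyclic_extension(2)[OF two_is_prime_nat i(1) refl dim_i s(1-3) this] show ?thesis using s(4) uv by simp
qed

text \<open>The case \<open>p = 2\<close> of \<open>radical_norm\<close> with
  \<open>M = k(i)\<close>.\<close>

lemma square_root_norm:
 assumes x: "x \<in> carrier W" "x \<notin> O.simple_extension k i" "x **[W] x \<in> k"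
 shows "\<exists>u\<in>k. \<exists>v\<in>k. \<ominus>[W] (x **[W] x) = u **[W] u \<oplus>[W] v **[W] v"
proof -
 obtain s where s: "O.hom_over (O.simple_extension k i) s" "s ` O.simple_extension k i \<subseteq> O.simple_extension k i"
  "s i ~= i" "\<forall>u\<in>k. \<forall>v\<in>k. s (u \<oplus>[W] v **[W] i) **[W] (u \<oplus>[W] v **[W] i) = u **[W] u \<oplus>[W] v **[W] v"
  by (rule O.conjugation[OF i])
 have x2: "x [^][W] (2::nat) = x **[W] x" using x(1) by (simp add: numeral_2_eq_2)
 have un: "r \<in> k" if "r \<in> carrier W" "r [^][W] (2::nat) = \<one>[W]" for r
  by (rule unity[OF two_is_prime_nat quadratic_case(1) that])
 have "\<exists>b\<in>O.simple_extension k i. nrm W s b 2 =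
   (if (2::nat) = 2 then \<ominus>[W] (x [^][W] (2::nat)) else x [^][W] (2::nat))"
  by (rule O.radical_norm[OF perfect two_is_prime_nat i(1) refl dim_i s(1-3) un _ x(1,2)]) (use norms x(3) x2 in auto)
 then obtain b where b: "b \<in> O.simple_extension k i" "nrm W s b 2 = \<ominus>[W] (x **[W] x)" using x2 by auto
 obtain u v where uv: "u \<in> k" "v \<in> k" "b = u \<oplus>[W] v **[W] i" using O.Ki_elements[OF i b(1)] by blast
 have "nrm W s b 2 = s b **[W] b"
  using O.hom_overD(2)[OF s(1) sk(3)] O.betweenD(5)[OF Mi(1) b(1)] by (simp add: numeral_2_eq_2)
 then have "\<ominus>[W] (x **[W] x) = u **[W] u \<oplus>[W] v **[W] v" using b(2) s(4) uv by simp
 then show ?thesis using uv(1,2) by blast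
qed

lemma inv_k: "e \<in> k ==> e ~= \<zero>[W] ==> inv[W] e \<in> k \<and> e **[W] inv[W] e = \<one>[W]"
 using O.subfield_m_inv[OF O.K_sub, of e] by blast

lemma sum_of_squares_scaled:
 assumes ab: "a \<in> k" "b \<in> k" and e: "e \<in> k" "e ~= \<zero>[W]"
 shows "a **[W] a \<oplus>[W] b **[W] b ~= \<ominus>[W] (e **[W] e)"
proof
 assume h: "a **[W] a \<oplus>[W] b **[W] b = \<ominus>[W] (e **[W] e)"
 define c where "c = inv[W] e"
 have c: "c \<in> k" "e **[W] c = \<one>[W]" using inv_k[OF e] by (simp_all add: c_def)
 note car = kc[OF ab(1)] kc[OF ab(2)] kc[OF e(1)] kc[OF c(1)]
 have "(a **[W] c) **[W] (a **[W] c) \<oplus>[W] (b **[W] c) **[W] (b **[W] c) =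
  (a **[W] a \<oplus>[W] b **[W] b) **[W] (c **[W] c)" using car by algebra
 also have "\<dots> = \<ominus>[W] ((e **[W] c) **[W] (e **[W] c))" unfolding h using car by algebra
 finally show False using sum_of_squares[OF sk(6)[OF ab(1) c(1)] sk(6)[OF ab(2) c(1)]] c(2) by simp
qed

text \<open>If \<open>x\<close> is not in \<open>k(i)\<close>, neither is \<open>i x\<close>, so
  both \<open>- x^2\<close> and \<open>x^2\<close> are sums of two squares. Then so is their product
  \<open>- (x^2)^2\<close>, which is impossible.\<close>

lemma square_root_mem:
 assumes x: "x \<in> carrier W" "x **[W] x \<in> k"
 shows "x \<in> O.simple_extension k i"
proof (rule ccontr)
 assume nx: "x \<notin> O.simple_extension k i"
 let ?d = "x **[W] x"
 obtain u v where uv: "u \<in> k" "v \<in> k" "\<ominus>[W] ?d = u **[W] u \<oplus>[W] v **[W] v"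
  using square_root_norm[OF x(1) nx x(2)] by blast
 have "i **[W] x **[W] (i **[W] x) = i **[W] i **[W] ?d" using i(1) x(1) by algebra
 also have "\<dots> = \<ominus>[W] ?d" unfolding i(2) using x(1) by algebra
 finally have ix2: "i **[W] x **[W] (i **[W] x) = \<ominus>[W] ?d" .
 have i0: "i ~= \<zero>[W]" using i(3) sk(2) by auto
 have nix: "i **[W] x \<notin> O.simple_extension k i"
  using O.between_cancel[OF Mi(1,3) i0 x(1)] nx by blast
 have "i **[W] x **[W] (i **[W] x) \<in> k" unfolding ix2 by (rule sk(5)[OF x(2)])
 then obtain a b where ab: "a \<in> k" "b \<in> k" "\<ominus>[W] (\<ominus>[W] ?d) = a **[W] a \<oplus>[W] b **[W] b"
  using square_root_norm[OF _ nix] i(1) x(1) ix2 by auto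
 note car = kc[OF ab(1)] kc[OF ab(2)] kc[OF uv(1)] kc[OF uv(2)]
 have d: "?d \<in> carrier W" using x(1) by simp
 have d0: "?d ~= \<zero>[W]"
 proof
  assume "?d = \<zero>[W]"
  then have "x = \<zero>[W]" using O.integral[of x x] x(1) by simp
  then show False using nx sM(2) by simp
 qed
 \<comment> \<open>The real and imaginary parts of \<open>(u + v i) (a + b i)\<close>.\<close>
 let ?p = "u **[W] a \<oplus>[W] \<ominus>[W] (v **[W] b)" and ?q = "u **[W] b \<oplus>[W] v **[W] a"
 have pq: "?p \<in> k" "?q \<in> k" using sk(5,6,7) ab(1,2) uv(1,2) by simp_all
 have "?p **[W] ?p \<oplus>[W] ?q **[W] ?q =
  (u **[W] u \<oplus>[W] v **[W] v) **[W] (a **[W] a \<oplus>[W] b **[W] b)" using car by algebra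
 also have "\<dots> = \<ominus>[W] (?d **[W] ?d)" unfolding uv(3)[symmetric] ab(3)[symmetric] using d by (simp add: O.l_minus)
 finally show False using sum_of_squares_scaled[OF pq x(2) d0] by simp
qed

lemma plus_minus_square:
 assumes d: "d \<in> k"
 shows "\<exists>e\<in>k. d = e **[W] e \<or> d = \<ominus>[W] (e **[W] e)"
proof -
 obtain x where x: "x \<in> carrier W" "x [^][W] (2::nat) = d" using O.exists_radical[of 2 d] kc[OF d] by auto
 then have x2: "x **[W] x = d" by (simp add: numeral_2_eq_2)
 then have "x \<in> O.simple_extension k i" using square_root_mem[OF x(1)] d by simp
 then obtain v where v: "v \<in> k" "x = v \<or> x = v **[W] i" using O.square_root_cases[OF i] x2 d by blast
 have "(v **[W] i) **[W] (v **[W] i) = v **[W] v **[W] (i **[W] i)" using kc[OF v(1)] i(1) by algebra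
 also have "\<dots> = \<ominus>[W] (v **[W] v)" unfolding i(2) using kc[OF v(1)] by algebra
 finally show ?thesis using v x2 by auto
qed

lemma sum_is_square:
 assumes ab: "a \<in> k" "b \<in> k"
 shows "\<exists>e\<in>k. a **[W] a \<oplus>[W] b **[W] b = e **[W] e"
proof -
 have "a **[W] a \<oplus>[W] b **[W] b \<in> k" using ab sk(6,7) by simp
 then obtain e where e: "e \<in> k" "a **[W] a \<oplus>[W] b **[W] b = e **[W] e \<or> a **[W] a \<oplus>[W] b **[W] b = \<ominus>[W] (e **[W] e)"
  using plus_minus_square by blast
 show ?thesis
 proof (cases "e = \<zero>[W]")
  case True
  then have "\<ominus>[W] (e **[W] e) = e **[W] e" by simp
  then show ?thesis using e(2) by (intro bexI[OF _ e(1)]) (metis)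
 next
  case False
  then show ?thesis using e sum_of_squares_scaled[OF ab e(1)] by blast
 qed
qed

text \<open>Every multiple of \<open>1\<close> is a square, as a sum of squares; if some positive
  multiple vanished, the preceding one would exhibit \<open>-1\<close> as a square.\<close>

lemma char_zero:
 assumes "n > 0"
 shows "add_pow W (n::nat) \<one>[W] ~= \<zero>[W]"
proof
 assume z: "add_pow W n \<one>[W] = \<zero>[W]"
 have sq: "\<exists>e\<in>k. add_pow W (m::nat) \<one>[W] = e **[W] e" for m
 proof (induction m)
  case 0
  show ?case using sk(2) by (intro bexI[of _ "\<zero>[W]"]) auto
 next
  case (Suc m)
  then obtain e where e: "e \<in> k" "add_pow W m \<one>[W] = e **[W] e" by blast
  then show ?case using sum_is_square[OF e(1) sk(3)] by simp
 qed
 obtain m where m: "n = Suc m" using assms by (cases n) auto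
 obtain e where e: "e \<in> k" "add_pow W m \<one>[W] = e **[W] e" using sq by blast
 then have "e **[W] e \<oplus>[W] \<one>[W] = \<zero>[W]" using z m by simp
 then have "e **[W] e = \<ominus>[W] \<one>[W]" using O.minus_equality[of "e **[W] e" "\<one>[W]"] kc[OF e(1)] by simp
 then show False using quadratic_case(2)[OF e(1)] by simp
qed

text \<open>For \<open>w^2 = a + b i\<close> take a square root \<open>v\<close> of the conjugate.
  Then \<open>(w v)^2 = a^2 + b^2\<close> is a square in \<open>k\<close>, so \<open>w v\<close>
  lies in \<open>k\<close>, and so do the squares of \<open>w + v\<close> and \<open>w - v\<close>.
  Hence both of these, and their sum \<open>2 w\<close>, lie in \<open>k(i)\<close>.\<close>

lemma square_root_closed:
 assumes w: "w \<in> carrier W" "w **[W] w \<in> O.simple_extension k i"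
 shows "w \<in> O.simple_extension k i"
proof -
 obtain a b where ab: "a \<in> k" "b \<in> k" "w **[W] w = a \<oplus>[W] b **[W] i" using O.Ki_elements[OF i w(2)] by blast
 note car = kc[OF ab(1)] kc[OF ab(2)] i(1)
 obtain v where v: "v \<in> carrier W" "v [^][W] (2::nat) = a \<ominus>[W] b **[W] i"
  using O.exists_radical[of 2 "a \<ominus>[W] b **[W] i"] car by auto
 then have v2: "v **[W] v = a \<ominus>[W] b **[W] i" by (simp add: numeral_2_eq_2)
 obtain e where e: "e \<in> k" "a **[W] a \<oplus>[W] b **[W] b = e **[W] e" using sum_is_square[OF ab(1,2)] by blast
 note ec = kc[OF e(1)]
 let ?p = "w **[W] v"
 have pc: "?p \<in> carrier W" using w v by simp
 have "(?p \<ominus>[W] e) **[W] (?p \<oplus>[W] e) = (w **[W] w) **[W] (v **[W] v) \<ominus>[W] e **[W] e"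
  using w(1) v(1) ec by algebra
 also have "(w **[W] w) **[W] (v **[W] v) = a **[W] a \<ominus>[W] b **[W] b **[W] (i **[W] i)"
  unfolding ab(3) v2 using car by algebra
 also have "\<dots> = a **[W] a \<oplus>[W] b **[W] b" unfolding i(2) using car by algebra
 finally have "(?p \<ominus>[W] e) **[W] (?p \<oplus>[W] e) = \<zero>[W]" unfolding e(2) using ec by (simp add: O.r_right_minus_eq)
 then have "?p \<ominus>[W] e = \<zero>[W] \<or> ?p \<oplus>[W] e = \<zero>[W]" by (rule O.integral) (use pc ec in simp_all)
 then have "?p = e \<or> ?p = \<ominus>[W] e" using pc ec O.minus_equality[of ?p e] by (auto simp: O.r_right_minus_eq)
 then have pk: "?p \<in> k" using e(1) sk(5) by auto
 have M1: "w \<oplus>[W] v \<in> O.simple_extension k i"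
 proof (rule square_root_mem)
  have "(w \<oplus>[W] v) **[W] (w \<oplus>[W] v) = w **[W] w \<oplus>[W] v **[W] v \<oplus>[W] (?p \<oplus>[W] ?p)" using w(1) v(1) by algebra
  also have "w **[W] w \<oplus>[W] v **[W] v = a \<oplus>[W] a" unfolding ab(3) v2 using car by algebra
  finally show "(w \<oplus>[W] v) **[W] (w \<oplus>[W] v) \<in> k" using sk(7) ab(1) pk by simp
 qed (use w v in simp)
 have M2: "w \<ominus>[W] v \<in> O.simple_extension k i"
 proof (rule square_root_mem)
  have "(w \<ominus>[W] v) **[W] (w \<ominus>[W] v) = w **[W] w \<oplus>[W] v **[W] v \<oplus>[W] \<ominus>[W] (?p \<oplus>[W] ?p)" using w(1) v(1) by algebra
  also have "w **[W] w \<oplus>[W] v **[W] v = a \<oplus>[W] a" unfolding ab(3) v2 using car by algebra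
  finally show "(w \<ominus>[W] v) **[W] (w \<ominus>[W] v) \<in> k" using sk(5,7) ab(1) pk by simp
 qed (use w v in simp)
 have "(\<one>[W] \<oplus>[W] \<one>[W]) **[W] w = (w \<oplus>[W] v) \<oplus>[W] (w \<ominus>[W] v)" using w(1) v(1) by algebra
 then have wM: "(\<one>[W] \<oplus>[W] \<one>[W]) **[W] w \<in> O.simple_extension k i" using sM(7)[OF M1 M2] by simp
 have two: "\<one>[W] \<oplus>[W] \<one>[W] ~= \<zero>[W]" using char_zero[of 2] by (simp add: numeral_2_eq_2)
 show ?thesis by (rule O.between_cancel[OF Mi(1) sM(7)[OF sM(3) sM(3)] two w(1) wM])
qed

text \<open>All degrees over \<open>k\<close> are powers of two, hence so are those over
  \<open>k(i)\<close>, and a proper extension would lead to a quadratic one. That one contains an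
  element changing sign under its automorphism, whose square lies in \<open>k(i)\<close> although
  the element does not, against \<open>square_root_closed\<close>.\<close>

theorem closure_eq: "carrier W = O.simple_extension k i"
proof (rule ccontr)
 assume ne: "carrier W ~= O.simple_extension k i"
 define M where "M = O.simple_extension k i"
 interpret M: algebraic_closure W M unfolding M_def by (rule O.closure_between[OF Mi(1)])
 have Mb: "O.between E" if "M.between E" for E
  unfolding O.between_def M_def
  by (rule conjI[OF M.betweenD(1)[OF that] subset_trans[OF Mi(2) M.betweenD(2)[OF that, unfolded M_def]]])
 have M2: "O.dimension 2 k M" unfolding M_def by (rule dim_i)
 have tower: "O.dimension (2 * n) k E" if "O.dimension n M E" for n E
  by (rule O.telescopic_base[OF O.K_sub M.K_sub M2 that])
 have perf: "M.perfect" unfolding M.perfect_def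
  by (intro allI impI ballI) (rule O.perfect_between[OF perfect Mi(1) dim_i, folded M_def])
 have deg: "2 dvd n" if E: "M.between E" "O.dimension n M E" "n ~= 1" for E n
 proof -
  have kd: "2 dvd m" if "O.between F" "O.dimension m k F" "m ~= 1" for F m
   by (rule degree_dvd[OF that two_is_prime_nat quadratic_case(1)])
  obtain j where j: "2 * n = 2 ^ j"
   by (rule O.prime_power_degrees[OF perfect two_is_prime_nat kd Mb[OF E(1)] tower[OF E(2)]])
  have "j ~= 0"
  proof
   assume "j = 0"
   then have "2 * n = 1" using j by simp
   then show False by presburger
  qed
  then obtain l where l: "j = Suc l" by (cases j) auto
  then show ?thesis using j E(3) by (cases l) auto
 qed
 show False
 proof (rule M.exists_cyclic[OF perf two_is_prime_nat deg])
  show "M ~= carrier W" using ne M_def by simp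
  fix y s assume y: "y \<in> carrier W" "O.dimension 2 M (O.simple_extension M y)"
   and s: "M.hom_over (O.simple_extension M y) s" "s ` O.simple_extension M y \<subseteq> O.simple_extension M y" "s y ~= y"
  note S = M.between_simple[OF M.between_K y(1)]
  note sS = subringE[OF M.betweenD(3)[OF S(1)]]
  have sc: "s x \<in> O.simple_extension M y" if "x \<in> O.simple_extension M y" for x using s(2) that by blast
  have cy: "x \<in> O.simple_extension M y ==> (s ^^ 2) x = x" "x \<in> O.simple_extension M y ==> s x = x \<longleftrightarrow> x \<in> M" for x
   using M.cyclic_prime_degree[where s = s, OF y(1) refl y(2) two_is_prime_nat s(1) _ s(3)] sc by blast+
  have ssy: "s (s y) = y" using cy(1)[OF S(3)] by (simp add: numeral_2_eq_2)
  interpret s: ring_hom_ring "M.sub (O.simple_extension M y)" W s by (rule M.hom_over_ring[OF S(1) s(1)])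
  \<comment> \<open>The automorphism \<open>s\<close> is an involution, so it changes the sign of
    \<open>t\<close>, and \<open>t\<close> is nonzero because \<open>s\<close> moves
    \<open>y\<close>.\<close>
  define t where "t = y \<oplus>[W] \<ominus>[W] s y"
  have sy: "s y \<in> O.simple_extension M y" "s y \<in> carrier W" using sc[OF S(3)] M.betweenD(5)[OF S(1)] by auto
  have mem: "t \<in> O.simple_extension M y" "\<ominus>[W] s y \<in> O.simple_extension M y" unfolding t_def using sS(5,7) S(3) sy(1) by simp_all
  have tc: "t \<in> carrier W" using M.betweenD(5)[OF S(1) mem(1)] .
  have "s (\<ominus>[W] s y) \<oplus>[W] s (s y) = s (\<ominus>[W] s y \<oplus>[W] s y)" using M.hom_overD(5)[OF s(1) mem(2) sy(1)] by simp
  also have "\<dots> = \<zero>[W]" using s.hom_zero sy(2) by (simp add: O.l_neg)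
  finally have "s (\<ominus>[W] s y) = \<ominus>[W] y"
   using O.minus_equality[of "s (\<ominus>[W] s y)" y] ssy y(1) M.hom_overD(3)[OF s(1) mem(2)] by simp
  then have st: "s t = \<ominus>[W] t"
   using M.hom_overD(5)[OF s(1) S(3) mem(2)] y(1) sy(2) by (simp add: t_def O.minus_add O.a_comm)
  have "s (t **[W] t) = t **[W] t"
   using M.hom_overD(4)[OF s(1) mem(1) mem(1)] st tc by (simp add: O.l_minus O.r_minus)
  then have "t **[W] t \<in> M" using cy(2)[OF sS(6)[OF mem(1) mem(1)]] by simp
  then have "t \<in> M" using square_root_closed[OF tc] unfolding M_def by simp
  then have "t = \<ominus>[W] t" using cy(2)[OF mem(1)] st by simp
  then have "t \<oplus>[W] t = \<zero>[W]" using O.r_neg[OF tc] by simp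
  then have "t = \<zero>[W]" by (rule O.double_eq_zero[OF i tc])
  then have "y \<ominus>[W] s y = \<zero>[W]" by (simp add: t_def O.minus_eq)
  then show False using y(1) sy(2) s(3) by (simp add: O.r_right_minus_eq)
 qed
qed

end

end

section \<open>Algebraic closures of finite degree\<close>

context algebraic_closure
begin

text \<open>Kummer theory gives \<open>w\<close> with \<open>L = K(w)\<close> and \<open>w\<^sup>q \<in> K\<close>; the norm of a \<open>q\<close>-th root of \<open>w\<close> is,
 up to the factor \<open>i\<close> if \<open>q = 2\<close>, again a \<open>q\<close>-th root of \<open>w\<^sup>q\<close>, but it lies in \<open>K\<close>.\<close>

lemma no_prime_degree:
 fixes q :: nat
 assumes char: "!!n::nat. n > 0 ==> add_pow L n \<one> ~= \<zero>" and i: "i \<in> K" "i ** i = \<ominus> \<one>"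
  and q: "prime q" and dim: "dimension q K (carrier L)"
 shows False
proof -
 have q0: "q > 0" "q > 1" using q prime_gt_0_nat prime_gt_1_nat by blast+
 note sK = subringE[OF betweenD(3)[OF between_K]]
 have perf: perfect unfolding perfect_def using char prime_gt_0_nat by blast
 obtain y where y: "y \<in> carrier L" "carrier L = simple_extension K y"
  by (rule primitive_element[OF perf between_L dim])
 have yK: "y \<notin> K"
 proof
  assume "y \<in> K"
  then have "simple_extension K y \<subseteq> K" by (rule simple_extension_least[OF between_K between_K subset_refl])
  then have "carrier L = K" using y(2) betweenD(4)[OF between_K] by blast
  then have "dimension 1 K (carrier L)" using dimension_one[OF K_sub] by simp
  then show False using dimension_unique[OF between_K dim] q0 by simp
 qed
 obtain y' where y': "y' \<in> carrier L" "y' ~= y" "eval (Irr K y) y' = \<zero>"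
  using exists_other_root[OF perf between_K dimension_one[OF K_sub] y(1) yK] by blast
 obtain s where s0: "hom_over (simple_extension K y) s" "s y = y'"
  using move_to_root[OF between_K y(1) y'(1,3)] by metis
 have s: "hom_over (carrier L) s" "s ` carrier L \<subseteq> carrier L" "s y ~= y"
  using s0 y(2) y'(2) hom_overD(3) by auto
 have sc: "s x \<in> carrier L" if "x \<in> carrier L" for x using s(2) that by blast
 have sm: "s (a ** b) = s a ** s b" "s (a \<oplus> b) = s a \<oplus> s b" if "a \<in> carrier L" "b \<in> carrier L" for a b
  using hom_overD(4,5)[OF s(1) that] by simp_all
 have sfix: "s c = c" if "c \<in> K" for c by (rule hom_overD(2)[OF s(1) that])
 have cy: "(s ^^ q) x = x" "s x = x \<longleftrightarrow> x \<in> K" if "x \<in> carrier L" for x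
  by (rule cyclic_prime_degree(1,2)[where s = s, OF y(1) y(2) dim q s(1) sc s(3) that]; assumption)+
 \<comment> \<open>A root of \<open>1 + ... + X^(q-1)\<close> has degree less than \<open>q\<close>
   and dividing \<open>q\<close>, so it lies in \<open>K\<close>.\<close>
 have un: "r \<in> K" if r: "r \<in> carrier L" "r [^] q = \<one>" for r
 proof (cases "r = \<one>")
  case False
  obtain m where m: "q = Suc m" using q0 by (cases q) auto
  have evc: "eval (replicate q \<one>) r \<in> carrier L" by (rule eval_in_carrier) (use r in auto)
  have "eval (replicate q \<one>) r ** (r \<ominus> \<one>) = \<zero>"
   using eval_replicate_one[OF r(1), of q] r by (simp add: r_right_minus_eq)
  then have "eval (replicate q \<one>) r = \<zero> \<or> r \<ominus> \<one> = \<zero>"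
   by (rule integral) (use r evc in simp_all)
  then have ev: "eval (replicate q \<one>) r = \<zero>" using False r by (simp add: r_right_minus_eq)
  have "replicate q \<one> \<in> carrier (K[X][L])"
   using sK(3) unfolding poly_carrier by (auto simp: m)
  from Irr_degree_le[OF between_K r(1) this ev] have le: "degree (Irr K r) < q" using m by simp
  note R = between_simple[OF between_K r(1)] and I = Irr_props[OF between_K r(1)]
  obtain a b where ab: "dimension a K (simple_extension K r)" "q = a * b"
   by (rule degree_tower[OF R(1) between_L betweenD(4)[OF R(1)] dim])
  have "a = degree (Irr K r)" by (rule dimension_unique[OF between_K ab(1) R(4)])
  then have "degree (Irr K r) = 1" using ab(2) q le by (metis dvd_triv_left less_irrefl prime_nat_iff)
  then show ?thesis using I(7) by fastforce
 qed (use sK(3) in simp)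
 have "\<exists>zs. set zs \<subseteq> carrier L \<and> replicate q \<one> = pl L zs"
  using exists_pl[of "replicate q \<one>"] replicate_one_poly[of "q - 1"] q0 by simp
 then obtain zs where zs: "set zs \<subseteq> carrier L" "replicate q \<one> = pl L zs" by blast
 have zq: "z [^] q = \<one>" "z ~= \<one>" if z: "z \<in> set zs" for z
 proof -
  have zc: "z \<in> carrier L" using z zs by blast
  have ev: "eval (replicate q \<one>) z = \<zero>" using pl_eval_zero[OF zs(1) zc] zs(2) z by simp
  then have "z [^] q \<ominus> \<one> = \<zero>" using eval_replicate_one[OF zc, of q] zc by simp
  then show "z [^] q = \<one>" using zc by (simp add: r_right_minus_eq)
  show "z ~= \<one>" using ev eval_one_replicate_one[of q] char[OF q0(1)] by auto
 qed
 have zsK: "set zs \<subseteq> K" using un zq(1) zs(1) by blast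
 have G: "abelian_group L" by (rule abelian_group_axioms)
 let ?R = "op_ring L"
 interpret R: ring ?R by (rule op_ring_is_ring[OF G])
 \<comment> \<open>As a linear operator, \<open>s\<close> satisfies \<open>X^q - 1\<close>. On the
   vector \<open>s y - y\<close> the factor \<open>X - 1\<close> is already used up, so some root of
   unity other than \<open>1\<close> is an eigenvalue.\<close>
 define t where "t = restrict s (carrier L)"
 define H where "H c = restrict (%v. c ** v) (carrier L)" for c
 have tR: "t \<in> carrier ?R" by (rule op_ring_closedI) (use sc sm in "auto simp: t_def")
 have HR: "H c \<in> carrier ?R" if "c \<in> K" for c
  by (rule op_ring_closedI) (use betweenD(5)[OF between_K that] in "auto simp: H_def r_distr")
 have app: "t v = s v" "H c v = c ** v" if "v \<in> carrier L" for c v using that by (simp_all add: t_def H_def)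
 have Rext: "a = b" if "a \<in> carrier ?R" "b \<in> carrier ?R" "!!v. v \<in> carrier L ==> a v = b v" for a b
  by (rule op_ring_ext[OF op_ring_extensional(1)[OF that(1)] op_ring_extensional(1)[OF that(2)] that(3)])
 have Hhom: "H \<in> ring_hom (sub K) ?R"
 proof (rule ring_hom_memI)
  show "H c \<in> carrier ?R" if "c \<in> carrier (sub K)" for c using HR that by simp
  fix a b assume ab: "a \<in> carrier (sub K)" "b \<in> carrier (sub K)"
  have abK: "a \<in> K" "b \<in> K" using ab by auto
  note c = betweenD(5)[OF between_K abK(1)] betweenD(5)[OF between_K abK(2)]
  have "a ** b \<in> K" "a \<oplus> b \<in> K" using sK(6,7) abK by auto
  then show "H (a **[sub K] b) = H a **[?R] H b" "H (a \<oplus>[sub K] b) = H a \<oplus>[?R] H b"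
   by (intro Rext; use HR abK c in "simp add: op_ring_simps(3,4) app m_assoc l_distr")+
 next
  show "H \<one>[sub K] = \<one>[?R]" by (rule Rext) (use HR sK(3) in "simp_all add: op_ring_simps(5) app")
 qed
 have comm: "t **[?R] H c = H c **[?R] t" if "c \<in> carrier (sub K)" for c
 proof -
  have c: "c \<in> K" "c \<in> carrier L" using that betweenD(5)[OF between_K] by auto
  show ?thesis
   by (rule Rext) (use tR HR[OF c(1)] c sc sm(1) sfix[OF c(1)] in "simp_all add: op_ring_simps(3) app")
 qed
 have tq: "(t [^][?R] n) v = (s ^^ n) v \<and> (s ^^ n) v \<in> carrier L" if v: "v \<in> carrier L" for v and n :: nat
 proof (induction n)
  case (Suc n)
  have "t [^][?R] Suc n = t **[?R] t [^][?R] n" by (rule R.nat_pow_Suc2[OF tR])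
  then show ?case using Suc op_ring_simps(3)[OF v] app(1) sc by simp
 qed (use v op_ring_simps(5) in simp)
 have t1: "t [^][?R] q = \<one>[?R]"
  by (rule Rext) (use tR tq cy(1) op_ring_simps(5)[where G = L] in simp_all)
 let ?P = "foldr (%y a. (t \<ominus>[?R] H y) **[?R] a) zs \<one>[?R]"
 have P: "?P = R.eval (replicate q \<one>[?R]) t"
 proof -
  have "R.eval (map H (pl (sub K) zs)) t = ?P"
   by (rule R.eval_pl_commuting[OF Hhom betweenD(6)[OF between_K] tR comm]) (use zsK in simp_all)
  moreover have "map H (pl (sub K) zs) = replicate q \<one>[?R]"
   unfolding pl_sub[OF between_K zsK] zs(2)[symmetric] using ring_hom_one[OF Hhom] by simp
  ultimately show ?thesis by simp
 qed
 have ev: "R.eval (replicate q \<one>[?R]) t \<in> carrier ?R" by (rule R.eval_in_carrier) (use tR in auto)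
 define v where "v = s y \<ominus> y"
 have v: "v \<in> carrier L" "v ~= \<zero>" using y(1) sc s(3) by (simp_all add: v_def r_right_minus_eq)
 have "(t \<ominus>[?R] \<one>[?R]) y = v"
  using op_ring_minus[OF G tR R.one_closed y(1)] op_ring_simps(5)[OF y(1)] app(1)[OF y(1)] by (simp add: v_def)
 then have "?P v = (?P **[?R] (t \<ominus>[?R] \<one>[?R])) y" using op_ring_simps(3)[OF y(1)] by simp
 also have "?P **[?R] (t \<ominus>[?R] \<one>[?R]) = \<zero>[?R]"
  unfolding P R.eval_replicate_one[OF tR] t1 by (simp add: R.r_right_minus_eq)
 also have "\<zero>[?R] y = \<zero>" by (rule op_ring_simps(6)[OF y(1)])
 finally have Pv: "?P v = \<zero>" .
 have HRz: "H z \<in> carrier ?R" if "z \<in> set zs" for z using HR zsK that by blast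
 obtain w z where wz: "w \<in> carrier L" "w ~= \<zero>" "z \<in> set zs" "t w = H z w"
  using op_ring_eigenvector[where H = H, OF G tR HRz v Pv] by blast
 have zK: "z \<in> K" and zc: "z \<in> carrier L" using wz(3) zsK zs(1) by auto
 have sw: "s w = z ** w" using wz(4) app wz(1) by simp
 have wK: "w \<notin> K"
 proof
  assume "w \<in> K"
  then have "z ** w = \<one> ** w" using sw sfix wz(1) by simp
  then show False using m_rcancel[of w z \<one>] wz(1,2) zc zq(2)[OF wz(3)] by simp
 qed
 obtain u where u: "u \<in> carrier L" "u [^] q = w" using exists_radical[OF q0(1) wz(1)] .
 define c where "c = nrm L s u q"
 have cK: "c \<in> K"
 proof -
  have "s c = c" unfolding c_def by (rule nrm_fixed[OF between_L s(1,2) cy(1) u(1)])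
  moreover have "c \<in> carrier L" unfolding c_def by (rule nrm_closed[OF sc u(1) betweenD(3)[OF between_L]])
  ultimately show ?thesis using cy(2) by blast
 qed
 have cc: "c \<in> carrier L" by (rule betweenD(5)[OF between_K cK])
 have n1: "nrm L s \<one> n = \<one>" for n using sfix[OF sK(3)] by (induction n) auto
 have "nrm L s (u [^] n) q = c [^] n" for n :: nat
 proof (induction n)
  case (Suc n)
  then show ?case
   using nrm_mult[OF between_L s(1,2) nat_pow_closed[OF u(1)] u(1), of n q] by (simp add: c_def)
 qed (use n1 in simp)
 then have "c [^] q = nrm L s w q" using u(2) by metis
 also have "\<dots> = z [^] (\<Sum>j<q. j) ** w [^] q" by (rule nrm_root[OF between_L s(1) wz(1) sw zK])
 also have "\<dots> = (if q = 2 then \<ominus> (w [^] q) else w [^] q)"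
  by (rule unity_power_sum[OF q zc zq(2,1)[OF wz(3)]]) (use wz in simp)
 finally have cq: "c [^] q = (if q = 2 then \<ominus> (w [^] q) else w [^] q)" .
 have ic: "i \<in> carrier L" by (rule betweenD(5)[OF between_K i(1)])
 have "\<exists>d\<in>K. d [^] q = w [^] q"
 proof (cases "q = 2")
  case True
  have "(i ** c) [^] q = (i ** i) ** c [^] q" unfolding True using ic cc by (simp add: numeral_2_eq_2 m_ac)
  also have "\<dots> = w [^] q" unfolding i(2) cq using True wz(1) by (simp add: l_minus)
  finally show ?thesis using sK(6)[OF i(1) cK] by blast
 qed (use cK cq in auto)
 then obtain d where d: "d \<in> K" "d [^] q = w [^] q" by blast
 have dc: "d \<in> carrier L" by (rule betweenD(5)[OF between_K d(1)])
 have wi: "inv w \<in> carrier L" "w ** inv w = \<one>" "inv w ** w = \<one>" using wz(1,2) field_Units by auto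
 \<comment> \<open>The quotient of \<open>d\<close> and \<open>w\<close> is a \<open>q\<close>-th
   root of unity, hence in \<open>K\<close>, which would put \<open>w\<close> into
   \<open>K\<close>.\<close>
 have "(d ** inv w) [^] q = (w ** inv w) [^] q"
  unfolding nat_pow_distrib[OF dc wi(1)] nat_pow_distrib[OF wz(1) wi(1)] d(2) ..
 then have rK: "d ** inv w \<in> K" using un[of "d ** inv w"] dc wi by simp
 have r0: "d ** inv w ~= \<zero>"
 proof
  assume "d ** inv w = \<zero>"
  then have "d ** inv w ** w = \<zero>" using wz(1) by simp
  then have "d = \<zero>" using dc wi wz(1) by (simp add: m_assoc)
  then have "w [^] q = \<zero>" using d(2) q0 by (cases q) auto
  then show False using pow_nonzero[OF wz(1,2)] by blast
 qed
 have "d ** inv w ** w = d" using dc wi wz(1) by (simp add: m_assoc)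
 then show False using between_cancel[OF between_K rK r0 wz(1)] d(1) wK by simp
qed

text \<open>Otherwise let the prime \<open>q\<close> divide the degree over \<open>K(i)\<close>. A
  subgroup of order \<open>q\<close> has a fixed field over which the closure has degree
  \<open>q\<close>, and \<open>no_prime_degree\<close> excludes this, as \<open>i\<close> lies in
  that field.\<close>

theorem finite_closure_eq:
 assumes char: "!!n::nat. n > 0 ==> add_pow L n \<one> ~= \<zero>" and i: "i \<in> carrier L" "i ** i = \<ominus> \<one>"
  and fin: "finite_dimension K (carrier L)"
 shows "carrier L = simple_extension K i"
proof (rule ccontr)
 assume ne: "carrier L ~= simple_extension K i"
 define M where "M = simple_extension K i"
 note Mi = between_simple[OF between_K i(1), folded M_def]
 interpret M: algebraic_closure L M by (rule closure_between[OF Mi(1)])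
 obtain n where n: "dimension n K (carrier L)" using fin finite_dimension_def by blast
 have "subalgebra M (carrier L) L" by (rule M.between_subalgebra[OF M.between_K M.between_L M.betweenD(4)[OF M.between_K]])
 from dimension_larger_base[OF K_sub M.K_sub Mi(2) n this] obtain N where N: "dimension N M (carrier L)"
  using finite_dimension_def by blast
 have "N ~= 1" using M.degree_one[OF M.between_K M.between_L M.betweenD(4)[OF M.between_K]] N ne M_def by auto
 then obtain q where q: "prime q" "q dvd N" using prime_factor_nat by blast
 have perf: M.perfect unfolding M.perfect_def using char prime_gt_0_nat by blast
 obtain m where m: "N = q ^ 1 * m" using q(2) by auto
 have "\<forall>h. M.hom_over (carrier L) h --> h ` carrier L \<subseteq> carrier L" using M.hom_overD(3) by blast
 then obtain E where E: "M.between E" "dimension (q ^ 1) E (carrier L)"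
  by (rule M.galois_sylow[OF perf M.between_L N _ q(1) m])
 have "algebraic_closure L E" by (rule M.closure_between[OF E(1)])
 from algebraic_closure.no_prime_degree[OF this char _ i(2) q(1)] show False
  using E(2) M.betweenD(2)[OF E(1)] Mi(3) by auto
qed

end

text \<open>The order is \<open>a \<le> b\<close> when \<open>b - a\<close> is a square. It is
  transitive since sums of two squares are squares, antisymmetric since \<open>-1\<close> is not a
  square, and total since every element is a square up to sign.\<close>

theorem real_closed_criterion:
 fixes K :: "('a, 'k) ring_scheme" (structure)
 assumes "field K"
  and neg: "!!b. b \<in> carrier K ==> b ** b ~= \<ominus> \<one>"
  and sum: "!!a b. a \<in> carrier K ==> b \<in> carrier K ==> \<exists>e\<in>carrier K. a ** a \<oplus> b ** b = e ** e"
  and pm: "!!a. a \<in> carrier K ==> \<exists>e\<in>carrier K. a = e ** e \<or> a = \<ominus> (e ** e)"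
  and odd_root: "!!p. p \<in> carrier (poly_ring K) ==> odd (degree p) ==> \<exists>x\<in>carrier K. ring.eval K p x = \<zero>"
 shows "real_closed K"
proof -
 interpret field K by fact
 define r where "r = {(a, b). a \<in> carrier K \<and> b \<in> carrier K \<and> (\<exists>c\<in>carrier K. b \<ominus> a = c ** c)}"
 have r: "(a, b) \<in> r \<longleftrightarrow> a \<in> carrier K \<and> b \<in> carrier K \<and> (\<exists>c\<in>carrier K. b \<ominus> a = c ** c)" for a b
  by (simp add: r_def)
 have zero: "c ** c \<oplus> d ** d = \<zero> ==> c = \<zero>" if cd: "c \<in> carrier K" "d \<in> carrier K" for c d
 proof (rule ccontr)
  assume z: "c ** c \<oplus> d ** d = \<zero>" and c0: "c ~= \<zero>"
  have i: "inv c \<in> carrier K" "inv c ** c = \<one>" using c0 cd(1) field_Units by auto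
  have "d ** d = \<ominus> (c ** c)" using minus_equality[of "d ** d" "c ** c"] z cd by (simp add: a_comm)
  then have "(inv c ** inv c) ** (d ** d) = (inv c ** inv c) ** \<ominus> (c ** c)" by simp
  also have "\<dots> = \<ominus> ((inv c ** c) ** (inv c ** c))" using i(1) cd(1) by algebra
  also have "(inv c ** inv c) ** (d ** d) = (inv c ** d) ** (inv c ** d)" using i(1) cd(2) by algebra
  finally show False using neg[of "inv c ** d"] i cd(2) by simp
 qed
 have lin: "linear_order_on (carrier K) r"
  unfolding linear_order_on_def partial_order_on_def preorder_on_def
 proof (intro conjI)
  show "r \<subseteq> carrier K \<times> carrier K" by (auto simp: r_def)
  show "refl_on (carrier K) r"
   by (rule refl_onI) (auto simp: r r_right_minus_eq intro!: bexI[of _ \<zero>])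
  show "trans r"
  proof (rule transI)
   fix a b c assume ab: "(a, b) \<in> r" "(b, c) \<in> r"
   then obtain d e where de: "d \<in> carrier K" "e \<in> carrier K" "b \<ominus> a = d ** d" "c \<ominus> b = e ** e"
    and car: "a \<in> carrier K" "b \<in> carrier K" "c \<in> carrier K" unfolding r by blast
   have "c \<ominus> a = (b \<ominus> a) \<oplus> (c \<ominus> b)" using car by algebra
   then show "(a, c) \<in> r" using sum[OF de(1,2)] car unfolding r de(3,4) by auto
  qed
  show "antisym r"
  proof (rule antisymI)
   fix a b assume ab: "(a, b) \<in> r" "(b, a) \<in> r"
   then obtain d e where de: "d \<in> carrier K" "e \<in> carrier K" "b \<ominus> a = d ** d" "a \<ominus> b = e ** e"
    and car: "a \<in> carrier K" "b \<in> carrier K" unfolding r by blast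
   have "(b \<ominus> a) \<oplus> (a \<ominus> b) = \<zero>" using car by algebra
   then have "d = \<zero>" using zero[OF de(1,2)] de(3,4) by simp
   then have "b \<ominus> a = \<zero>" using de by simp
   then show "a = b" using car by (simp add: r_right_minus_eq)
  qed
  show "total_on (carrier K) r"
  proof (rule total_onI)
   fix a b assume car: "a \<in> carrier K" "b \<in> carrier K"
   obtain e where e: "e \<in> carrier K" "b \<ominus> a = e ** e \<or> b \<ominus> a = \<ominus> (e ** e)" using pm[of "b \<ominus> a"] car by auto
   have "a \<ominus> b = \<ominus> (b \<ominus> a)" using car by algebra
   then have "b \<ominus> a = e ** e \<or> a \<ominus> b = e ** e" using e by auto
   then show "(a, b) \<in> r \<or> (b, a) \<in> r" unfolding r using car e(1) by blast
  qed
 qed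
 have add: "(a \<oplus> c, b \<oplus> c) \<in> r" if "(a, b) \<in> r" "c \<in> carrier K" for a b c
 proof -
  have "a \<in> carrier K" "b \<in> carrier K" using that(1) unfolding r by blast+
  then have "(b \<oplus> c) \<ominus> (a \<oplus> c) = b \<ominus> a" using minus_add_cancel that(2) by blast
  then show ?thesis using that unfolding r by auto
 qed
 have nonneg: "(\<zero>, a) \<in> r \<longleftrightarrow> a \<in> carrier K \<and> (\<exists>c\<in>carrier K. a = c ** c)" for a
  unfolding r by (auto simp: minus_eq)
 have mult: "(\<zero>, a ** b) \<in> r" if ab: "(\<zero>, a) \<in> r" "(\<zero>, b) \<in> r" for a b
 proof -
  obtain c where c: "c \<in> carrier K" "a = c ** c" using ab(1) unfolding nonneg by blast
  obtain d where d: "d \<in> carrier K" "b = d ** d" using ab(2) unfolding nonneg by blast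
  note cd = c(1) d(1) c(2) d(2)
  have "a ** b = (c ** d) ** (c ** d)" unfolding cd(3,4) using cd(1,2) by algebra
  then show ?thesis unfolding nonneg using cd(1,2) by (intro conjI bexI[of _ "c ** d"]) simp_all
 qed
 have "field_ordering K r"
  by (intro field_ordering.intro field_ordering_axioms.intro assms(1) lin add mult)
 moreover have "\<exists>x. is_root p x" if "p \<in> carrier (poly_ring K)" "odd (degree p)" for p
  using odd_root[OF that] that(2) unfolding is_root_def by auto
 moreover have "\<exists>b\<in>carrier K. a = b ** b" if "(\<zero>, a) \<in> r" for a using that unfolding nonneg by (rule conjunct2)
 ultimately show ?thesis
  unfolding real_closed_def by (intro exI[of _ r] conjI allI impI ballI)
qed

section \<open>Base fields whose closure is generated by a square root of -1\<close>

context algebraic_closure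
begin

context
 fixes i
 assumes i: "i \<in> carrier L" "i ** i = \<ominus> \<one>" "i \<notin> K" and top: "carrier L = simple_extension K i"
begin

lemma base_neg:
 assumes b: "b \<in> K"
 shows "b ** b ~= \<ominus> \<one>"
proof
 assume e: "b ** b = \<ominus> \<one>"
 have bc: "b \<in> carrier L" by (rule betweenD(5)[OF between_K b])
 have "(i \<ominus> b) ** (i \<oplus> b) = i ** i \<ominus> b ** b" using bc i(1) by algebra
 then have "(i \<ominus> b) ** (i \<oplus> b) = \<zero>" unfolding i(2) e by (simp add: r_right_minus_eq)
 then have "i \<ominus> b = \<zero> \<or> i \<oplus> b = \<zero>" by (rule integral) (use bc i(1) in simp_all)
 then have "i = b \<or> i = \<ominus> b" using bc i(1) minus_equality[of i b] by (auto simp: r_right_minus_eq)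
 then show False using b i(3) betweenE(5)[OF between_K b] by auto
qed

lemma base_square_root:
 assumes "z \<in> carrier L"
 obtains u v where "u \<in> K" "v \<in> K" "z = (u \<oplus> v ** i) ** (u \<oplus> v ** i)"
proof -
 obtain w where w: "w \<in> carrier L" "w [^] (2::nat) = z" using exists_radical[of 2 z] assms by auto
 obtain u v where uv: "u \<in> K" "v \<in> K" "w = u \<oplus> v ** i" using Ki_elements[OF i] w(1) top by blast
 have "z = w ** w" using w by (simp add: numeral_2_eq_2)
 then show ?thesis using that uv by blast
qed

text \<open>\<open>a + b i\<close> is the square of some \<open>w\<close>; taking norms,
  \<open>a^2 + b^2\<close> is the square of the norm of \<open>w\<close>.\<close>

lemma base_sum:
 assumes ab: "a \<in> K" "b \<in> K"
 shows "\<exists>e\<in>K. a ** a \<oplus> b ** b = e ** e"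
proof -
 note sK = subringE[OF betweenD(3)[OF between_K]]
 obtain s where s: "hom_over (simple_extension K i) s" "s ` simple_extension K i \<subseteq> simple_extension K i"
  "s i ~= i" "\<forall>u\<in>K. \<forall>v\<in>K. s (u \<oplus> v ** i) = u \<ominus> v ** i"
  "\<forall>u\<in>K. \<forall>v\<in>K. s (u \<oplus> v ** i) ** (u \<oplus> v ** i) = u ** u \<oplus> v ** v"
  by (rule conjugation[OF i])
 have car: "a \<in> carrier L" "b \<in> carrier L" using ab betweenD(5)[OF between_K] by auto
 then have z: "a \<oplus> b ** i \<in> carrier L" using i(1) by simp
 obtain u v where uv: "u \<in> K" "v \<in> K" "a \<oplus> b ** i = (u \<oplus> v ** i) ** (u \<oplus> v ** i)"
  by (rule base_square_root[OF z])
 have uvc: "u \<in> carrier L" "v \<in> carrier L" using uv betweenD(5)[OF between_K] by auto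
 define w where "w = u \<oplus> v ** i"
 have wc: "w \<in> carrier L" using uvc i(1) by (simp add: w_def)
 then have w: "w \<in> carrier L" "w \<in> simple_extension K i" using top by auto
 note w = w hom_overD(3)[OF s(1) w(2)]
 have "s (a \<oplus> b ** i) ** (a \<oplus> b ** i) = a ** a \<oplus> b ** b" using s(5) ab by blast
 then have "a ** a \<oplus> b ** b = s (w ** w) ** (w ** w)" unfolding uv(3) w_def[symmetric] by simp
 also have "\<dots> = (s w ** w) ** (s w ** w)" unfolding hom_overD(4)[OF s(1) w(2,2)] using w(1,3) by algebra
 also have "s w ** w = u ** u \<oplus> v ** v" unfolding w_def using s(5) uv(1,2) by blast
 finally have e: "a ** a \<oplus> b ** b = (u ** u \<oplus> v ** v) ** (u ** u \<oplus> v ** v)" .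
 have "u ** u \<oplus> v ** v \<in> K" using sK(6,7) uv(1,2) by simp
 then show ?thesis by (rule rev_bexI) (rule e)
qed

lemma base_plus_minus:
 assumes a: "a \<in> K"
 shows "\<exists>e\<in>K. a = e ** e \<or> a = \<ominus> (e ** e)"
proof -
 obtain w where w: "w \<in> carrier L" "w [^] (2::nat) = a"
  using exists_radical[of 2 a] betweenD(5)[OF between_K a] by auto
 have w2: "w ** w = a" using w by (simp add: numeral_2_eq_2)
 then obtain v where v: "v \<in> K" "w = v \<or> w = v ** i" using square_root_cases[OF i] w(1) top a by blast
 have vc: "v \<in> carrier L" by (rule betweenD(5)[OF between_K v(1)])
 have "(v ** i) ** (v ** i) = v ** v ** (i ** i)" using vc i(1) by algebra
 also have "\<dots> = \<ominus> (v ** v)" unfolding i(2) using vc by algebra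
 finally show ?thesis using v w2 by auto
qed

text \<open>A root outside \<open>K\<close> has a minimal polynomial of degree \<open>2\<close>;
  dividing by it lowers the degree and keeps it odd.\<close>

lemma base_odd_root:
 assumes "p \<in> carrier (K[X][L])" "odd (degree p)"
 shows "\<exists>x\<in>K. eval p x = \<zero>"
 using assms
proof (induction "degree p" arbitrary: p rule: less_induct)
 case less
 have pL: "p \<in> carrier (poly_ring L)" by (rule poly_sub_mono[OF betweenD(4)[OF between_K] less(2)])
 have p0: "p ~= []" using less(3) by auto
 have "size (roots p) = degree p" using roots_over_carrier[OF pL] unfolding splitted_def by simp
 moreover have "degree p ~= 0" using less(3) by (metis dvd_0_right)
 ultimately have "size (roots p) ~= 0" by (simp only:) simp
 then obtain x where "x \<in># roots p" by (metis multiset_nonemptyE size_empty)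
 then have x: "x \<in> carrier L" "eval p x = \<zero>" using roots_mem_iff_is_root[OF pL] unfolding is_root_def by auto
 show ?case
 proof (cases "x \<in> K")
  case False
  note I = Irr_props[OF between_K x(1)] and S = between_simple[OF between_K x(1)]
  have "i ** i \<in> K" unfolding i(2) using betweenE(3,5)[OF between_K] by simp
  then have d2: "dimension 2 K (carrier L)" using quadratic_extension(1)[OF i i(1,3)] top by simp
  obtain m l where ml: "dimension m K (simple_extension K x)" "2 = m * l"
   by (rule degree_tower[OF S(1) between_L betweenD(4)[OF S(1)] d2])
  have "m = degree (Irr K x)" by (rule dimension_unique[OF between_K ml(1) S(4)])
  moreover have "m dvd 2" by (rule dvdI[OF ml(2)])
  ultimately have dI: "degree (Irr K x) = 2" using I(7)[OF False] dvd_imp_le[of m 2] by simp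
  obtain q where q: "q \<in> carrier (K[X][L])" "p = Irr K x **[poly_ring L] q"
   by (rule Irr_dvd[OF between_K x(1) less(2) x(2)])
  have qL: "q \<in> carrier (poly_ring L)" by (rule poly_sub_mono[OF betweenD(4)[OF between_K] q(1)])
  have q0: "q ~= []"
  proof
   assume "q = []"
   then have "p = []" using q(2) poly_mult_zero(2)[OF poly_set[OF I(5)]] by (simp add: univ_poly_mult)
   then show False using p0 by simp
  qed
  have dp: "degree p = 2 + degree q" using monic_mult(3)[OF I(5) qL I(4) q0] q(2) dI by simp
  then obtain x' where x': "x' \<in> K" "eval q x' = \<zero>" using less(1)[OF _ q(1)] less(3) by auto
  have xc: "x' \<in> carrier L" by (rule betweenD(5)[OF between_K x'(1)])
  have "eval p x' = \<zero>"
   unfolding q(2) eval_mult[OF I(5) qL xc] x'(2) using eval_in_carrier[OF poly_set[OF I(5)] xc] by simp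
  then show ?thesis using x'(1) by blast
 qed (use x in blast)
qed

end

end

theorem theorem25:
  fixes K :: "('a, 'k) ring_scheme"
  assumes "field K"
    and "finite (noncomm_division_algebra_classes K)"
    and "card (noncomm_division_algebra_classes K) > 0"
  shows "real_closed K"
proof -
 interpret K: field K by fact
 obtain D where "maximal_center K D" using exists_maximal_center[OF assms] by blast
 then interpret maximal_center K D .
 \<comment> \<open>The closure is formed over the center \<open>Z\<close>, to which the preceding
   results apply. As \<open>Z\<close> is finite over \<open>K\<close>, it will serve as a closure of
   \<open>K\<close> as well.\<close>
 define W where "W = field.alg_closure Zr"
 define g :: "'a list => ('a list list \<times> nat) multiset => 'a list" where "g = ring.indexed_const Zr"
 have g: "g \<in> ring_hom Zr W" and cl: "algebraic_closure W (g ` Z)"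
  using field.alg_closureE[OF Z_field] by (simp_all add: W_def g_def)
 interpret center_closure K D W g
  by (intro center_closure.intro center_closure_axioms.intro maximal_center_axioms cl g)
 obtain i where i: "i \<in> carrier W" "i **[W] i = \<ominus>[W] \<one>[W]" "i \<notin> k" using exists_i by blast
 define h where "h = (%c. g (scal D c))"
 have sc: "scal D c \<in> Z" if "c \<in> carrier K" for c using scal_central that by blast
 have "scal D \<in> ring_hom K Zr" using scal_hom sc unfolding ring_hom_def by auto
 from ring_hom_trans[OF this g] have h: "h \<in> ring_hom K W" by (simp add: h_def comp_def)
 interpret h: ring_hom_ring K W h by (rule ring_hom_ringI2[OF K.ring_axioms O.ring_axioms h])
 have h_inj: "inj_on h (carrier K)" by (rule non_trivial_field_hom_is_inj[OF h K.field_axioms O.field_axioms])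
 define kap where "kap = h ` carrier K"
 have kap: "subfield kap W" unfolding kap_def by (rule h.img_is_subfield(2)[OF K.carrier_is_subfield]) simp
 have kapk: "kap \<subseteq> k" using sc by (auto simp: kap_def h_def)
 have "O.finite_dimension kap k"
 proof -
  interpret Zr: field Zr by (rule Z_field)
  interpret g: ring_hom_ring Zr W g by (rule ring_hom_ringI2[OF Zr.ring_axioms O.ring_axioms g])
  let ?S = "scal D ` carrier K"
  have S: "subfield ?S Zr"
   by (rule Zr.subfield_iff(1)) (use D.subfield_iff(2)[OF scal_subfield] scal_central in simp_all)
  obtain n where "cdim K D n" using finite_division_algebra.cdim_ex[OF fda] by blast
  then have "Zr.dimension n ?S Z"
   using D.dimension_consistent[OF subfieldE(1)[OF Z_subfield] scal_subfield scal_central] unfolding cdim_def by simp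
  then have "O.dimension n (g ` ?S) (g ` Z)" using g.inj_hom_dimension[OF S _ g_inj] by simp
  moreover have "g ` ?S = kap" by (simp add: kap_def h_def image_image)
  ultimately show ?thesis using O.finite_dimensionI by simp
 qed
 then have fin: "O.finite_dimension kap (carrier W)"
  using O.telescopic_base_dim(1)[OF kap O.K_sub] O.finite_dimensionI[OF dim_i[OF i]] closure_eq[OF i] by simp
 \<comment> \<open>The same \<open>W\<close>, now with base \<open>kap\<close>, the image of
   \<open>K\<close>. It is finite over \<open>kap\<close>, being \<open>k(i)\<close> with
   \<open>k\<close> finite over \<open>kap\<close>, so the results on closures of finite degree
   apply.\<close>
 interpret B: algebraic_closure W kap
 proof (intro algebraic_closure.intro algebraic_closure_axioms.intro O.field_axioms kap)
  show "(O.algebraic over kap) x" if "x \<in> carrier W" for x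
   using O.finite_dimension_imp_algebraic[OF kap O.carrier_is_subring fin that] .
  show "O.splitted P" if "P \<in> carrier (kap[X][W])" for P
   by (rule O.roots_over_carrier[OF O.poly_sub_mono[OF subfieldE(3)[OF kap] that]])
 qed
 have ikap: "i \<notin> kap" using i(3) kapk by blast
 have top: "carrier W = O.simple_extension kap i"
  by (rule B.finite_closure_eq[OF char_zero[OF i] i(1,2) fin])
 note I = i(1,2) ikap top
 have mem: "h x \<in> kap" if "x \<in> carrier K" for x using that by (simp add: kap_def)
 have eq: "x = y" if "h x = h y" "x \<in> carrier K" "y \<in> carrier K" for x y
  by (rule inj_onD[OF h_inj that])
 have minus: "h (\<ominus>[K] x) = \<ominus>[W] h x" if "x \<in> carrier K" for x
  using h.hom_a_inv[OF that] .
 show ?thesis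
 proof (rule real_closed_criterion[OF assms(1)])
  show "b **[K] b ~= \<ominus>[K] \<one>[K]" if b: "b \<in> carrier K" for b
   using B.base_neg[OF I mem[OF b]] h.hom_mult[OF b b] minus[OF K.one_closed] h.hom_one by auto
 next
  fix a b assume ab: "a \<in> carrier K" "b \<in> carrier K"
  obtain e where e: "e \<in> carrier K" "h a **[W] h a \<oplus>[W] h b **[W] h b = h e **[W] h e"
   using B.base_sum[OF I mem[OF ab(1)] mem[OF ab(2)]] unfolding kap_def by blast
  have "a **[K] a \<oplus>[K] b **[K] b = e **[K] e" by (rule eq) (use ab e in simp_all)
  then show "\<exists>e\<in>carrier K. a **[K] a \<oplus>[K] b **[K] b = e **[K] e" using e(1) by blast
 next
  fix a assume a: "a \<in> carrier K"
  obtain e where e: "e \<in> carrier K" "h a = h e **[W] h e \<or> h a = \<ominus>[W] (h e **[W] h e)"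
   using B.base_plus_minus[OF I mem[OF a]] unfolding kap_def by blast
  have "h a = h (e **[K] e) \<or> h a = h (\<ominus>[K] (e **[K] e))" using e minus[of "e **[K] e"] by simp
  then have "a = e **[K] e \<or> a = \<ominus>[K] (e **[K] e)" using eq[OF _ a] e(1) by auto
  then show "\<exists>e\<in>carrier K. a = e **[K] e \<or> a = \<ominus>[K] (e **[K] e)" using e(1) by blast
 next
  fix p assume p: "p \<in> carrier (poly_ring K)" "odd (degree p)"
  have pK: "set p \<subseteq> carrier K" by (rule K.poly_set[OF p(1)])
  have p0: "p ~= []" using p(2) by auto
  have "lead_coeff p \<in> carrier K" "lead_coeff p ~= \<zero>[K]"
   using p(1) p0 pK unfolding poly_carrier by auto
  then have "h (lead_coeff p) ~= \<zero>[W]" using eq[of "lead_coeff p" "\<zero>[K]"] h.hom_zero by auto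
  then have "map h p \<in> carrier (kap[X][W])"
   using p0 pK mem unfolding poly_carrier by (auto simp: hd_map)
  then obtain x where x: "x \<in> carrier K" "O.eval (map h p) (h x) = \<zero>[W]"
   using B.base_odd_root[OF I, of "map h p"] p(2) unfolding kap_def by auto
  have "K.eval p x = \<zero>[K]"
   by (rule eq) (use x h.eval_hom'[OF x(1) pK] K.eval_in_carrier[OF pK x(1)] in simp_all)
  then show "\<exists>x\<in>carrier K. K.eval p x = \<zero>[K]" using x(1) by blast
 qed
qed

end
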